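(* Let $\psi$ be a semialgebraic property of several polytopes of the same combinatorial type such that ridges always projectively inherit $\psi$. Then $\psi$ holds for some realizations of every combinatorial type of polytope if and only if it holds for some realizations of every projective type of polytope. Moreover, there can be a gap of at most $2$ between the lowest dimension of a combinatorial type for which $\psi$ fails for all realizations and the lowest dimension of a projective type for which $\psi$ fails for all realizations.
   Context: Polytopes are convex polytopes in $\mathbb{R}^d$ with faces indexed by a poset: a combinatorial polytope $\mathcal{P}$ is a bounded poset isomorphic to the face lattice of a polytope, a realization of $\mathcal{P}$ is a polytope $P$ with an isomorphism from $\mathcal{P}$ to its face lattice, and $\operatorname{face}(P,f)$ is the face with index $f$. Polytopes have the same combinatorial type if their faces are indexed by the same poset. They have the same projective type if moreover there is an invertible projective transformation (projectivity) $\pi$, finite on $P$, with $\pi(\operatorname{face}(P,f))=\operatorname{face}(Q,f)$ for every index $f$. For a property $\psi$ of $K$ polytopes, "$\psi$ holds for some realizations of a (combinatorial or projective) type" means that there are polytopes $P_1,\dots,P_K$, all of that type, with $\psi(P_1,\dots,P_K)$ true. A property $\psi$ of $K$ polytopes of the same combinatorial type is semialgebraic if for each combinatorial polytope $\mathcal{P}$ with $m$ vertices (realized in dimension $d$) there is a formula $\psi_{\mathcal{P}}$ in the first-order language of real closed fields $(+,\cdot,0,1,\le)$ with free variables $v_{i,j,k}$ ($1\le i\le d$, $1\le j\le m$, $1\le k\le K$) such that for every real closed field $\mathbb{K}$ and all polytopes $P_1,\dots,P_K$ of type $\mathcal{P}$ with vertex coordinates $c\in\mathbb{K}^{dmK}$,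 $\psi(P_1,\dots,P_K)$ is true if and only if $\psi_{\mathcal{P}}$ with each $v_{i,j,k}$ replaced by $c_{i,j,k}$ is true in $\mathbb{K}$. A face $f\in\mathcal{P}$ projectively inherits $\psi$ if, whenever $P_1,\dots,P_K$ are realizations of $\mathcal{P}$ with $\psi(P_1,\dots,P_K)$ true, there are projectivities $\pi_1,\dots,\pi_K$ such that $\psi(\pi_1(\operatorname{face}(P_1,f)),\dots,\pi_K(\operatorname{face}(P_K,f)))$ is true. A ridge is a face of codimension $2$; "ridges always projectively inherit" means that every ridge of every combinatorial polytope does. *)

theory Defs
  imports
    "HOL-Analysis.Analysis"
    "HOL-Analysis.Finite_Function_Topology"
    "HOL-Computational_Algebra.Polynomial"
    "HOL-Library.Infinite_Typeclass"
begin

section \<open>Polytopes in varying dimension\<close>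

text \<open>
  The dimension varies inside the statement, so all spaces \<open>\<real>\<^sup>n\<close> are realized as the coordinate
  subspaces of the real vector space \<open>nat \<Rightarrow>\<^sub>0 real\<close>; in particular
  \<open>\<real>\<^sup>m \<subseteq> \<real>\<^sup>n\<close> as sets for \<open>m \<le> n\<close>. The library notions \<^const>\<open>polytope\<close>, \<^const>\<open>face_of\<close>
  and \<open>affine hull\<close> are available there.
\<close>

type_synonym vec = "nat \<Rightarrow>\<^sub>0 real"

definition coord_space :: "nat \<Rightarrow> vec set" where
  "coord_space n = {x. \<forall>i\<ge>n. Poly_Mapping.lookup x i = 0}"

text \<open>
  The library's \<open>aff_dim\<close> requires a Euclidean space; this is its definition, for
  sets with a finite-dimensional affine hull. The empty set has dimension \<open>-1\<close>.
\<close>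

definition affdim :: "vec set \<Rightarrow> int" where
  "affdim S = (THE d. \<exists>B. finite B \<and> affine hull B = affine hull S
                 \<and> \<not> affine_dependent B \<and> int (card B) = d + 1)"

text \<open>
  A polytope together with a family of faces indexed by the elements of some poset.
  Posets are given by their (reflexive) order relation, with carrier \<^term>\<open>Field r\<close>.
\<close>

type_synonym 'i indexed_polytope = "vec set \<times> ('i \<Rightarrow> vec set)"

definition body :: "'i indexed_polytope \<Rightarrow> vec set" where
  "body P = fst P"

definition face :: "'i indexed_polytope \<Rightarrow> 'i \<Rightarrow> vec set" where
  "face P f = snd P f"

text \<open>
  A realization is a polytope of dimension \<open>d\<close> lying in \<open>\<real>\<^sup>d\<close> (so it is full-dimensional), with an
  order isomorphism from the poset to its face lattice. As for \<^const>\<open>face_of\<close>, the empty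
  face and the polytope itself are faces, and the empty set is a polytope.
\<close>

definition realization :: "'i rel \<Rightarrow> 'i indexed_polytope \<Rightarrow> bool" where
  "realization r P \<longleftrightarrow>
     Partial_order r \<and>
     polytope (body P) \<and> body P \<subseteq> coord_space (nat (affdim (body P))) \<and>
     bij_betw (face P) (Field r) {F. F face_of body P} \<and>
     (\<forall>f\<in>Field r. \<forall>g\<in>Field r. (f, g) \<in> r \<longleftrightarrow> face P f \<subseteq> face P g)"

definition combinatorial_polytope :: "'i rel \<Rightarrow> bool" where
  "combinatorial_polytope r \<longleftrightarrow> (\<exists>P. realization r P)"

definition has_dimension :: "'i rel \<Rightarrow> int \<Rightarrow> bool" where
  "has_dimension r d \<longleftrightarrow> (\<exists>P. realization r P \<and> affdim (body P) = d)"

definition ridge :: "'i rel \<Rightarrow> 'i \<Rightarrow> bool" where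
  "ridge r f \<longleftrightarrow> f \<in> Field r \<and>
     (\<exists>P. realization r P \<and> affdim (face P f) = affdim (body P) - 2)"

definition vertices :: "'i rel \<Rightarrow> 'i set" where
  "vertices r = {v \<in> Field r. \<exists>z\<in>Field r. (\<forall>g\<in>Field r. (z, g) \<in> r) \<and> z \<noteq> v \<and>
                   (\<forall>g. (g, v) \<in> r \<longrightarrow> g = z \<or> g = v)}"

definition vertex_point :: "'i indexed_polytope \<Rightarrow> 'i \<Rightarrow> vec" where
  "vertex_point P v = the_elem (face P v)"

text \<open>The polytope \<open>face P f\<close>, whose faces are indexed by the lower interval of \<open>f\<close>.\<close>

definition face_poset :: "'i rel \<Rightarrow> 'i \<Rightarrow> 'i rel" where
  "face_poset r f = {(g, h) \<in> r. (h, f) \<in> r}"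

definition face_polytope :: "'i indexed_polytope \<Rightarrow> 'i \<Rightarrow> 'i indexed_polytope" where
  "face_polytope P f = (face P f, face P)"


section \<open>Projectivities\<close>

text \<open>
  A projectivity of \<open>\<real>\<^sup>n\<close> is given by a linear automorphism \<open>h\<close> of the space
  \<open>\<real>\<^sup>n \<times> \<real>\<close> of homogeneous coordinates, in which \<open>x\<close> is represented by \<open>(x, 1)\<close>.
  The values of \<open>h\<close> outside \<open>\<real>\<^sup>n \<times> \<real>\<close> are irrelevant.
\<close>

definition projectivity :: "nat \<Rightarrow> (vec \<times> real \<Rightarrow> vec \<times> real) \<Rightarrow> bool" where
  "projectivity n h \<longleftrightarrow> linear h \<and>
     bij_betw h (coord_space n \<times> UNIV) (coord_space n \<times> UNIV)"

definition finite_on :: "(vec \<times> real \<Rightarrow> vec \<times> real) \<Rightarrow> vec set \<Rightarrow> bool" where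
  "finite_on h S \<longleftrightarrow> (\<forall>x\<in>S. snd (h (x, 1)) \<noteq> 0)"

definition proj_map :: "(vec \<times> real \<Rightarrow> vec \<times> real) \<Rightarrow> vec \<Rightarrow> vec" where
  "proj_map h x = fst (h (x, 1)) /\<^sub>R snd (h (x, 1))"

definition proj_image ::
  "(vec \<times> real \<Rightarrow> vec \<times> real) \<Rightarrow> 'i indexed_polytope \<Rightarrow> 'i indexed_polytope" where
  "proj_image h P = (proj_map h ` body P, \<lambda>f. proj_map h ` face P f)"

definition same_projective_type ::
  "'i rel \<Rightarrow> 'i indexed_polytope \<Rightarrow> 'i indexed_polytope \<Rightarrow> bool" where
  "same_projective_type r P Q \<longleftrightarrow> realization r P \<and> realization r Q \<and>
     (\<exists>h. projectivity (nat (affdim (body P))) h \<and> finite_on h (body P) \<and>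
          (\<forall>f\<in>Field r. proj_map h ` face P f = face Q f))"


section \<open>First-order formulas over real closed fields\<close>

datatype 'v rcf_term =
    Var 'v
  | Zero
  | One
  | Add "'v rcf_term" "'v rcf_term"
  | Mul "'v rcf_term" "'v rcf_term"

datatype 'v rcf_formula =
    Le "'v rcf_term" "'v rcf_term"
  | Eq "'v rcf_term" "'v rcf_term"
  | Neg "'v rcf_formula"
  | Conj "'v rcf_formula" "'v rcf_formula"
  | Exi 'v "'v rcf_formula"

primrec term_val :: "('v \<Rightarrow> real) \<Rightarrow> 'v rcf_term \<Rightarrow> real" where
  "term_val e (Var x) = e x"
| "term_val e Zero = 0"
| "term_val e One = 1"
| "term_val e (Add s t) = term_val e s + term_val e t"
| "term_val e (Mul s t) = term_val e s * term_val e t"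

text \<open>Truth in the ordered field \<open>K \<subseteq> \<real>\<close>: the quantifier ranges over \<open>K\<close>.\<close>

primrec sat :: "real set \<Rightarrow> ('v \<Rightarrow> real) \<Rightarrow> 'v rcf_formula \<Rightarrow> bool" where
  "sat K e (Le s t) \<longleftrightarrow> term_val e s \<le> term_val e t"
| "sat K e (Eq s t) \<longleftrightarrow> term_val e s = term_val e t"
| "sat K e (Neg p) \<longleftrightarrow> \<not> sat K e p"
| "sat K e (Conj p q) \<longleftrightarrow> sat K e p \<and> sat K e q"
| "sat K e (Exi x p) \<longleftrightarrow> (\<exists>a\<in>K. sat K (e(x := a)) p)"

primrec term_vars :: "'v rcf_term \<Rightarrow> 'v set" where
  "term_vars (Var x) = {x}"
| "term_vars Zero = {}"
| "term_vars One = {}"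
| "term_vars (Add s t) = term_vars s \<union> term_vars t"
| "term_vars (Mul s t) = term_vars s \<union> term_vars t"

primrec free_vars :: "'v rcf_formula \<Rightarrow> 'v set" where
  "free_vars (Le s t) = term_vars s \<union> term_vars t"
| "free_vars (Eq s t) = term_vars s \<union> term_vars t"
| "free_vars (Neg p) = free_vars p"
| "free_vars (Conj p q) = free_vars p \<union> free_vars q"
| "free_vars (Exi x p) = free_vars p - {x}"

text \<open>
  Polytopes live in \<open>\<real>\<^sup>d\<close>, so the real closed fields that can contain their
  vertex coordinates are taken as subfields of \<open>\<real>\<close> (including \<open>\<real>\<close> itself).
\<close>

definition real_closed_subfield :: "real set \<Rightarrow> bool" where
  "real_closed_subfield K \<longleftrightarrow>
     0 \<in> K \<and> 1 \<in> K \<and>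
     (\<forall>x\<in>K. \<forall>y\<in>K. x + y \<in> K \<and> x * y \<in> K) \<and>
     (\<forall>x\<in>K. - x \<in> K \<and> inverse x \<in> K) \<and>
     (\<forall>x\<in>K. 0 \<le> x \<longrightarrow> (\<exists>y\<in>K. y * y = x)) \<and>
     (\<forall>p :: real poly. (\<forall>i. coeff p i \<in> K) \<and> odd (degree p) \<longrightarrow> (\<exists>x\<in>K. poly p x = 0))"


section \<open>Properties of several polytopes of the same combinatorial type\<close>

text \<open>
  A property takes the poset indexing the faces and a list of realizations of it.
\<close>

type_synonym 'i poly_property = "'i rel \<Rightarrow> 'i indexed_polytope list \<Rightarrow> bool"

definition realizations :: "nat \<Rightarrow> 'i rel \<Rightarrow> 'i indexed_polytope list \<Rightarrow> bool" where
  "realizations K r Ps \<longleftrightarrow> length Ps = K \<and> (\<forall>P\<in>set Ps. realization r P)"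

text \<open>
  The variable \<open>(i, j, k)\<close> stands for coordinate \<open>i\<close> of vertex \<open>j\<close> of polytope \<open>k\<close>, counting
  from \<open>0\<close>; \<open>vs\<close> is an enumeration of the vertices of the combinatorial polytope.
\<close>

definition coordinates :: "'i list \<Rightarrow> 'i indexed_polytope list \<Rightarrow> nat \<times> nat \<times> nat \<Rightarrow> real" where
  "coordinates vs Ps = (\<lambda>(i, j, k). Poly_Mapping.lookup (vertex_point (Ps ! k) (vs ! j)) i)"

definition semialgebraic :: "nat \<Rightarrow> 'i poly_property \<Rightarrow> bool" where
  "semialgebraic K \<psi> \<longleftrightarrow>
     (\<forall>r d vs. has_dimension r d \<and> distinct vs \<and> set vs = vertices r \<longrightarrow>
        (let idx = {..<nat d} \<times> {..<length vs} \<times> {..<K} in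
          \<exists>\<phi>. free_vars \<phi> \<subseteq> idx \<and>
            (\<forall>F Ps. real_closed_subfield F \<and> realizations K r Ps \<and>
                    (\<forall>x\<in>idx. coordinates vs Ps x \<in> F) \<longrightarrow>
                    (\<psi> r Ps \<longleftrightarrow> sat F (coordinates vs Ps) \<phi>))))"

text \<open>
  For polytopes in \<open>\<real>\<^sup>d\<close> and \<open>f\<close> of dimension \<open>e\<close>, projectivities of \<open>\<real>\<^sup>d\<close> move the faces with
  index \<open>f\<close> into \<open>\<real>\<^sup>e \<subseteq> \<real>\<^sup>d\<close>, where they are realizations of the face poset of \<open>f\<close>; the
  projectivities need only be finite on these faces.
\<close>

definition projectively_inherits :: "nat \<Rightarrow> 'i poly_property \<Rightarrow> 'i rel \<Rightarrow> 'i \<Rightarrow> bool" where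
  "projectively_inherits K \<psi> r f \<longleftrightarrow>
     (\<forall>Ps. realizations K r Ps \<and> \<psi> r Ps \<longrightarrow>
       (\<exists>hs. length hs = K \<and>
          (\<forall>k<K. projectivity (nat (affdim (body (Ps ! k)))) (hs ! k) \<and>
                 finite_on (hs ! k) (face (Ps ! k) f)) \<and>
          (let Qs = map2 (\<lambda>h P. proj_image h (face_polytope P f)) hs Ps in
             realizations K (face_poset r f) Qs \<and> \<psi> (face_poset r f) Qs)))"

definition ridges_inherit :: "nat \<Rightarrow> 'i poly_property \<Rightarrow> bool" where
  "ridges_inherit K \<psi> \<longleftrightarrow>
     (\<forall>r f. combinatorial_polytope r \<and> ridge r f \<longrightarrow> projectively_inherits K \<psi> r f)"

definition holds_combinatorial :: "nat \<Rightarrow> 'i poly_property \<Rightarrow> 'i rel \<Rightarrow> bool" where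
  "holds_combinatorial K \<psi> r \<longleftrightarrow> (\<exists>Ps. realizations K r Ps \<and> \<psi> r Ps)"

text \<open>The projective type is that of the realization \<open>P\<close> of \<open>r\<close>.\<close>

definition holds_projective ::
  "nat \<Rightarrow> 'i poly_property \<Rightarrow> 'i rel \<Rightarrow> 'i indexed_polytope \<Rightarrow> bool" where
  "holds_projective K \<psi> r P \<longleftrightarrow>
     (\<exists>Ps. length Ps = K \<and> (\<forall>Q\<in>set Ps. same_projective_type r P Q) \<and> \<psi> r Ps)"

definition lowest :: "int set \<Rightarrow> int \<Rightarrow> bool" where
  "lowest D d \<longleftrightarrow> d \<in> D \<and> (\<forall>e\<in>D. d \<le> e)"

end

theory Submission
  imports Defs
begin

text \<open>
  Only one implication needs work: a projective type without realizations satisfying the property must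
  yield such a combinatorial type, of dimension at most two higher. In dimension at most \<open>1\<close> all
  realizations of a combinatorial type are projectively equivalent. In dimension \<open>d \<ge> 2\<close> the
  idea is to build a polytope of dimension \<open>d + 2\<close>, the stamp of \<open>P\<close>, in every realization of which a
  certain ridge is projectively equivalent to \<open>P\<close>.

  A realization is encoded by the homogeneous coordinate vectors of its vertices, and its face lattice by
  the zero sets of linear functionals that are nonnegative on them (the facial sets). The stamp consists of
  \<open>P\<close> at infinity and a stack of generic simple polyhedra (layers) whose recession cone is the cone over
  \<open>P\<close>. In any realization the functionals that belong to the facet normals of adjacent layers agree
  on the ridge, so that suitable layers force collinearities among the dual vectors. Constructions as in
  von Staudt's algebra of throws then force every vector with algebraic coordinates into place, up to
  a projectivity.

  Hence the stamp exists as soon as the facets of \<open>P\<close> are algebraic up to a projectivity. Being the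
  projective type of a counterexample is a first-order condition by semialgebraicity of the property, so
  elimination of quantifiers provides an algebraic counterexample whenever there is any.
\<close>

section \<open>Finite vector configurations and their facial sets\<close>

text \<open>A realization of the stamp is known by its face lattice only, so the functional of a
  facet is known up to a positive factor, and two of them can be compared only where the facets meet
  a common layer. The functionals for a normal \<open>x\<close> in the gaps on both sides of a layer
  are proportional at infinity if \<open>x\<close> is a facet normal of that layer. But to force
  \<open>a\<close>, which lies between \<open>b\<close> and \<open>x\<close>, into their span takes
  a layer whose facets \<open>b\<close> and \<open>x\<close> are adjacent, and such a layer cannot
  have \<open>a\<close> as a facet normal. Hence blocks of layers \<open>A\<close>,
  \<open>B\<close>, \<open>A\<close>, in which auxiliary lines carry \<open>a\<close> across
  \<open>B\<close>. Finitely many incidences and inequalities pin a number by polynomial relations,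
  so it has to be algebraic. Sums are respected only in the interior of the dual cone, so the cone
  is moved into the positive orthant, where vectors with nonnegative entries form the grid for
  coordinates; a functional with entries of any sign is found as the meeting point of two lines
  through the grid. The two extra dimensions are the homogenizing coordinate of the layers and the
  coordinate that numbers them.\<close>

definition facial :: "('v => 'x::real_vector) => 'v set => 'v set => bool" where
 "facial a V B \<longleftrightarrow>
   (\<exists>f. linear f & (\<forall>v\<in>V. 0 <= (f (a v) :: real)) & B = {v\<in>V. f (a v) = 0})"

lemma facialI:
 assumes "linear f" "!!v. v \<in> V ==> 0 <= (f (a v) :: real)" "B = {v\<in>V. f (a v) = 0}"
 shows "facial a V B"
 using assms unfolding facial_def by blast

lemma facialE:
 assumes "facial a V B"
 obtains f where "linear f" "!!v. v \<in> V ==> 0 <= (f (a v) :: real)"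
  "!!v. v \<in> V ==> f (a v) = 0 \<longleftrightarrow> v \<in> B" "!!v. v \<in> V ==> v ~: B ==> 0 < f (a v)"
proof -
 obtain f where f: "linear f" "\<forall>v\<in>V. 0 <= (f (a v) :: real)" "B = {v\<in>V. f (a v) = 0}"
  using assms unfolding facial_def by blast
 have "0 < f (a v)" if "v \<in> V" "v ~: B" for v
  using f that by (metis (mono_tags, lifting) mem_Collect_eq order_less_le)
 thus ?thesis
  using that[of f] f by blast
qed

lemma facialE3:
 assumes "facial a V B"
 obtains f where "linear f" "!!v. v \<in> V ==> 0 <= (f (a v) :: real)"
  "!!v. v \<in> V ==> f (a v) = 0 \<longleftrightarrow> v \<in> B"
 using facialE[OF assms] by metis

lemma facial_subset: "facial a V B ==> B \<subseteq> V"
 unfolding facial_def by blast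

lemma facial_singletons_inj:
 assumes "!!v. v \<in> V ==> facial a V {v}"
 shows "inj_on a V"
proof (rule inj_onI)
 fix v w assume vw: "v \<in> V" "w \<in> V" "a v = a w"
 obtain f where "!!u. u \<in> V ==> f (a u) = (0::real) \<longleftrightarrow> u \<in> {v}" using assms[OF vw(1)] by (metis facialE)
 thus "v = w" using vw by (metis singletonD singletonI)
qed

lemma linear_zero_fun: "linear (%x. 0)"
 by (rule linearI) auto

lemma facial_self: "facial a V V"
 by (rule facialI[OF linear_zero_fun]) auto

lemma facial_Int:
 assumes "facial a V B" "facial a V C"
 shows "facial a V (B \<inter> C)"
proof -
 obtain f where f: "linear f" "!!v. v \<in> V ==> 0 <= (f (a v) :: real)"
  "!!v. v \<in> V ==> f (a v) = 0 \<longleftrightarrow> v \<in> B" using assms(1) by (rule facialE3) blast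
 obtain g where g: "linear g" "!!v. v \<in> V ==> 0 <= (g (a v) :: real)"
  "!!v. v \<in> V ==> g (a v) = 0 \<longleftrightarrow> v \<in> C" using assms(2) by (rule facialE3) blast
 have "B \<inter> C = {v\<in>V. f (a v) + g (a v) = 0}"
  using f g facial_subset[OF assms(1)] by (auto simp: add_nonneg_eq_0_iff)
 thus ?thesis
  by (intro facialI[of "%x. f x + g x"]) (auto simp: linear_compose_add f(1,2) g(1,2))
qed

text \<open>The functional is pulled back along \<open>T\<close>, and the factors \<open>c\<close>
  change no sign. Used with a map and with its inverse on the span, this makes facial sets invariant
  under linear maps combined with positive rescaling of single vectors, which is what projectivities
  do to homogeneous coordinates.\<close>

lemma facial_mono_linear:
 assumes "facial b V B" "linear T" "!!v. v \<in> V ==> c v > 0 & T (a v) = c v *\<^sub>R b v"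
 shows "facial a V B"
proof -
 obtain f where f: "linear f" "!!v. v \<in> V ==> 0 <= (f (b v) :: real)"
  "!!v. v \<in> V ==> f (b v) = 0 \<longleftrightarrow> v \<in> B" using assms(1) by (rule facialE3) blast
 have eq: "f (T (a v)) = c v * f (b v)" "c v ~= 0" if "v \<in> V" for v
  using assms(3)[OF that] f(1) by (simp_all add: linear_cmul)
 have "B = {v\<in>V. f (T (a v)) = 0}"
  using eq f(3) facial_subset[OF assms(1)] by auto
 thus ?thesis
  using f(2) assms(3) eq
  by (intro facialI[of "%x. f (T x)"]) (auto simp: linear_compose[OF assms(2) f(1), unfolded o_def] less_imp_le)
qed

lemma facial_cong:
 assumes "!!v. v \<in> V ==> a v = b v"
 shows "facial a V B \<longleftrightarrow> facial b V B"
 unfolding facial_def using assms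
 by (metis (no_types, lifting) Collect_cong)

lemma facial_image:
 assumes "inj_on h V" "B \<subseteq> V"
 shows "facial a (h ` V) (h ` B) \<longleftrightarrow> facial (%v. a (h v)) V B"
proof -
 have "h ` B = {v \<in> h ` V. P v} \<longleftrightarrow> B = {v \<in> V. P (h v)}" for P
 proof -
  have "{v \<in> h ` V. P v} = h ` {v \<in> V. P (h v)}" by auto
  thus ?thesis using inj_on_image_eq_iff[OF assms(1,2), of "{v \<in> V. P (h v)}"] by auto
 qed
 thus ?thesis
  unfolding facial_def by simp
qed

lemma ex_bound_scale:
 assumes "finite A" "!!v. v \<in> A ==> 0 < (g v :: real)"
 shows "\<exists>N\<ge>0. \<forall>v\<in>A. f v + N * g v > 0"
proof -
 have "\<exists>N\<ge>0. \<forall>v\<in>A. \<bar>f v\<bar> < N * g v"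
  using assms
 proof (induction A)
  case empty
  thus ?case by (intro exI[of _ 0]) auto
 next
  case (insert x A)
  then obtain N where N: "N >= 0" "\<forall>v\<in>A. \<bar>f v\<bar> < N * g v" by auto
  define M where "M = max N (\<bar>f x\<bar> / g x + 1)"
  have "\<bar>f v\<bar> < M * g v" if "v \<in> A" for v
  proof -
   have "N * g v <= M * g v"
    using insert.prems that by (intro mult_right_mono) (auto simp: M_def less_imp_le)
   thus ?thesis using N that by fastforce
  qed
  moreover have "\<bar>f x\<bar> < M * g x"
  proof -
   have "\<bar>f x\<bar> < (\<bar>f x\<bar> / g x + 1) * g x"
    using insert.prems[of x] by (simp add: field_simps)
   also have "\<dots> <= M * g x"
    using insert.prems[of x] by (intro mult_right_mono) (auto simp: M_def less_imp_le)
   finally show ?thesis .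
  qed
  ultimately show ?case
   using N(1) by (intro exI[of _ M]) (auto simp: M_def)
 qed
 then obtain N where N: "N >= 0" "\<forall>v\<in>A. \<bar>f v\<bar> < N * g v" by blast
 have "f v + N * g v > 0" if "v \<in> A" for v
  using N(2) that by (smt (verit))
 thus ?thesis using N(1) by blast
qed

text \<open>A face of a face is a face: a functional exposing \<open>B\<close> inside
  \<open>G\<close> may be negative outside \<open>G\<close>, and a large multiple of the functional
  exposing \<open>G\<close> repairs this without touching \<open>G\<close>.\<close>

lemma facial_sub:
 assumes "finite V" "facial a V G" "B \<subseteq> G"
 shows "facial a G B \<longleftrightarrow> facial a V B"
proof
 assume "facial a G B"
 then obtain f where f: "linear f" "!!v. v \<in> G ==> 0 <= (f (a v) :: real)"
  "!!v. v \<in> G ==> f (a v) = 0 \<longleftrightarrow> v \<in> B" by (rule facialE3) blast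
 obtain g where g: "linear g" "!!v. v \<in> V ==> 0 <= (g (a v) :: real)"
  "!!v. v \<in> V ==> g (a v) = 0 \<longleftrightarrow> v \<in> G" "!!v. v \<in> V ==> v ~: G ==> 0 < g (a v)"
  using assms(2) by (rule facialE) blast
 obtain N where N: "N >= 0" "\<forall>v\<in>V - G. f (a v) + N * g (a v) > 0"
  using ex_bound_scale[of "V - G" "%v. g (a v)" "%v. f (a v)"] g(4) assms(1) by auto
 have sub: "G \<subseteq> V" using facial_subset[OF assms(2)] .
 have on: "g (a v) = 0" if "v \<in> G" for v
  using g(3)[of v] that sub by auto
 have nn: "0 <= f (a v) + N * g (a v)" if "v \<in> V" for v
 proof (cases "v \<in> G")
  case True thus ?thesis using on[OF True] f(2)[OF True] by simp
 next
  case False thus ?thesis using N(2) that by (simp add: less_imp_le)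
 qed
 have "B = {v\<in>V. f (a v) + N * g (a v) = 0}"
 proof (intro set_eqI iffI)
  fix v assume "v \<in> B"
  thus "v \<in> {v\<in>V. f (a v) + N * g (a v) = 0}" using assms(3) sub on f(3) by auto
 next
  fix v assume v: "v \<in> {v\<in>V. f (a v) + N * g (a v) = 0}"
  have "v \<in> G"
  proof (rule ccontr)
   assume "v ~: G"
   hence "f (a v) + N * g (a v) > 0" using N(2) v by blast
   thus False using v by simp
  qed
  thus "v \<in> B" using v on[of v] f(3)[of v] by simp
 qed
 thus "facial a V B"
  using nn linear_compose_add[OF f(1) linear_compose_scale_right[OF g(1), of N]]
  by (intro facialI[of "%x. f x + N * g x"]) auto
next
 assume "facial a V B"
 then obtain f where f: "linear f" "!!v. v \<in> V ==> 0 <= (f (a v) :: real)"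
  "!!v. v \<in> V ==> f (a v) = 0 \<longleftrightarrow> v \<in> B" by (rule facialE3) blast
 thus "facial a G B"
  using facial_subset[OF assms(2)] assms(3) by (intro facialI[OF f(1)]) (auto simp: subset_iff)
qed

text \<open>Induction on the generators, in any real vector space and without closedness arguments.
  If the functional \<open>f\<close> obtained for \<open>V\<close> is negative on the new vector
  \<open>a n\<close>, everything is projected along \<open>a n\<close> to the kernel of
  \<open>f\<close>, and the induction hypothesis is applied there once more.\<close>

lemma farkas:
 assumes "finite V"
 shows "(\<exists>c. (\<forall>v\<in>V. 0 <= c v) & b = (\<Sum>v\<in>V. c v *\<^sub>R a v)) |
     (\<exists>f. linear f & (\<forall>v\<in>V. 0 <= (f (a v) :: real)) & f b < 0)"
 using assms
proof (induction V arbitrary: a b rule: finite_induct)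
 case empty
 show ?case
 proof (cases "b = 0")
  case False
  hence "independent {b}" by (simp add: dependent_single)
  then obtain f where "linear f" "\<forall>x\<in>{b}. f x = (- 1 :: real)"
   using linear_independent_extend[of "{b}" "%_. - 1 :: real"] by blast
  thus ?thesis by (intro disjI2 exI[of _ f]) auto
 qed simp
next
 case (insert n V)
 consider c where "\<forall>v\<in>V. 0 <= c v" "b = (\<Sum>v\<in>V. c v *\<^sub>R a v)"
  | f where "linear f" "\<forall>v\<in>V. 0 <= (f (a v) :: real)" "f b < 0"
  using insert.IH[where a=a and b=b] by blast
 thus ?case
 proof cases
  case 1
  have "b = (\<Sum>v\<in>insert n V. (c(n := 0)) v *\<^sub>R a v)"
   using insert.hyps 1(2) by (simp, intro sum.cong) auto
  moreover have "\<forall>v\<in>insert n V. 0 <= (c(n := 0)) v" using 1(1) by auto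
  ultimately show ?thesis by blast
 next
  case (2 f)
  note f = 2
  show ?thesis
  proof (cases "f (a n) >= 0")
   case True
   thus ?thesis using f by blast
  next
   case False
   hence neg: "f (a n) < 0" by simp
   define pr where "pr x = x - (f x / f (a n)) *\<^sub>R a n" for x
   have lpr: "linear pr"
    unfolding pr_def using f(1)
    by (intro linearI) (auto simp: linear_add linear_cmul algebra_simps add_divide_distrib)
   consider c where "\<forall>v\<in>V. 0 <= c v" "pr b = (\<Sum>v\<in>V. c v *\<^sub>R pr (a v))"
    | g where "linear g" "\<forall>v\<in>V. 0 <= (g (pr (a v)) :: real)" "g (pr b) < 0"
    using insert.IH[where a="%v. pr (a v)" and b="pr b"] by blast
   thus ?thesis
   proof cases
    case 1
    \<comment> \<open>The coefficient of \<open>a n\<close> that undoes the projection. It is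
      nonnegative because \<open>f\<close> is negative at \<open>b\<close> and at \<open>a n\<close>
      and nonnegative on the old vectors.\<close>
    define d where "d = f b / f (a n) - (\<Sum>v\<in>V. c v * (f (a v) / f (a n)))"
    have d: "d >= 0"
    proof -
     have "(\<Sum>v\<in>V. c v * (f (a v) / f (a n))) <= 0"
      using 1(1) f(2) neg
      by (intro sum_nonpos mult_nonneg_nonpos) (auto simp: divide_nonneg_neg)
     moreover have "f b / f (a n) >= 0" using f(3) neg by (simp add: divide_nonpos_neg)
     ultimately show ?thesis by (simp add: d_def)
    qed
    have "b = (\<Sum>v\<in>V. c v *\<^sub>R pr (a v)) + (f b / f (a n)) *\<^sub>R a n"
     using 1(2) unfolding pr_def by (simp add: algebra_simps)
    also have "(\<Sum>v\<in>V. c v *\<^sub>R pr (a v)) =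
      (\<Sum>v\<in>V. c v *\<^sub>R a v) - (\<Sum>v\<in>V. c v * (f (a v) / f (a n))) *\<^sub>R a n"
     unfolding pr_def by (simp add: scaleR_diff_right sum_subtractf scaleR_sum_left)
    finally have "b = (\<Sum>v\<in>V. c v *\<^sub>R a v) + d *\<^sub>R a n"
     by (simp add: d_def algebra_simps)
    moreover have "(\<Sum>v\<in>V. (c(n := d)) v *\<^sub>R a v) = (\<Sum>v\<in>V. c v *\<^sub>R a v)"
     using insert.hyps by (intro sum.cong) auto
    ultimately have "b = (\<Sum>v\<in>insert n V. (c(n := d)) v *\<^sub>R a v)"
     using insert.hyps by simp
    moreover have "\<forall>v\<in>insert n V. 0 <= (c(n := d)) v" using 1(1) d by auto
    ultimately show ?thesis by blast
   next
    case (2 g)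
    have "pr (a n) = 0" using neg by (simp add: pr_def)
    hence "g (pr (a n)) = 0" using 2(1) by (simp add: linear_0)
    thus ?thesis
     using 2 linear_compose[OF lpr 2(1)] unfolding o_def
     by (intro disjI2 exI[of _ "%x. g (pr x)"]) auto
   qed
  qed
 qed
qed

section \<open>Separating functionals and the dimension of finite sets, in spaces of arbitrary
  dimension\<close>

lemma ex_separating_functional:
 fixes S :: "'x::real_vector set"
 assumes "x ~: span S"
 shows "\<exists>f. linear f & (\<forall>y\<in>span S. f y = (0::real)) & f x = 1"
proof -
 obtain B where B: "B \<subseteq> S" "independent B" "span B = span S"
  using maximal_independent_subset[of S] by (metis span_eq span_superset subset_trans)
 have ind: "independent (insert x B)"
  using B assms by (metis independent_insert span_superset subsetD)
 then obtain f where f: "linear f" "\<forall>y\<in>insert x B. f y = (if y = x then 1 else 0 :: real)"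
  using linear_independent_extend[of "insert x B" "%y. if y = x then 1 else 0 :: real"] by blast
 have "x ~: B" using B assms span_superset by blast
 hence "\<forall>y\<in>B. f y = 0" using f by auto
 hence "\<forall>y\<in>span B. f y = 0"
  using linear_eq_0_on_span[OF f(1)] by blast
 thus ?thesis using f B(3) by auto
qed

lemma fin_basis:
 fixes S :: "'x::real_vector set"
 assumes "finite S"
 obtains B where "B \<subseteq> S" "independent B" "span B = span S" "card B = dim S"
proof -
 obtain B where B: "B \<subseteq> S" "independent B" "S \<subseteq> span B" "card B = dim S"
  using basis_exists[of S] by metis
 thus ?thesis
  using that[of B] by (metis span_mono span_span subset_antisym)
qed

lemma dim_mono_fin:
 fixes S T :: "'x::real_vector set"
 assumes "S \<subseteq> span T" "finite T"
 shows "dim S <= dim T"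
proof -
 obtain B where B: "B \<subseteq> S" "independent B" "S \<subseteq> span B" "card B = dim S"
  using basis_exists[of S] by metis
 obtain C where C: "C \<subseteq> T" "independent C" "span C = span T" "card C = dim T"
  using fin_basis[OF assms(2)] by metis
 have "B \<subseteq> span C" using B(1) assms(1) C(3) by auto
 hence "card B <= card C"
  using independent_span_bound[OF _ B(2)] C(1) assms(2) finite_subset by blast
 thus ?thesis using B C by simp
qed

lemma dim_le_card_fin:
 fixes T :: "'x::real_vector set"
 assumes "S \<subseteq> span T" "finite T"
 shows "dim S <= card T"
proof -
 obtain C where C: "C \<subseteq> T" "independent C" "span C = span T" "card C = dim T"
  using fin_basis[OF assms(2)] by metis
 have "dim S <= dim T" using dim_mono_fin assms by blast
 also have "\<dots> <= card T" using C assms(2) card_mono by metis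
 finally show ?thesis .
qed

lemma dim_empty_fin: "dim ({} :: 'x::real_vector set) = 0"
 using dim_le_card_fin[of "{}" "{} :: 'x set"] by simp

lemma dim_insert_fin:
 fixes S :: "'x::real_vector set"
 assumes "finite S" "x ~: span S"
 shows "dim (insert x S) = Suc (dim S)"
proof -
 obtain B where B: "B \<subseteq> S" "independent B" "span B = span S" "card B = dim S"
  using fin_basis[OF assms(1)] by metis
 have "independent (insert x B)" "x ~: B"
  using B assms span_superset by (auto simp: independent_insert)
 moreover have "span (insert x B) = span (insert x S)"
  using B(3) by (simp add: span_insert)
 ultimately have "dim (insert x S) = card (insert x B)"
  using dim_eq_card by blast
 thus ?thesis
  using B \<open>x ~: B\<close> assms(1) finite_subset by fastforce
qed

lemma dim_less_fin:
 fixes S T :: "'x::real_vector set"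
 assumes "finite T" "S \<subseteq> span T" "x \<in> span T" "x ~: span S" "finite S"
 shows "dim S < dim T"
proof -
 have "dim (insert x S) <= dim T" using assms by (intro dim_mono_fin) auto
 thus ?thesis using dim_insert_fin[OF assms(5,4)] by simp
qed

lemma span_eq_if_dim:
 fixes S T :: "'x::real_vector set"
 assumes "finite T" "finite S" "S \<subseteq> span T" "dim T <= dim S"
 shows "span S = span T"
proof -
 have "T \<subseteq> span S"
  using dim_less_fin[OF assms(1,3) _ _ assms(2)] assms(4) span_superset by (metis linorder_not_le subset_iff)
 thus ?thesis using assms(3) by (simp add: span_eq)
qed

lemma linear_inj_on_if_dim:
 fixes G :: "'x::real_vector => 'y::real_vector"
 assumes fin: "finite X" and lin: "linear G" and dim: "dim (G ` X) = dim X"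
 shows "inj_on G (span X)"
proof -
 obtain B where B: "B \<subseteq> X" "independent B" "span B = span X" "card B = dim X" using fin_basis[OF fin] by blast
 have fB: "finite B" using B(1) fin finite_subset by blast
 have "span (G ` B) = span (G ` X)" using B(3) linear_span_image[OF lin] by metis
 hence dG: "dim (G ` B) = card B" using dim B(4) by (metis dim_span)
 have cG: "card (G ` B) = card B"
  using dim_le_card_fin[of "G ` B" "G ` B"] fB dG card_image_le[OF fB, of G] by (simp add: span_superset)
 have "independent (G ` B)"
 proof (rule ccontr)
  assume "\<not> ?thesis"
  then obtain b where b: "b \<in> G ` B" "b \<in> span (G ` B - {b})" unfolding dependent_def by blast
  hence "G ` B \<subseteq> span (G ` B - {b})" by (metis Diff_insert0 insert_Diff insert_subset span_superset)
  hence "dim (G ` B) <= card (G ` B - {b})" using fB by (intro dim_le_card_fin) auto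
  thus False using b(1) fB dG cG by (metis card_Diff1_less finite_imageI leD)
 qed
 thus ?thesis
  using linear_inj_on_span_independent_image[OF lin] eq_card_imp_inj_on[OF fB cG] B(3) by metis
qed

lemma span_scaled:
 assumes "!!v. v \<in> V ==> 0 < c v & a v = c v *\<^sub>R b v"
 shows "span (a ` V) = span (b ` V)"
proof -
 have "b v = (1 / c v) *\<^sub>R a v" if "v \<in> V" for v using assms[OF that] by simp
 hence "b ` V \<subseteq> span (a ` V)" by (auto intro: span_scale span_base)
 moreover have "a ` V \<subseteq> span (b ` V)" using assms by (auto intro: span_scale span_base)
 ultimately show ?thesis by (simp add: span_eq)
qed

text \<open>The partner of \<open>facial_mono_linear\<close>: a left inverse of \<open>G\<close> on
  the span carries the \<open>b v\<close> back to positive multiples of the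
  \<open>a v\<close>.\<close>

lemma scaled_inverse:
 assumes G: "linear G" "inj_on G (span (a ` V))" "!!v. v \<in> V ==> 0 < c v & G (a v) = c v *\<^sub>R b v"
 shows "\<exists>g. linear g & (\<forall>x\<in>span (a ` V). g (G x) = x) & (\<forall>v\<in>V. g (b v) = (1 / c v) *\<^sub>R a v)"
proof -
 obtain g where g: "linear g" "\<forall>x\<in>span (a ` V). g (G x) = x" using linear_inj_on_left_inverse[OF G(1,2)] by metis
 have "g (b v) = (1 / c v) *\<^sub>R a v" if v: "v \<in> V" for v
 proof -
  have "a v = c v *\<^sub>R g (b v)"
   using g(2)[rule_format, of "a v"] G(3)[OF v] v linear_cmul[OF g(1)] by (simp add: span_base)
  thus ?thesis using G(3)[OF v] by (metis divide_self_if less_irrefl scaleR_one scaleR_scaleR times_divide_eq_left mult_1)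
 qed
 thus ?thesis using g by blast
qed

section \<open>The dimension as an invariant of the facial sets\<close>

lemma facial_dim_less:
 assumes "finite V" "facial a V B" "B \<subset> C" "C \<subseteq> V"
 shows "dim (a ` B) < dim (a ` C)"
proof -
 obtain f where f: "linear f" "!!v. v \<in> V ==> f (a v) = (0::real) \<longleftrightarrow> v \<in> B"
  using assms(2) by (metis facialE)
 obtain x where x: "x \<in> C" "x ~: B" using assms(3) by auto
 have "\<forall>y\<in>a ` B. f y = 0" using f(2) assms(3,4) by auto
 hence "\<forall>y\<in>span (a ` B). f y = 0" using linear_eq_0_on_span[OF f(1)] by blast
 moreover have "f (a x) ~= 0" using f(2) x assms(4) by auto
 ultimately have "a x ~: span (a ` B)" by auto
 moreover have "finite C" using assms(1,4) finite_subset by blast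
 ultimately show ?thesis
  using assms(3) x finite_subset[of B C]
  by (intro dim_less_fin[of _ _ "a x"]) (auto intro!: span_base)
qed

lemma facial_span_mem:
 assumes "facial a V B" "v \<in> V" "C \<subseteq> B" "a v \<in> span (a ` C)"
 shows "v \<in> B"
proof -
 obtain f where f: "linear f" "!!v. v \<in> V ==> f (a v) = (0::real) \<longleftrightarrow> v \<in> B"
  using assms(1) by (metis facialE)
 have "\<forall>y\<in>a ` C. f y = 0" using f(2) assms(3) facial_subset[OF assms(1)] by auto
 hence "f (a v) = 0" using linear_eq_0_on_span[OF f(1)] assms(4) by blast
 thus ?thesis using f(2) assms(2) by simp
qed

text \<open>A smallest facial set \<open>G\<close> properly containing \<open>B\<close> has the
  required dimension. Otherwise some functional \<open>q\<close> vanishes on \<open>B\<close> and on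
  one more vector \<open>v\<close> of \<open>G\<close> but not on all of \<open>G\<close>; tilting
  it against the functional \<open>u\<close> that exposes \<open>B\<close> produces a facial set
  strictly between.\<close>

lemma facial_up:
 assumes "finite V" "facial a V B" "B ~= V"
 shows "\<exists>C. facial a V C & B \<subset> C & dim (a ` C) = Suc (dim (a ` B))"
proof -
 have ex: "\<exists>G. facial a V G & B \<subset> G"
  using facial_self facial_subset[OF assms(2)] assms(3) by blast
 define P where "P G \<longleftrightarrow> facial a V G & B \<subset> G" for G
 obtain G0 where "P G0" using ex by (auto simp: P_def)
 from ex_has_least_nat[of P, OF this, of card] obtain G
  where G': "P G" "!!G'. P G' ==> card G <= card G'" by blast
 have G: "facial a V G" "B \<subset> G"
  and min: "!!G'. facial a V G' ==> B \<subset> G' ==> card G <= card G'"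
  using G' by (simp_all add: P_def)
 have GV: "G \<subseteq> V" and fG: "finite G" using facial_subset[OF G(1)] assms(1) finite_subset by auto
 have fB: "finite B" using G(2) fG finite_subset by blast
 obtain v where v: "v \<in> G" "v ~: B" using G(2) by auto
 have "a ` G \<subseteq> span (a ` insert v B)"
 proof (rule ccontr)
  assume "\<not> ?thesis"
  then obtain w where w: "w \<in> G" "a w ~: span (a ` insert v B)" by auto
  obtain q where q: "linear q" "\<forall>y\<in>span (a ` insert v B). q y = (0::real)" "q (a w) = 1"
   using ex_separating_functional[OF w(2)] by blast
  have q0: "q (a z) = 0" if "z \<in> insert v B" for z
   using q(2) that by (meson imageI span_base)
  have "facial a G B" using facial_sub[OF assms(1) G(1)] assms(2) G(2) by blast
  then obtain u where u: "linear u" "!!z. z \<in> G ==> 0 <= (u (a z) :: real)"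
   "!!z. z \<in> G ==> u (a z) = 0 \<longleftrightarrow> z \<in> B" "!!z. z \<in> G ==> z ~: B ==> 0 < u (a z)"
   by (rule facialE) blast
  \<comment> \<open>The largest multiple of \<open>u\<close> that can be subtracted from
    \<open>q\<close> with a nonnegative result on \<open>G\<close>; it creates a zero outside
    \<open>B\<close>.\<close>
  define m where "m = Min ((%z. q (a z) / u (a z)) ` (G - B))"
  have fin: "finite ((%z. q (a z) / u (a z)) ` (G - B))" "(%z. q (a z) / u (a z)) ` (G - B) ~= {}"
   using fG v by auto
  obtain z0 where z0: "z0 \<in> G" "z0 ~: B" "m = q (a z0) / u (a z0)"
   using Min_in[OF fin] unfolding m_def by auto
  have mle: "m * u (a z) <= q (a z)" if "z \<in> G" "z ~: B" for z
  proof -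
   have "m <= q (a z) / u (a z)" unfolding m_def using that by (intro Min_le[OF fin(1)]) auto
   thus ?thesis using u(4)[OF that] by (simp add: field_simps)
  qed
  define F where "F x = q x - m * u x" for x
  have lF: "linear F" unfolding F_def
   using linear_compose_sub[OF q(1) linear_compose_scale_right[OF u(1), of m]] by simp
  have FB: "F (a z) = 0" if "z \<in> B" for z
   using q0[of z] u(3)[of z] that G(2) by (auto simp: F_def)
  have F0: "F (a z0) = 0" using z0 u(4)[of z0] by (simp add: F_def)
  define Z where "Z = {z\<in>G. F (a z) = 0}"
  have "facial a G Z"
   using mle FB by (intro facialI[OF lF]) (force simp: Z_def F_def)+
  hence fz: "facial a V Z" using facial_sub[OF assms(1) G(1), of Z] by (auto simp: Z_def)
  have "B \<subset> Z" using FB F0 z0 G(2) by (auto simp: Z_def)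
  hence "card G <= card Z" using min fz by blast
  hence "Z = G" using fG by (metis (no_types, lifting) Z_def card_seteq mem_Collect_eq subsetI)
  \<comment> \<open>The zero at \<open>v\<close> forces \<open>m = 0\<close>, and then
    \<open>F\<close> is \<open>q\<close>, which is \<open>1\<close> at \<open>w\<close>.\<close>
  hence "F (a v) = 0" "F (a w) = 0" using v w by (auto simp: Z_def)
  thus False using q0[of v] u(4)[OF v] q(3) by (auto simp: F_def)
 qed
 hence "dim (a ` G) <= dim (a ` insert v B)" using fB by (intro dim_mono_fin) auto
 also have "\<dots> <= Suc (dim (a ` B))"
  using fB dim_insert_fin[of "a ` B" "a v"]
  by (cases "a v \<in> span (a ` B)")
    (auto simp: dim_mono_fin span_superset le_SucI intro!: le_SucI[OF dim_mono_fin])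
 finally have "dim (a ` G) = Suc (dim (a ` B))"
  using facial_dim_less[OF assms(1,2) G(2) GV] by simp
 thus ?thesis using G by blast
qed

text \<open>Along a chain of facial sets from \<open>{}\<close> to \<open>V\<close> given by
  \<open>facial_up\<close>, the dimension grows by exactly one in each step for \<open>a\<close> and
  by at least one for \<open>b\<close>.\<close>

lemma facial_dim_le:
 fixes a :: "'v => 'x::real_vector" and b :: "'v => 'y::real_vector"
 assumes "finite V" "!!B. facial a V B ==> facial b V B" "facial a V {}"
 shows "dim (a ` V) <= dim (b ` V)"
proof -
 have "dim (a ` V) + dim (b ` B) <= dim (b ` V) + dim (a ` B)" if "facial a V B" for B
  using that
 proof (induction "card V - card B" arbitrary: B rule: less_induct)
  case less
  show ?case
  proof (cases "B = V")
   case False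
   then obtain C where C: "facial a V C" "B \<subset> C" "dim (a ` C) = Suc (dim (a ` B))"
    using facial_up[OF assms(1) less.prems] by blast
   have CV: "C \<subseteq> V" using facial_subset[OF C(1)] .
   have "card B < card C" "card C <= card V"
    using C(2) CV assms(1) by (auto intro: psubset_card_mono card_mono finite_subset)
   hence "dim (a ` V) + dim (b ` C) <= dim (b ` V) + dim (a ` C)"
    using less.hyps[of C] C(1) by auto
   moreover have "dim (b ` B) < dim (b ` C)"
    using facial_dim_less[OF assms(1) assms(2)[OF less.prems] C(2) CV] .
   ultimately show ?thesis using C(3) by linarith
  qed simp
 qed
 from this[OF assms(3)] show ?thesis by (simp add: dim_empty_fin)
qed

lemma facial_dim_eq:
 fixes a :: "'v => 'x::real_vector" and b :: "'v => 'y::real_vector"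
 assumes "finite V" "!!B. facial a V B \<longleftrightarrow> facial b V B" "facial a V {}"
 shows "dim (a ` V) = dim (b ` V)"
proof (rule antisym)
 show "dim (a ` V) <= dim (b ` V)"
  by (rule facial_dim_le[OF assms(1) _ assms(3)]) (rule iffD1[OF assms(2)])
 show "dim (b ` V) <= dim (a ` V)"
  by (rule facial_dim_le[OF assms(1) iffD2[OF assms(2)] iffD1[OF assms(2) assms(3)]])
qed

text \<open>Only the facets among the \<open>B\<close> are needed below, but this way no notion of facet is.\<close>

lemma cone_by_facial_functionals:
 fixes a :: "'v => 'x::real_vector" and u :: "'v set => 'x => real"
 assumes V: "finite V" "card V >= 2"
  and single: "!!v. v \<in> V ==> facial a V {v}"
  and u: "!!B. facial a V B ==> B ~= {} ==> B ~= V ==> linear (u B) & (\<forall>v\<in>V. 0 <= u B (a v)) & B = {v\<in>V. u B (a v) = 0}"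
  and b: "b \<in> span (a ` V)"
  and pos: "!!B. facial a V B ==> B ~= {} ==> B ~= V ==> 0 <= u B b"
 shows "\<exists>c. (\<forall>v\<in>V. 0 <= c v) & b = (\<Sum>v\<in>V. c v *\<^sub>R a v)"
proof (rule ccontr)
 assume "\<not> ?thesis"
 hence ex: "\<exists>f. linear f & (\<forall>v\<in>V. 0 <= (f (a v) :: real)) & f b < 0"
  using farkas[OF V(1), of b a] by blast
 define Z where "Z f = {v\<in>V. f (a v) = (0::real)}" for f
 define good where "good f \<longleftrightarrow> linear f & (\<forall>v\<in>V. 0 <= (f (a v) :: real)) & f b < 0" for f
 obtain f0 where "good f0" using ex by (auto simp: good_def)
 moreover have "card (Z f) < Suc (card V)" for f
  using V(1) by (auto simp: Z_def less_Suc_eq_le intro!: card_mono)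
 ultimately obtain f where gf: "good f" and gmax: "!!g. good g ==> card (Z g) <= card (Z f)"
  using ex_has_greatest_nat_lemma[of good f0 "%f. card (Z f)"] ex_has_greatest_nat[of good f0 "%f. card (Z f)"]
  by (metis less_Suc_eq_le)
 have f: "linear f" "!!v. v \<in> V ==> 0 <= f (a v)" "f b < 0"
  using gf by (auto simp: good_def)
 have max: "card (Z g) <= card (Z f)"
  if "linear g" "!!v. v \<in> V ==> 0 <= (g (a v) :: real)" "g b < 0" for g
  using gmax[of g] that by (auto simp: good_def)
 have facZ: "facial a V (Z f)" by (rule facialI[OF f(1)]) (auto simp: Z_def f)
 have ZV: "Z f ~= V"
 proof
  assume "Z f = V"
  hence "\<forall>y\<in>a ` V. f y = 0" by (auto simp: Z_def)
  hence "f b = 0" using linear_eq_0_on_span[OF f(1)] b by blast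
  thus False using f(3) by simp
 qed
 obtain v0 where v0: "v0 \<in> V" using V(2) by fastforce
 \<comment> \<open>If \<open>f\<close> has no zeros, any singleton serves, so that
   \<open>u B\<close> is available. With the largest admissible \<open>t\<close>, the functional
   \<open>f - t * u B\<close> is still negative at \<open>b\<close> but has one zero more, against
   the choice of \<open>f\<close>.\<close>
 define B where "B = (if Z f = {} then {v0} else Z f)"
 have B: "facial a V B" "B ~= {}" "Z f \<subseteq> B" "B ~= V"
  using facZ single[OF v0] ZV V(2) by (auto simp: B_def)
 note uB = u[OF B(1,2,4)]
 have ulin: "linear (u B)" and unn: "!!v. v \<in> V ==> 0 <= u B (a v)" and uz: "!!v. v \<in> V ==> u B (a v) = 0 \<longleftrightarrow> v \<in> B"
  using uB by auto
 have upos: "0 < u B (a v)" if "v \<in> V - B" for v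
  using unn[of v] uz[of v] that by auto
 define t where "t = Min ((%v. f (a v) / u B (a v)) ` (V - B))"
 have fin: "finite ((%v. f (a v) / u B (a v)) ` (V - B))" "(%v. f (a v) / u B (a v)) ` (V - B) ~= {}"
  using V(1) B(4) facial_subset[OF B(1)] by auto
 obtain z where z: "z \<in> V - B" "t = f (a z) / u B (a z)"
  using Min_in[OF fin] unfolding t_def by auto
 have t0: "t >= 0" using z f(2) upos[of z] by (simp add: less_imp_le)
 have tle: "t * u B (a v) <= f (a v)" if "v \<in> V - B" for v
 proof -
  have "t <= f (a v) / u B (a v)" unfolding t_def using that by (intro Min_le[OF fin(1)]) auto
  thus ?thesis using upos[OF that] by (simp add: field_simps)
 qed
 define g where "g x = f x - t * u B x" for x
 have lg: "linear g" unfolding g_def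
  using linear_compose_sub[OF f(1) linear_compose_scale_right[OF ulin, of t]] by simp
 have "0 <= g (a v)" if "v \<in> V" for v
  using tle[of v] f(2)[OF that] uz[OF that] that by (cases "v \<in> B") (auto simp: g_def)
 moreover have "g b < 0" using f(3) t0 pos[OF B(1,2,4)] by (simp add: g_def) (smt (verit) mult_nonneg_nonneg)
 ultimately have le: "card (Z g) <= card (Z f)" using max lg by blast
 have "insert z (Z f) \<subseteq> Z g"
  using z upos[of z] B(3) uz by (auto simp: Z_def g_def)
 moreover have "z ~: Z f" using z B(3) by auto
 moreover have "finite (Z g)" "finite (Z f)" using V(1) by (auto simp: Z_def)
 ultimately have "Suc (card (Z f)) <= card (Z g)" by (metis card_insert_disjoint card_mono)
 thus False using le by simp
qed

section \<open>Faces of the convex hull of finitely many points\<close>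

abbreviation hom :: "'a::real_vector => 'a \<times> real" where "hom x \<equiv> (x, 1)"

lemma in_hull_iff_cone:
 assumes "finite V" "inj_on p V"
 shows "x \<in> convex hull (p ` V) \<longleftrightarrow>
  (\<exists>c. (\<forall>v\<in>V. 0 <= c v) & hom x = (\<Sum>v\<in>V. c v *\<^sub>R hom (p v)))"
proof -
 have "x \<in> convex hull (p ` V) \<longleftrightarrow>
   (\<exists>u. (\<forall>y\<in>p ` V. 0 <= u y) & sum u (p ` V) = 1 & (\<Sum>y\<in>p ` V. u y *\<^sub>R y) = x)"
  using convex_hull_finite[of "p ` V"] assms(1) by auto
 also have "\<dots> \<longleftrightarrow> (\<exists>c. (\<forall>v\<in>V. 0 <= c v) & sum c V = 1 & (\<Sum>v\<in>V. c v *\<^sub>R p v) = x)"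
 proof
  assume "\<exists>u. (\<forall>y\<in>p ` V. 0 <= u y) & sum u (p ` V) = 1 & (\<Sum>y\<in>p ` V. u y *\<^sub>R y) = x"
  then obtain u where "\<forall>y\<in>p ` V. 0 <= u y" "sum u (p ` V) = 1" "(\<Sum>y\<in>p ` V. u y *\<^sub>R y) = x" by blast
  thus "\<exists>c. (\<forall>v\<in>V. 0 <= c v) & sum c V = 1 & (\<Sum>v\<in>V. c v *\<^sub>R p v) = x"
   using assms(2) by (intro exI[of _ "%v. u (p v)"]) (auto simp: sum.reindex)
 next
  assume "\<exists>c. (\<forall>v\<in>V. 0 <= c v) & sum c V = 1 & (\<Sum>v\<in>V. c v *\<^sub>R p v) = x"
  then obtain c where c: "\<forall>v\<in>V. 0 <= c v" "sum c V = 1" "(\<Sum>v\<in>V. c v *\<^sub>R p v) = x" by blast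
  thus "\<exists>u. (\<forall>y\<in>p ` V. 0 <= u y) & sum u (p ` V) = 1 & (\<Sum>y\<in>p ` V. u y *\<^sub>R y) = x"
   using assms(2)
   by (intro exI[of _ "%y. c (inv_into V p y)"]) (auto simp: sum.reindex cong: sum.cong)
 qed
 also have "\<dots> \<longleftrightarrow> (\<exists>c. (\<forall>v\<in>V. 0 <= c v) & hom x = (\<Sum>v\<in>V. c v *\<^sub>R hom (p v)))"
  by (auto simp: prod_eq_iff fst_sum snd_sum)
 finally show ?thesis .
qed

lemma hull_zero_set:
 assumes "finite V" "inj_on p V" "linear f" "!!v. v \<in> V ==> 0 <= (f (hom (p v)) :: real)"
  and B: "B = {v\<in>V. f (hom (p v)) = 0}"
 shows "convex hull (p ` B) = {x \<in> convex hull (p ` V). f (hom x) = 0}"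
  and "!!x. x \<in> convex hull (p ` V) ==> 0 <= f (hom x)"
proof -
 have fsum: "f (\<Sum>v\<in>V. c v *\<^sub>R hom (p v)) = (\<Sum>v\<in>V. c v * f (hom (p v)))" for c
  using assms(3) by (simp add: linear_sum linear_cmul del: scaleR_Pair)
 have BV: "B \<subseteq> V" using B by auto
 show nn: "0 <= f (hom x)" if "x \<in> convex hull (p ` V)" for x
  using that assms(4) in_hull_iff_cone[OF assms(1,2), of x] fsum
  by (auto intro!: sum_nonneg)
 show "convex hull (p ` B) = {x \<in> convex hull (p ` V). f (hom x) = 0}"
 proof (intro set_eqI iffI)
  fix x assume x: "x \<in> convex hull (p ` B)"
  then obtain c where c: "\<forall>v\<in>B. 0 <= c v" "hom x = (\<Sum>v\<in>B. c v *\<^sub>R hom (p v))"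
   using in_hull_iff_cone[of B p x] assms(1,2) BV inj_on_subset finite_subset by blast
  have "f (hom x) = (\<Sum>v\<in>B. c v * f (hom (p v)))"
   unfolding c(2) using assms(3) by (simp add: linear_sum linear_cmul del: scaleR_Pair)
  also have "\<dots> = 0" using B by (intro sum.neutral) auto
  finally show "x \<in> {x \<in> convex hull (p ` V). f (hom x) = 0}"
   using x hull_mono[of "p ` B" "p ` V"] BV by auto
 next
  fix x assume x: "x \<in> {x \<in> convex hull (p ` V). f (hom x) = 0}"
  then obtain c where c: "\<forall>v\<in>V. 0 <= c v" "hom x = (\<Sum>v\<in>V. c v *\<^sub>R hom (p v))"
   using in_hull_iff_cone[OF assms(1,2), of x] by blast
  have "(\<Sum>v\<in>V. c v * f (hom (p v))) = 0" using x c(2) fsum[of c] by simp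
  hence "\<forall>v\<in>V. c v * f (hom (p v)) = 0"
   using c(1) assms(1,4) by (subst (asm) sum_nonneg_eq_0_iff) auto
  hence "\<forall>v\<in>V - B. c v *\<^sub>R hom (p v) = 0"
   using B by (auto simp: zero_prod_def)
  hence "hom x = (\<Sum>v\<in>B. c v *\<^sub>R hom (p v))"
   using c(2) sum.mono_neutral_right[OF assms(1) BV, of "%v. c v *\<^sub>R hom (p v)"] by simp
  thus "x \<in> convex hull (p ` B)"
   using c(1) BV finite_subset[OF BV assms(1)] inj_on_subset[OF assms(2) BV]
   by (intro iffD2[OF in_hull_iff_cone[of B p x]] exI[of _ c]) auto
 qed
qed

lemma facial_imp_face_of_hull:
 assumes "finite V" "inj_on p V" "facial (%v. hom (p v)) V B"
 shows "convex hull (p ` B) face_of convex hull (p ` V)"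
  and "{v\<in>V. p v \<in> convex hull (p ` B)} = B"
proof -
 obtain f where f: "linear f" "!!v. v \<in> V ==> 0 <= (f (hom (p v)) :: real)"
  "!!v. v \<in> V ==> f (hom (p v)) = 0 \<longleftrightarrow> v \<in> B" using assms(3) by (rule facialE3) blast
 have B: "B = {v\<in>V. f (hom (p v)) = 0}" using f(3) facial_subset[OF assms(3)] by auto
 note eq = hull_zero_set[OF assms(1,2) f(1,2) B]
 show "convex hull (p ` B) face_of convex hull (p ` V)"
  unfolding face_of_def
 proof (intro conjI ballI impI)
  show "convex hull (p ` B) \<subseteq> convex hull (p ` V)" using eq(1) by auto
  fix x y z assume xy: "x \<in> convex hull (p ` V)" "y \<in> convex hull (p ` V)"
  note nn = eq(2)[OF _ xy(1)] eq(2)[OF _ xy(2)]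
  assume z: "z \<in> convex hull (p ` B)" "z \<in> open_segment x y"
  obtain t where t: "0 < t" "t < 1" "z = (1 - t) *\<^sub>R x + t *\<^sub>R y" using z(2) by (auto simp: in_segment)
  have "hom z = (1 - t) *\<^sub>R hom x + t *\<^sub>R hom y" using t by simp
  hence "f (hom z) = (1 - t) * f (hom x) + t * f (hom y)"
   using f(1) by (simp add: linear_add linear_cmul del: scaleR_Pair add_Pair)
  moreover have "f (hom z) = 0" using z(1) eq(1) by auto
  moreover have "0 <= (1 - t) * f (hom x)" "0 <= t * f (hom y)" using t nn by auto
  ultimately have "(1 - t) * f (hom x) = 0" "t * f (hom y) = 0" by linarith+
  hence "f (hom x) = 0" "f (hom y) = 0" using t by auto
  thus "x \<in> convex hull (p ` B)" "y \<in> convex hull (p ` B)" using eq(1) xy by auto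
 qed simp
 show "{v\<in>V. p v \<in> convex hull (p ` B)} = B"
 proof -
  have "p v \<in> convex hull (p ` B) \<longleftrightarrow> f (hom (p v)) = 0" if "v \<in> V" for v
   using that by (subst eq(1)) (auto intro: hull_inc)
  thus ?thesis using f(3) facial_subset[OF assms(3)] by auto
 qed
qed

text \<open>The smallest facial set \<open>B\<close> containing the labels \<open>A\<close> of
  \<open>F\<close> equals \<open>A\<close>. For \<open>v\<close> in \<open>B\<close>, Farkas' lemma
  for the vectors of \<open>B\<close> and minus the sum over \<open>A\<close> has two outcomes: the
  barycentre of \<open>A\<close>, a point of \<open>F\<close>, is a combination with positive weight
  on \<open>v\<close>, so that \<open>p v\<close> lies in \<open>F\<close>; or a functional exposes
  a smaller facial set containing \<open>A\<close>.\<close>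

lemma face_of_hull_imp_facial:
 assumes V: "finite V" "inj_on p V" and F: "F face_of convex hull (p ` V)"
 shows "facial (%v. hom (p v)) V {v\<in>V. p v \<in> F}" and "F = convex hull (p ` {v\<in>V. p v \<in> F})"
proof -
 define A where "A = {v\<in>V. p v \<in> F}"
 have AV: "A \<subseteq> V" "finite A" "inj_on p A"
  using V by (auto simp: A_def inj_on_def)
 \<comment> \<open>A point of \<open>F\<close> with positive weight at \<open>v\<close> lies on the
   open segment from \<open>p v\<close> to the normalized rest \<open>y\<close>, unless it equals
   \<open>p v\<close>; so the face property yields \<open>p v\<close>.\<close>
 have mem: "p v \<in> F" if "v \<in> V" "x \<in> F" "!!w. w \<in> V ==> 0 <= c w" "c v > 0" "hom x = (\<Sum>w\<in>V. c w *\<^sub>R hom (p w))" for v x c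
 proof -
  have c1: "sum c V = 1" using that(5) by (simp add: prod_eq_iff snd_sum)
  have split: "hom x = c v *\<^sub>R hom (p v) + (\<Sum>w\<in>V - {v}. c w *\<^sub>R hom (p w))"
   using that(1,5) V(1) by (simp add: sum.remove)
  have rest: "sum c (V - {v}) = 1 - c v" using c1 that(1) V(1) by (simp add: sum_diff1)
  show ?thesis
  proof (cases "c v = 1")
   case True
   hence "\<forall>w\<in>V - {v}. c w = 0"
    using rest that(3) V(1) sum_nonneg_eq_0_iff[of "V - {v}" c] by auto
   hence "(\<Sum>w\<in>V - {v}. c w *\<^sub>R hom (p w)) = 0" by (intro sum.neutral) (simp add: zero_prod_def)
   hence "hom x = hom (p v)" using split True by simp
   thus ?thesis using that(2) by simp
  next
   case False
   have "sum c (V - {v}) >= 0" using that(3) by (intro sum_nonneg) auto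
   hence lt: "c v < 1" using False rest by simp
   define y where "y = (\<Sum>w\<in>V - {v}. (c w / (1 - c v)) *\<^sub>R p w)"
   have y: "y \<in> convex hull (p ` V)"
    unfolding y_def using V(1) that(3) lt rest
    by (intro convex_sum) (auto simp: sum_divide_distrib[symmetric] intro: hull_inc)
   have xe: "x = c v *\<^sub>R p v + (1 - c v) *\<^sub>R y"
   proof -
    have "(1 - c v) *\<^sub>R y = (\<Sum>w\<in>V - {v}. c w *\<^sub>R p w)"
     using lt by (simp add: y_def scaleR_sum_right)
    thus ?thesis using split by (simp add: prod_eq_iff fst_sum)
   qed
   show ?thesis
   proof (cases "y = p v")
    case True
    hence "x = p v" using xe by (simp add: algebra_simps)
    thus ?thesis using that(2) by simp
   next
    case False
    hence "x \<in> open_segment y (p v)"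
     using xe that(4) lt by (auto simp: in_segment intro!: exI[of _ "c v"])
    thus ?thesis
     using face_ofD[OF F _ y _ that(2)] that(1) by (simp add: hull_inc)
   qed
  qed
 qed
 have conv: "convex F" "F \<subseteq> convex hull (p ` V)" using F by (auto simp: face_of_def)
 have Feq: "F = convex hull (p ` A)"
 proof
  show "convex hull (p ` A) \<subseteq> F" using conv(1) by (intro hull_minimal) (auto simp: A_def)
  show "F \<subseteq> convex hull (p ` A)"
  proof
   fix x assume x: "x \<in> F"
   then obtain c where c: "\<forall>v\<in>V. 0 <= c v" "hom x = (\<Sum>v\<in>V. c v *\<^sub>R hom (p v))"
    using in_hull_iff_cone[OF V, of x] conv(2) by blast
   have "c v = 0" if "v \<in> V - A" for v
    using mem[of v x c] c that x by (force simp: A_def)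
   hence "hom x = (\<Sum>v\<in>A. c v *\<^sub>R hom (p v))"
    using c(2) sum.mono_neutral_right[OF V(1) AV(1), of "%v. c v *\<^sub>R hom (p v)"]
    by (simp add: zero_prod_def)
   thus "x \<in> convex hull (p ` A)"
    using c(1) AV(1) in_hull_iff_cone[OF AV(2,3), of x] by (meson subsetD)
  qed
 qed
 thus "F = convex hull (p ` {v\<in>V. p v \<in> F})" by (simp add: A_def)
 let ?a = "%v. hom (p v)"
 have "facial ?a V A"
 proof (cases "A = {}")
  case True
  thus ?thesis by (intro facialI[of snd]) (auto simp: linear_snd)
 next
  case False
  define P where "P B \<longleftrightarrow> facial ?a V B & A \<subseteq> B" for B
  have "P V" using facial_self AV(1) by (simp add: P_def)
  from ex_has_least_nat[of P, OF this, of card] obtain B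
   where B': "P B" "!!B'. P B' ==> card B <= card B'" by blast
  have B: "facial ?a V B" "A \<subseteq> B"
   and min: "!!B'. facial ?a V B' ==> A \<subseteq> B' ==> card B <= card B'"
   using B' by (simp_all add: P_def)
  have BV: "B \<subseteq> V" "finite B" using facial_subset[OF B(1)] V(1) finite_subset by auto
  have "B \<subseteq> A"
  proof
   fix v assume v: "v \<in> B"
   define xb where "xb = (\<Sum>w\<in>A. ?a w)"
   define a' where "a' i = (case i of None => - xb | Some w => ?a w)" for i
   have fin': "finite (insert None (Some ` B))" using BV by simp
   consider c where "\<forall>i\<in>insert None (Some ` B). 0 <= c i" "- ?a v = (\<Sum>i\<in>insert None (Some ` B). c i *\<^sub>R a' i)"
    | f where "linear f" "\<forall>i\<in>insert None (Some ` B). 0 <= (f (a' i) :: real)" "f (- ?a v) < 0"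
    using farkas[OF fin', of "- ?a v" a'] by blast
   thus "v \<in> A"
   proof cases
    case 1
    have "- ?a v = - c None *\<^sub>R xb + (\<Sum>w\<in>B. c (Some w) *\<^sub>R ?a w)"
     using 1(2) BV by (simp add: sum.reindex a'_def)
    moreover have "(\<Sum>w\<in>B. (if w = v then 1 else 0) *\<^sub>R ?a w) = ?a v"
     using v BV(2) by (simp add: if_distrib[of "%t. t *\<^sub>R _"] sum.delta cong: if_cong del: scaleR_Pair)
    ultimately have e1: "c None *\<^sub>R xb = (\<Sum>w\<in>B. (c (Some w) + (if w = v then 1 else 0)) *\<^sub>R ?a w)"
     unfolding scaleR_add_left sum.distrib by (simp add: algebra_simps del: scaleR_Pair add_Pair uminus_Pair)
    have snd_pos: "c None * card A = (\<Sum>w\<in>B. c (Some w) + (if w = v then 1 else 0))"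
     using arg_cong[OF e1, of snd] by (simp add: xb_def snd_sum)
    have "(\<Sum>w\<in>B. c (Some w) + (if w = v then 1 else 0)) >= c (Some v) + 1"
     using 1(1) BV v member_le_sum[of v B "%w. c (Some w) + (if w = v then 1 else 0)"] by auto
    moreover have "c (Some v) >= 0" using 1(1) v by auto
    ultimately have "c None * card A > 0" using snd_pos by linarith
    hence cp: "c None > 0" "card A > 0"
     by (auto simp: zero_less_mult_iff)
    define k where "k = c None * card A"
    have k: "k > 0" using cp by (simp add: k_def)
    define x where "x = (1 / card A) *\<^sub>R (\<Sum>w\<in>A. p w)"
    have "hom x = (1 / card A) *\<^sub>R xb" using cp by (simp add: x_def xb_def prod_eq_iff fst_sum snd_sum)
    hence hx: "hom x = (\<Sum>w\<in>A. (1 / card A) *\<^sub>R ?a w)" by (simp add: xb_def scaleR_sum_right)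
    hence xF: "x \<in> F"
     unfolding Feq by (intro iffD2[OF in_hull_iff_cone[OF AV(2,3)]] exI[of _ "%_. 1 / card A"]) simp
    define c' where "c' w = (if w \<in> B then (c (Some w) + (if w = v then 1 else 0)) / k else 0)" for w
    have "hom x = (1 / k) *\<^sub>R (c None *\<^sub>R xb)"
     using cp \<open>hom x = (1 / card A) *\<^sub>R xb\<close> by (simp add: k_def)
    also have "\<dots> = (\<Sum>w\<in>B. c' w *\<^sub>R ?a w)"
     unfolding e1 scaleR_sum_right by (intro sum.cong) (auto simp: c'_def)
    also have "\<dots> = (\<Sum>w\<in>V. c' w *\<^sub>R ?a w)"
     using V(1) BV by (intro sum.mono_neutral_left) (auto simp: c'_def zero_prod_def)
    finally have "hom x = (\<Sum>w\<in>V. c' w *\<^sub>R ?a w)" .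
    moreover have "0 <= c' w" for w using 1(1) k by (auto simp: c'_def)
    moreover have "c' v > 0" using 1(1) k v by (auto simp: c'_def add_nonneg_pos)
    ultimately have "p v \<in> F" using mem[of v x c'] v BV xF by blast
    thus ?thesis using v BV by (auto simp: A_def)
   next
    case (2 f)
    have fx: "f xb <= 0" using 2(1,2) by (auto simp: a'_def linear_neg)
    have fB: "0 <= f (?a w)" if "w \<in> B" for w using 2(2) that by (auto simp: a'_def)
    have "(\<Sum>w\<in>A. f (?a w)) <= 0" using fx 2(1) by (simp add: xb_def linear_sum)
    hence "(\<Sum>w\<in>A. f (?a w)) = 0" using fB B(2) by (intro antisym sum_nonneg) auto
    hence f0: "f (?a w) = 0" if "w \<in> A" for w
     using fB B(2) AV(2) that by (subst (asm) sum_nonneg_eq_0_iff) auto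
    define C where "C = {w\<in>B. f (?a w) = 0}"
    have "facial ?a B C" by (intro facialI[OF 2(1)]) (auto simp: C_def fB)
    hence "facial ?a V C" using facial_sub[OF V(1) B(1), of C] by (auto simp: C_def)
    moreover have "A \<subseteq> C" using f0 B(2) by (auto simp: C_def)
    ultimately have "card B <= card C" using min by blast
    hence "C = B" using BV by (metis (no_types, lifting) C_def card_seteq mem_Collect_eq subsetI)
    hence "f (?a v) = 0" using v by (auto simp: C_def)
    thus ?thesis using 2(3) linear_neg[OF 2(1), of "?a v"] by (simp del: uminus_Pair)
   qed
  qed
  thus ?thesis using B by auto
 qed
 thus "facial ?a V {v\<in>V. p v \<in> F}" by (simp add: A_def)
qed

section \<open>Elimination of a real variable\<close>

lemma ex_between_finite:
 fixes A B :: "real set"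
 assumes "finite A" "finite B" "!!a b. a \<in> A ==> b \<in> B ==> a < b"
 shows "\<exists>y. (\<forall>a\<in>A. a < y) & (\<forall>b\<in>B. y < b)"
proof (cases "A = {} | B = {}")
 case True
 thus ?thesis
 proof
  assume A: "A = {}"
  show ?thesis
  proof (cases "B = {}")
   case False
   have "Min B - 1 < b" if "b \<in> B" for b using Min_le[OF assms(2) that] by simp
   thus ?thesis using A by blast
  qed (use A in auto)
 next
  assume B: "B = {}"
  show ?thesis
  proof (cases "A = {}")
   case False
   have "a < Max A + 1" if "a \<in> A" for a using Max_ge[OF assms(1) that] by simp
   thus ?thesis using B by blast
  qed (use B in auto)
 qed
next
 case False
 hence "Max A < Min B" using assms by (meson Max_in Min_in)
 then obtain y where "Max A < y" "y < Min B" using dense by blast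
 thus ?thesis using False assms(1,2) by (intro exI[of _ y]) auto
qed

text \<open>The marks \<open>Z\<close> are the roots found so far and \<open>h\<close> pairs them
  with the roots on the other side; \<open>x\<close> and \<open>x'\<close> occupy corresponding
  cells of the two subdivisions of the line.\<close>

definition matched :: "real set => (real => real) => real => real => bool" where
 "matched Z h x x' \<longleftrightarrow> (\<forall>z\<in>Z. sgn (x - z) = sgn (x' - h z))"

lemma matched_lt: "matched Z h x x' ==> z \<in> Z ==> x < z \<longleftrightarrow> x' < h z"
 unfolding matched_def by (metis diff_gt_0_iff_gt diff_less_0_iff_less sgn_less)

lemma matched_gt: "matched Z h x x' ==> z \<in> Z ==> z < x \<longleftrightarrow> h z < x'"
 unfolding matched_def by (metis diff_gt_0_iff_gt sgn_greater)

lemma matched_eq: "matched Z h x x' ==> z \<in> Z ==> x = z \<longleftrightarrow> x' = h z"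
 using matched_lt matched_gt by (metis linorder_neqE_linordered_idom less_irrefl)

lemma matchedI:
 assumes "!!z. z \<in> Z ==> x < z ==> x' < h z" "!!z. z \<in> Z ==> z < x ==> h z < x'"
  "!!z. z \<in> Z ==> x = z ==> x' = h z"
 shows "matched Z h x x'"
 unfolding matched_def using assms by (auto simp: sgn_if) (metis linorder_neqE_linordered_idom less_irrefl less_asym)+

lemma ex_matched:
 assumes "finite Z" "strict_mono_on Z h"
 shows "\<exists>x'. matched Z h x x'"
proof (cases "x \<in> Z")
 case True
 thus ?thesis
  using assms(2) by (intro exI[of _ "h x"] matchedI) (auto simp: strict_mono_on_def)
next
 case False
 have "\<exists>y. (\<forall>a\<in>h ` {z\<in>Z. z < x}. a < y) & (\<forall>b\<in>h ` {z\<in>Z. x < z}. y < b)"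
  using assms by (intro ex_between_finite) (auto simp: strict_mono_on_def)
 then obtain y where "\<forall>a\<in>h ` {z\<in>Z. z < x}. a < y" "\<forall>b\<in>h ` {z\<in>Z. x < z}. y < b" by blast
 thus ?thesis using False by (intro exI[of _ y] matchedI) auto
qed

lemma sgn_const_without_root:
 fixes f :: "real poly"
 assumes "!!t. min a b <= t ==> t <= max a b ==> poly f t ~= 0"
 shows "sgn (poly f a) = sgn (poly f b)"
proof -
 have *: "sgn (poly f a) = sgn (poly f b)" if ab: "a <= b" and nr: "!!t. a <= t ==> t <= b ==> poly f t ~= 0" for a b
 proof (cases "a = b")
  case False
  hence "a < b" using ab by simp
  have "\<not> poly f a * poly f b < 0"
  proof
   assume "poly f a * poly f b < 0"
   then obtain x where "a < x" "x < b" "poly f x = 0" using poly_IVT[OF \<open>a < b\<close>] by blast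
   thus False using nr[of x] by simp
  qed
  thus ?thesis using nr[of a] nr[of b] ab
   by (auto simp: sgn_if mult_less_0_iff)
 qed simp
 show ?thesis
 proof (cases "a <= b")
  case True
  thus ?thesis using assms by (intro *) auto
 next
  case False
  hence "sgn (poly f b) = sgn (poly f a)" using assms by (intro *) auto
  thus ?thesis by simp
 qed
qed

lemma sgn_const_within:
 fixes f :: "real poly"
 assumes "poly f b ~= 0" "lo < a" "a < hi" "lo <= b" "b <= hi" "!!t. lo < t ==> t < hi ==> poly f t ~= 0"
 shows "sgn (poly f a) = sgn (poly f b)"
proof (rule sgn_const_without_root)
 fix t assume "min a b <= t" "t <= max a b"
 hence "t = b | (lo < t & t < hi)" using assms(2-5) by (auto simp: min_def max_def split: if_splits)
 thus "poly f t ~= 0" using assms(1,6) by blast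
qed

lemma sgn_power': "sgn (x ^ k) = sgn (x :: real) ^ k"
 by (induction k) (auto simp: sgn_mult)

lemma rolle_poly:
 fixes f :: "real poly"
 assumes "a < b" "poly f a = 0" "poly f b = 0"
 shows "\<exists>c. a < c & c < b & poly (pderiv f) c = 0"
proof -
 obtain c where "a < c" "c < b" "poly f b - poly f a = (b - a) * poly (pderiv f) c"
  using poly_MVT[OF assms(1), of f] by blast
 thus ?thesis using assms by auto
qed

lemma ex_neighbours:
 fixes x :: real
 assumes "finite Z" "\<exists>z\<in>Z. z < x" "\<exists>z\<in>Z. x < z"
 obtains a b where "a \<in> Z" "a < x" "!!z. z \<in> Z ==> z < x ==> z <= a"
  "b \<in> Z" "x < b" "!!z. z \<in> Z ==> x < z ==> b <= z"
proof -
 have "Max {z\<in>Z. z < x} \<in> {z\<in>Z. z < x}" "Min {z\<in>Z. x < z} \<in> {z\<in>Z. x < z}"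
  by (rule Max_in Min_in; use assms in auto)+
 thus ?thesis using assms(1) by (intro that[of "Max {z\<in>Z. z < x}" "Min {z\<in>Z. x < z}"]) auto
qed

text \<open>Here \<open>f'\<close> is the partner of \<open>f\<close>, not its derivative. Between
  the marks \<open>a\<close> and \<open>b\<close> next to the root \<open>xi\<close> the derivative
  has no zero, so by the mean value theorem on both sides of \<open>xi\<close> the signs of
  \<open>f\<close> at \<open>a\<close> and \<open>b\<close> are opposite. The signs at the marks
  carry this over to \<open>f'\<close>, and the intermediate value theorem gives its root.\<close>

lemma root_transfer:
 fixes f f' :: "real poly"
 assumes Z: "finite Z" "strict_mono_on Z h" "\<exists>z\<in>Z. z < xi" "\<exists>z\<in>Z. xi < z"
  and der: "!!c. poly (pderiv f) c = 0 ==> c \<in> Z"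
  and sgns: "!!z. z \<in> Z ==> sgn (poly f z) = sgn (poly f' (h z))"
  and root: "poly f xi = 0" "xi ~: Z"
 shows "\<exists>xi'. poly f' xi' = 0 & matched Z h xi xi'"
proof -
 obtain a b where a: "a \<in> Z" "a < xi" and amax: "!!z. z \<in> Z ==> z < xi ==> z <= a"
  and b: "b \<in> Z" "xi < b" and bmin: "!!z. z \<in> Z ==> xi < z ==> b <= z"
  using ex_neighbours[OF Z(1,3,4)] by metis
 have noder: "poly (pderiv f) c ~= 0" if "a < c" "c < b" for c
 proof
  assume "poly (pderiv f) c = 0"
  hence "c \<in> Z" by (rule der)
  thus False using amax[of c] bmin[of c] root(2) that by (cases c xi rule: linorder_cases) auto
 qed
 obtain c1 where c1: "a < c1" "c1 < xi" "poly f xi - poly f a = (xi - a) * poly (pderiv f) c1"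
  using poly_MVT[OF a(2), of f] by blast
 obtain c2 where c2: "xi < c2" "c2 < b" "poly f b - poly f xi = (b - xi) * poly (pderiv f) c2"
  using poly_MVT[OF b(2), of f] by blast
 have "sgn (poly (pderiv f) c1) = sgn (poly (pderiv f) c2)"
  using c1 c2 a b by (intro sgn_const_without_root noder) auto
 moreover have "poly (pderiv f) c1 ~= 0" using noder[of c1] c1 b by auto
 ultimately have "poly (pderiv f) c1 * poly (pderiv f) c2 > 0"
  by (auto simp: sgn_if zero_less_mult_iff split: if_splits)
 hence "(xi - a) * (b - xi) * (poly (pderiv f) c1 * poly (pderiv f) c2) > 0"
  using a b by simp
 moreover have "- (poly f a * poly f b) = (xi - a) * (b - xi) * (poly (pderiv f) c1 * poly (pderiv f) c2)"
 proof -
  have e: "poly f a = - ((xi - a) * poly (pderiv f) c1)" "poly f b = (b - xi) * poly (pderiv f) c2"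
   using c1(3) c2(3) root(1) by linarith+
  show ?thesis unfolding e by (simp add: ac_simps)
 qed
 ultimately have "poly f a * poly f b < 0" by linarith
 hence "sgn (poly f a) * sgn (poly f b) < 0" by (metis sgn_less sgn_mult)
 hence "sgn (poly f' (h a) * poly f' (h b)) < 0"
  using sgns[OF a(1)] sgns[OF b(1)] by (simp add: sgn_mult)
 hence "poly f' (h a) * poly f' (h b) < 0" by (simp add: sgn_less)
 moreover have "h a < h b" using Z(2) a b by (auto simp: strict_mono_on_def)
 ultimately obtain xi' where xi': "h a < xi'" "xi' < h b" "poly f' xi' = 0"
  using poly_IVT by blast
 have mono: "h z <= h w" if "z \<in> Z" "w \<in> Z" "z <= w" for z w
  using Z(2) that by (metis strict_mono_on_leD)
 have "matched Z h xi xi'"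
 proof (rule matchedI)
  fix z assume z: "z \<in> Z" "xi < z"
  thus "xi' < h z" using xi'(2) mono[OF b(1) z(1)] bmin by fastforce
 next
  fix z assume z: "z \<in> Z" "z < xi"
  thus "h z < xi'" using xi'(1) mono[OF z(1) a(1)] amax by fastforce
 next
  fix z assume "z \<in> Z" "xi = z" thus "xi' = h z" using root by simp
 qed
 thus ?thesis using xi'(3) by blast
qed

lemma sgn_lead_coeff_at_top:
 fixes p :: "real poly"
 shows "\<exists>B. \<forall>t\<ge>B. sgn (poly p t) = sgn (lead_coeff p)"
proof -
 consider "lead_coeff p = 0" | "lead_coeff p > 0" | "lead_coeff (- p) > 0"
  by fastforce
 thus ?thesis
 proof cases
  case 1
  hence "p = 0" by simp
  thus ?thesis by simp
 next
  case 2
  obtain n where n: "\<forall>x\<ge>n. lead_coeff p <= poly p x" using poly_pinfty_gt_lc[OF 2] by blast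
  have "sgn (poly p t) = sgn (lead_coeff p)" if "t >= n" for t
   using n that 2 by (metis less_le_trans sgn_pos)
  thus ?thesis by blast
 next
  case 3
  obtain n where n: "\<forall>x\<ge>n. lead_coeff (- p) <= poly (- p) x" using poly_pinfty_gt_lc[OF 3] by blast
  have "sgn (poly p t) = sgn (lead_coeff p)" if "t >= n" for t
   using n[rule_format, OF that] 3 by (auto simp: sgn_if)
  thus ?thesis by blast
 qed
qed

text \<open>Signs are compared at different arguments, so that each of the two half-lines outside
  the bound counts as a single cell.\<close>

definition agree_beyond :: "real => real poly => real poly => bool" where
 "agree_beyond B p p' \<longleftrightarrow>
   (\<forall>t t'. (B <= t & B <= t') | (t <= - B & t' <= - B) --> sgn (poly p t) = sgn (poly p' t')) &
   (\<forall>t. p ~= 0 & B <= \<bar>t\<bar> --> poly p t ~= 0 & poly p' t ~= 0)"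

lemma agree_beyond_mono: "agree_beyond B p p' ==> B <= C ==> agree_beyond C p p'"
 unfolding agree_beyond_def by (smt (verit))

lemma ex_agree_beyond:
 assumes "degree p = degree p'" "sgn (lead_coeff p) = sgn (lead_coeff p')"
 shows "\<exists>B. agree_beyond B p p'"
proof -
 define n n' where "n = pcompose p [:0, -1:]" and "n' = pcompose p' [:0, -1:]"
 have lc: "sgn (lead_coeff n) = sgn (lead_coeff n')"
  using assms by (simp add: n_def n'_def lead_coeff_comp sgn_mult)
 have nz: "p = 0 \<longleftrightarrow> p' = 0" using assms(2) by (metis leading_coeff_0_iff sgn_0_0)
 have nzn: "n = 0 \<longleftrightarrow> p = 0" "n' = 0 \<longleftrightarrow> p' = 0"
  using pcompose_eq_0_iff[of "[:0, -1::real:]"] by (auto simp: n_def n'_def)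
 have ev: "poly n t = poly p (- t)" "poly n' t = poly p' (- t)" for t
  by (simp_all add: n_def n'_def poly_pcompose)
 obtain B1 where B1: "\<forall>t\<ge>B1. sgn (poly p t) = sgn (lead_coeff p)"
  using sgn_lead_coeff_at_top[of p] by blast
 obtain B2 where B2: "\<forall>t\<ge>B2. sgn (poly p' t) = sgn (lead_coeff p')"
  using sgn_lead_coeff_at_top[of p'] by blast
 obtain B3 where B3: "\<forall>t\<ge>B3. sgn (poly n t) = sgn (lead_coeff n)"
  using sgn_lead_coeff_at_top[of n] by blast
 obtain B4 where B4: "\<forall>t\<ge>B4. sgn (poly n' t) = sgn (lead_coeff n')"
  using sgn_lead_coeff_at_top[of n'] by blast
 note B = B1 B2 B3 B4
 define B where "B = max (max 1 B1) (max B2 (max B3 B4))"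
 have s1: "sgn (poly p t) = sgn (lead_coeff p)" "sgn (poly p' t) = sgn (lead_coeff p)" if "B <= t" for t
  using B(1,2) that assms(2) by (auto simp: B_def)
 have s2: "sgn (poly p t) = sgn (lead_coeff n)" "sgn (poly p' t) = sgn (lead_coeff n)" if "t <= - B" for t
 proof -
  have "sgn (poly n (- t)) = sgn (lead_coeff n)" "sgn (poly n' (- t)) = sgn (lead_coeff n)"
   using B(3,4) that lc by (auto simp: B_def)
  thus "sgn (poly p t) = sgn (lead_coeff n)" "sgn (poly p' t) = sgn (lead_coeff n)" by (auto simp: ev)
 qed
 have "poly p t ~= 0 & poly p' t ~= 0" if "p ~= 0" "B <= \<bar>t\<bar>" for t
 proof (cases "t >= 0")
  case True
  hence "sgn (poly p t) ~= 0" "sgn (poly p' t) ~= 0" using s1[of t] that by (auto simp: sgn_0_0)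
  thus ?thesis by (auto simp: sgn_0_0)
 next
  case False
  hence "sgn (poly p t) ~= 0" "sgn (poly p' t) ~= 0" using s2[of t] that nzn by (auto simp: sgn_0_0)
  thus ?thesis by (auto simp: sgn_0_0)
 qed
 thus ?thesis using s1 s2 by (intro exI[of _ B]) (auto simp: agree_beyond_def)
qed

text \<open>
 The relation \<open>R\<close> pairs the specializations of one family of polynomials at two parameter values.
\<close>

locale sign_pairs =
 fixes R :: "(real poly \<times> real poly) set"
 assumes fin: "finite R"
  and lead: "(p, p') \<in> R ==> degree p = degree p' & sgn (lead_coeff p) = sgn (lead_coeff p')"
  and der: "(p, p') \<in> R ==> (pderiv p, pderiv p') \<in> R"
  and remainder: "(p, p') \<in> R ==> (q, q') \<in> R ==> 0 < degree q ==> degree q <= degree p ==>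
   \<exists>r r' k. (r, r') \<in> R & degree r < degree q &
    (\<forall>t. poly q t = 0 --> lead_coeff q ^ k * poly p t = poly r t) &
    (\<forall>t. poly q' t = 0 --> lead_coeff q' ^ k * poly p' t = poly r' t)"
begin

lemma zero_iff: "(p, p') \<in> R ==> p = 0 \<longleftrightarrow> p' = 0"
 using lead by (metis leading_coeff_0_iff sgn_0_0)

lemma ex_bound: "\<exists>B>0. \<forall>(p, p')\<in>R. agree_beyond B p p'"
proof -
 have "\<forall>x\<in>R. eventually (%B. agree_beyond B (fst x) (snd x)) at_top"
  using ex_agree_beyond lead agree_beyond_mono unfolding eventually_at_top_linorder by (metis prod.collapse)
 hence "eventually (%B. 0 < B & (\<forall>x\<in>R. agree_beyond B (fst x) (snd x))) at_top"
  using fin by (intro eventually_conj eventually_gt_at_top eventually_ball_finite)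
 then obtain B where "0 < B & (\<forall>x\<in>R. agree_beyond B (fst x) (snd x))"
  using eventually_happens'[OF trivial_limit_at_top_linorder] by blast
 thus ?thesis by (intro exI[of _ B]) auto
qed

definition bnd :: real where "bnd = (SOME B. B > 0 & (\<forall>(p, p')\<in>R. agree_beyond B p p'))"

lemma bnd:
 shows "bnd > 0"
  and "(p, p') \<in> R ==> bnd <= t ==> bnd <= t' ==> sgn (poly p t) = sgn (poly p' t')"
  and "(p, p') \<in> R ==> t <= - bnd ==> t' <= - bnd ==> sgn (poly p t) = sgn (poly p' t')"
  and "(p, p') \<in> R ==> p ~= 0 ==> poly p t = 0 | poly p' t = 0 ==> - bnd < t & t < bnd"
proof -
 have b: "bnd > 0" "(p, p') \<in> R ==> agree_beyond bnd p p'" for p p'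
  using someI_ex[OF ex_bound[unfolded Bex_def]] unfolding bnd_def by blast+
 show "bnd > 0" by (rule b)
 show "(p, p') \<in> R ==> bnd <= t ==> bnd <= t' ==> sgn (poly p t) = sgn (poly p' t')"
  "(p, p') \<in> R ==> t <= - bnd ==> t' <= - bnd ==> sgn (poly p t) = sgn (poly p' t')"
  using b(2) unfolding agree_beyond_def by blast+
 assume A: "(p, p') \<in> R" "p ~= 0" "poly p t = 0 | poly p' t = 0"
 hence "\<not> bnd <= \<bar>t\<bar>" using b(2) unfolding agree_beyond_def by blast
 thus "- bnd < t & t < bnd" by auto
qed

text \<open>A common sign diagram for the pairs in \<open>S\<close>. That every mark except
  \<open>bnd\<close> and \<open>- bnd\<close> is a root of some \<open>q\<close> is what makes
  remainders usable when a polynomial is added.\<close>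

definition tracks :: "(real poly \<times> real poly) set => real set => (real => real) => bool" where
 "tracks S Z h \<longleftrightarrow> finite Z & strict_mono_on Z h & {- bnd, bnd} \<subseteq> Z & h bnd = bnd & h (- bnd) = - bnd &
   (\<forall>(p, p')\<in>S. p ~= 0 --> {t. poly p t = 0} \<subseteq> Z & {t. poly p' t = 0} \<subseteq> h ` Z) &
   (\<forall>z\<in>Z. z = bnd | z = - bnd | (\<exists>(q, q')\<in>S. q ~= 0 & poly q z = 0)) &
   (\<forall>x x'. matched Z h x x' --> (\<forall>(p, p')\<in>S. sgn (poly p x) = sgn (poly p' x')))"

text \<open>At an old mark, a root of some \<open>q\<close>, the sign of \<open>f\<close> is up to a
  known factor that of a remainder of smaller degree, which is tracked already. The derivative is
  tracked too; so the new roots are simple, at most one lies between neighbouring old marks, and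
  \<open>root_transfer\<close> matches them in both directions.\<close>

lemma tracks_insert:
 assumes T: "tracks S Z h" and S: "S \<subseteq> R" "!!p p'. (p, p') \<in> R ==> degree p < n ==> (p, p') \<in> S"
  "!!p p'. (p, p') \<in> S ==> degree p <= n"
  and f: "(f, f') \<in> R" "degree f = n" "n > 0"
 shows "\<exists>Z h. tracks (insert (f, f') S) Z h"
proof -
 have Z: "finite Z" "strict_mono_on Z h" "- bnd \<in> Z" "bnd \<in> Z" "h bnd = bnd" "h (- bnd) = - bnd"
  and roots: "!!p p' t. (p, p') \<in> S ==> p ~= 0 ==> poly p t = 0 ==> t \<in> Z"
  "!!p p' t. (p, p') \<in> S ==> p ~= 0 ==> poly p' t = 0 ==> t \<in> h ` Z"
  and isroot: "!!z. z \<in> Z ==> z = bnd | z = - bnd | (\<exists>(q, q')\<in>S. q ~= 0 & poly q z = 0)"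
  and sg: "!!x x' p p'. matched Z h x x' ==> (p, p') \<in> S ==> sgn (poly p x) = sgn (poly p' x')"
  using T unfolding tracks_def by fast+
 have f0: "f ~= 0" "f' ~= 0" using f zero_iff[OF f(1)] by auto
 have df': "degree f' = n" using lead[OF f(1)] f(2) by simp
 have d0: "pderiv f ~= 0" "pderiv f' ~= 0" using f(2,3) df' by (auto simp: pderiv_eq_0_iff)
 have dS: "(pderiv f, pderiv f') \<in> S"
  using der[OF f(1)] S(2) f by (simp add: degree_pderiv)
 have selfm: "matched Z h z (h z)" if "z \<in> Z" for z
  using Z(2) that by (intro matchedI) (auto simp: strict_mono_on_def)
 have a: "sgn (poly f z) = sgn (poly f' (h z))" if z: "z \<in> Z" for z
 proof -
  consider "z = bnd" | "z = - bnd" | q q' where "(q, q') \<in> S" "q ~= 0" "poly q z = 0"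
   using isroot[OF z] by blast
  thus ?thesis
  proof cases
   case 1 thus ?thesis using bnd(2)[OF f(1)] Z(5) by simp
  next
   case 2 thus ?thesis using bnd(3)[OF f(1)] Z(6) by simp
  next
   case 3
   have dq: "0 < degree q"
   proof (rule ccontr)
    assume "\<not> 0 < degree q"
    then obtain c where "q = [:c:]" using degree_eq_zeroE by blast
    thus False using 3(2,3) by simp
   qed
   have qR: "(q, q') \<in> R" using 3(1) S(1) by auto
   have "degree q <= degree f" using S(3)[OF 3(1)] f(2) by simp
   then obtain r r' k where r: "(r, r') \<in> R" "degree r < degree q"
    "!!t. poly q t = 0 ==> lead_coeff q ^ k * poly f t = poly r t"
    "!!t. poly q' t = 0 ==> lead_coeff q' ^ k * poly f' t = poly r' t"
    using remainder[OF f(1) qR dq] by blast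
   have rS: "(r, r') \<in> S" using S(2)[OF r(1)] r(2) S(3)[OF 3(1)] by simp
   have q'z: "poly q' (h z) = 0" using sg[OF selfm[OF z] 3(1)] 3(3) by (simp add: sgn_0_0)
   have "sgn (lead_coeff q ^ k * poly f z) = sgn (lead_coeff q' ^ k * poly f' (h z))"
    using r(3)[OF 3(3)] r(4)[OF q'z] sg[OF selfm[OF z] rS] by simp
   moreover have "sgn (lead_coeff q' ^ k) = sgn (lead_coeff q ^ k)" "sgn (lead_coeff q ^ k) ~= 0"
    using lead[OF qR] leading_coeff_neq_0[OF 3(2)] by (auto simp: sgn_power' sgn_zero_iff)
   ultimately have "sgn (lead_coeff q ^ k) * sgn (poly f z) = sgn (lead_coeff q ^ k) * sgn (poly f' (h z))"
    by (simp only: sgn_mult)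
   thus ?thesis using \<open>sgn (lead_coeff q ^ k) ~= 0\<close> by (simp only: mult_cancel_left simp_thms)
  qed
 qed
 have b: "\<exists>xi'. poly f' xi' = 0 & matched Z h xi xi'" if "poly f xi = 0" "xi ~: Z" for xi
  using bnd(4)[OF f(1) f0(1), of xi] that Z roots(1)[OF dS d0(1)] a
  by (intro root_transfer[of Z h xi f f']) auto
 \<comment> \<open>The same argument with the roles exchanged, along the inverse \<open>k\<close> of
   \<open>h\<close>.\<close>
 have b': "\<exists>xi. poly f xi = 0 & matched Z h xi xi'" if x': "poly f' xi' = 0" "xi' ~: h ` Z" for xi'
 proof -
  define k where "k = inv_into Z h"
  have inj: "inj_on h Z" using Z(2) strict_mono_on_imp_inj_on by blast
  have kh: "k (h z) = z" if "z \<in> Z" for z using inj that by (simp add: k_def)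
  have lt: "z < w" if "z \<in> Z" "w \<in> Z" "h z < h w" for z w
   using Z(2) that by (metis linorder_not_less strict_mono_on_leD)
  have sm: "strict_mono_on (h ` Z) k"
   using lt kh by (auto simp: strict_mono_on_def)
  have x'b: "- bnd < xi'" "xi' < bnd" using bnd(4)[OF f(1) f0(1), of xi'] x' by simp_all
  have hb: "- bnd \<in> h ` Z" "bnd \<in> h ` Z" using Z(3-6) by (metis imageI)+
  have "\<exists>xi. poly f xi = 0 & matched (h ` Z) k xi' xi"
  proof (rule root_transfer[of "h ` Z" k xi' f' f])
   show "finite (h ` Z)" "strict_mono_on (h ` Z) k" using Z(1) sm by simp_all
   show "\<exists>z\<in>h ` Z. z < xi'" "\<exists>z\<in>h ` Z. xi' < z" using hb x'b by blast+
   show "c \<in> h ` Z" if "poly (pderiv f') c = 0" for c using roots(2)[OF dS d0(1) that] .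
   show "sgn (poly f' z) = sgn (poly f (k z))" if "z \<in> h ` Z" for z
    using that a kh by force
   show "poly f' xi' = 0" "xi' ~: h ` Z" using x' .
  qed
  then obtain xi where xi: "poly f xi = 0" "matched (h ` Z) k xi' xi" by blast
  have "matched Z h xi xi'"
   using xi(2) kh unfolding matched_def by auto
  thus ?thesis using xi(1) by blast
 qed
 define X where "X = {t. poly f t = 0} - Z"
 define h2 where "h2 z = (if z \<in> Z then h z else (SOME xi'. poly f' xi' = 0 & matched Z h z xi'))" for z
 have h2Z: "h2 z = h z" if "z \<in> Z" for z using that by (simp add: h2_def)
 have h2X: "poly f' (h2 z) = 0" "matched Z h z (h2 z)" if "z \<in> X" for z
  using someI_ex[OF b[of z]] that by (auto simp: h2_def X_def)
 have h2m: "matched Z h z (h2 z)" if "z \<in> Z \<union> X" for z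
  using that h2X selfm h2Z by auto
 have finX: "finite X" using poly_roots_finite[OF f0(1)] by (simp add: X_def)
 have sep: "\<exists>c\<in>Z. z1 < c & c < z2" if "poly f z1 = 0" "poly f z2 = 0" "z1 < z2" for z1 z2
  using rolle_poly[OF that(3,1,2)] roots(1)[OF dS d0(1)] by blast
 have mono2: "strict_mono_on (Z \<union> X) h2"
 proof (rule strict_mono_onI)
  fix z1 z2 assume z: "z1 \<in> Z \<union> X" "z2 \<in> Z \<union> X" "z1 < z2"
  consider "z1 \<in> Z" | "z2 \<in> Z" | "z1 \<in> X" "z2 \<in> X" using z by blast
  thus "h2 z1 < h2 z2"
  proof cases
   case 1 thus ?thesis using matched_gt[OF h2m[OF z(2)] 1] z h2Z by simp
  next
   case 2 thus ?thesis using matched_lt[OF h2m[OF z(1)] 2] z h2Z by simp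
  next
   case 3
   then obtain c where c: "c \<in> Z" "z1 < c" "c < z2" using sep[of z1 z2] z(3) by (auto simp: X_def)
   thus ?thesis using matched_lt[OF h2m[OF z(1)] c(1)] matched_gt[OF h2m[OF z(2)] c(1)] by simp
  qed
 qed
 have rf: "t \<in> Z \<union> X" if "poly f t = 0" for t using that by (auto simp: X_def)
 have rf': "t \<in> h2 ` (Z \<union> X)" if t: "poly f' t = 0" for t
 proof (cases "t \<in> h ` Z")
  case True thus ?thesis using h2Z by force
 next
  case False
  obtain xi where xi: "poly f xi = 0" "matched Z h xi t" using b'[OF t False] by blast
  have "xi ~: Z" using matched_eq[OF xi(2), of xi] False by auto
  hence X: "xi \<in> X" using xi by (simp add: X_def)
  have "h2 xi = t"
  proof (rule ccontr)
   assume "h2 xi ~= t"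
   then consider "h2 xi < t" | "t < h2 xi" by linarith
   then obtain c where c: "poly (pderiv f') c = 0" "(h2 xi < c & c < t) | (t < c & c < h2 xi)"
    using rolle_poly[of "h2 xi" t f'] rolle_poly[of t "h2 xi" f'] h2X(1)[OF X] t by cases blast+
   then obtain z where z: "z \<in> Z" "c = h z" using roots(2)[OF dS d0(1)] by blast
   show False
    using c(2) z matched_lt[OF xi(2) z(1)] matched_gt[OF xi(2) z(1)]
     matched_lt[OF h2X(2)[OF X] z(1)] matched_gt[OF h2X(2)[OF X] z(1)] by auto
  qed
  thus ?thesis using X by blast
 qed
 have a2: "sgn (poly f z) = sgn (poly f' (h2 z))" if "z \<in> Z \<union> X" for z
  using that a h2Z h2X(1) by (cases "z \<in> Z") (auto simp: X_def)
 have sgf: "sgn (poly f x) = sgn (poly f' x')" if m: "matched (Z \<union> X) h2 x x'" for x x'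
 proof -
  consider "x \<in> Z \<union> X" | "x > bnd" | "x < - bnd" | "x ~: Z \<union> X" "- bnd < x" "x < bnd"
   using Z(3,4) by (metis UnI1 linorder_neqE_linordered_idom)
  thus ?thesis
  proof cases
   case 1
   hence "x' = h2 x" using matched_eq[OF m 1] by simp
   thus ?thesis using a2[OF 1] by simp
  next
   case 2
   hence "x' > bnd" using matched_gt[OF m, of bnd] Z h2Z by simp
   thus ?thesis using bnd(2)[OF f(1)] 2 by simp
  next
   case 3
   hence "x' < - bnd" using matched_lt[OF m, of "- bnd"] Z h2Z by simp
   thus ?thesis using bnd(3)[OF f(1)] 3 by simp
  next
   case 4
   let ?W = "Z \<union> X"
   have finW: "finite ?W" using Z(1) finX by simp
   have ex: "\<exists>z\<in>?W. z < x" "\<exists>z\<in>?W. x < z" using 4 Z(3,4) by blast+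
   obtain lo hi where lo: "lo \<in> ?W" "lo < x" and lomax: "!!z. z \<in> ?W ==> z < x ==> z <= lo"
    and hi: "hi \<in> ?W" "x < hi" and himin: "!!z. z \<in> ?W ==> x < z ==> hi <= z"
    by (rule ex_neighbours[OF finW ex]) (rule that; assumption)
   have x': "h2 lo < x'" "x' < h2 hi"
    using matched_gt[OF m lo(1)] matched_lt[OF m hi(1)] lo hi by auto
   have no: "z ~: ?W" if "lo < z" "z < hi" for z
    using lomax[of z] himin[of z] 4(1) that by (cases z x rule: linorder_cases) auto
   have nof: "poly f z ~= 0" if "lo < z" "z < hi" for z using no[OF that] rf by blast
   have nof': "poly f' t ~= 0" if t: "h2 lo < t" "t < h2 hi" for t
   proof
    assume "poly f' t = 0"
    then obtain z where z: "z \<in> ?W" "t = h2 z" using rf' by blast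
    hence "lo < z" "z < hi"
     using t mono2 lo(1) hi(1) by (metis linorder_not_less strict_mono_on_leD)+
    thus False using no z(1) by blast
   qed
   \<comment> \<open>Between neighbouring marks the sign is read off at an end where
     \<open>f\<close> does not vanish. Both ends cannot be zeros, since by Rolle the derivative
     would then have a root between them, which would be a mark.\<close>
   show ?thesis
   proof (cases "poly f lo = 0")
    case False
    have "poly f' (h2 lo) ~= 0" using a2[OF lo(1)] False by (metis sgn_0_0)
    have "sgn (poly f x) = sgn (poly f lo)"
     using False lo hi nof by (intro sgn_const_within[of _ _ lo _ hi]) auto
    moreover have "sgn (poly f' x') = sgn (poly f' (h2 lo))"
     using \<open>poly f' (h2 lo) ~= 0\<close> x' nof' by (intro sgn_const_within[of _ _ "h2 lo" _ "h2 hi"]) auto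
    ultimately show ?thesis using a2[OF lo(1)] by simp
   next
    case True
    have hn: "poly f hi ~= 0"
    proof
     assume "poly f hi = 0"
     then obtain c where "c \<in> Z" "lo < c" "c < hi" using sep[OF True] lo hi by fastforce
     thus False using no by blast
    qed
    hence "poly f' (h2 hi) ~= 0" using a2[OF hi(1)] by (metis sgn_0_0)
    have "sgn (poly f x) = sgn (poly f hi)"
     using hn lo hi nof by (intro sgn_const_within[of _ _ lo _ hi]) auto
    moreover have "sgn (poly f' x') = sgn (poly f' (h2 hi))"
     using \<open>poly f' (h2 hi) ~= 0\<close> x' nof' by (intro sgn_const_within[of _ _ "h2 lo" _ "h2 hi"]) auto
    ultimately show ?thesis using a2[OF hi(1)] by simp
   qed
  qed
 qed
 have mZ: "matched Z h x x'" if "matched (Z \<union> X) h2 x x'" for x x'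
  using that h2Z unfolding matched_def by auto
 have "tracks (insert (f, f') S) (Z \<union> X) h2"
  unfolding tracks_def
 proof (intro conjI)
  show "finite (Z \<union> X)" "strict_mono_on (Z \<union> X) h2" using Z(1) finX mono2 by auto
  show "{- bnd, bnd} \<subseteq> Z \<union> X" "h2 bnd = bnd" "h2 (- bnd) = - bnd" using Z h2Z by auto
  have "h ` Z \<subseteq> h2 ` (Z \<union> X)" using h2Z by force
  hence "{t. poly p t = 0} \<subseteq> Z \<union> X & {t. poly p' t = 0} \<subseteq> h2 ` (Z \<union> X)"
   if "(p, p') \<in> insert (f, f') S" "p ~= 0" for p p'
   using roots[of p p'] rf rf' that by (cases "(p, p') \<in> S") blast+
  thus "\<forall>(p, p')\<in>insert (f, f') S. p ~= 0 --> {t. poly p t = 0} \<subseteq> Z \<union> X & {t. poly p' t = 0} \<subseteq> h2 ` (Z \<union> X)"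
   by blast
  show "\<forall>z\<in>Z \<union> X. z = bnd | z = - bnd | (\<exists>(q, q')\<in>insert (f, f') S. q ~= 0 & poly q z = 0)"
   using isroot f0 unfolding X_def by blast
  show "\<forall>x x'. matched (Z \<union> X) h2 x x' --> (\<forall>(p, p')\<in>insert (f, f') S. sgn (poly p x) = sgn (poly p' x'))"
   using sg mZ sgf by blast
 qed
 thus ?thesis by blast
qed

text \<open>Degrees are treated in increasing order, since remainders and derivatives have smaller
  degree.\<close>

lemma ex_tracks: "\<exists>Z h. tracks {(p, p')\<in>R. degree p <= n} Z h"
proof (induction n)
 case 0
 have "tracks {(p, p')\<in>R. degree p <= 0} {- bnd, bnd} id"
 proof -
  have const: "sgn (poly p x) = sgn (poly p' x') & (p ~= 0 --> poly p x ~= 0 & poly p' x ~= 0)"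
   if pp: "(p, p') \<in> R" "degree p = 0" for p p' x x'
  proof -
   obtain c where c: "p = [:c:]" using degree_eq_zeroE[OF pp(2)] by blast
   have "degree p' = 0" using lead[OF pp(1)] pp(2) by simp
   then obtain c' where c': "p' = [:c':]" using degree_eq_zeroE by blast
   have "sgn c = sgn c'" using lead[OF pp(1)] unfolding c c' by simp
   thus ?thesis unfolding c c' by (auto simp: sgn_zero_iff)
  qed
  thus ?thesis using const bnd(1) unfolding tracks_def by (auto simp: strict_mono_on_def)
 qed
 thus ?case by blast
next
 case (Suc n)
 define Q where "Q = {(p, p')\<in>R. degree p = Suc n}"
 have "\<exists>Z h. tracks ({(p, p')\<in>R. degree p <= n} \<union> S) Z h" if "finite S" "S \<subseteq> Q" for S
  using that
 proof (induction S rule: finite_induct)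
  case empty thus ?case using Suc.IH by simp
 next
  case (insert x S)
  obtain f f' where x: "x = (f, f')" by (cases x)
  obtain Z h where T: "tracks ({(p, p')\<in>R. degree p <= n} \<union> S) Z h" using insert by auto
  have "\<exists>Z h. tracks (insert (f, f') ({(p, p')\<in>R. degree p <= n} \<union> S)) Z h"
   using insert.prems x by (intro tracks_insert[OF T, of "Suc n"]) (auto simp: Q_def)
  thus ?case by (simp add: x)
 qed
 moreover have "finite Q" using fin by (rule rev_finite_subset) (auto simp: Q_def)
 ultimately have "\<exists>Z h. tracks ({(p, p')\<in>R. degree p <= n} \<union> Q) Z h" by blast
 moreover have "{(p, p')\<in>R. degree p <= n} \<union> Q = {(p, p')\<in>R. degree p <= Suc n}" by (auto simp: Q_def)
 ultimately show ?case by simp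
qed

theorem sign_transfer: "\<exists>t'. \<forall>(p, p')\<in>R. sgn (poly p t) = sgn (poly p' t')"
proof -
 define n where "n = Max (insert 0 ((%x. degree (fst x)) ` R))"
 have "degree p <= n" if "(p, p') \<in> R" for p p'
  unfolding n_def using fin that by (intro Max_ge) force+
 hence eq: "{(p, p')\<in>R. degree p <= n} = R" by auto
 obtain Z h where T: "tracks R Z h" using ex_tracks[of n] eq by auto
 have Z: "finite Z" "strict_mono_on Z h"
  and sg: "\<forall>x x'. matched Z h x x' --> (\<forall>(p, p')\<in>R. sgn (poly p x) = sgn (poly p' x'))"
  using T unfolding tracks_def by simp_all
 obtain t' where "matched Z h t t'" using ex_matched[OF Z] by metis
 thus ?thesis using sg by (intro exI[of _ t']) simp
qed

end

section \<open>Sign-determined sets\<close>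

text \<open>Integer polynomials taken as functions of an assignment and not as expressions;
  coefficients, remainders and specializations are then plain functions as well.\<close>

inductive_set Pol :: "(('v => real) => real) set" where
 Pol_var: "(%e. e x) \<in> Pol"
| Pol_0: "(%e. 0) \<in> Pol"
| Pol_1: "(%e. 1) \<in> Pol"
| Pol_add: "f \<in> Pol ==> g \<in> Pol ==> (%e. f e + g e) \<in> Pol"
| Pol_mult: "f \<in> Pol ==> g \<in> Pol ==> (%e. f e * g e) \<in> Pol"
| Pol_uminus: "f \<in> Pol ==> (%e. - f e) \<in> Pol"

lemma Pol_diff: "f \<in> Pol ==> g \<in> Pol ==> (%e. f e - g e) \<in> Pol"
 using Pol_add[of f "%e. - g e"] Pol_uminus[of g] by simp

lemma Pol_sum: "(!!i. i \<in> I ==> f i \<in> Pol) ==> (%e. \<Sum>i\<in>I. f i e) \<in> Pol"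
 by (induction I rule: infinite_finite_induct) (auto intro: Pol_0 Pol_add)

lemma Pol_of_nat: "(%e. real n) \<in> Pol"
proof (induction n)
 case (Suc n)
 thus ?case using Pol_add[OF Pol_1 Suc] by simp
qed (simp add: Pol_0)

lemma Pol_of_int: "(%e. real_of_int n) \<in> Pol"
proof (cases n rule: int_cases2)
 case (nonneg k) thus ?thesis using Pol_of_nat[of k] by simp
next
 case (nonpos k) thus ?thesis using Pol_uminus[OF Pol_of_nat[of k]] by simp
qed

lemma Pol_power: "f \<in> Pol ==> (%e. f e ^ k) \<in> Pol"
 by (induction k) (auto intro: Pol_1 Pol_mult)

lemma Pol_int_poly:
 assumes "\<forall>i. coeff p i \<in> \<int>"
 shows "(%e. poly p (e x)) \<in> Pol"
proof -
 have "(%e. coeff p i * e x ^ i) \<in> Pol" for i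
 proof -
  obtain n where "coeff p i = real_of_int n" using assms by (auto elim: Ints_cases)
  thus ?thesis using Pol_of_int[of n] by (intro Pol_mult Pol_power Pol_var) simp
 qed
 hence "(%e. \<Sum>i\<le>degree p. coeff p i * e x ^ i) \<in> Pol" by (intro Pol_sum)
 thus ?thesis by (simp add: poly_altdef)
qed

section \<open>Polynomials in one variable whose coefficients depend on the other variables\<close>

definition spec :: "'e => ('e => real) list => real poly" where
 "spec e L = Poly (map (%c. c e) L)"

definition nthc :: "('e => real) list => nat => 'e => real" where
 "nthc L i = (if i < length L then L ! i else (%_. 0))"

lemma coeff_spec: "coeff (spec e L) i = nthc L i e"
 by (simp add: spec_def nthc_def nth_default_def)

lemma nthc_Pol: "set L \<subseteq> Pol ==> nthc L i \<in> Pol"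
 by (auto simp: nthc_def intro: Pol_0)

lemma coeff_spec_map: "coeff (spec e (map c [0..<n])) i = (if i < n then c i e else 0)"
 by (simp add: coeff_spec nthc_def)

lemma degree_spec: "L ~= [] ==> degree (spec e L) < length L"
proof -
 assume "L ~= []"
 have "degree (spec e L) <= length L - 1"
  by (rule degree_le) (auto simp: coeff_spec nthc_def)
 thus ?thesis using \<open>L ~= []\<close> by (cases L) auto
qed

lemma Pol_fun_upd:
 assumes "f \<in> Pol"
 shows "\<exists>L. set L \<subseteq> Pol & (\<forall>e t. f (e(x := t)) = poly (spec e L) t)"
 using assms
proof (induction rule: Pol.induct)
 case (Pol_var y)
 show ?case
 proof (cases "y = x")
  case True
  thus ?thesis by (intro exI[of _ "[%_. 0, %_. 1]"]) (auto simp: spec_def Pol_0 Pol_1)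
 next
  case False
  thus ?thesis by (intro exI[of _ "[%e. e y]"]) (auto simp: spec_def Pol.Pol_var)
 qed
next
 case Pol_0 thus ?case by (intro exI[of _ "[]"]) (auto simp: spec_def)
next
 case Pol_1 thus ?case by (intro exI[of _ "[%_. 1]"]) (auto simp: spec_def Pol.Pol_1)
next
 case (Pol_uminus f)
 then obtain L where L: "set L \<subseteq> Pol" "\<forall>e t. f (e(x := t)) = poly (spec e L) t" by blast
 have "spec e (map (%i e. - nthc L i e) [0..<length L]) = - spec e L" for e
  by (rule poly_eqI) (simp add: coeff_spec_map coeff_spec, simp add: nthc_def)
 thus ?case
  using L nthc_Pol[OF L(1)]
  by (intro exI[of _ "map (%i e. - nthc L i e) [0..<length L]"]) (auto intro: Pol.Pol_uminus simp del: fun_upd_apply)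
next
 case (Pol_add f g)
 then obtain L M where L: "set L \<subseteq> Pol" "\<forall>e t. f (e(x := t)) = poly (spec e L) t"
  and M: "set M \<subseteq> Pol" "\<forall>e t. g (e(x := t)) = poly (spec e M) t" by blast
 let ?S = "map (%i e. nthc L i e + nthc M i e) [0..<length L + length M]"
 have "spec e ?S = spec e L + spec e M" for e
  by (rule poly_eqI) (simp add: coeff_spec_map coeff_spec, simp add: nthc_def)
 thus ?case
  using L M nthc_Pol[OF L(1)] nthc_Pol[OF M(1)]
  by (intro exI[of _ ?S]) (auto intro: Pol.Pol_add simp del: fun_upd_apply)
next
 case (Pol_mult f g)
 then obtain L M where L: "set L \<subseteq> Pol" "\<forall>e t. f (e(x := t)) = poly (spec e L) t"
  and M: "set M \<subseteq> Pol" "\<forall>e t. g (e(x := t)) = poly (spec e M) t" by blast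
 let ?c = "%k e. \<Sum>i\<le>k. nthc L i e * nthc M (k - i) e"
 let ?S = "map ?c [0..<length L + length M]"
 have "nthc L i e * nthc M (k - i) e = 0" if "length L + length M <= k" "i <= k" for i k e
  using that by (auto simp: nthc_def)
 hence "spec e ?S = spec e L * spec e M" for e
  by (intro poly_eqI, unfold coeff_spec_map coeff_mult, unfold coeff_spec)
    (auto intro!: sum.neutral)
 thus ?case
  using L M nthc_Pol[OF L(1)] nthc_Pol[OF M(1)]
  by (intro exI[of _ ?S]) (auto intro!: Pol_sum Pol.Pol_mult simp del: fun_upd_apply)
qed

definition list_deriv :: "('e => real) list => ('e => real) list" where
 "list_deriv L = map (%i e. real (Suc i) * nthc L (Suc i) e) [0..<length L - 1]"

lemma spec_list_deriv: "spec e (list_deriv L) = pderiv (spec e L)"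
 unfolding list_deriv_def
 by (rule poly_eqI) (auto simp: coeff_spec_map coeff_pderiv coeff_spec nthc_def less_diff_conv)

text \<open>Pseudo-division, uniform in the parameters. Only values at zeros of \<open>g\<close> are
  recorded, so no quotient appears. The entry \<open>last g\<close> is the formal leading
  coefficient and may vanish at particular assignments.\<close>

definition is_rem :: "(('v => real) => real) list => (('v => real) => real) list => (('v => real) => real) list => bool" where
 "is_rem f g r \<longleftrightarrow> set r \<subseteq> Pol & length r < length g &
   (\<exists>k. \<forall>e t. poly (spec e g) t = 0 --> last g e ^ k * poly (spec e f) t = poly (spec e r) t)"

lemma ex_rem:
 assumes "set f \<subseteq> Pol" "set g \<subseteq> Pol" "g ~= []"
 shows "\<exists>r. is_rem f g r"
 using assms(1)
proof (induction "length f" arbitrary: f rule: less_induct)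
 case less
 show ?case
 proof (cases "length f < length g")
  case True
  thus ?thesis using less.prems by (intro exI[of _ f]) (auto simp: is_rem_def intro: exI[of _ 0])
 next
  case False
  define d where "d = length f - length g"
  define n where "n = length f - 1"
  have f0: "f ~= []" "length f = Suc n" using False assms(3) by (auto simp: n_def) (cases f; cases g; auto)+
  have g: "length f = d + length g" "length g > 0" using False assms(3) by (auto simp: d_def)
  \<comment> \<open>One step of the division: \<open>last g\<close> times \<open>f\<close> minus the
    top coefficient of \<open>f\<close> times the shifted \<open>g\<close>. The entry at
    \<open>n\<close> cancels.\<close>
  define c where "c i e = nthc g (length g - 1) e * nthc f i e - (if i < d then 0 else nthc f n e * nthc g (i - d) e)" for i e
  define f1 where "f1 = map c [0..<n]"
  have lg: "last g = nthc g (length g - 1)" using assms(3) by (simp add: last_conv_nth nthc_def)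
  have "c i \<in> Pol" for i
   using nthc_Pol[OF less.prems] nthc_Pol[OF assms(2)]
   unfolding c_def by (cases "i < d") (auto intro!: Pol_diff Pol_mult Pol_0)
  hence "set f1 \<subseteq> Pol" by (auto simp: f1_def)
  then obtain r where "is_rem f1 g r" using less.hyps[of f1] f0 by (auto simp: f1_def)
  then obtain k where r: "set r \<subseteq> Pol" "length r < length g"
   "!!e t. poly (spec e g) t = 0 ==> last g e ^ k * poly (spec e f1) t = poly (spec e r) t"
   unfolding is_rem_def by blast
  have "spec e f1 = smult (last g e) (spec e f) - monom (nthc f n e) d * spec e g" for e
  proof (rule poly_eqI)
   fix i
   have "c n e = 0"
   proof -
    have "n - d = length g - 1" "\<not> n < d" using g f0(2) by linarith+
    thus ?thesis by (simp add: c_def)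
   qed
   moreover have "nthc f i e = 0" "nthc g (i - d) e = 0" if "n < i"
    using that f0(2) g by (auto simp: nthc_def)
   ultimately show "coeff (spec e f1) i = coeff (smult (last g e) (spec e f) - monom (nthc f n e) d * spec e g) i"
    unfolding f1_def coeff_spec_map
    by (cases i n rule: linorder_cases)
      (auto simp: coeff_spec lg coeff_monom_mult c_def)
  qed
  hence "last g e ^ Suc k * poly (spec e f) t = poly (spec e r) t" if "poly (spec e g) t = 0" for e t
   using r(3)[OF that] that by (simp add: mult.assoc mult.left_commute)
  thus ?thesis using r(1,2) by (auto simp: is_rem_def intro!: exI[of _ r] exI[of _ "Suc k"])
 qed
qed

definition list_rem where "list_rem f g = (SOME r. is_rem f g r)"

lemma list_rem: "set f \<subseteq> Pol ==> set g \<subseteq> Pol ==> g ~= [] ==> is_rem f g (list_rem f g)"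
 unfolding list_rem_def using ex_rem by (rule someI_ex)

text \<open>Truncation by \<open>butlast\<close> is included because a formal leading coefficient
  can vanish at an assignment; the specialized polynomial is then the one of the shorter
  list.\<close>

definition closed_family :: "(('v => real) => real) list set => bool" where
 "closed_family C \<longleftrightarrow> (\<forall>L\<in>C. set L \<subseteq> Pol) &
  (\<forall>f\<in>C. f ~= [] --> butlast f \<in> C & list_deriv f \<in> C) &
  (\<forall>f\<in>C. \<forall>g\<in>C. g ~= [] & length g <= length f --> list_rem f g \<in> C)"

text \<open>Truncations and derivatives are shorter than the list they come from, and remainders
  shorter than the divisor. So the lists are saturated from the longest downwards: the round for
  length \<open>N - j\<close> adds only shorter lists and does not disturb the earlier
  rounds.\<close>

lemma ex_closure:
 assumes "finite F" "!!L. L \<in> F ==> set L \<subseteq> Pol"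
 shows "\<exists>C. finite C & F \<subseteq> C & closed_family C"
proof -
 define N where "N = Max (insert 0 (length ` F))"
 have N: "length L <= N" if "L \<in> F" for L using that assms(1) by (auto simp: N_def intro!: Max_ge)
 have "\<exists>C. finite C & F \<subseteq> C & (\<forall>L\<in>C. set L \<subseteq> Pol) &
  (\<forall>f\<in>C. N - j < length f --> butlast f \<in> C & list_deriv f \<in> C) &
  (\<forall>f\<in>C. \<forall>g\<in>C. N - j < length g & length g <= length f --> list_rem f g \<in> C)" for j
 proof (induction j)
  case 0
  have "\<not> N < length L" if "L \<in> F" for L using N[OF that] by simp
  thus ?case using assms by (intro exI[of _ F]) auto
 next
  case (Suc j)
  show ?case
  proof (cases "j < N")
   case False
   hence "N - Suc j = N - j" by simp
   thus ?thesis using Suc.IH by simp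
  next
   case True
   define k where "k = N - Suc j"
   have kj: "N - j = Suc k" using True by (simp add: k_def)
   obtain C where C: "finite C" "F \<subseteq> C" "!!L. L \<in> C ==> set L \<subseteq> Pol"
    "!!f. f \<in> C ==> Suc k < length f ==> butlast f \<in> C & list_deriv f \<in> C"
    "!!f g. f \<in> C ==> g \<in> C ==> Suc k < length g ==> length g <= length f ==> list_rem f g \<in> C"
    using Suc.IH unfolding kj by blast
   define D where "D = {f\<in>C. k < length f}"
   have DC: "D \<subseteq> C" by (auto simp: D_def)
   have rem: "is_rem f g (list_rem f g)" if "f \<in> D" "g \<in> D" for f g
    using that C(3) by (intro list_rem) (auto simp: D_def)
   define E where "E = C \<union> butlast ` D \<union> list_deriv ` D \<union> (%(f, g). list_rem f g) ` {(f, g) \<in> D \<times> D. length g <= length f}"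
   have Ebig: "L \<in> C" if L: "L \<in> E" "k < length L" for L
   proof (rule ccontr)
    assume nL: "L ~: C"
    have "(\<exists>f\<in>D. L = butlast f | L = list_deriv f) |
      (\<exists>f\<in>D. \<exists>g\<in>D. length g <= length f & L = list_rem f g)"
     using L(1) nL unfolding E_def by auto
    then consider f where "f \<in> D" "L = butlast f | L = list_deriv f"
     | f g where "f \<in> D" "g \<in> D" "length g <= length f" "L = list_rem f g"
     by blast
    thus False
    proof cases
     case 1
     hence "\<not> Suc k < length f" using C(4)[of f] nL DC by auto
     thus ?thesis using 1(2) L(2) by (auto simp: list_deriv_def)
    next
     case 2
     hence "\<not> Suc k < length g" using C(5)[of f g] nL DC by auto
     thus ?thesis using rem[OF 2(1,2)] 2(4) L(2) by (auto simp: is_rem_def)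
    qed
   qed
   have fD: "finite D" using C(1) by (simp add: D_def)
   have "finite {(f, g) \<in> D \<times> D. length g <= length f}"
    by (rule finite_subset[OF _ finite_cartesian_product[OF fD fD]]) auto
   from finite_imageI[OF this] finite_imageI[OF fD] C(1) have finE: "finite E"
    unfolding E_def finite_Un by blast
   have PolE: "set L \<subseteq> Pol" if "L \<in> E" for L
   proof -
    have "set (butlast f) \<subseteq> Pol" if "f \<in> D" for f using that C(3)[of f] DC in_set_butlastD by fastforce
    moreover have "set (list_deriv f) \<subseteq> Pol" if "f \<in> D" for f
     using nthc_Pol[OF C(3)[of f]] that DC unfolding list_deriv_def by (auto intro!: Pol_mult Pol_of_nat simp del: of_nat_Suc)
    moreover have "set (list_rem f g) \<subseteq> Pol" if "f \<in> D" "g \<in> D" for f g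
     using rem[OF that] by (simp add: is_rem_def)
    moreover have "L \<in> C | (\<exists>f\<in>D. L = butlast f) | (\<exists>f\<in>D. L = list_deriv f) | (\<exists>f\<in>D. \<exists>g\<in>D. L = list_rem f g)"
     using that unfolding E_def by auto
    ultimately show ?thesis using C(3) by (elim disjE bexE) simp_all
   qed
   have in_D: "L \<in> D" if "L \<in> E" "k < length L" for L using Ebig[OF that] that by (simp add: D_def)
   have "butlast f \<in> E & list_deriv f \<in> E" if "f \<in> E" "k < length f" for f
    using in_D[OF that] by (auto simp: E_def)
   moreover have "list_rem f g \<in> E" if "f \<in> E" "g \<in> E" "k < length g" "length g <= length f" for f g
   proof -
    have "f \<in> D" "g \<in> D" using in_D[of f] in_D[of g] that by auto
    hence "(f, g) \<in> {(f, g) \<in> D \<times> D. length g <= length f}" using that(4) by simp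
    hence "list_rem f g \<in> (%(f, g). list_rem f g) ` {(f, g) \<in> D \<times> D. length g <= length f}"
     by (rule rev_image_eqI) simp
    thus ?thesis by (simp only: E_def Un_iff simp_thms)
   qed
   moreover have "F \<subseteq> E" using C(2) by (auto simp: E_def)
   ultimately show ?thesis
    unfolding k_def[symmetric] using finE PolE by (intro exI[of _ E] conjI ballI impI) simp_all
  qed
 qed
 from this[of N] show ?thesis by (simp add: closed_family_def)
qed

text \<open>Quantifier-free definability over the integers in semantic form.\<close>

definition sign_determined :: "(('v => real) => bool) => bool" where
 "sign_determined A \<longleftrightarrow> (\<exists>F. finite F & F \<subseteq> Pol &
   (\<forall>e e'. (\<forall>f\<in>F. sgn (f e) = sgn (f e')) --> A e = A e'))"

lemma sign_determinedI:
 assumes "finite F" "F \<subseteq> Pol" "!!e e'. \<forall>f\<in>F. sgn (f e) = sgn (f e') ==> A e ==> A e'"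
 shows "sign_determined A"
 unfolding sign_determined_def
proof (intro exI[of _ F] conjI allI impI)
 show "A e = A e'" if "\<forall>f\<in>F. sgn (f e) = sgn (f e')" for e e'
  using assms(3)[of e e'] assms(3)[of e' e] that by auto
qed (use assms in auto)

lemma sign_determinedE:
 assumes "sign_determined A"
 obtains F where "finite F" "F \<subseteq> Pol" "!!e e'. \<forall>f\<in>F. sgn (f e) = sgn (f e') ==> A e = A e'"
 using assms unfolding sign_determined_def by blast

text \<open>The Tarski-Seidenberg theorem. The new polynomials are the coefficients of a closed
  family: if their signs agree at two assignments, the two specializations of the family form a
  \<open>sign_pairs\<close> relation, along which a witness \<open>t\<close> is transferred.\<close>

theorem sign_determined_ex:
 fixes A :: "('v => real) => bool"
 assumes "sign_determined A"
 shows "sign_determined (%e. \<exists>t. A (e(x := t)))"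
proof -
 obtain F where F: "finite F" "F \<subseteq> Pol" "!!e e'. \<forall>f\<in>F. sgn (f e) = sgn (f e') ==> A e = A e'"
  using assms by (rule sign_determinedE) blast
 have "\<forall>f\<in>F. \<exists>L. set L \<subseteq> Pol & (\<forall>e t. f (e(x := t)) = poly (spec e L) t)"
  using F(2) by (intro ballI Pol_fun_upd) auto
 from bchoice[OF this] obtain l where
  l0: "\<forall>f\<in>F. set (l f) \<subseteq> Pol & (\<forall>e t. f (e(x := t)) = poly (spec e (l f)) t)" by blast
 have l: "set (l f) \<subseteq> Pol" "f (e(x := t)) = poly (spec e (l f)) t" if "f \<in> F" for f e t
  using l0[rule_format, OF that] by blast+
 obtain C where fC: "finite C" "l ` F \<subseteq> C" and "closed_family C"
  using ex_closure[of "l ` F"] F(1) l(1) by auto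
 hence C: "finite C" "l ` F \<subseteq> C" "!!L. L \<in> C ==> set L \<subseteq> Pol"
  "!!f. f \<in> C ==> f ~= [] ==> butlast f \<in> C & list_deriv f \<in> C"
  "!!f g. f \<in> C ==> g \<in> C ==> g ~= [] ==> length g <= length f ==> list_rem f g \<in> C"
  by (simp_all add: closed_family_def)
 define G where "G = (\<Union>L\<in>C. set L)"
 have transfer: "\<exists>t. A (e'(x := t))" if agree: "\<forall>g\<in>G. sgn (g e) = sgn (g e')" and A: "\<exists>t. A (e(x := t))" for e e'
 proof -
  define R where "R = (%L. (spec e L, spec e' L)) ` C"
  have sgc: "sgn (coeff (spec e L) i) = sgn (coeff (spec e' L) i)" if "L \<in> C" for L i
   using agree that by (auto simp: coeff_spec nthc_def G_def)
  have deg: "degree (spec e L) = degree (spec e' L) & sgn (lead_coeff (spec e L)) = sgn (lead_coeff (spec e' L))" if "L \<in> C" for L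
  proof -
   have cz: "coeff (spec e L) i = 0 \<longleftrightarrow> coeff (spec e' L) i = 0" for i
    using sgc[OF that, of i] by (metis sgn_zero_iff)
   have "degree (spec e L) = degree (spec e' L)"
   proof (rule antisym; rule degree_le; intro allI impI)
    show "coeff (spec e L) i = 0" if "degree (spec e' L) < i" for i
     using cz[of i] coeff_eq_0[OF that] by simp
    show "coeff (spec e' L) i = 0" if "degree (spec e L) < i" for i
     using cz[of i] coeff_eq_0[OF that] by simp
   qed
   thus ?thesis using sgc[OF that] by simp
  qed
  \<comment> \<open>Vanishing leading entries are dropped, so that the length of the list fits the
    degree and \<open>last\<close> is the true leading coefficient.\<close>
  have strip: "\<exists>M\<in>C. spec e M = spec e L & spec e' M = spec e' L & length M = Suc (degree (spec e L))"
   if "L \<in> C" "spec e L ~= 0" for L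
   using that
  proof (induction "length L" arbitrary: L rule: less_induct)
   case less
   have L0: "L ~= []" using less.prems(2) by (auto simp: spec_def)
   show ?case
   proof (cases "length L = Suc (degree (spec e L))")
    case True thus ?thesis using less.prems by blast
   next
    case False
    hence lt: "degree (spec e L) < length L - 1" "degree (spec e' L) < length L - 1"
     using degree_spec[OF L0, of e] deg[OF less.prems(1)] by auto
    have bl: "nthc (butlast L) i = (if i < length L - 1 then nthc L i else (%_. 0))" for i
     by (auto simp: nthc_def nth_butlast)
    have eq: "spec e (butlast L) = spec e L" "spec e' (butlast L) = spec e' L"
    proof -
     have "coeff (spec d (butlast L)) i = coeff (spec d L) i" if "degree (spec d L) < length L - 1" for d i
      using that coeff_eq_0[of "spec d L" i] by (auto simp: coeff_spec bl)
     thus "spec e (butlast L) = spec e L" "spec e' (butlast L) = spec e' L"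
      using lt by (auto intro: poly_eqI)
    qed
    have "butlast L \<in> C" using C(4)[OF less.prems(1) L0] by simp
    moreover have "length (butlast L) < length L" using L0 by (cases L) auto
    ultimately show ?thesis using less.hyps[of "butlast L"] eq less.prems(2) by simp
   qed
  qed
  have last: "last M e = lead_coeff (spec e M)" "last M e' = lead_coeff (spec e' M)"
   if "M \<in> C" "length M = Suc (degree (spec e M))" for M
  proof -
   have "M ~= []" using that(2) by auto
   thus "last M e = lead_coeff (spec e M)" "last M e' = lead_coeff (spec e' M)"
    using that deg[OF that(1)] by (auto simp: coeff_spec nthc_def last_conv_nth)
  qed
  interpret sign_pairs R
  proof
   show "finite R" using C(1) by (simp add: R_def)
   show "degree p = degree p' & sgn (lead_coeff p) = sgn (lead_coeff p')" if "(p, p') \<in> R" for p p'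
    using that deg by (auto simp: R_def)
   show "(pderiv p, pderiv p') \<in> R" if pp: "(p, p') \<in> R" for p p'
   proof -
    obtain L where L: "L \<in> C" "p = spec e L" "p' = spec e' L" using pp by (auto simp: R_def)
    show ?thesis
    proof (cases "L = []")
     case True thus ?thesis using pp L by (simp add: spec_def)
    next
     case False
     thus ?thesis using C(4)[OF L(1)] L spec_list_deriv[of e L] spec_list_deriv[of e' L]
      by (auto simp: R_def image_iff intro!: bexI[of _ "list_deriv L"])
    qed
   qed
   fix p p' q q' assume A: "(p, p') \<in> R" "(q, q') \<in> R" "0 < degree q" "degree q <= degree p"
   obtain L where L: "L \<in> C" "p = spec e L" "p' = spec e' L" "length L = Suc (degree p)"
   proof -
    obtain L where L: "L \<in> C" "p = spec e L" "p' = spec e' L" using A(1) by (auto simp: R_def)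
    moreover have "spec e L ~= 0" using L A(3,4) by auto
    ultimately show ?thesis using strip[of L] that by metis
   qed
   obtain M where M: "M \<in> C" "q = spec e M" "q' = spec e' M" "length M = Suc (degree q)"
   proof -
    obtain L where L: "L \<in> C" "q = spec e L" "q' = spec e' L" using A(2) by (auto simp: R_def)
    moreover have "spec e L ~= 0" using L A(3) by auto
    ultimately show ?thesis using strip[of L] that by metis
   qed
   have M0: "M ~= []" using M(4) by auto
   have le: "length M <= length L" using L(4) M(4) A(4) by simp
   define r where "r = list_rem L M"
   have rC: "r \<in> C" using C(5)[OF L(1) M(1) M0 le] by (simp add: r_def)
   have "is_rem L M r" unfolding r_def using C(3) L(1) M(1) M0 by (intro list_rem) auto
   then obtain k where r: "length r < length M"
    "!!e t. poly (spec e M) t = 0 ==> last M e ^ k * poly (spec e L) t = poly (spec e r) t"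
    unfolding is_rem_def by blast
   have dr: "degree (spec e r) < degree q"
    using r(1) M(4) degree_spec[of r e] A(3) by (cases "r = []") (auto simp: spec_def)
   have lm: "last M e = lead_coeff q" "last M e' = lead_coeff q'" using last[OF M(1)] M by auto
   show "\<exists>r r' k. (r, r') \<in> R & degree r < degree q &
    (\<forall>t. poly q t = 0 --> lead_coeff q ^ k * poly p t = poly r t) &
    (\<forall>t. poly q' t = 0 --> lead_coeff q' ^ k * poly p' t = poly r' t)"
    using rC dr r(2)[of e] r(2)[of e'] L M lm
    by (intro exI[of _ "spec e r"] exI[of _ "spec e' r"] exI[of _ k]) (auto simp: R_def)
  qed
  obtain t where t: "A (e(x := t))" using A by blast
  obtain t' where t': "\<forall>(p, p')\<in>R. sgn (poly p t) = sgn (poly p' t')" using sign_transfer by blast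
  have "sgn (f (e(x := t))) = sgn (f (e'(x := t')))" if "f \<in> F" for f
  proof -
   have "(spec e (l f), spec e' (l f)) \<in> R" using that C(2) by (auto simp: R_def)
   thus ?thesis using t' l(2)[OF that] by fastforce
  qed
  thus ?thesis using F(3) t by blast
 qed
 show ?thesis
 proof (rule sign_determinedI[of G])
  show "finite G" "G \<subseteq> Pol" using C(1,3) by (auto simp: G_def)
  show "\<exists>t. A (e'(x := t))" if "\<forall>f\<in>G. sgn (f e) = sgn (f e')" "\<exists>t. A (e(x := t))" for e e'
   using that by (rule transfer)
 qed
qed

section \<open>Closure properties of sign-determined predicates\<close>

lemma sign_determined_not: "sign_determined A ==> sign_determined (%e. \<not> A e)"
 unfolding sign_determined_def by simp

lemma sign_determined_conj:
 assumes "sign_determined A" "sign_determined B"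
 shows "sign_determined (%e. A e & B e)"
proof -
 obtain F where F: "finite F" "F \<subseteq> Pol" "!!e e'. \<forall>f\<in>F. sgn (f e) = sgn (f e') ==> A e = A e'"
  using assms(1) by (rule sign_determinedE) blast
 obtain G where G: "finite G" "G \<subseteq> Pol" "!!e e'. \<forall>f\<in>G. sgn (f e) = sgn (f e') ==> B e = B e'"
  using assms(2) by (rule sign_determinedE) blast
 show ?thesis
 proof (rule sign_determinedI[of "F \<union> G"])
  show "A e' & B e'" if "\<forall>f\<in>F \<union> G. sgn (f e) = sgn (f e')" "A e & B e" for e e'
   using F(3)[of e e'] G(3)[of e e'] that by simp
 qed (use F(1,2) G(1,2) in auto)
qed

lemma sign_determined_const: "sign_determined (%_. c)"
 unfolding sign_determined_def by (intro exI[of _ "{}"]) auto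

lemma sign_determined_ball:
 assumes "finite I" "!!i. i \<in> I ==> sign_determined (A i)"
 shows "sign_determined (%e. \<forall>i\<in>I. A i e)"
 using assms by (induction I rule: finite_induct) (auto intro: sign_determined_const sign_determined_conj)

lemma sign_determined_atom:
 assumes "f \<in> Pol" "!!a b. sgn a = sgn b ==> P a ==> P (b :: real)"
 shows "sign_determined (%e. P (f e))"
proof (rule sign_determinedI[of "{f}"])
 show "P (f e')" if "\<forall>g\<in>{f}. sgn (g e) = sgn (g e')" "P (f e)" for e e'
  using assms(2)[of "f e" "f e'"] that by simp
qed (use assms(1) in auto)

lemma sign_determined_eq: "f \<in> Pol ==> g \<in> Pol ==> sign_determined (%e. f e = g e)"
 using sign_determined_atom[OF Pol_diff[of f g], of "%a. a = 0"] by (simp add: sgn_zero_iff)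

lemma sign_determined_le: "f \<in> Pol ==> g \<in> Pol ==> sign_determined (%e. f e <= g e)"
 using sign_determined_atom[OF Pol_diff[of g f], of "%a. 0 <= a"] by (simp add: sgn_if split: if_splits)

lemma sign_determined_less: "f \<in> Pol ==> g \<in> Pol ==> sign_determined (%e. f e < g e)"
 using sign_determined_not[OF sign_determined_le[of g f]] by (simp add: not_le)

lemma sign_determined_ex_block:
 assumes "sign_determined A" "finite X"
 shows "sign_determined (%e. \<exists>u. A (%x. if x \<in> X then u x else e x))"
 using assms(2)
proof (induction X rule: finite_induct)
 case empty thus ?case using assms(1) by simp
next
 case (insert y X)
 have "(\<exists>u. A (%x. if x \<in> insert y X then u x else e x)) \<longleftrightarrow>
   (\<exists>t u. A (%x. if x \<in> X then u x else (e(y := t)) x))" for e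
 proof
  assume "\<exists>u. A (%x. if x \<in> insert y X then u x else e x)"
  then obtain u where u: "A (%x. if x \<in> insert y X then u x else e x)" by blast
  have "(%x. if x \<in> insert y X then u x else e x) = (%x. if x \<in> X then u x else (e(y := u y)) x)"
   by auto
  thus "\<exists>t u. A (%x. if x \<in> X then u x else (e(y := t)) x)" using u by metis
 next
  assume "\<exists>t u. A (%x. if x \<in> X then u x else (e(y := t)) x)"
  then obtain t u where u: "A (%x. if x \<in> X then u x else (e(y := t)) x)" by blast
  have "(%x. if x \<in> X then u x else (e(y := t)) x) = (%x. if x \<in> insert y X then (u(y := t)) x else e x)"
   using insert.hyps(2) by auto
  thus "\<exists>u. A (%x. if x \<in> insert y X then u x else e x)" using u by metis
 qed
 thus ?case using sign_determined_ex[OF insert.IH, of y] by simp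
qed

lemma term_val_Pol: "(%e. term_val e s) \<in> Pol"
 by (induction s) (auto intro: Pol.intros)

lemma sign_determined_sat: "sign_determined (%e. sat UNIV e p)"
proof (induction p)
 case (Le s t) thus ?case by (simp add: sign_determined_le term_val_Pol)
next
 case (Eq s t) thus ?case by (simp add: sign_determined_eq term_val_Pol)
next
 case (Neg p) thus ?case by (simp add: sign_determined_not)
next
 case (Conj p q) thus ?case by (simp add: sign_determined_conj)
next
 case (Exi x p)
 thus ?case using sign_determined_ex[of "%e. sat UNIV e p" x] by simp
qed

lemma term_val_agree: "(!!x. x \<in> term_vars s ==> e x = e' x) ==> term_val e s = term_val e' s"
 by (induction s) auto

lemma sat_agree: "(!!x. x \<in> free_vars p ==> e x = e' x) ==> sat K e p = sat K e' p"
proof (induction p arbitrary: e e')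
 case (Le s t)
 thus ?case using term_val_agree[of s e e'] term_val_agree[of t e e'] by simp
next
 case (Eq s t)
 thus ?case using term_val_agree[of s e e'] term_val_agree[of t e e'] by simp
next
 case (Exi x p)
 have "sat K (e(x := a)) p = sat K (e'(x := a)) p" for a
 proof (rule Exi.IH)
  fix y assume "y \<in> free_vars p"
  thus "(e(x := a)) y = (e'(x := a)) y" using Exi.prems[of y] by (cases "y = x") simp_all
 qed
 thus ?case by simp
next
 case (Neg p)
 have "sat K e p = sat K e' p" by (rule Neg.IH) (rule Neg.prems, simp)
 thus ?case by simp
next
 case (Conj p q)
 have "sat K e p = sat K e' p" by (rule Conj.IH(1)) (rule Conj.prems, simp)
 moreover have "sat K e q = sat K e' q" by (rule Conj.IH(2)) (rule Conj.prems, simp)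
 ultimately show ?case by simp
qed

section \<open>Algebraic points\<close>

text \<open>\<open>n\<close> exceeds the reciprocals of the distances from \<open>al\<close> to the
  other roots, and \<open>m\<close> is the floor of \<open>n * al\<close>. The interval from
  \<open>m / n\<close> to \<open>(m + 1) / n\<close> isolates \<open>al\<close>, so that
  \<open>al\<close> is definable with integer coefficients.\<close>

lemma algebraic_isolated:
 fixes al :: real
 assumes "algebraic al"
 shows "\<exists>P n m. (\<forall>i. coeff P i \<in> \<int>) & poly P al = 0 & P ~= 0 & (n::nat) > 0 & of_int m <= real n * al & real n * al <= of_int m + 1 &
  (\<forall>be. poly P be = 0 --> of_int m <= real n * be --> real n * be <= of_int m + 1 --> be = al)"
proof -
 obtain P where P: "\<forall>i. coeff P i \<in> \<int>" "P ~= 0" "poly P al = 0"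
  using assms unfolding algebraic_def by blast
 have fin: "finite {be. poly P be = 0}" using poly_roots_finite[OF P(2)] .
 obtain n :: nat where n: "n > 0" "!!be. poly P be = 0 ==> be ~= al ==> 1 < real n * \<bar>be - al\<bar>"
 proof -
  obtain N where N: "N >= 0" "\<forall>be\<in>{be. poly P be = 0} - {al}. - 1 + N * \<bar>be - al\<bar> > 0"
   using ex_bound_scale[of "{be. poly P be = 0} - {al}" "%be. \<bar>be - al\<bar>" "%_. - 1"] fin by auto
  define n where "n = Suc (nat \<lceil>N\<rceil>)"
  have "N <= real n" by (simp add: n_def) linarith
  have "1 < real n * \<bar>be - al\<bar>" if "poly P be = 0" "be ~= al" for be
  proof -
   have "1 < N * \<bar>be - al\<bar>" using N(2) that by fastforce
   also have "\<dots> <= real n * \<bar>be - al\<bar>" using \<open>N <= real n\<close> by (intro mult_right_mono) auto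
   finally show ?thesis .
  qed
  thus ?thesis using that[of n] by (simp add: n_def)
 qed
 define m where "m = \<lfloor>real n * al\<rfloor>"
 have m: "of_int m <= real n * al" "real n * al <= of_int m + 1"
  unfolding m_def by linarith+
 have "be = al" if b: "poly P be = 0" "of_int m <= real n * be" "real n * be <= of_int m + 1" for be
 proof (rule ccontr)
  assume "be ~= al"
  hence "1 < real n * \<bar>be - al\<bar>" using n(2) b(1) by blast
  also have "\<dots> = \<bar>real n * be - real n * al\<bar>" by (simp add: abs_mult right_diff_distrib[symmetric])
  finally show False using m b by linarith
 qed
 thus ?thesis using P n(1) m by blast
qed

lemma sign_determined_singleton:
 assumes "algebraic (al::real)"
 shows "sign_determined (%e. e x = al)"
proof -
 obtain P n m where P: "\<forall>i. coeff P i \<in> \<int>" "poly P al = 0" "(n::nat) > 0" "of_int m <= real n * al" "real n * al <= of_int m + 1"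
  "!!be. poly P be = 0 ==> of_int m <= real n * be ==> real n * be <= of_int m + 1 ==> be = al"
  using algebraic_isolated[OF assms] by blast
 have "e x = al \<longleftrightarrow> poly P (e x) = 0 & of_int m <= real n * e x & real n * e x <= of_int m + 1" for e
  using P by blast
 moreover have "sign_determined (%e. poly P (e x) = 0 & of_int m <= real n * e x & real n * e x <= of_int m + 1)"
  using P(1) by (intro sign_determined_conj sign_determined_eq sign_determined_le Pol_int_poly Pol_0 Pol_of_int Pol_mult Pol_of_nat Pol_var Pol_add Pol_1) auto
 ultimately show ?thesis by simp
qed

lemma Pol_one_variable:
 assumes "f \<in> Pol"
 shows "\<exists>P. (\<forall>i. coeff P i \<in> \<int>) & (\<forall>t. f ((%_. 0)(x := t)) = poly P t)"
 using assms
proof (induction rule: Pol.induct)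
 case (Pol_var y)
 show ?case
 proof (cases "y = x")
  case True
  thus ?thesis by (intro exI[of _ "[:0, 1:]"]) (auto simp: coeff_pCons split: nat.splits)
 next
  case False
  thus ?thesis by (intro exI[of _ 0]) auto
 qed
next
 case Pol_0 show ?case by (intro exI[of _ 0]) auto
next
 case Pol_1 show ?case by (intro exI[of _ 1]) (auto simp: coeff_1)
next
 case (Pol_add f g)
 then obtain P Q where "\<forall>i. coeff P i \<in> \<int>" "\<forall>t. f ((%_. 0)(x := t)) = poly P t"
  "\<forall>i. coeff Q i \<in> \<int>" "\<forall>t. g ((%_. 0)(x := t)) = poly Q t" by blast
 thus ?case by (intro exI[of _ "P + Q"]) (auto simp del: fun_upd_apply)
next
 case (Pol_mult f g)
 then obtain P Q where "\<forall>i. coeff P i \<in> \<int>" "\<forall>t. f ((%_. 0)(x := t)) = poly P t"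
  "\<forall>i. coeff Q i \<in> \<int>" "\<forall>t. g ((%_. 0)(x := t)) = poly Q t" by blast
 thus ?case by (intro exI[of _ "P * Q"]) (auto simp: coeff_mult simp del: fun_upd_apply)
next
 case (Pol_uminus f)
 then obtain P where "\<forall>i. coeff P i \<in> \<int>" "\<forall>t. f ((%_. 0)(x := t)) = poly P t" by blast
 thus ?case by (intro exI[of _ "- P"]) (auto simp del: fun_upd_apply)
qed

text \<open>No nonzero integer polynomial vanishes at a transcendental \<open>t0\<close>; so the
  relevant signs are constant near \<open>t0\<close>, and a rational number close to it
  serves.\<close>

lemma algebraic_witness:
 fixes t0 :: real
 assumes "sign_determined A" "A ((%_. 0)(x := t0))"
 shows "\<exists>al. algebraic al & A ((%_. 0)(x := al))"
proof (cases "algebraic t0")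
 case True thus ?thesis using assms(2) by blast
next
 case False
 obtain F where F: "finite F" "F \<subseteq> Pol" "!!e e'. \<forall>f\<in>F. sgn (f e) = sgn (f e') ==> A e = A e'"
  using assms(1) by (rule sign_determinedE) blast
 have "\<forall>f\<in>F. eventually (%t. sgn (f ((%_. 0)(x := t))) = sgn (f ((%_. 0)(x := t0)))) (nhds t0)"
 proof
  fix f assume "f \<in> F"
  then obtain P where P: "\<forall>i. coeff P i \<in> \<int>" "\<forall>t. f ((%_. 0)(x := t)) = poly P t"
   using Pol_one_variable[of f x] F(2) by blast
  show "eventually (%t. sgn (f ((%_. 0)(x := t))) = sgn (f ((%_. 0)(x := t0)))) (nhds t0)"
  proof (cases "P = 0")
   case True thus ?thesis using P(2) by simp
  next
   case P0: False
   hence "poly P t0 ~= 0" using False P(1) unfolding algebraic_def by blast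
   moreover have "(poly P \<longlongrightarrow> poly P t0) (nhds t0)"
    by (rule isCont_tendsto_compose[OF _ filterlim_ident]) simp
   ultimately have "eventually (%t. sgn (poly P t) = sgn (poly P t0)) (nhds t0)"
   proof (cases "poly P t0 > 0")
    case True
    thus ?thesis using order_tendstoD(1)[OF \<open>(poly P \<longlongrightarrow> poly P t0) (nhds t0)\<close> True]
     by (auto elim!: eventually_mono simp: sgn_if)
   next
    case False
    hence neg: "poly P t0 < 0" using \<open>poly P t0 ~= 0\<close> by simp
    thus ?thesis using order_tendstoD(2)[OF \<open>(poly P \<longlongrightarrow> poly P t0) (nhds t0)\<close> neg]
     by (auto elim!: eventually_mono simp: sgn_if)
   qed
   thus ?thesis using P(2) by simp
  qed
 qed
 hence "eventually (%t. \<forall>f\<in>F. sgn (f ((%_. 0)(x := t))) = sgn (f ((%_. 0)(x := t0)))) (nhds t0)"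
  using F(1) by (simp add: eventually_ball_finite)
 then obtain d where d: "d > 0" "!!t. dist t t0 < d ==> \<forall>f\<in>F. sgn (f ((%_. 0)(x := t))) = sgn (f ((%_. 0)(x := t0)))"
  unfolding eventually_nhds_metric by blast
 obtain q where q: "q \<in> \<rat>" "t0 < q" "q < t0 + d" using Rats_dense_in_real[of t0 "t0 + d"] d(1) by auto
 have "A ((%_. 0)(x := q)) = A ((%_. 0)(x := t0))"
  using d(2)[of q] q by (intro F(3)) (auto simp: dist_real_def)
 thus ?thesis using assms(2) rat_imp_algebraic[OF q(1)] by blast
qed

text \<open>One coordinate at a time: the others are quantified away, an algebraic value
  \<open>al\<close> is found for \<open>y\<close>, and the condition \<open>e y = al\<close>, which
  is sign-determined, is added to \<open>A\<close> before continuing.\<close>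

theorem algebraic_point:
 assumes "sign_determined A" "finite X" "!!e e'. (!!x. x \<in> X ==> e x = e' x) ==> A e ==> A e'" "A e0"
 shows "\<exists>e. A e & (\<forall>x\<in>X. algebraic (e x))"
proof -
 have "\<exists>e. A e & (\<forall>x\<in>Y. algebraic (e x))" if "finite Y" "Y \<subseteq> X" for Y
  using that assms(1,3,4)
 proof (induction Y arbitrary: A e0 rule: finite_induct)
  case empty thus ?case by blast
 next
  case (insert y Y)
  define B where "B = (%e. \<exists>u. A (%x. if x \<in> X - {y} then u x else e x))"
  have sB: "sign_determined B"
   unfolding B_def using insert.prems(2) assms(2) by (intro sign_determined_ex_block) auto
  have "A (%x. if x \<in> X - {y} then e0 x else ((%_. 0)(y := e0 y)) x)"
   by (rule insert.prems(3)[OF _ insert.prems(4)]) auto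
  hence "B ((%_. 0)(y := e0 y))" unfolding B_def by blast
  then obtain al where al: "algebraic al" "B ((%_. 0)(y := al))"
   using algebraic_witness[OF sB] by blast
  then obtain u where u: "A (%x. if x \<in> X - {y} then u x else ((%_. 0)(y := al)) x)"
   unfolding B_def by blast
  have "\<exists>e. (A e & e y = al) & (\<forall>x\<in>Y. algebraic (e x))"
  proof (rule insert.IH)
   show "Y \<subseteq> X" using insert.prems(1) by simp
   show "sign_determined (%e. A e & e y = al)"
    using insert.prems(2) sign_determined_singleton[OF al(1)] by (rule sign_determined_conj)
   show "A e' & e' y = al" if "!!x. x \<in> X ==> e x = e' x" "A e & e y = al" for e e'
    using insert.prems(3)[of e e'] that insert.prems(1) by auto
   show "A (%x. if x \<in> X - {y} then u x else ((%_. 0)(y := al)) x) &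
     (if y \<in> X - {y} then u y else ((%_. 0)(y := al)) y) = al"
    using u by simp
  qed
  thus ?case using al(1) by auto
 qed
 from this[OF assms(2) order_refl] show ?thesis .
qed

section \<open>Coordinate spaces\<close>

abbreviation "csp \<equiv> coord_space"

abbreviation "lkp \<equiv> Poly_Mapping.lookup"

lemma lookup_scaleR: "lkp (c *\<^sub>R x) i = c * lkp (x :: 'a \<Rightarrow>\<^sub>0 real) i"
proof -
 have "finite {i. c *\<^sub>R lkp x i ~= 0}"
  by (rule finite_subset[OF _ finite_lookup[of x]]) auto
 thus ?thesis by (simp add: scaleR_poly_mapping_def)
qed

definition axis' :: "nat => vec" where "axis' i = Poly_Mapping.single i 1"

lemma lookup_axis': "lkp (axis' i) j = (if i = j then 1 else 0)"
 by (simp add: axis'_def lookup_single when_def)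

lemma axis'_in_csp: "i < n ==> axis' i \<in> csp n"
 by (auto simp: coord_space_def lookup_axis')

lemma csp_expand:
 assumes "x \<in> csp n"
 shows "x = (\<Sum>i<n. lkp x i *\<^sub>R axis' i)"
proof (rule poly_mapping_eqI)
 fix j
 have "lkp (\<Sum>i<n. lkp x i *\<^sub>R axis' i) j = (\<Sum>i<n. if i = j then lkp x i else 0)"
  by (simp add: lookup_sum lookup_scaleR lookup_axis' if_distrib cong: if_cong)
 also have "\<dots> = lkp x j" using assms by (auto simp: coord_space_def sum.delta)
 finally show "lkp x j = lkp (\<Sum>i<n. lkp x i *\<^sub>R axis' i) j" by simp
qed

lemma subspace_csp: "subspace (csp n)"
 by (auto simp: subspace_def coord_space_def lookup_add lookup_scaleR)

lemma span_axes: "span (axis' ` {..<n}) = csp n"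
proof
 show "span (axis' ` {..<n}) \<subseteq> csp n"
  using subspace_csp axis'_in_csp by (intro span_minimal) auto
 show "csp n \<subseteq> span (axis' ` {..<n})"
 proof
  fix x assume "x \<in> csp n"
  hence "x = (\<Sum>i<n. lkp x i *\<^sub>R axis' i)" by (rule csp_expand)
  moreover have "(\<Sum>i<n. lkp x i *\<^sub>R axis' i) \<in> span (axis' ` {..<n})"
   by (intro span_sum span_scale span_base) auto
  ultimately show "x \<in> span (axis' ` {..<n})" by simp
 qed
qed

lemma inj_axis': "inj_on axis' S"
 by (rule inj_onI) (metis lookup_axis' zero_neq_one)

lemma independent_axes: "independent (axis' ` {..<n})"
proof
 assume "dependent (axis' ` {..<n})"
 then obtain u i where u: "i < n" "u (axis' i) ~= 0" "(\<Sum>v\<in>axis' ` {..<n}. u v *\<^sub>R v) = 0"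
  unfolding dependent_finite[OF finite_imageI[OF finite_lessThan]] by auto
 have "(\<Sum>j<n. u (axis' j) *\<^sub>R axis' j) = 0" using u(3) by (simp add: sum.reindex[OF inj_axis'])
 hence "lkp (\<Sum>j<n. u (axis' j) *\<^sub>R axis' j) i = 0" by simp
 hence "(\<Sum>j<n. if j = i then u (axis' j) else 0) = 0"
  by (simp add: lookup_sum lookup_scaleR lookup_axis' if_distrib cong: if_cong)
 thus False using u(1,2) by (simp add: sum.delta)
qed

lemma dim_csp_set:
 assumes "span S = csp n"
 shows "dim S = n"
proof -
 have "dim S = dim (axis' ` {..<n})" using assms span_axes[of n] by (metis dim_span)
 also have "\<dots> = n" using dim_eq_card_independent[OF independent_axes[of n]] card_image[OF inj_axis'] by simp
 finally show ?thesis .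
qed

definition hcoords :: "nat => (vec \<times> real) set" where
 "hcoords n = insert (0, 1) ((%i. (axis' i, 0)) ` {..<n})"

lemma span_hcoords: "span (hcoords n) = csp n \<times> UNIV"
proof
 have "subspace (csp n \<times> (UNIV :: real set))"
  using subspace_csp[of n] by (auto simp: subspace_def zero_prod_def)
 thus "span (hcoords n) \<subseteq> csp n \<times> UNIV"
  using axis'_in_csp subspace_0[OF subspace_csp]
  by (intro span_minimal) (auto simp: hcoords_def)
 show "csp n \<times> UNIV \<subseteq> span (hcoords n)"
 proof
  fix y :: "vec \<times> real" assume "y \<in> csp n \<times> UNIV"
  then obtain x t where y: "y = (x, t)" "x \<in> csp n" by auto
  have "(x, t) = (\<Sum>i<n. lkp x i *\<^sub>R (axis' i, 0)) + t *\<^sub>R (0, 1)"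
   using csp_expand[OF y(2)] by (simp add: prod_eq_iff fst_sum snd_sum)
  also have "\<dots> \<in> span (hcoords n)"
   by (intro span_add span_sum span_scale span_base) (auto simp: hcoords_def)
  finally show "y \<in> span (hcoords n)" using y by simp
 qed
qed

lemma finite_hcoords: "finite (hcoords n)" and card_hcoords: "card (hcoords n) = Suc n"
proof -
 show "finite (hcoords n)" by (simp add: hcoords_def)
 have "inj_on (%i. (axis' i, 0::real)) {..<n}" using inj_axis' by (auto simp: inj_on_def)
 hence "card ((%i. (axis' i, 0::real)) ` {..<n}) = n" by (simp add: card_image)
 moreover have "(0, 1) ~: (%i. (axis' i, 0::real)) ` {..<n}" by auto
 ultimately show "card (hcoords n) = Suc n" by (simp add: hcoords_def)
qed

section \<open>Dimension of polytopes\<close>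

lemma ex_fun_hom: "(\<exists>u. Q (%v. u (hom v))) \<longleftrightarrow> (\<exists>u. Q u)"
proof
 assume "\<exists>u. Q u"
 then obtain u where "Q u" ..
 thus "\<exists>u. Q (%v. u (hom v))" by (intro exI[of _ "%w. u (fst w)"]) simp
qed blast

lemma sum_hom: "(\<Sum>w\<in>hom ` B. u w *\<^sub>R w) = (\<Sum>v\<in>B. u (hom v) *\<^sub>R hom v)"
 by (subst sum.reindex) (auto simp: inj_on_def)

lemma in_affine_hull_iff:
 assumes "finite B"
 shows "x \<in> affine hull B \<longleftrightarrow> hom x \<in> span (hom ` B)"
proof -
 have "hom x \<in> span (hom ` B) \<longleftrightarrow> (\<exists>u. (\<Sum>v\<in>B. u (hom v) *\<^sub>R hom v) = hom x)"
  unfolding span_finite[OF finite_imageI[OF assms]] sum_hom image_iff by (simp add: eq_commute)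
 also have "\<dots> \<longleftrightarrow> (\<exists>u. (\<Sum>v\<in>B. u v *\<^sub>R hom v) = hom x)"
  by (rule ex_fun_hom[of "%u. (\<Sum>v\<in>B. u v *\<^sub>R hom v) = hom x"])
 also have "\<dots> \<longleftrightarrow> (\<exists>u. sum u B = 1 & (\<Sum>v\<in>B. u v *\<^sub>R v) = x)"
  by (auto simp: prod_eq_iff fst_sum snd_sum)
 also have "\<dots> \<longleftrightarrow> x \<in> affine hull B" using affine_hull_finite[OF assms] by auto
 finally show ?thesis by simp
qed

lemma affine_dependent_iff_hom:
 assumes "finite B"
 shows "affine_dependent B \<longleftrightarrow> dependent (hom ` B)"
proof -
 have "dependent (hom ` B) \<longleftrightarrow> (\<exists>u. (\<exists>v\<in>B. u (hom v) ~= 0) & (\<Sum>v\<in>B. u (hom v) *\<^sub>R hom v) = 0)"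
  unfolding dependent_finite[OF finite_imageI[OF assms]] sum_hom by simp
 also have "\<dots> \<longleftrightarrow> (\<exists>u. (\<exists>v\<in>B. u v ~= 0) & (\<Sum>v\<in>B. u v *\<^sub>R hom v) = 0)"
  by (rule ex_fun_hom[of "%u. (\<exists>v\<in>B. u v ~= 0) & (\<Sum>v\<in>B. u v *\<^sub>R hom v) = 0"])
 also have "\<dots> \<longleftrightarrow> (\<exists>u. sum u B = 0 & (\<exists>v\<in>B. u v ~= 0) & (\<Sum>v\<in>B. u v *\<^sub>R v) = 0)"
  by (auto simp: prod_eq_iff fst_sum snd_sum)
 also have "\<dots> \<longleftrightarrow> affine_dependent B" using affine_dependent_explicit_finite[OF assms] by simp
 finally show ?thesis by simp
qed

lemma affine_hull_eq_iff:
 assumes "finite B" "finite C"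
 shows "affine hull B = affine hull C \<longleftrightarrow> span (hom ` B) = span (hom ` C)"
proof
 assume eq: "affine hull B = affine hull C"
 have "hom ` B \<subseteq> span (hom ` C)"
  using in_affine_hull_iff[OF assms(2)] eq hull_subset[of B affine] by auto
 moreover have "hom ` C \<subseteq> span (hom ` B)"
  using in_affine_hull_iff[OF assms(1)] eq hull_subset[of C affine] by auto
 ultimately show "span (hom ` B) = span (hom ` C)" by (simp add: span_eq)
next
 assume "span (hom ` B) = span (hom ` C)"
 thus "affine hull B = affine hull C"
  using in_affine_hull_iff[OF assms(1)] in_affine_hull_iff[OF assms(2)] by auto
qed

text \<open>Affine hulls and affine independence become linear ones for the vectors
  \<open>hom x\<close>; hence the shift by one.\<close>

lemma affdim_hull:
 assumes "finite S"
 shows "affdim (convex hull S) = int (dim (hom ` S)) - 1"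
 unfolding affdim_def
proof (rule the_equality)
 obtain C where C: "C \<subseteq> hom ` S" "independent C" "span C = span (hom ` S)" "card C = dim (hom ` S)"
  using fin_basis[of "hom ` S"] assms by auto
 define B where "B = fst ` C"
 have CB: "C = hom ` B" using C(1) by (force simp: B_def)
 have fB: "finite B" using C(1) assms finite_subset[OF C(1)] by (simp add: B_def)
 have "card B = card C" using CB by (metis card_image inj_onI prod.inject)
 thus "\<exists>B. finite B & affine hull B = affine hull (convex hull S) & \<not> affine_dependent B &
   int (card B) = int (dim (hom ` S)) - 1 + 1"
  using fB C CB affine_hull_eq_iff[OF fB assms] affine_dependent_iff_hom[OF fB]
  by (intro exI[of _ B]) auto
next
 fix d assume "\<exists>B. finite B & affine hull B = affine hull (convex hull S) & \<not> affine_dependent B & int (card B) = d + 1"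
 then obtain B where B: "finite B" "affine hull B = affine hull S" "\<not> affine_dependent B" "int (card B) = d + 1" by auto
 have "independent (hom ` B)" using affine_dependent_iff_hom[OF B(1)] B(3) by simp
 hence "dim (hom ` B) = card (hom ` B)" by (rule dim_eq_card_independent)
 also have "\<dots> = card B" by (rule card_image) (auto simp: inj_on_def)
 finally have "dim (hom ` S) = card B"
  using affine_hull_eq_iff[OF B(1) assms] B(2) by (metis dim_span)
 thus "d = int (dim (hom ` S)) - 1" using B(4) by simp
qed

section \<open>Realizations as vector configurations\<close>

definition below :: "'i rel => 'i => 'i set" where
 "below r f = {v \<in> vertices r. (v, f) \<in> r}"

lemma facial_hom_empty: "facial (%v. hom (p v)) V {}"
 by (rule facialI[OF linear_snd]) auto

lemma facial_inj_points:
 assumes "inj_on p V" "finite V" "B \<subseteq> V" "dim ((%v. hom (p v)) ` B) = 1"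
 shows "\<exists>v. B = {v}"
proof -
 have "B ~= {}" using assms(4) by (auto simp: dim_empty_fin)
 then obtain v where v: "v \<in> B" by auto
 have "w = v" if w: "w \<in> B" for w
 proof -
  let ?a = "%v. hom (p v)"
  have fin: "finite B" using assms(2,3) finite_subset by blast
  have "dim {?a v} = 1" using dim_eq_card_independent[of "{?a v}"] by (simp add: zero_prod_def dependent_single)
  hence "span {?a v} = span (?a ` B)"
   using fin v assms(4) by (intro span_eq_if_dim) (auto intro: span_base)
  hence "?a w \<in> span {?a v}" using w by (auto intro: span_base)
  then obtain c where "?a w = c *\<^sub>R ?a v" unfolding span_singleton by auto
  hence "p w = p v" by simp
  thus ?thesis using assms(1,3) v w by (metis inj_onD subsetD)
 qed
 thus ?thesis using v by blast
qed

text \<open>\<open>facial_up\<close>, started at the empty set, gives a facial subset of dimension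
  one, and proportional homogenized points are equal.\<close>

lemma facial_contains_vertex:
 assumes "inj_on p V" "finite V" "facial (%v. hom (p v)) V B" "B ~= {}"
 shows "\<exists>v\<in>B. facial (%v. hom (p v)) V {v}"
proof -
 let ?a = "%v. hom (p v)"
 have BV: "B \<subseteq> V" "finite B" using facial_subset[OF assms(3)] assms(2) finite_subset by auto
 obtain C where C: "facial ?a B C" "{} \<subset> C" "dim (?a ` C) = Suc (dim (?a ` {}))"
  using facial_up[OF BV(2) facial_hom_empty[of p B]] assms(4) by blast
 have CB: "C \<subseteq> B" using facial_subset[OF C(1)] .
 have "inj_on p B" using inj_on_subset[OF assms(1) BV(1)] .
 then obtain v where v: "C = {v}"
  using facial_inj_points[of p B C] BV(2) CB C(3) by (auto simp: dim_empty_fin)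
 hence "facial ?a V {v}" using facial_sub[OF assms(2,3) CB] C(1) by simp
 thus ?thesis using v CB by auto
qed

text \<open>A point of \<open>S\<close> outside the hull of the exposed ones would be separated from
  them by a functional; but the minimum of this functional over \<open>S\<close> is attained on a
  facial set, which contains an exposed point.\<close>

lemma polytope_vertices:
 assumes "finite S"
 shows "\<exists>T\<subseteq>S. convex hull T = convex hull S & (\<forall>t\<in>T. facial hom T {t})"
proof -
 define T where "T = {t\<in>S. facial hom S {t}}"
 have TS: "T \<subseteq> S" by (auto simp: T_def)
 have fT: "finite T" using TS assms finite_subset by blast
 have inT: "s \<in> convex hull T" if s: "s \<in> S" for s
 proof -
  consider c where "\<forall>t\<in>T. 0 <= c t" "hom s = (\<Sum>t\<in>T. c t *\<^sub>R hom t)"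
   | f where "linear f" "\<forall>t\<in>T. 0 <= (f (hom t) :: real)" "f (hom s) < 0"
   using farkas[OF fT, of "hom s" hom] by blast
  thus ?thesis
  proof cases
   case 1
   thus ?thesis using in_hull_iff_cone[of T "%x. x" s] fT by auto
  next
   case 2
   define m where "m = Min ((%s. f (hom s)) ` S)"
   have fin: "finite ((%s. f (hom s)) ` S)" "(%s. f (hom s)) ` S ~= {}" using assms s by auto
   have mle: "m <= f (hom x)" if "x \<in> S" for x unfolding m_def using that by (intro Min_le[OF fin(1)]) auto
   obtain s0 where s0: "s0 \<in> S" "f (hom s0) = m" using Min_in[OF fin] unfolding m_def by auto
   define B where "B = {x\<in>S. f (hom x) = m}"
   have "linear (%y. f y - m * snd y)"
    using linear_compose_sub[OF 2(1) linear_compose_scale_right[OF linear_snd, of m]] by simp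
   hence "facial hom S B" using mle by (intro facialI) (auto simp: B_def)
   moreover have "B ~= {}" using s0 by (auto simp: B_def)
   ultimately obtain t where "t \<in> B" "facial hom S {t}"
    using facial_contains_vertex[of "%x. x" S B] assms by auto
   hence "t \<in> T" "f (hom t) = m" by (auto simp: T_def B_def)
   thus ?thesis using 2(2,3) mle[OF s] by auto
  qed
 qed
 have "convex hull S \<subseteq> convex hull T" using inT by (intro hull_minimal) auto
 hence "convex hull T = convex hull S" using hull_mono[OF TS] by blast
 moreover have "facial hom T {t}" if t: "t \<in> T" for t
 proof -
  obtain f where f: "linear f" "!!v. v \<in> S ==> 0 <= (f (hom v) :: real)"
   "!!v. v \<in> S ==> f (hom v) = 0 \<longleftrightarrow> v \<in> {t}"
   using t unfolding T_def mem_Collect_eq by (elim conjE facialE3) blast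
  show ?thesis using f t TS by (intro facialI[OF f(1)]) auto
 qed
 ultimately show ?thesis using TS by blast
qed

locale realized =
 fixes r :: "'i rel" and P :: "'i indexed_polytope"
 assumes real: "realization r P"
begin

abbreviation "V \<equiv> vertices r"
abbreviation "p \<equiv> vertex_point P"

lemma po: "Partial_order r" and poly: "polytope (body P)"
 and coords: "body P \<subseteq> csp (nat (affdim (body P)))"
 and bij: "bij_betw (face P) (Field r) {F. F face_of body P}"
 and le_iff: "f \<in> Field r ==> g \<in> Field r ==> (f, g) \<in> r \<longleftrightarrow> face P f \<subseteq> face P g"
 using real unfolding realization_def by auto

lemma face_face: "f \<in> Field r ==> face P f face_of body P"
 using bij by (auto simp: bij_betw_def)

lemma ex_index:
 assumes "F face_of body P"
 shows "\<exists>f\<in>Field r. face P f = F"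
proof -
 have "F \<in> face P ` Field r" using bij assms by (simp add: bij_betw_def)
 thus ?thesis by auto
qed

lemma face_inj: "f \<in> Field r ==> g \<in> Field r ==> face P f = face P g ==> f = g"
 using bij inj_onD[of "face P" "Field r" f g] by (simp add: bij_betw_def)

text \<open>The singletons of exposed points are the atoms of the face lattice, and the order
  isomorphism identifies these with \<open>vertices r\<close>.\<close>

lemma facts:
 shows finV: "finite V" and injp: "inj_on p V" and body_hull: "body P = convex hull (p ` V)"
  and vertex_face: "v \<in> V ==> face P v = {p v}"
  and V_Field: "V \<subseteq> Field r"
proof -
 obtain S where S: "finite S" "body P = convex hull S" using poly unfolding polytope_def by auto
 obtain T where T: "T \<subseteq> S" "convex hull T = body P" "!!t. t \<in> T ==> facial hom T {t}"
  using polytope_vertices[OF S(1)] S(2) by auto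
 have fT: "finite T" using T(1) S(1) finite_subset by blast
 obtain z where z: "z \<in> Field r" "face P z = {}" using ex_index[of "{}"] by auto
 have zle: "(z, g) \<in> r" if "g \<in> Field r" for g using le_iff[OF z(1) that] z(2) by simp
 show VF: "V \<subseteq> Field r" by (auto simp: vertices_def)
 have tface: "{t} face_of body P" if "t \<in> T" for t
  using facial_imp_face_of_hull(1)[of T "%x. x" "{t}"] fT T(2,3) that by auto
 have sing: "\<exists>t\<in>T. face P v = {t}" if v: "v \<in> V" for v
 proof -
  obtain z' where z': "z' \<in> Field r" "\<forall>g\<in>Field r. (z', g) \<in> r" "z' ~= v" "\<forall>g. (g, v) \<in> r --> g = z' | g = v"
   using v by (auto simp: vertices_def)
  have vF: "v \<in> Field r" using v VF by auto
  have "face P z' = {}" using z'(2) z(1) le_iff[OF z'(1) z(1)] z(2) by auto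
  hence zz: "z' = z" using face_inj z z'(1) by auto
  have "face P v ~= {}" using face_inj[OF vF z(1)] z(2) z'(3) zz by auto
  moreover have "face P v = convex hull {t\<in>T. t \<in> face P v}"
   using face_of_hull_imp_facial(2)[of T "%x. x" "face P v"] fT T(2) face_face[OF vF] by simp
  ultimately have "{t\<in>T. t \<in> face P v} ~= {}" by (metis (no_types, lifting) convex_hull_empty)
  then obtain t where t: "t \<in> T" "t \<in> face P v" by auto
  obtain g where g: "g \<in> Field r" "face P g = {t}" using ex_index[OF tface[OF t(1)]] by auto
  have "(g, v) \<in> r" using le_iff[OF g(1) vF] g(2) t(2) by simp
  hence "g = v" using z'(4) zz g(2) z(2) by auto
  thus ?thesis using g(2) t(1) by auto
 qed
 show vf: "face P v = {p v}" if "v \<in> V" for v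
 proof -
  obtain t where "face P v = {t}" using sing[OF \<open>v \<in> V\<close>] by blast
  thus ?thesis by (simp add: vertex_point_def)
 qed
 have pT: "p ` V = T"
 proof
  show "p ` V \<subseteq> T"
  proof
   fix t assume "t \<in> p ` V"
   then obtain v where v: "v \<in> V" "t = p v" by blast
   thus "t \<in> T" using sing[OF v(1)] vf[OF v(1)] by auto
  qed
  show "T \<subseteq> p ` V"
  proof
   fix t assume t: "t \<in> T"
   obtain v where v: "v \<in> Field r" "face P v = {t}" using ex_index[OF tface[OF t]] by auto
   have "g = z | g = v" if "(g, v) \<in> r" for g
   proof -
    have gF: "g \<in> Field r" using that by (auto simp: Field_def)
    have "face P g \<subseteq> {t}" using le_iff[OF gF v(1)] that v(2) by simp
    hence "face P g = face P z | face P g = face P v" using z(2) v(2) by auto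
    thus ?thesis using face_inj gF z(1) v(1) by blast
   qed
   moreover have "z ~= v" using z(2) v(2) by auto
   ultimately have "v \<in> V" using v(1) z(1) zle unfolding vertices_def by auto
   moreover have "p v = t" using v(2) by (simp add: vertex_point_def)
   ultimately show "t \<in> p ` V" by blast
  qed
 qed
 show inj: "inj_on p V"
 proof (rule inj_onI)
  fix v w assume vw: "v \<in> V" "w \<in> V" "p v = p w"
  thus "v = w" using vf[OF vw(1)] vf[OF vw(2)] VF by (intro face_inj) auto
 qed
 show "finite V" using pT fT finite_image_iff[OF inj] by simp
 show "body P = convex hull (p ` V)" using pT T(2) by simp
qed

lemma below_iff: "v \<in> V ==> f \<in> Field r ==> v \<in> below r f \<longleftrightarrow> p v \<in> face P f"
 using le_iff[of v f] V_Field vertex_face[of v] by (auto simp: below_def)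

lemma below_subset: "below r f \<subseteq> V"
 by (auto simp: below_def)

lemma below_eq: "f \<in> Field r ==> below r f = {v\<in>V. p v \<in> face P f}"
 using below_iff below_subset by blast

lemma face_hull: "f \<in> Field r ==> face P f = convex hull (p ` below r f)"
 using face_of_hull_imp_facial(2)[OF finV injp, of "face P f"] face_face body_hull
 by (simp add: below_eq)

lemma facial_iff: "facial (%v. hom (p v)) V B \<longleftrightarrow> (\<exists>f\<in>Field r. B = below r f)"
proof
 assume B: "facial (%v. hom (p v)) V B"
 note face = facial_imp_face_of_hull[OF finV injp B]
 then obtain f where "f \<in> Field r" "face P f = convex hull (p ` B)"
  using ex_index[of "convex hull (p ` B)"] body_hull by metis
 thus "\<exists>f\<in>Field r. B = below r f" using face(2) below_eq by auto
next
 assume "\<exists>f\<in>Field r. B = below r f"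
 then obtain f where f: "f \<in> Field r" "B = below r f" by blast
 thus "facial (%v. hom (p v)) V B"
  using face_of_hull_imp_facial(1)[OF finV injp, of "face P f"] face_face body_hull below_eq by simp
qed

lemma below_mono: "f \<in> Field r ==> g \<in> Field r ==> (f, g) \<in> r \<longleftrightarrow> below r f \<subseteq> below r g"
proof
 assume fg: "f \<in> Field r" "g \<in> Field r"
 show "below r f \<subseteq> below r g" if "(f, g) \<in> r" using le_iff[OF fg] that below_eq fg by auto
 show "(f, g) \<in> r" if "below r f \<subseteq> below r g"
  using le_iff[OF fg] that face_hull fg hull_mono[of "p ` below r f" "p ` below r g" convex] by auto
qed

lemma below_vertex: "v \<in> V ==> below r v = {v}"
 using below_eq[of v] V_Field vertex_face[of v] injp by (auto dest: inj_onD)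

lemma facial_vertex: "v \<in> V ==> facial (%v. hom (p v)) V {v}"
 using facial_iff below_vertex V_Field by blast

lemma affdim_body: "affdim (body P) = int (dim ((%v. hom (p v)) ` V)) - 1"
 using affdim_hull[of "p ` V"] finV by (simp add: body_hull image_image)

lemma affdim_face: "f \<in> Field r ==> affdim (face P f) = int (dim ((%v. hom (p v)) ` below r f)) - 1"
 using affdim_hull[of "p ` below r f"] finite_subset[OF below_subset finV] by (simp add: face_hull image_image)

lemma p_coords: "v \<in> V ==> p v \<in> csp (nat (affdim (body P)))"
 using coords body_hull hull_subset[of "p ` V" convex] by auto

lemma span_points:
 assumes "V ~= {}"
 shows "span ((%v. hom (p v)) ` V) = csp (nat (affdim (body P))) \<times> UNIV"
proof -
 let ?n = "nat (affdim (body P))"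
 obtain v where "v \<in> V" using assms by blast
 hence "dim {hom (p v)} <= dim ((%v. hom (p v)) ` V)"
  using finV by (intro dim_mono_fin) (auto intro: span_base)
 moreover have "dim {hom (p v)} = 1"
  using dim_eq_card_independent[of "{hom (p v)}"] by (simp add: zero_prod_def dependent_single)
 ultimately have "int (dim ((%v. hom (p v)) ` V)) = int ?n + 1" using affdim_body by simp
 hence d: "dim (hcoords ?n) <= dim ((%v. hom (p v)) ` V)"
  using dim_le_card_fin[OF span_superset finite_hcoords[of ?n]] card_hcoords[of ?n] by linarith
 have "(%v. hom (p v)) ` V \<subseteq> span (hcoords ?n)" using p_coords by (auto simp: span_hcoords)
 hence "span ((%v. hom (p v)) ` V) = span (hcoords ?n)"
  using d finV finite_hcoords by (intro span_eq_if_dim) auto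
 thus ?thesis by (simp add: span_hcoords)
qed

end

lemma realization_same_affdim:
 assumes "realization r P" "realization r Q"
 shows "affdim (body P) = affdim (body Q)"
proof -
 interpret P: realized r P by (unfold_locales) (rule assms)
 interpret Q: realized r Q by (unfold_locales) (rule assms)
 have "dim ((%v. hom (vertex_point P v)) ` vertices r) = dim ((%v. hom (vertex_point Q v)) ` vertices r)"
 proof (rule facial_dim_eq[OF P.finV _ facial_hom_empty])
  show "facial (%v. hom (vertex_point P v)) (vertices r) B \<longleftrightarrow> facial (%v. hom (vertex_point Q v)) (vertices r) B" for B
   by (simp only: P.facial_iff Q.facial_iff)
 qed
 thus ?thesis by (simp add: P.affdim_body Q.affdim_body)
qed

text \<open>The second alternative for the dimension covers the empty polytope, of dimension
  \<open>- 1\<close>, for which \<open>nat\<close> yields \<open>0\<close>.\<close>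

lemma realizationI:
 fixes q :: "'i => vec"
 assumes po: "Partial_order r" and fin: "finite (vertices r)"
  and inj: "inj_on q (vertices r)" and coords: "!!v. v \<in> vertices r ==> q v \<in> csp n"
  and dim: "dim ((%v. hom (q v)) ` vertices r) = Suc n | (vertices r = {} & n = 0)"
  and fac: "!!B. facial (%v. hom (q v)) (vertices r) B \<longleftrightarrow> (\<exists>f\<in>Field r. B = below r f)"
  and mono: "!!f g. f \<in> Field r ==> g \<in> Field r ==> (f, g) \<in> r \<longleftrightarrow> below r f \<subseteq> below r g"
 shows "realization r (convex hull (q ` vertices r), %f. convex hull (q ` below r f))"
proof -
 let ?V = "vertices r"
 have ad: "nat (affdim (convex hull (q ` ?V))) = n"
  using dim affdim_hull[of "q ` ?V"] fin by (auto simp: image_image dim_empty_fin)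
 have facial: "facial (%v. hom (q v)) ?V (below r f)" if "f \<in> Field r" for f using fac that by blast
 have rec: "{v\<in>?V. q v \<in> convex hull (q ` below r f)} = below r f" if "f \<in> Field r" for f
  using facial_imp_face_of_hull(2)[OF fin inj facial[OF that]] .
 have sub: "convex hull (q ` below r f) \<subseteq> convex hull (q ` below r g) \<longleftrightarrow> below r f \<subseteq> below r g"
  if "f \<in> Field r" "g \<in> Field r" for f g
 proof
  assume "convex hull (q ` below r f) \<subseteq> convex hull (q ` below r g)"
  thus "below r f \<subseteq> below r g" using rec[OF that(1)] rec[OF that(2)] by auto
 qed (auto intro!: hull_mono)
 have "convex hull (q ` ?V) \<subseteq> csp n"
  using coords subspace_imp_convex[OF subspace_csp] by (intro hull_minimal) auto
 moreover have "bij_betw (%f. convex hull (q ` below r f)) (Field r) {F. F face_of convex hull (q ` ?V)}"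
 proof (rule bij_betw_imageI)
  show "inj_on (%f. convex hull (q ` below r f)) (Field r)"
  proof (rule inj_onI)
   fix f g assume fg: "f \<in> Field r" "g \<in> Field r" "convex hull (q ` below r f) = convex hull (q ` below r g)"
   hence "below r f = below r g" using rec by metis
   hence "(f, g) \<in> r" "(g, f) \<in> r" using mono fg by auto
   thus "f = g" using po unfolding partial_order_on_def by (meson antisymD)
  qed
  show "(%f. convex hull (q ` below r f)) ` Field r = {F. F face_of convex hull (q ` ?V)}"
  proof (intro set_eqI iffI)
   fix F assume "F \<in> (%f. convex hull (q ` below r f)) ` Field r"
   thus "F \<in> {F. F face_of convex hull (q ` ?V)}"
    using facial_imp_face_of_hull(1)[OF fin inj facial] by auto
  next
   fix F assume F: "F \<in> {F. F face_of convex hull (q ` ?V)}"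
   hence "facial (%v. hom (q v)) ?V {v\<in>?V. q v \<in> F}" "F = convex hull (q ` {v\<in>?V. q v \<in> F})"
    using face_of_hull_imp_facial[OF fin inj] by auto
   thus "F \<in> (%f. convex hull (q ` below r f)) ` Field r"
    using fac by (metis (no_types, lifting) imageI)
  qed
 qed
 ultimately show ?thesis
  unfolding realization_def body_def face_def fst_conv snd_conv ad
  using po polytope_convex_hull[of "q ` ?V"] fin mono sub by simp
qed

section \<open>Projective equivalence of realizations\<close>

lemma proj_map_hull:
 fixes p q :: "'v => vec"
 assumes V: "finite V" "inj_on p V" "inj_on q V"
  and h: "linear h" "!!v. v \<in> V ==> 0 < c v & h (hom (p v)) = c v *\<^sub>R hom (q v)"
  and x: "x \<in> convex hull (p ` V)"
 shows "snd (h (hom x)) > 0 & hom (proj_map h x) = (1 / snd (h (hom x))) *\<^sub>R h (hom x) &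
  proj_map h x \<in> convex hull (q ` V)"
proof -
 obtain d where d: "\<forall>v\<in>V. 0 <= d v" "hom x = (\<Sum>v\<in>V. d v *\<^sub>R hom (p v))"
  using x in_hull_iff_cone[OF V(1,2), of x] by blast
 have "h (hom x) = (\<Sum>v\<in>V. d v *\<^sub>R h (hom (p v)))"
  unfolding d(2) using h(1) by (simp add: linear_sum linear_cmul del: scaleR_Pair)
 also have "\<dots> = (\<Sum>v\<in>V. (d v * c v) *\<^sub>R hom (q v))"
  using h(2) by (intro sum.cong) (auto simp del: scaleR_Pair)
 finally have hx: "h (hom x) = (\<Sum>v\<in>V. (d v * c v) *\<^sub>R hom (q v))" .
 define s where "s = snd (h (hom x))"
 have s': "s = (\<Sum>v\<in>V. d v * c v)" unfolding s_def hx by (simp add: snd_sum)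
 have nn: "0 <= d v * c v" if "v \<in> V" for v using d(1) h(2) that by (simp add: less_imp_le)
 have "s ~= 0"
 proof
  assume "s = 0"
  hence "\<forall>v\<in>V. d v * c v = 0" using nn V(1) unfolding s' by (subst (asm) sum_nonneg_eq_0_iff) auto
  hence "\<forall>v\<in>V. d v = 0" using h(2) by (metis less_irrefl mult_eq_0_iff)
  moreover have "sum d V = 1" using d(2) by (simp add: prod_eq_iff snd_sum)
  ultimately show False by simp
 qed
 moreover have "s >= 0" unfolding s' using nn by (rule sum_nonneg)
 ultimately have s: "s > 0" by simp
 have e: "hom (proj_map h x) = (1 / s) *\<^sub>R h (hom x)"
  using s by (simp add: proj_map_def prod_eq_iff divide_inverse s_def)
 also have "\<dots> = (\<Sum>v\<in>V. (d v * c v / s) *\<^sub>R hom (q v))"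
  unfolding hx scaleR_sum_right by (intro sum.cong) (auto simp: divide_inverse)
 finally have "proj_map h x \<in> convex hull (q ` V)"
  using nn s by (intro iffD2[OF in_hull_iff_cone[OF V(1,3)]] exI[of _ "%v. d v * c v / s"]) auto
 thus ?thesis using s e by (simp add: s_def)
qed

text \<open>Projective equivalence in homogeneous form. The map is bijective because both vertex
  sets span the same space, and its inverse is of the same kind, which makes it surjective on every
  face.\<close>

lemma same_projective_typeI:
 assumes P: "realization r P" and Q: "realization r Q"
  and T: "linear T" "!!v. v \<in> vertices r ==> 0 < c v"
   "!!v. v \<in> vertices r ==> T (hom (vertex_point P v)) = c v *\<^sub>R hom (vertex_point Q v)"
 shows "same_projective_type r P Q"
proof -
 interpret P: realized r P by (unfold_locales) (rule P)
 interpret Q: realized r Q by (unfold_locales) (rule Q)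
 \<comment> \<open>Without vertices the hypotheses say nothing about \<open>T\<close>, which need
   not be bijective.\<close>
 define h where "h = (if vertices r = {} then id else T)"
 let ?n = "nat (affdim (body P))"
 let ?E = "csp ?n \<times> (UNIV :: real set)"
 let ?p = "%v. hom (vertex_point P v)" and ?q = "%v. hom (vertex_point Q v)"
 let ?V = "vertices r"
 have lh: "linear h" by (auto simp: h_def T(1) linear_id[unfolded id_def[symmetric]])
 have hp: "0 < c v & h (?p v) = c v *\<^sub>R ?q v" if "v \<in> ?V" for v using T(2,3)[OF that] that by (auto simp: h_def)
 have sameaff: "affdim (body Q) = affdim (body P)" using realization_same_affdim[OF P Q] by simp
 have sp: "span (?p ` ?V) = ?E" "span (?q ` ?V) = ?E" if "?V ~= {}"
  using P.span_points[OF that] Q.span_points[OF that] sameaff by simp_all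
 have sh: "span (h ` ?p ` ?V) = span (?q ` ?V)"
  using span_scaled[of ?V c "%v. h (?p v)" ?q] hp by (simp add: image_image)
 have inj: "inj_on h (span (?p ` ?V))"
 proof (rule linear_inj_on_if_dim[OF _ lh])
  show "dim (h ` ?p ` ?V) = dim (?p ` ?V)" using sh sp by (cases "?V = {}") (auto intro: span_eq_dim)
 qed (simp add: P.finV)
 have "bij_betw h ?E ?E"
 proof (cases "?V = {}")
  case False
  thus ?thesis using inj sh sp linear_span_image[OF lh, of "?p ` ?V"] by (simp add: bij_betw_def)
 qed (simp add: h_def bij_betw_id)
 hence proj: "projectivity ?n h" using lh by (simp add: projectivity_def)
 obtain g where g: "linear g" "\<forall>v\<in>?V. g (?q v) = (1 / c v) *\<^sub>R ?p v" using scaled_inverse[OF lh inj hp] by blast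
 have fB: "finite B" "inj_on (vertex_point P) B" "inj_on (vertex_point Q) B" if "B \<subseteq> ?V" for B
  using that P.finV P.injp Q.injp finite_subset inj_on_subset by blast+
 have main: "snd (h (hom x)) > 0 & proj_map h x \<in> convex hull (vertex_point Q ` B)"
  if B: "B \<subseteq> ?V" and x: "x \<in> convex hull (vertex_point P ` B)" for B x
  using proj_map_hull[OF fB[OF B] lh hp x] B by blast
 have onto: "y \<in> proj_map h ` (convex hull (vertex_point P ` B))"
  if B: "B \<subseteq> ?V" and y: "y \<in> convex hull (vertex_point Q ` B)" for B y
 proof -
  have "B ~= {}" using y by auto
  define s where "s = snd (g (hom y))"
  have "0 < 1 / c v & g (?q v) = (1 / c v) *\<^sub>R ?p v" if "v \<in> B" for v using g(2) hp that B by auto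
  hence s: "s > 0" "hom (proj_map g y) = (1 / s) *\<^sub>R g (hom y)" "proj_map g y \<in> convex hull (vertex_point P ` B)"
   using proj_map_hull[OF fB(1,3,2)[OF B] g(1) _ y, of "%v. 1 / c v"] unfolding s_def by blast+
  have "h (g z) = z" if "z \<in> ?q ` ?V" for z
  proof -
   obtain v where v: "v \<in> ?V" "z = ?q v" using \<open>z \<in> _\<close> by blast
   have "h (g z) = (1 / c v) *\<^sub>R h (?p v)" unfolding v(2) bspec[OF g(2) v(1)] by (rule linear_cmul[OF lh])
   thus ?thesis using hp[OF v(1)] v(2) by simp
  qed
  moreover have "hom y \<in> span (?q ` ?V)"
  proof -
   obtain d where "hom y = (\<Sum>v\<in>B. d v *\<^sub>R ?q v)"
    using y in_hull_iff_cone[OF fB(1,3)[OF B], of y] by blast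
   also have "\<dots> \<in> span (?q ` ?V)" using B by (intro span_sum span_scale span_base) auto
   finally show ?thesis .
  qed
  ultimately have "h (g (hom y)) = hom y"
   using linear_eq_on_span[OF linear_compose[OF g(1) lh, unfolded o_def] linear_id[unfolded id_def]] by blast
  hence "h (hom (proj_map g y)) = (1 / s) *\<^sub>R hom y" unfolding s(2) by (metis linear_cmul[OF lh])
  hence "proj_map h (proj_map g y) = y" using s(1) by (simp add: proj_map_def)
  thus ?thesis using s(3) by (metis imageI)
 qed
 have "proj_map h ` face P f = face Q f" if f: "f \<in> Field r" for f
 proof -
  have B: "below r f \<subseteq> ?V" by (auto simp: below_def)
  show ?thesis unfolding P.face_hull[OF f] Q.face_hull[OF f] using main[OF B] onto[OF B] by blast
 qed
 moreover have "finite_on h (body P)"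
  unfolding finite_on_def P.body_hull using main[of ?V] by fastforce
 ultimately show ?thesis unfolding same_projective_type_def using P Q proj by blast
qed

section \<open>Simple polyhedra with a prescribed recession cone\<close>

definition ip :: "nat => vec => vec => real" where
 "ip D x y = (\<Sum>i<D. lkp x i * lkp y i)"

lemma ip_commute: "ip D x y = ip D y x"
 by (simp add: ip_def mult.commute)

lemma ip_add_right: "ip D x (y + z) = ip D x y + ip D x z"
 by (simp add: ip_def lookup_add algebra_simps sum.distrib)

lemma ip_scale_right: "ip D x (c *\<^sub>R y) = c * ip D x y"
 by (simp add: ip_def lookup_scaleR sum_distrib_left mult.left_commute)

lemma ip_zero_right [simp]: "ip D x 0 = 0"
 by (simp add: ip_def)

lemma ip_minus_right: "ip D x (- y) = - ip D x y"
 using ip_scale_right[of D x "-1" y] by simp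

lemma ip_diff_right: "ip D x (y - z) = ip D x y - ip D x z"
 using ip_add_right[of D x y "- z"] ip_minus_right[of D x z] by simp

lemma linear_ip: "linear (ip D x)"
 by (intro linearI) (auto simp: ip_add_right ip_scale_right)

lemma ip_sum_right: "ip D x (\<Sum>i\<in>I. f i) = (\<Sum>i\<in>I. ip D x (f i))"
 using linear_sum[OF linear_ip] .

lemma ip_add_left: "ip D (y + z) x = ip D y x + ip D z x"
 and ip_scale_left: "ip D (c *\<^sub>R y) x = c * ip D y x"
 and ip_zero_left [simp]: "ip D 0 x = 0"
 and ip_diff_left: "ip D (y - z) x = ip D y x - ip D z x"
 and ip_sum_left: "ip D (\<Sum>i\<in>I. f i) x = (\<Sum>i\<in>I. ip D (f i) x)"
 by (simp_all add: ip_commute[of D _ x] ip_add_right ip_scale_right ip_diff_right ip_sum_right)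

lemma ip_self_zero:
 assumes "x \<in> csp D" "ip D x x = 0"
 shows "x = 0"
proof (rule poly_mapping_eqI)
 fix i
 have "\<forall>j\<in>{..<D}. lkp x j * lkp x j = 0"
  using assms(2) unfolding ip_def by (subst (asm) sum_nonneg_eq_0_iff) auto
 thus "lkp x i = lkp 0 i" using assms(1) by (cases "i < D") (auto simp: coord_space_def)
qed

lemma ip_self_nonneg: "0 <= ip D x x"
 by (simp add: ip_def sum_nonneg)

lemma ip_self_pos: "x \<in> csp D ==> x ~= 0 ==> 0 < ip D x x"
 using ip_self_zero ip_self_nonneg[of D x] by (metis order_le_less)

lemma lin_as_ip:
 assumes "linear f"
 shows "\<exists>e\<in>csp D. \<forall>x\<in>csp D. f x = ip D x e"
proof -
 define e where "e = (\<Sum>i<D. f (axis' i) *\<^sub>R axis' i)"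
 have e: "e \<in> csp D"
  unfolding e_def using subspace_csp
  by (intro subspace_sum subspace_scale axis'_in_csp) auto
 have le: "lkp e i = f (axis' i)" if "i < D" for i
  using that by (simp add: e_def lookup_sum lookup_scaleR lookup_axis' if_distrib sum.delta cong: if_cong)
 have "f x = ip D x e" if "x \<in> csp D" for x
 proof -
  have "f x = f (\<Sum>i<D. lkp x i *\<^sub>R axis' i)" using csp_expand[OF that] by simp
  also have "\<dots> = (\<Sum>i<D. lkp x i * f (axis' i))" using assms by (simp add: linear_sum linear_cmul)
  also have "\<dots> = ip D x e" by (simp add: ip_def le)
  finally show ?thesis .
 qed
 thus ?thesis using e by blast
qed

lemma finite_ex_min:
 fixes f :: "'b => real"
 assumes "finite S" "S ~= {}"
 obtains w where "w \<in> S" "!!y. y \<in> S ==> f w <= f y"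
proof -
 have "Min (f ` S) \<in> f ` S" using assms by (intro Min_in) auto
 then obtain w where "w \<in> S" "Min (f ` S) = f w" by blast
 moreover have "Min (f ` S) <= f y" if "y \<in> S" for y using assms that by (intro Min_le) auto
 ultimately show ?thesis using that[of w] by simp
qed

lemma ip_separate:
 assumes "S \<subseteq> csp D" "x \<in> csp D" "x ~: span S"
 shows "\<exists>e\<in>csp D. (\<forall>y\<in>S. ip D y e = 0) & ip D x e = 1"
proof -
 obtain f where f: "linear f" "\<forall>y\<in>span S. f y = (0::real)" "f x = 1"
  using ex_separating_functional[OF assms(3)] by blast
 obtain e where "e \<in> csp D" "\<forall>x\<in>csp D. f x = ip D x e"
  using lin_as_ip[OF f(1)] by blast
 moreover have "f y = 0" if "y \<in> S" for y using f(2) span_base[OF that] by blast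
 ultimately show ?thesis using f(3) assms(1,2) by (intro bexI[of _ e]) (auto simp: subset_iff)
qed

lemma ip_dual:
 assumes "independent X" "X \<subseteq> csp D" "u \<in> X"
 shows "\<exists>e\<in>csp D. (\<forall>y\<in>X - {u}. ip D y e = 0) & ip D u e = 1"
 using assms by (intro ip_separate) (auto simp: dependent_def)

lemma card_independent_coord:
 assumes "independent X" "X \<subseteq> csp D"
 shows "finite X" "card X <= D"
proof -
 have "X \<subseteq> span (axis' ` {..<D})" using assms(2) span_axes by simp
 hence "finite X & card X <= card (axis' ` {..<D})"
  using independent_span_bound[OF _ assms(1)] by blast
 thus "finite X" "card X <= D" by (auto simp: card_image[OF inj_axis'])
qed

lemma span_full_independent:
 assumes "independent X" "X \<subseteq> csp D" "card X = D"
 shows "span X = csp D"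
proof -
 have fin: "finite X" using card_independent_coord[OF assms(1,2)] by simp
 have "dim (axis' ` {..<D}) <= dim X"
  using dim_eq_card_independent[OF assms(1)] assms(3) dim_csp_set[OF span_axes] by simp
 hence "span X = span (axis' ` {..<D})"
  using fin assms(2) span_axes[of D] by (intro span_eq_if_dim) auto
 thus ?thesis using span_axes by simp
qed

lemma ip_zero_span:
 assumes "\<forall>x\<in>X. ip D x w = 0" "y \<in> span X"
 shows "ip D y w = 0"
 using assms(2)
 by (induction rule: span_induct_alt) (auto simp: ip_add_left ip_scale_left assms(1))

lemma ip_eq_on_spanning:
 assumes "span X = csp D" "w \<in> csp D" "\<forall>x\<in>X. ip D x w = 0"
 shows "w = 0"
 using ip_zero_span[OF assms(3), of w] assms(1,2) ip_self_zero by simp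

text \<open>The cone over the polytope: by \<open>single_p\<close> the \<open>p v\<close> are its
  extreme rays, and \<open>empty_p\<close> makes it pointed. \<open>D\<close> counts homogeneous
  coordinates, and \<open>3 <= D\<close> leaves room for a third coordinate index and for a
  direction outside a plane.\<close>

locale cone_config =
 fixes VP :: "'v set" and p :: "'v => vec" and D :: nat
 assumes finVP: "finite VP" and p_coord: "!!v. v \<in> VP ==> p v \<in> csp D"
  and span_p: "span (p ` VP) = csp D"
  and single_p: "!!v. v \<in> VP ==> facial p VP {v}" and empty_p: "facial p VP {}"
  and D3: "3 <= D"
begin

definition dualC :: "vec set" where
 "dualC = {x \<in> csp D. \<forall>v\<in>VP. 0 <= ip D x (p v)}"

text \<open>An interior vector of the cone. It is positive on the dual cone except at the origin and
  normalizes dual vectors to the base \<open>slice\<close>.\<close>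

definition wbar :: vec where "wbar = (\<Sum>v\<in>VP. p v)"

definition slice :: "vec set" where "slice = {x \<in> dualC. ip D x wbar = 1}"

lemma cone_sum_coord: "(\<Sum>v\<in>VP. c v *\<^sub>R p v) \<in> csp D"
 using subspace_csp p_coord by (intro subspace_sum subspace_scale)

lemma wbar_coord: "wbar \<in> csp D"
 using cone_sum_coord[of "%_. 1"] by (simp add: wbar_def)

lemma dualC_coord: "x \<in> dualC ==> x \<in> csp D"
 by (simp add: dualC_def)

lemma slice_dual: "x \<in> slice ==> x \<in> dualC"
 and slice_coord: "x \<in> slice ==> x \<in> csp D"
 and slice_wbar: "x \<in> slice ==> ip D x wbar = 1"
 by (auto simp: slice_def dualC_def)

lemma slice_nz: "x \<in> slice ==> x ~= 0"
 by (auto simp: slice_def)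

lemma ip_wbar: "ip D x wbar = (\<Sum>v\<in>VP. ip D x (p v))"
 by (simp add: wbar_def ip_sum_right)

lemma dual_wbar_nonneg: "x \<in> dualC ==> 0 <= ip D x wbar"
 by (auto simp: ip_wbar dualC_def intro: sum_nonneg)

lemma dual_ip_le: "x \<in> dualC ==> v \<in> VP ==> ip D x (p v) <= ip D x wbar"
 unfolding ip_wbar using finVP by (intro member_le_sum) (auto simp: dualC_def)

lemma dual_wbar_pos:
 assumes "x \<in> dualC" "x ~= 0"
 shows "0 < ip D x wbar"
proof (rule ccontr)
 assume "\<not> ?thesis"
 hence "ip D x (p v) = 0" if "v \<in> VP" for v
  using dual_ip_le[OF assms(1) that] assms(1) that by (auto simp: dualC_def intro: antisym)
 hence "\<forall>y\<in>p ` VP. ip D y x = 0" by (auto simp: ip_commute)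
 hence "x = 0" using ip_eq_on_spanning[OF span_p] dualC_coord[OF assms(1)] by blast
 thus False using assms(2) by simp
qed

lemma dualC_add: "x \<in> dualC ==> y \<in> dualC ==> x + y \<in> dualC"
 and dualC_scale: "0 <= c ==> x \<in> dualC ==> c *\<^sub>R x \<in> dualC"
 using subspace_csp by (auto simp: dualC_def ip_add_left ip_scale_left subspace_add subspace_scale)

lemma dualC_0: "0 \<in> dualC"
 using subspace_csp by (auto simp: dualC_def subspace_0)

lemma dualC_sum: "(!!i. i \<in> I ==> f i \<in> dualC) ==> (\<Sum>i\<in>I. f i) \<in> dualC"
 by (induction I rule: infinite_finite_induct) (auto intro: dualC_add dualC_0)

text \<open>\<open>w\<close> is a combination of the \<open>p v\<close>, and for \<open>x\<close> in
  the dual cone each value \<open>ip D x (p v)\<close> lies between \<open>0\<close> and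
  \<open>ip D x wbar\<close>.\<close>

lemma ip_bounded_by_wbar:
 assumes "w \<in> csp D"
 shows "\<exists>c\<ge>0. \<forall>x\<in>dualC. \<bar>ip D x w\<bar> <= c * ip D x wbar"
proof -
 have "w \<in> span (p ` VP)" using assms span_p by simp
 then obtain b where b: "w = (\<Sum>y\<in>p ` VP. b y *\<^sub>R y)"
  using span_finite[of "p ` VP"] finVP by auto
 define c where "c = (\<Sum>y\<in>p ` VP. \<bar>b y\<bar>)"
 have "\<bar>ip D x w\<bar> <= c * ip D x wbar" if x: "x \<in> dualC" for x
 proof -
  have "\<bar>ip D x w\<bar> <= (\<Sum>y\<in>p ` VP. \<bar>b y * ip D x y\<bar>)"
   unfolding b ip_sum_right ip_scale_right by (rule sum_abs)
  also have "\<dots> <= (\<Sum>y\<in>p ` VP. \<bar>b y\<bar> * ip D x wbar)"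
  proof (rule sum_mono)
   fix y assume "y \<in> p ` VP"
   then obtain v where v: "v \<in> VP" "y = p v" by auto
   have "0 <= ip D x (p v)" using x v by (simp add: dualC_def)
   thus "\<bar>b y * ip D x y\<bar> <= \<bar>b y\<bar> * ip D x wbar"
    using dual_ip_le[OF x v(1)] v(2) by (auto simp: abs_mult intro: mult_left_mono)
  qed
  also have "\<dots> = c * ip D x wbar" by (simp add: c_def sum_distrib_right)
  finally show ?thesis .
 qed
 moreover have "c >= 0" unfolding c_def by (intro sum_nonneg) auto
 ultimately show ?thesis by blast
qed

lemma cone_pointed:
 assumes "\<forall>v\<in>VP. 0 <= c v" "(\<Sum>v\<in>VP. c v *\<^sub>R p v) = 0" "v \<in> VP"
 shows "c v = 0"
proof -
 obtain f where f: "linear f" "!!v. v \<in> VP ==> v ~: {} ==> 0 < (f (p v) :: real)"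
  using empty_p by (elim facialE) blast
 have "(\<Sum>v\<in>VP. c v * f (p v)) = f (\<Sum>v\<in>VP. c v *\<^sub>R p v)" using f(1) by (simp add: linear_sum linear_cmul)
 also have "\<dots> = 0" using f(1) assms(2) by (simp add: linear_0)
 finally have "\<forall>v\<in>VP. c v * f (p v) = 0"
  using assms(1) f(2) finVP by (subst (asm) sum_nonneg_eq_0_iff) (auto simp: less_imp_le)
 thus ?thesis using f(2)[of v] assms(3) by fastforce
qed

lemma facial_dual:
 assumes "facial p VP B"
 shows "\<exists>x\<in>dualC. B = {v\<in>VP. ip D x (p v) = 0}"
proof -
 obtain f where f: "linear f" "!!v. v \<in> VP ==> 0 <= (f (p v) :: real)" "!!v. v \<in> VP ==> f (p v) = 0 \<longleftrightarrow> v \<in> B"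
  using assms by (rule facialE3) blast
 obtain e where e: "e \<in> csp D" "\<forall>x\<in>csp D. f x = ip D x e" using lin_as_ip[OF f(1)] by blast
 hence fe: "f (p v) = ip D e (p v)" if "v \<in> VP" for v using p_coord[OF that] by (simp add: ip_commute)
 hence "e \<in> dualC" using e(1) f(2) by (auto simp: dualC_def)
 moreover have "B = {v\<in>VP. ip D e (p v) = 0}" using fe f(3) facial_subset[OF assms] by auto
 ultimately show ?thesis by blast
qed

end

text \<open>The polyhedron of all \<open>w\<close> with \<open>om x <= ip D x w\<close> for
  \<open>x\<close> in \<open>Gam\<close>. By \<open>dual\<close> the normals generate the dual cone,
  so its recession cone is the cone over the polytope; \<open>generic\<close> makes it simple, and
  \<open>supported\<close> makes every inequality tight somewhere.\<close>

locale layer = cone_config VP p D for VP :: "'v set" and p and D +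
 fixes Gam :: "vec set" and om :: "vec => real"
 assumes finGam: "finite Gam" and Gam_slice: "Gam \<subseteq> slice"
  and dual: "!!w. w \<in> csp D ==> (!!x. x \<in> Gam ==> 0 <= ip D x w) ==>
    \<exists>c. (\<forall>v\<in>VP. 0 <= c v) & w = (\<Sum>v\<in>VP. c v *\<^sub>R p v)"
  and generic: "!!w. w \<in> csp D ==> independent {x\<in>Gam. ip D x w = om x}"
  and supported: "!!x. x \<in> Gam ==> \<exists>w\<in>csp D. ip D x w = om x & (\<forall>y\<in>Gam. om y <= ip D y w)"
begin

section \<open>Vertices, edges and rays of a layer\<close>

definition Q :: "vec set" where "Q = {w \<in> csp D. \<forall>x\<in>Gam. om x <= ip D x w}"
definition tight :: "vec => vec set" where "tight w = {x\<in>Gam. ip D x w = om x}"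
definition Vt :: "vec set" where "Vt = {w \<in> Q. card (tight w) = D}"

lemma Gam_coord: "x \<in> Gam ==> x \<in> csp D"
 using Gam_slice slice_coord by auto

lemma Gam_p: "x \<in> Gam ==> v \<in> VP ==> 0 <= ip D x (p v)"
 using Gam_slice slice_dual by (auto simp: dualC_def)

lemma Q_coord: "w \<in> Q ==> w \<in> csp D" and Q_le: "w \<in> Q ==> x \<in> Gam ==> om x <= ip D x w"
 by (auto simp: Q_def)

lemma Vt_Q: "w \<in> Vt ==> w \<in> Q" and Vt_coord: "w \<in> Vt ==> w \<in> csp D"
 by (auto simp: Vt_def Q_def)

lemma tight_sub: "tight w \<subseteq> Gam" and tight_ip: "x \<in> tight w ==> ip D x w = om x"
 by (auto simp: tight_def)

lemma tight_fin: "finite (tight w)" using tight_sub finGam finite_subset by blast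

lemma tight_indep: "w \<in> csp D ==> independent (tight w)"
 using generic by (simp add: tight_def)

lemma tight_coord: "tight w \<subseteq> csp D" using tight_sub Gam_coord by blast

lemma tight_card_le: "w \<in> csp D ==> card (tight w) <= D"
 using card_independent_coord[OF tight_indep tight_coord] by blast

lemma Vt_span: "w \<in> Vt ==> span (tight w) = csp D"
 by (intro span_full_independent tight_indep tight_coord) (auto simp: Vt_def Q_def)

lemma Vt_eq:
 assumes "w \<in> Vt" "z \<in> csp D" "tight w \<subseteq> tight z"
 shows "w = z"
proof -
 have "ip D x (w - z) = 0" if "x \<in> tight w" for x
  using that assms(3) tight_ip[of x w] tight_ip[of x z] by (auto simp: ip_diff_right)
 moreover have "w - z \<in> csp D"
  using Vt_coord[OF assms(1)] assms(2) subspace_csp by (simp add: subspace_diff)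
 ultimately have "w - z = 0" using ip_eq_on_spanning[OF Vt_span[OF assms(1)]] by blast
 thus ?thesis by simp
qed

lemma finite_Vt: "finite Vt"
proof (rule inj_on_finite[of tight])
 show "inj_on tight Vt" by (rule inj_onI) (metis Vt_eq Vt_coord order_refl)
 show "tight ` Vt \<subseteq> Pow Gam" using tight_sub by auto
qed (simp add: finGam)

lemma no_line:
 assumes "e \<in> csp D" "\<forall>x\<in>Gam. ip D x e = 0"
 shows "e = 0"
proof -
 obtain c where c: "\<forall>v\<in>VP. 0 <= c v" "e = (\<Sum>v\<in>VP. c v *\<^sub>R p v)"
  using dual[OF assms(1)] assms(2) by auto
 have "- e \<in> csp D" using assms(1) subspace_csp by (simp add: subspace_neg)
 moreover have "0 <= ip D x (- e)" if "x \<in> Gam" for x using assms(2) that by (simp add: ip_minus_right)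
 ultimately obtain d where d: "\<forall>v\<in>VP. 0 <= d v" "- e = (\<Sum>v\<in>VP. d v *\<^sub>R p v)"
  using dual[of "- e"] by auto
 have "(\<Sum>v\<in>VP. (c v + d v) *\<^sub>R p v) = e + - e"
  unfolding scaleR_add_left sum.distrib c(2)[symmetric] d(2)[symmetric] ..
 hence s: "(\<Sum>v\<in>VP. (c v + d v) *\<^sub>R p v) = 0" by simp
 have "c v + d v = 0" if "v \<in> VP" for v
  using cone_pointed[OF _ s that] c(1) d(1) by auto
 hence "c v = 0" if "v \<in> VP" for v using c(1) d(1) that by (metis add_nonneg_eq_0_iff)
 thus ?thesis using c(2) by simp
qed

text \<open>The ratio test of the simplex method: \<open>s\<close> is the first moment at which a
  constraint that decreases along \<open>e\<close> becomes tight.\<close>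

lemma step:
 assumes w: "w \<in> Q" and e: "e \<in> csp D" "!!x. x \<in> tight w ==> 0 <= ip D x e"
  and neg: "\<exists>x\<in>Gam. ip D x e < 0"
 shows "\<exists>s>0. w + s *\<^sub>R e \<in> Q & (\<exists>y\<in>tight (w + s *\<^sub>R e). ip D y e < 0)"
proof -
 define N where "N = {x\<in>Gam. ip D x e < 0}"
 have N: "finite N" "N ~= {}" using neg finGam by (auto simp: N_def)
 define g where "g x = (ip D x w - om x) / (- ip D x e)" for x
 obtain y where y: "y \<in> N" and ymin: "!!x. x \<in> N ==> g y <= g x" using finite_ex_min[OF N, of g] by blast
 define s where "s = g y"
 have gpos: "g x > 0" if "x \<in> N" for x
 proof -
  have "x ~: tight w" using e(2)[of x] that by (auto simp: N_def)
  hence "om x < ip D x w" using Q_le[OF w, of x] that by (auto simp: N_def tight_def)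
  thus ?thesis using that by (auto simp: g_def N_def intro!: divide_pos_neg divide_neg_neg)
 qed
 hence s: "s > 0" using y by (simp add: s_def)
 have le: "s <= g x" if "x \<in> N" for x using ymin[OF that] by (simp add: s_def)
 have ipe: "ip D x (w + s *\<^sub>R e) = ip D x w + s * ip D x e" for x
  by (simp add: ip_add_right ip_scale_right)
 have "om x <= ip D x (w + s *\<^sub>R e)" if x: "x \<in> Gam" for x
 proof (cases "x \<in> N")
  case True
  hence ne: "ip D x e < 0" by (simp add: N_def)
  hence "s * (- ip D x e) <= ip D x w - om x"
   using le[OF True] unfolding g_def by (subst (asm) pos_le_divide_eq) auto
  thus ?thesis by (simp add: ipe)
 next
  case False
  hence "0 <= s * ip D x e" using s x by (auto simp: N_def)
  thus ?thesis using Q_le[OF w x] by (simp add: ipe)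
 qed
 moreover have "w + s *\<^sub>R e \<in> csp D"
  using Q_coord[OF w] e(1) subspace_csp by (simp add: subspace_add subspace_scale)
 ultimately have "w + s *\<^sub>R e \<in> Q" by (simp add: Q_def)
 moreover have "y \<in> tight (w + s *\<^sub>R e)"
 proof -
  have "ip D y e ~= 0" "y \<in> Gam" using y by (auto simp: N_def)
  hence "s * ip D y e = om y - ip D y w" by (simp add: s_def g_def field_simps)
  thus ?thesis using ipe[of y] \<open>y \<in> Gam\<close> by (simp add: tight_def)
 qed
 ultimately show ?thesis using s y by (auto simp: N_def)
qed

text \<open>Among the points that keep the constraints of \<open>w\<close> tight, one with the most
  tight constraints is a vertex. Otherwise some direction preserves them all, and by
  \<open>no_line\<close> one of its two orientations runs into a further constraint.\<close>

lemma ex_vertex: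
 assumes "w \<in> Q"
 shows "\<exists>z\<in>Vt. tight w \<subseteq> tight z"
proof -
 define good where "good z \<longleftrightarrow> z \<in> Q & tight w \<subseteq> tight z" for z
 have "good w" using assms by (simp add: good_def)
 moreover have "card (tight z) < Suc (card Gam)" for z
  using finGam tight_sub by (simp add: less_Suc_eq_le card_mono)
 ultimately obtain z where z: "good z" "!!y. good y ==> card (tight y) <= card (tight z)"
  using ex_has_greatest_nat[of good w "%z. card (tight z)" "Suc (card Gam)"] by (auto simp: less_Suc_eq_le)
 have zQ: "z \<in> Q" "tight w \<subseteq> tight z" using z(1) by (auto simp: good_def)
 note zc = Q_coord[OF zQ(1)]
 have "card (tight z) = D"
 proof (rule ccontr)
  assume ne: "card (tight z) ~= D"
  have "span (tight z) ~= csp D"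
   using dim_csp_set[of "tight z" D] dim_eq_card_independent[OF tight_indep[OF zc]] ne by auto
  moreover have "span (tight z) \<subseteq> csp D"
   using tight_coord subspace_csp by (intro span_minimal)
  ultimately obtain x where x: "x \<in> csp D" "x ~: span (tight z)" by auto
  obtain e where e: "e \<in> csp D" "\<forall>y\<in>tight z. ip D y e = 0" "ip D x e = 1"
   using ip_separate[OF tight_coord x] by blast
  have "e ~= 0" using e(3) by auto
  then obtain x' where x': "x' \<in> Gam" "ip D x' e ~= 0" using no_line[OF e(1)] by blast
  define e' where "e' = (if ip D x' e < 0 then e else - e)"
  have e': "e' \<in> csp D" "!!y. y \<in> tight z ==> ip D y e' = 0" "ip D x' e' < 0"
   using e x' subspace_csp by (auto simp: e'_def ip_minus_right subspace_neg)
  have "\<exists>s>0. z + s *\<^sub>R e' \<in> Q & (\<exists>y\<in>tight (z + s *\<^sub>R e'). ip D y e' < 0)"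
   using e'(2,3) x'(1) by (intro step[OF zQ(1) e'(1)]) auto
  then obtain s y where s: "z + s *\<^sub>R e' \<in> Q" "y \<in> tight (z + s *\<^sub>R e')" "ip D y e' < 0" by blast
  let ?w = "z + s *\<^sub>R e'"
  have sub: "tight z \<subseteq> tight ?w"
   using e'(2) tight_sub by (auto simp: tight_def ip_add_right ip_scale_right)
  have "y ~: tight z" using s(3) e'(2) by auto
  hence "insert y (tight z) \<subseteq> tight ?w" "card (insert y (tight z)) = Suc (card (tight z))"
   using sub s(2) tight_fin by auto
  hence "Suc (card (tight z)) <= card (tight ?w)" using tight_fin card_mono by metis
  moreover have "good ?w" using sub zQ s(1) by (auto simp: good_def)
  ultimately show False using z(2) by fastforce
 qed
 thus ?thesis using zQ by (auto simp: Vt_def)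
qed

text \<open>Edge directions at a vertex, as the basis dual to the tight normals: the edge leaves the
  facet \<open>u\<close> and stays on the others.\<close>

definition dvec :: "vec => vec => vec" where
 "dvec w u = (SOME e. e \<in> csp D & (\<forall>y\<in>tight w - {u}. ip D y e = 0) & ip D u e = 1)"

lemma dvec:
 assumes "w \<in> Vt" "u \<in> tight w"
 shows "dvec w u \<in> csp D" "!!y. y \<in> tight w ==> y ~= u ==> ip D y (dvec w u) = 0" "ip D u (dvec w u) = 1"
proof -
 have "\<exists>e. e \<in> csp D & (\<forall>y\<in>tight w - {u}. ip D y e = 0) & ip D u e = 1"
  using ip_dual[OF tight_indep[OF Vt_coord[OF assms(1)]] tight_coord assms(2)] by blast
 hence "dvec w u \<in> csp D & (\<forall>y\<in>tight w - {u}. ip D y (dvec w u) = 0) & ip D u (dvec w u) = 1"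
  unfolding dvec_def by (rule someI_ex)
 thus "dvec w u \<in> csp D" "!!y. y \<in> tight w ==> y ~= u ==> ip D y (dvec w u) = 0" "ip D u (dvec w u) = 1"
  by auto
qed

lemma dvec_expand:
 assumes "w \<in> Vt" "z \<in> csp D"
 shows "z = (\<Sum>u\<in>tight w. ip D u z *\<^sub>R dvec w u)"
proof -
 let ?s = "\<Sum>u\<in>tight w. ip D u z *\<^sub>R dvec w u"
 have "?s \<in> csp D"
  using subspace_csp dvec(1)[OF assms(1)] by (intro subspace_sum subspace_scale)
 hence "z - ?s \<in> csp D" using assms(2) subspace_csp by (simp add: subspace_diff)
 moreover have "\<forall>x\<in>tight w. ip D x (z - ?s) = 0"
 proof
  fix x assume x: "x \<in> tight w"
  have "ip D x ?s = (\<Sum>u\<in>tight w. if u = x then ip D u z else 0)"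
   unfolding ip_sum_right ip_scale_right using dvec[OF assms(1)] x by (intro sum.cong) auto
  hence "ip D x ?s = ip D x z" using x tight_fin by (simp add: sum.delta)
  thus "ip D x (z - ?s) = 0" by (simp add: ip_diff_right)
 qed
 ultimately have "z - ?s = 0" using ip_eq_on_spanning[OF Vt_span[OF assms(1)]] by blast
 thus ?thesis by simp
qed

text \<open>If no constraint stops the edge, its direction lies in the cone over the polytope, and
  every \<open>p v\<close> that contributes to it vanishes on the other tight normals. Expanded in
  the dual basis, such a \<open>p v\<close> has a single term, so the direction is an extreme
  ray.\<close>

lemma edge:
 assumes "w \<in> Vt" "u \<in> tight w"
 shows "(\<exists>s>0. w + s *\<^sub>R dvec w u \<in> Vt & tight w - {u} \<subseteq> tight (w + s *\<^sub>R dvec w u) & u ~: tight (w + s *\<^sub>R dvec w u)) |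
  (\<exists>v\<in>VP. \<exists>s>0. p v = s *\<^sub>R dvec w u)"
proof (cases "\<exists>x\<in>Gam. ip D x (dvec w u) < 0")
 case True
 note d = dvec[OF assms]
 have nn: "0 <= ip D x (dvec w u)" if "x \<in> tight w" for x using d(2)[OF that] d(3) by (cases "x = u") auto
 obtain s where s: "s > 0" "w + s *\<^sub>R dvec w u \<in> Q" "\<exists>y\<in>tight (w + s *\<^sub>R dvec w u). ip D y (dvec w u) < 0"
  using step[OF Vt_Q[OF assms(1)] d(1) nn True] by blast
 then obtain y where y: "y \<in> tight (w + s *\<^sub>R dvec w u)" "ip D y (dvec w u) < 0" by blast
 let ?z = "w + s *\<^sub>R dvec w u"
 have sub: "tight w - {u} \<subseteq> tight ?z"
  using d(2) by (auto simp: tight_def ip_add_right ip_scale_right)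
 have nu: "u ~: tight ?z" using s(1) d(3) assms(2) by (auto simp: tight_def ip_add_right ip_scale_right)
 have "y ~: tight w" using y(2) nn by fastforce
 hence "insert y (tight w - {u}) \<subseteq> tight ?z" "card (insert y (tight w - {u})) = Suc (card (tight w) - 1)"
  using sub y(1) tight_fin assms(2) by auto
 hence "Suc (card (tight w) - 1) <= card (tight ?z)" using tight_fin card_mono by metis
 hence "card (tight ?z) = D"
  using tight_card_le[OF Q_coord[OF s(2)]] assms(1) D3 by (auto simp: Vt_def)
 hence "?z \<in> Vt" using s(2) by (simp add: Vt_def)
 thus ?thesis using s(1) sub nu by blast
next
 case False
 note d = dvec[OF assms]
 have dn0: "0 <= ip D x (dvec w u)" if "x \<in> Gam" for x using False that by (meson not_less)
 obtain c where c: "\<forall>v\<in>VP. 0 <= c v" "dvec w u = (\<Sum>v\<in>VP. c v *\<^sub>R p v)" using dual[OF d(1) dn0] by blast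
 have zero: "c v * ip D x (p v) = 0" if "x \<in> tight w" "x ~= u" "v \<in> VP" for x v
 proof -
  have "(\<Sum>v\<in>VP. c v * ip D x (p v)) = ip D x (dvec w u)"
   by (subst c(2)) (simp add: ip_sum_right ip_scale_right)
  also have "\<dots> = 0" using d(2) that by simp
  finally have "\<forall>v\<in>VP. c v * ip D x (p v) = 0"
   using c(1) Gam_p[of x] that(1) tight_sub[of w] finVP
   by (subst (asm) sum_nonneg_eq_0_iff) (auto simp: subset_iff)
  thus ?thesis using that(3) by blast
 qed
 have "(\<Sum>v\<in>VP. c v * ip D u (p v)) = ip D u (dvec w u)"
  by (subst c(2)) (simp add: ip_sum_right ip_scale_right)
 hence "(\<Sum>v\<in>VP. c v * ip D u (p v)) ~= 0" using d(3) by simp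
 then obtain v where v: "v \<in> VP" "c v * ip D u (p v) ~= 0" by (meson sum.neutral)
 hence "c v ~= 0" "ip D u (p v) ~= 0" by auto
 moreover have "0 <= ip D u (p v)" using Gam_p[of u v] assms(2) tight_sub v(1) by blast
 ultimately have up: "ip D u (p v) > 0" by simp
 have "ip D x (p v) = 0" if "x \<in> tight w" "x ~= u" for x using zero[OF that v(1)] \<open>c v ~= 0\<close> by simp
 hence "(\<Sum>x\<in>tight w. ip D x (p v) *\<^sub>R dvec w x) = (\<Sum>x\<in>{u}. ip D x (p v) *\<^sub>R dvec w x)"
  using tight_fin assms(2) by (intro sum.mono_neutral_right) auto
 hence "p v = ip D u (p v) *\<^sub>R dvec w u" using dvec_expand[OF assms(1) p_coord[OF v(1)]] by simp
 thus ?thesis using v(1) up by blast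
qed

text \<open>The simplex method. The sum \<open>q\<close> of the tight normals at \<open>z\<close> is
  minimal on the polyhedron only at \<open>z\<close>. A vertex other than \<open>z\<close> that
  minimizes \<open>q\<close> among those with \<open>G\<close> would have an edge along which
  \<open>q\<close> decreases; since \<open>q\<close> is nonnegative on the rays, this edge ends at a
  better vertex with \<open>G\<close>.\<close>

lemma vertex_connected:
 assumes "w0 \<in> Vt" "G w0"
  and closed: "!!w u s. w \<in> Vt ==> G w ==> u \<in> tight w ==> 0 < s ==> w + s *\<^sub>R dvec w u \<in> Vt ==>
    tight w - {u} \<subseteq> tight (w + s *\<^sub>R dvec w u) ==> u ~: tight (w + s *\<^sub>R dvec w u) ==> G (w + s *\<^sub>R dvec w u)"
  and z: "z \<in> Vt"
 shows "G z"
proof -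
 define q where "q = (\<Sum>x\<in>tight z. x)"
 have ipq: "ip D q y = (\<Sum>x\<in>tight z. ip D x y)" for y by (simp add: q_def ip_sum_left)
 define S where "S = {w\<in>Vt. G w}"
 have S: "finite S" "S ~= {}" using finite_Vt assms(1,2) by (auto simp: S_def)
 obtain w where w: "w \<in> S" "!!y. y \<in> S ==> ip D q w <= ip D q y"
  using finite_ex_min[OF S, of "ip D q"] by blast
 have wV: "w \<in> Vt" "G w" using w(1) by (auto simp: S_def)
 have "w = z"
 proof (rule ccontr)
  assume ne: "w ~= z"
  have le: "om x <= ip D x w" if "x \<in> tight z" for x using Q_le[OF Vt_Q[OF wV(1)]] that tight_sub by blast
  have "\<not> tight z \<subseteq> tight w" using Vt_eq[OF z Vt_coord[OF wV(1)]] ne by auto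
  then obtain x where "x \<in> tight z" "x ~: tight w" by auto
  hence "om x < ip D x w" "x \<in> tight z" using le[of x] tight_sub[of z] by (auto simp: tight_def)
  hence "(\<Sum>x\<in>tight z. om x) < (\<Sum>x\<in>tight z. ip D x w)"
   using le tight_fin by (intro sum_strict_mono_ex1) auto
  moreover have "(\<Sum>x\<in>tight z. om x) = (\<Sum>x\<in>tight z. ip D x z)" by (intro sum.cong) (auto simp: tight_ip)
  ultimately have lt: "ip D q z < ip D q w" by (simp add: ipq)
  have zw: "z - w \<in> csp D"
   using Vt_coord[OF z] Vt_coord[OF wV(1)] subspace_csp by (simp add: subspace_diff)
  have "ip D q (z - w) = (\<Sum>u\<in>tight w. ip D u (z - w) * ip D q (dvec w u))"
   by (subst dvec_expand[OF wV(1) zw]) (simp add: ip_sum_right ip_scale_right)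
  moreover have "ip D q (z - w) < 0" using lt by (simp add: ip_diff_right)
  ultimately have neg: "(\<Sum>u\<in>tight w. ip D u (z - w) * ip D q (dvec w u)) < 0" by simp
  have "\<exists>u\<in>tight w. ip D u (z - w) * ip D q (dvec w u) < 0"
  proof (rule ccontr)
   assume "\<not> ?thesis"
   hence "0 <= (\<Sum>u\<in>tight w. ip D u (z - w) * ip D q (dvec w u))" by (intro sum_nonneg) (simp add: not_less)
   thus False using neg by simp
  qed
  then obtain u where u: "u \<in> tight w" "ip D u (z - w) * ip D q (dvec w u) < 0" by blast
  have "0 <= ip D u (z - w)" using Q_le[OF Vt_Q[OF z], of u] u(1) tight_sub tight_ip by (auto simp: ip_diff_right)
  hence qn: "ip D q (dvec w u) < 0" using u(2) by (simp add: mult_less_0_iff)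
  have "\<not> (\<exists>v\<in>VP. \<exists>s>0. p v = s *\<^sub>R dvec w u)"
  proof
   assume "\<exists>v\<in>VP. \<exists>s>0. p v = s *\<^sub>R dvec w u"
   then obtain v s where v: "v \<in> VP" "s > 0" "p v = s *\<^sub>R dvec w u" by blast
   have "0 <= ip D q (p v)" unfolding ipq using Gam_p v(1) tight_sub by (intro sum_nonneg) blast
   thus False using v(2,3) qn by (simp add: ip_scale_right zero_le_mult_iff)
  qed
  then obtain s where s: "s > 0" "w + s *\<^sub>R dvec w u \<in> Vt" "tight w - {u} \<subseteq> tight (w + s *\<^sub>R dvec w u)" "u ~: tight (w + s *\<^sub>R dvec w u)"
   using edge[OF wV(1) u(1)] by blast
  have "G (w + s *\<^sub>R dvec w u)" using closed[OF wV u(1) s] .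
  hence "ip D q w <= ip D q (w + s *\<^sub>R dvec w u)" using w(2) s(2) by (simp add: S_def)
  moreover have "s * ip D q (dvec w u) < 0" using s(1) qn by (simp add: mult_pos_neg)
  ultimately show False by (simp add: ip_add_right ip_scale_right)
 qed
 thus ?thesis using wV(2) by simp
qed

text \<open>\<open>q\<close> exposes the ray \<open>p v\<close>, and \<open>l\<close> is positive on
  it. At a vertex that minimizes \<open>q\<close> and then maximizes \<open>l\<close>, the vector
  \<open>p v\<close> is a nonnegative combination of edge directions, and \<open>q\<close> vanishes
  on those with positive coefficient. One of them increases \<open>l\<close>, hence ends at no
  vertex; it is a ray, which \<open>q\<close> identifies as \<open>p v\<close>.\<close>

lemma ray_at_some_vertex:
 assumes v: "v \<in> VP" and ne: "Vt ~= {}"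
 shows "\<exists>w\<in>Vt. \<exists>u\<in>tight w. \<exists>s>0. p v = s *\<^sub>R dvec w u"
proof -
 obtain q where q: "q \<in> dualC" "{v} = {v'\<in>VP. ip D q (p v') = 0}" using facial_dual[OF single_p[OF v]] by blast
 have qv: "ip D q (p v) = 0" "!!v'. v' \<in> VP ==> ip D q (p v') = 0 ==> v' = v" using q(2) by auto
 obtain l where l: "l \<in> dualC" "{} = {v'\<in>VP. ip D l (p v') = 0}" using facial_dual[OF empty_p] by blast
 have lv: "0 < ip D l (p v)" using l v by (force simp: dualC_def)
 obtain w1 where w1: "w1 \<in> Vt" "!!y. y \<in> Vt ==> ip D q w1 <= ip D q y"
  using finite_ex_min[OF finite_Vt ne, of "ip D q"] by blast
 define m where "m = ip D q w1"
 define S where "S = {w\<in>Vt. ip D q w = m}"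
 have S: "finite S" "S ~= {}" using w1(1) finite_Vt by (auto simp: S_def m_def)
 have mle: "m <= ip D q w" if "w \<in> Vt" for w using w1(2)[OF that] by (simp add: m_def)
 obtain w where w: "w \<in> S" "!!y. y \<in> S ==> - ip D l w <= - ip D l y"
  using finite_ex_min[OF S, of "%y. - ip D l y"] by blast
 have wV: "w \<in> Vt" "ip D q w = m" using w(1) by (auto simp: S_def)
 have qd: "0 <= ip D q (dvec w u)" if u: "u \<in> tight w" for u
  using edge[OF wV(1) u]
 proof (elim disjE exE bexE conjE)
  fix s assume s: "s > 0" "w + s *\<^sub>R dvec w u \<in> Vt"
  hence "m <= m + s * ip D q (dvec w u)" using mle[OF s(2)] wV(2) by (simp add: ip_add_right ip_scale_right)
  thus ?thesis using s(1) by (simp add: zero_le_mult_iff)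
 next
  fix v' s assume s: "v' \<in> VP" "s > 0" "p v' = s *\<^sub>R dvec w u"
  have "0 <= ip D q (p v')" using q(1) s(1) by (simp add: dualC_def)
  thus ?thesis using s(2,3) by (simp add: ip_scale_right zero_le_mult_iff)
 qed
 have c0: "0 <= ip D u (p v)" if "u \<in> tight w" for u using Gam_p v that tight_sub by blast
 have "(\<Sum>u\<in>tight w. ip D u (p v) * ip D q (dvec w u)) = ip D q (p v)"
  by (subst (2) dvec_expand[OF wV(1) p_coord[OF v]]) (simp add: ip_sum_right ip_scale_right)
 hence z: "\<forall>u\<in>tight w. ip D u (p v) * ip D q (dvec w u) = 0"
  using qv(1) qd c0 sum_nonneg_eq_0_iff[OF tight_fin, of w "%u. ip D u (p v) * ip D q (dvec w u)"] by simp
 have "(\<Sum>u\<in>tight w. ip D u (p v) * ip D l (dvec w u)) = ip D l (p v)"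
  by (subst (2) dvec_expand[OF wV(1) p_coord[OF v]]) (simp add: ip_sum_right ip_scale_right)
 hence lpos: "(\<Sum>u\<in>tight w. ip D u (p v) * ip D l (dvec w u)) > 0" using lv by simp
 have "\<exists>u\<in>tight w. ip D u (p v) * ip D l (dvec w u) > 0"
 proof (rule ccontr)
  assume "\<not> ?thesis"
  hence "(\<Sum>u\<in>tight w. ip D u (p v) * ip D l (dvec w u)) <= 0" by (intro sum_nonpos) (simp add: not_less)
  thus False using lpos by simp
 qed
 then obtain u where u: "u \<in> tight w" "ip D u (p v) * ip D l (dvec w u) > 0" by blast
 have up: "ip D u (p v) > 0" "ip D l (dvec w u) > 0" using u(2) c0[OF u(1)] by (auto simp: zero_less_mult_iff)
 have q0: "ip D q (dvec w u) = 0" using z u(1) up(1) by auto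
 show ?thesis
  using edge[OF wV(1) u(1)]
 proof (elim disjE exE bexE conjE)
  fix s assume s: "s > 0" "w + s *\<^sub>R dvec w u \<in> Vt"
  hence "w + s *\<^sub>R dvec w u \<in> S" using wV q0 by (simp add: S_def ip_add_right ip_scale_right)
  hence "- ip D l w <= - ip D l (w + s *\<^sub>R dvec w u)" by (rule w(2))
  moreover have "0 < s * ip D l (dvec w u)" using s(1) up(2) by simp
  ultimately show ?thesis by (simp add: ip_add_right ip_scale_right)
 next
  fix v' s assume s: "v' \<in> VP" "s > 0" "p v' = s *\<^sub>R dvec w u"
  have "ip D q (p v') = 0" using q0 s(3) by (simp add: ip_scale_right)
  hence "v' = v" using qv(2) s(1) by blast
  thus ?thesis using wV(1) u(1) s by blast
 qed
qed

lemma cell_vertex: "x \<in> Gam ==> \<exists>w\<in>Vt. x \<in> tight w"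
proof -
 assume x: "x \<in> Gam"
 obtain w where w: "w\<in>csp D" "ip D x w = om x" "\<forall>y\<in>Gam. om y <= ip D y w" using supported[OF x] by blast
 hence "w \<in> Q" "x \<in> tight w" using x by (auto simp: Q_def tight_def)
 thus ?thesis using ex_vertex by blast
qed

end

section \<open>Stacks of layers\<close>

lemma convex_seq_right:
 fixes g :: "nat => real"
 assumes "!!j. i < j ==> j < k ==> 2 * g j < g (j - 1) + g (j + 1)" "g i = 0" "g (i + 1) >= 0"
  and "i + 2 + n <= k"
 shows "0 < g (i + 2 + n) & g (i + 1 + n) < g (i + 2 + n)"
 using assms(4)
proof (induction n)
 case 0
 have "2 * g (i + 1) < g (i + 1 - 1) + g (i + 1 + 1)" using 0 by (intro assms(1)) auto
 hence "2 * g (i + 1) < g (i + 2)" using assms(2) by (simp add: numeral_2_eq_2)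
 thus ?case using assms(3) by simp
next
 case (Suc n)
 have "2 * g (i + 2 + n) < g (i + 2 + n - 1) + g (i + 2 + n + 1)" using Suc.prems by (intro assms(1)) auto
 hence "2 * g (i + 2 + n) < g (i + 1 + n) + g (i + 2 + Suc n)" by simp
 thus ?case using Suc.IH Suc.prems by simp
qed

text \<open>After subtraction of the chord, \<open>convex_seq_right\<close> applies to the right of
  it, and to the left after the reflection \<open>h\<close>.\<close>

lemma convex_seq_line:
 fixes f :: "nat => real"
 assumes conv: "!!j. 0 < j ==> j < k ==> 2 * f j < f (j - 1) + f (j + 1)" and i: "i < k"
 shows "\<exists>a b. a + b * real i = f i & a + b * real (i + 1) = f (i + 1) &
  (\<forall>j\<le>k. j ~= i & j ~= i + 1 --> a + b * real j < f j)"
proof -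
 define b where "b = f (i + 1) - f i"
 define a where "a = f i - b * real i"
 define g where "g j = f j - (a + b * real j)" for j
 have g0: "g i = 0" "g (i + 1) = 0" by (simp_all add: g_def a_def b_def algebra_simps)
 have gc: "2 * g j < g (j - 1) + g (j + 1)" if "0 < j" "j < k" for j
  using conv[OF that] that by (cases j) (auto simp: g_def algebra_simps)
 have right: "0 < g j" if "i + 1 < j" "j <= k" for j
 proof -
  define n where "n = j - (i + 2)"
  have n: "j = i + 2 + n" using that(1) by (simp add: n_def)
  have "0 < g (i + 2 + n) & g (i + 1 + n) < g (i + 2 + n)"
   by (rule convex_seq_right[of i k g]) (use gc g0 that(2) n in simp_all)
  thus ?thesis using n by simp
 qed
 define h where "h j = g (i + 1 - j)" for j
 have left: "0 < g j" if "j < i" for j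
 proof -
  define n where "n = i - (j + 1)"
  have n: "i = j + 1 + n" using that by (simp add: n_def)
  have hc: "2 * h l < h (l - 1) + h (l + 1)" if "0 < l" "l < i + 1" for l
  proof -
   have "2 * g (i + 1 - l) < g (i + 1 - l - 1) + g (i + 1 - l + 1)" using that i by (intro gc) auto
   moreover have "i + 1 - l + 1 = i + 1 - (l - 1)" "i + 1 - l - 1 = i + 1 - (l + 1)" using that by auto
   ultimately show ?thesis by (simp add: h_def)
  qed
  have "0 < h (0 + 2 + n) & h (0 + 1 + n) < h (0 + 2 + n)"
  proof (rule convex_seq_right[of 0 "i + 1" h])
   show "h 0 = 0" "0 <= h (0 + 1)" "0 + 2 + n <= i + 1" using g0 n by (simp_all add: h_def)
  qed (rule hc)
  moreover have "i + 1 - (2 + n) = j" using n by simp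
  ultimately show ?thesis by (simp add: h_def)
 qed
 have "a + b * real j < f j" if "j <= k" "j ~= i" "j ~= i + 1" for j
  using left[of j] right[of j] that by (cases "j < i") (auto simp: g_def)
 thus ?thesis using g0 by (intro exI[of _ a] exI[of _ b]) (auto simp: g_def)
qed

text \<open>The relative interior of the cone generated by \<open>kap\<close>.\<close>

definition posc :: "vec set => vec => bool" where
 "posc kap x \<longleftrightarrow> (\<exists>c. (\<forall>u\<in>kap. 0 < c u) & x = (\<Sum>u\<in>kap. c u *\<^sub>R u))"

lemma posc_sum: "posc kap (\<Sum>u\<in>kap. u)"
 unfolding posc_def by (intro exI[of _ "%_. 1"]) auto

lemma posc_single: "posc {x} x"
 unfolding posc_def by (intro exI[of _ "%_. 1"]) auto

locale stack = cone_config VP p D for VP :: "'v set" and p and D +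
 fixes k :: nat and Gam :: "nat => vec set" and om :: "nat => vec => real"
 assumes k1: "1 <= k" and layers: "!!i. i <= k ==> layer VP p D (Gam i) (om i)"
  and Gam_ne: "!!i. i <= k ==> Gam i ~= {}"
begin

definition LV :: "nat => vec set" where "LV i = layer.Vt D (Gam i) (om i)"
definition tg :: "nat => vec => vec set" where "tg i w = layer.tight D (Gam i) (om i) w"
text \<open>The support value of layer \<open>i\<close>: for \<open>x\<close> in the dual cone, the
  minimum over the polyhedron is attained at a vertex.\<close>

definition \<phi> :: "nat => vec => real" where "\<phi> i x = Min (ip D x ` LV i)"

lemma LV_fin: "i <= k ==> finite (LV i)"
 and LV_coord: "i <= k ==> w \<in> LV i ==> w \<in> csp D"
 and tg_fin: "i <= k ==> finite (tg i w)"
 and tg_sub: "i <= k ==> tg i w \<subseteq> Gam i"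
 and tg_card: "i <= k ==> w \<in> LV i ==> card (tg i w) = D"
 and tg_span: "i <= k ==> w \<in> LV i ==> span (tg i w) = csp D"
 and tg_inj: "i <= k ==> w \<in> LV i ==> z \<in> LV i ==> tg i w \<subseteq> tg i z ==> w = z"
 and cell: "i <= k ==> x \<in> Gam i ==> \<exists>w\<in>LV i. x \<in> tg i w"
 and Gam_dual: "i <= k ==> x \<in> Gam i ==> x \<in> dualC & x ~= 0"
proof -
 assume i: "i <= k"
 interpret layer VP p D "Gam i" "om i" using layers[OF i] .
 show "finite (LV i)" by (simp add: LV_def finite_Vt)
 show "w \<in> LV i ==> w \<in> csp D" by (simp add: LV_def Vt_coord)
 show "finite (tg i w)" by (simp add: tg_def tight_fin)
 show "tg i w \<subseteq> Gam i" by (simp add: tg_def tight_sub)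
 show "w \<in> LV i ==> card (tg i w) = D" by (simp add: LV_def tg_def Vt_def)
 show "w \<in> LV i ==> span (tg i w) = csp D" by (simp add: LV_def tg_def Vt_span)
 show "w \<in> LV i ==> z \<in> LV i ==> tg i w \<subseteq> tg i z ==> w = z"
  by (simp add: LV_def tg_def Vt_eq Vt_coord)
 show "x \<in> Gam i ==> \<exists>w\<in>LV i. x \<in> tg i w" using cell_vertex by (simp add: LV_def tg_def)
 show "x \<in> Gam i ==> x \<in> dualC & x ~= 0" using Gam_slice slice_dual slice_nz by blast
qed

lemma LV_ne: "i <= k ==> LV i ~= {}"
 using Gam_ne cell by blast

lemma \<phi>_le: "i <= k ==> w \<in> LV i ==> \<phi> i x <= ip D x w"
 unfolding \<phi>_def by (simp add: LV_fin)

lemma \<phi>_attained: "i <= k ==> \<exists>w\<in>LV i. ip D x w = \<phi> i x"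
proof -
 assume i: "i <= k"
 have "\<phi> i x \<in> ip D x ` LV i" unfolding \<phi>_def using LV_fin[OF i] LV_ne[OF i] by (intro Min_in) auto
 thus ?thesis by auto
qed

text \<open>\<open>x\<close> is a positive combination of normals that are all tight at
  \<open>w0\<close>. So it is minimal exactly where all of them are, and exposes the face cut out by
  \<open>kap\<close>, on vertices and on rays alike.\<close>

lemma cell_facts:
 assumes i: "i <= k" and w0: "w0 \<in> LV i" and kap: "kap \<subseteq> tg i w0" and x: "posc kap x"
 shows "w \<in> LV i ==> ip D x w = \<phi> i x \<longleftrightarrow> kap \<subseteq> tg i w"
  and "v \<in> VP ==> ip D x (p v) = 0 \<longleftrightarrow> (\<forall>u\<in>kap. ip D u (p v) = 0)"
  and "x \<in> dualC"
proof -
 interpret layer VP p D "Gam i" "om i" using layers[OF i] .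
 obtain c where c: "!!u. u \<in> kap ==> 0 < c u" "x = (\<Sum>u\<in>kap. c u *\<^sub>R u)" using x unfolding posc_def by blast
 have fin: "finite kap" using kap tg_fin[OF i] finite_subset by blast
 have ipx: "ip D x y = (\<Sum>u\<in>kap. c u * ip D u y)" for y by (simp add: c(2) ip_sum_left ip_scale_left)
 have kapGam: "kap \<subseteq> Gam i" using kap tg_sub[OF i] by blast
 define m where "m = (\<Sum>u\<in>kap. c u * om i u)"
 have le: "c u * om i u <= c u * ip D u w" if "w \<in> LV i" "u \<in> kap" for u w
  using that Q_le[OF Vt_Q, of w u] c(1)[OF that(2)] kapGam by (auto simp: LV_def)
 have eqm: "ip D x w = m \<longleftrightarrow> kap \<subseteq> tg i w" if w: "w \<in> LV i" for w
 proof
  assume "ip D x w = m"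
  hence "(\<Sum>u\<in>kap. c u * ip D u w - c u * om i u) = 0" by (simp add: ipx m_def sum_subtractf)
  hence z: "\<forall>u\<in>kap. c u * ip D u w - c u * om i u = 0"
   using le[OF w] fin by (subst (asm) sum_nonneg_eq_0_iff) auto
  show "kap \<subseteq> tg i w"
  proof
   fix u assume u: "u \<in> kap"
   hence "c u * (ip D u w - om i u) = 0" using z by (simp add: algebra_simps)
   hence "ip D u w = om i u" using c(1)[OF u] by simp
   thus "u \<in> tg i w" using u kapGam by (auto simp: tg_def tight_def)
  qed
 next
  assume "kap \<subseteq> tg i w"
  hence "c u * ip D u w = c u * om i u" if "u \<in> kap" for u using that by (auto simp: tg_def tight_def)
  thus "ip D x w = m" unfolding ipx m_def by (intro sum.cong) auto
 qed
 have "m <= ip D x w" if "w \<in> LV i" for w unfolding ipx m_def using le[OF that] by (rule sum_mono)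
 moreover have "ip D x w0 = m" using eqm[OF w0] kap by simp
 ultimately have "\<phi> i x = m" unfolding \<phi>_def using LV_fin[OF i] w0 by (intro Min_eqI) auto
 thus "ip D x w = \<phi> i x \<longleftrightarrow> kap \<subseteq> tg i w" if "w \<in> LV i" using eqm[OF that] by simp
 have nn: "0 <= c u * ip D u (p v)" if "u \<in> kap" "v \<in> VP" for u v
  using Gam_p[of u v] that kapGam c(1)[OF that(1)] by auto
 show "ip D x (p v) = 0 \<longleftrightarrow> (\<forall>u\<in>kap. ip D u (p v) = 0)" if v: "v \<in> VP"
 proof -
  have "ip D x (p v) = 0 \<longleftrightarrow> (\<forall>u\<in>kap. c u * ip D u (p v) = 0)"
   unfolding ipx using fin nn[OF _ v] by (intro sum_nonneg_eq_0_iff) auto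
  also have "\<dots> \<longleftrightarrow> (\<forall>u\<in>kap. ip D u (p v) = 0)" using c(1) by fastforce
  finally show ?thesis .
 qed
 show "x \<in> dualC"
  unfolding c(2) using kapGam Gam_dual[OF i] c(1) by (intro dualC_sum dualC_scale) (auto simp: less_imp_le)
qed

definition bnd :: real where
 "bnd = (SOME c. 0 <= c & (\<forall>i\<le>k. \<forall>w\<in>LV i. \<forall>x\<in>dualC. \<bar>ip D x w\<bar> <= c * ip D x wbar))"

lemma bnd: "0 <= bnd" "i <= k ==> w \<in> LV i ==> x \<in> dualC ==> \<bar>ip D x w\<bar> <= bnd * ip D x wbar"
proof -
 define S where "S = (\<Union>i\<in>{..k}. LV i)"
 have finS: "finite S" using LV_fin by (auto simp: S_def)
 have "\<exists>c\<ge>0. \<forall>x\<in>dualC. \<bar>ip D x w\<bar> <= c * ip D x wbar" if "w \<in> S" for w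
  using that LV_coord by (intro ip_bounded_by_wbar) (auto simp: S_def)
 then obtain c where c: "!!w. w \<in> S ==> 0 <= c w" "!!w x. w \<in> S ==> x \<in> dualC ==> \<bar>ip D x w\<bar> <= c w * ip D x wbar"
  by metis
 have "\<bar>ip D x w\<bar> <= sum c S * ip D x wbar" if "w \<in> S" "x \<in> dualC" for w x
 proof -
  have "c w <= sum c S" using that(1) finS c(1) by (intro member_le_sum) auto
  hence "c w * ip D x wbar <= sum c S * ip D x wbar"
   using dual_wbar_nonneg[OF that(2)] by (rule mult_right_mono)
  thus ?thesis using c(2)[OF that] by simp
 qed
 moreover have "0 <= sum c S" using c(1) by (rule sum_nonneg)
 ultimately have "\<exists>c. 0 <= c & (\<forall>i\<le>k. \<forall>w\<in>LV i. \<forall>x\<in>dualC. \<bar>ip D x w\<bar> <= c * ip D x wbar)"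
  by (intro exI[of _ "sum c S"]) (auto simp: S_def)
 hence B: "0 <= bnd & (\<forall>i\<le>k. \<forall>w\<in>LV i. \<forall>x\<in>dualC. \<bar>ip D x w\<bar> <= bnd * ip D x wbar)"
  unfolding bnd_def by (rule someI_ex)
 show "0 <= bnd" using B by blast
 show "i <= k ==> w \<in> LV i ==> x \<in> dualC ==> \<bar>ip D x w\<bar> <= bnd * ip D x wbar" using B by blast
qed

text \<open>
 The translation by a multiple of \<open>wbar\<close> growing quadratically in \<open>i\<close> puts the layers in convex
 position; the linear bound \<open>bnd\<close> makes one multiple work for all directions at once.
\<close>

definition hgt :: "nat => real" where "hgt i = (2 * bnd + 1) * (real i)\<^sup>2 + bnd + 1"

text \<open>The last two coordinates are the homogenizing coordinate, \<open>0\<close> for the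
  polytope at infinity, and the number of the layer. They are added to the \<open>D\<close>
  homogeneous coordinates of the polytope, hence the two additional dimensions.\<close>

definition s :: "'v + nat \<times> vec => vec \<times> real \<times> real" where
 "s = (%n. case n of Inl v => (p v, 0, 0) | Inr (i, w) => (w + hgt i *\<^sub>R wbar, 1, real i))"

definition VS :: "('v + nat \<times> vec) set" where
 "VS = Inl ` VP \<union> Inr ` (SIGMA i:{..k}. LV i)"

lemma s_simps: "s (Inl v) = (p v, 0, 0)" "s (Inr (i, w)) = (w + hgt i *\<^sub>R wbar, 1, real i)"
 by (simp_all add: s_def)

lemma finite_VS: "finite VS"
 using finVP LV_fin by (auto simp: VS_def)

lemma VS_cases:
 assumes "n \<in> VS"
 obtains v where "n = Inl v" "v \<in> VP" | i w where "n = Inr (i, w)" "i <= k" "w \<in> LV i"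
 using assms by (auto simp: VS_def)

lemma VS_iff [simp]: "Inl v \<in> VS \<longleftrightarrow> v \<in> VP" "Inr (i, w) \<in> VS \<longleftrightarrow> i <= k & w \<in> LV i"
 by (auto simp: VS_def)

text \<open>The face that \<open>x\<close> exposes in the gap between the layers \<open>i\<close>
  and \<open>i + 1\<close>.\<close>

definition Phi :: "nat => vec => ('v + nat \<times> vec) set" where
 "Phi i x = {n\<in>VS. case n of Inl v => ip D x (p v) = 0 | Inr (j, w) => (j = i | j = i + 1) & ip D x w = \<phi> j x}"

lemma Phi_iff [simp]: "Inl v \<in> Phi i x \<longleftrightarrow> v \<in> VP & ip D x (p v) = 0"
 "Inr (j, w) \<in> Phi i x \<longleftrightarrow> j <= k & w \<in> LV j & (j = i | j = i + 1) & ip D x w = \<phi> j x"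
 by (auto simp: Phi_def)

definition lay :: "nat => ('v + nat \<times> vec) set" where
 "lay i = Inl ` VP \<union> Inr ` ({i} \<times> LV i)"

definition J :: "nat => vec set => ('v + nat \<times> vec) set" where
 "J i kap = {n\<in>lay i. case n of Inl v => (\<forall>u\<in>kap. ip D u (p v) = 0) | Inr (j, w) => kap \<subseteq> tg i w}"

lemma lay_iff [simp]: "Inl v \<in> lay i \<longleftrightarrow> v \<in> VP" "Inr (j, w) \<in> lay i \<longleftrightarrow> j = i & w \<in> LV i"
 by (auto simp: lay_def)

lemma J_iff [simp]: "Inl v \<in> J i kap \<longleftrightarrow> v \<in> VP & (\<forall>u\<in>kap. ip D u (p v) = 0)"
 "Inr (j, w) \<in> J i kap \<longleftrightarrow> j = i & w \<in> LV i & kap \<subseteq> tg i w"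
 by (auto simp: J_def)

lemma lay_VS: "i <= k ==> lay i \<subseteq> VS"
 by (auto simp: lay_def)

lemma J_lay: "J i kap \<subseteq> lay i" by (auto simp: J_def)

lemma J_anti: "kap \<subseteq> kap' ==> J i kap' \<subseteq> J i kap"
 unfolding J_def by (auto split: sum.splits) blast

lemma Phi_VS: "Phi i x \<subseteq> VS" by (auto simp: Phi_def)

lemma linear_comp3: "linear (%y :: vec \<times> real \<times> real. ip D x (fst y) - (a * fst (snd y) + b * snd (snd y)))"
 by (intro linearI) (auto simp: ip_add_right ip_scale_right algebra_simps)

text \<open>\<open>f j\<close> is the support value of the raised layer \<open>j\<close> and
  strictly convex in \<open>j\<close>. The chord through \<open>f i\<close> and
  \<open>f (i + 1)\<close>, subtracted from \<open>ip D x\<close>, gives a functional whose zeros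
  off infinity lie on these two layers.\<close>

lemma facial_Phi:
 assumes i: "i < k" and x: "x \<in> dualC" "x ~= 0"
 shows "facial s VS (Phi i x)"
proof -
 define X where "X = ip D x wbar"
 have X: "X > 0" using dual_wbar_pos[OF x] by (simp add: X_def)
 define f where "f j = \<phi> j x + hgt j * X" for j
 have \<phi>b: "\<bar>\<phi> j x\<bar> <= bnd * X" if "j <= k" for j
 proof -
  obtain w where "w \<in> LV j" "ip D x w = \<phi> j x" using \<phi>_attained[OF \<open>j <= k\<close>] by blast
  thus ?thesis using bnd(2)[OF \<open>j <= k\<close> _ x(1), of w] by (simp add: X_def)
 qed
 have conv: "2 * f j < f (j - 1) + f (j + 1)" if j: "0 < j" "j < k" for j
 proof -
  \<comment> \<open>The second difference of \<open>hgt\<close> is \<open>4 * bnd + 2\<close>, and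
    that of \<phi> is at least \<open>- 4 * bnd * X\<close>; the remaining \<open>2\<close> gives
    strictness.\<close>
  have "hgt (j - 1) + hgt (j + 1) - 2 * hgt j = 2 * (2 * bnd + 1)"
   using j(1) by (cases j) (auto simp: hgt_def algebra_simps power2_eq_square)
  hence "(hgt (j - 1) + hgt (j + 1) - 2 * hgt j) * X = (2 * (2 * bnd + 1)) * X" by (rule arg_cong)
  hence h: "hgt (j - 1) * X + hgt (j + 1) * X - 2 * (hgt j * X) = 4 * (bnd * X) + 2 * X"
   by (simp add: algebra_simps)
  have "\<phi> (j - 1) x >= - (bnd * X)" "\<phi> (j + 1) x >= - (bnd * X)" "\<phi> j x <= bnd * X"
   using \<phi>b[of "j - 1"] \<phi>b[of "j + 1"] \<phi>b[of j] j by linarith+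
  thus ?thesis using h X unfolding f_def distrib_left by linarith
 qed
 obtain a b where ab: "a + b * real i = f i" "a + b * real (i + 1) = f (i + 1)"
  "!!j. j <= k ==> j ~= i ==> j ~= i + 1 ==> a + b * real j < f j"
  using convex_seq_line[of k f i] conv i by blast
 define F where "F = (%y :: vec \<times> real \<times> real. ip D x (fst y) - (a * fst (snd y) + b * snd (snd y)))"
 have Fl: "F (s (Inl v)) = ip D x (p v)" for v by (simp add: F_def s_simps)
 have Fr: "F (s (Inr (j, w))) = (ip D x w - \<phi> j x) + (f j - (a + b * real j))" for j w
  by (simp add: F_def s_simps f_def X_def ip_add_right ip_scale_right)
 show ?thesis
 proof (rule facialI[of F])
  show "linear F" unfolding F_def by (rule linear_comp3)
  show "0 <= F (s n)" if "n \<in> VS" for n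
   using that
  proof (cases rule: VS_cases)
   case (1 v) thus ?thesis using x(1) by (simp add: Fl dualC_def)
  next
   case (2 j w)
   have "0 <= f j - (a + b * real j)" using ab 2(2) by (cases "j = i"; cases "j = i + 1") (auto intro: less_imp_le)
   thus ?thesis using \<phi>_le[OF 2(2,3), of x] 2 by (simp add: Fr)
  qed
  show "Phi i x = {n \<in> VS. F (s n) = 0}"
  proof (intro set_eqI iffI)
   fix n assume n: "n \<in> Phi i x"
   hence "n \<in> VS" using Phi_VS by blast
   thus "n \<in> {n \<in> VS. F (s n) = 0}"
    using n by (cases rule: VS_cases) (use ab in \<open>auto simp: Fl Fr\<close>)
  next
   fix n assume n: "n \<in> {n \<in> VS. F (s n) = 0}"
   hence "n \<in> VS" by simp
   thus "n \<in> Phi i x"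
   proof (cases rule: VS_cases)
    case (1 v) thus ?thesis using n by (simp add: Fl)
   next
    case (2 j w)
    have z: "(ip D x w - \<phi> j x) + (f j - (a + b * real j)) = 0" using n 2 by (simp add: Fr)
    have "\<phi> j x <= ip D x w" using \<phi>_le[OF 2(2,3)] .
    hence "j = i | j = i + 1" using ab(3)[OF 2(2)] z by fastforce
    thus ?thesis using z ab 2 by (elim disjE) simp_all
   qed
  qed
 qed
qed

lemma facial_base: "facial s VS (Inl ` VP)"
proof (rule facialI[of "%y. fst (snd y)"])
 show "linear (%y :: vec \<times> real \<times> real. fst (snd y))" by (intro linearI) auto
 show "0 <= fst (snd (s n))" if "n \<in> VS" for n using that by (cases rule: VS_cases) (auto simp: s_simps)
 show "Inl ` VP = {n \<in> VS. fst (snd (s n)) = 0}"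
  by (auto simp: s_simps elim: VS_cases)
qed

lemma facial_lay_0: "facial s VS (lay 0)"
proof (rule facialI[of "%y. snd (snd y)"])
 show "linear (%y :: vec \<times> real \<times> real. snd (snd y))" by (intro linearI) auto
 show "0 <= snd (snd (s n))" if "n \<in> VS" for n using that by (cases rule: VS_cases) (auto simp: s_simps)
 show "lay 0 = {n \<in> VS. snd (snd (s n)) = 0}"
  by (auto simp: s_simps lay_def elim!: VS_cases)
qed

lemma facial_lay_k: "facial s VS (lay k)"
proof (rule facialI[of "%y. real k * fst (snd y) - snd (snd y)"])
 show "linear (%y :: vec \<times> real \<times> real. real k * fst (snd y) - snd (snd y))"
  by (intro linearI) (auto simp: algebra_simps)
 show "0 <= real k * fst (snd (s n)) - snd (snd (s n))" if "n \<in> VS" for n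
  using that by (cases rule: VS_cases) (auto simp: s_simps)
 show "lay k = {n \<in> VS. real k * fst (snd (s n)) - snd (snd (s n)) = 0}"
  by (auto simp: s_simps lay_def elim!: VS_cases)
qed

lemma Phi_lay:
 assumes "i <= k" "w0 \<in> LV i" "kap \<subseteq> tg i w0" "posc kap x" "j = i | i = j + 1"
 shows "Phi j x \<inter> lay i = J i kap"
proof (intro set_eqI)
 fix n
 note c = cell_facts[OF assms(1-4)]
 show "n \<in> Phi j x \<inter> lay i \<longleftrightarrow> n \<in> J i kap"
 proof (cases n)
  case (Inl v) thus ?thesis using c(2) by auto
 next
  case (Inr y)
  obtain l w where "y = (l, w)" by (cases y)
  thus ?thesis using Inr c(1)[of w] assms(1,5) by auto
 qed
qed

lemma span_ne_0:
 assumes "i <= k" "w0 \<in> LV i" "kap \<subseteq> tg i w0" "posc kap x" "kap ~= {}"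
 shows "x ~= 0"
proof -
 obtain u where u: "u \<in> kap" using assms(5) by blast
 hence "u \<in> dualC" "u ~= 0" using Gam_dual[OF assms(1)] assms(3) tg_sub[OF assms(1)] by blast+
 hence "\<not> (\<forall>v\<in>VP. ip D u (p v) = 0)"
  using dual_wbar_pos[of u] unfolding ip_wbar by (metis less_irrefl sum.neutral)
 then obtain v where "v \<in> VP" "ip D u (p v) ~= 0" by blast
 hence "ip D x (p v) ~= 0" using cell_facts(2)[OF assms(1-4), of v] u by blast
 thus ?thesis by auto
qed

text \<open>A layer in the middle is the common part of the gaps below and above it, so the face is
  the intersection of two adjacent \<open>Phi\<close>; the bottom and top layers are facial sets
  themselves. As \<open>x\<close> serves the sum over \<open>kap\<close>.\<close>

lemma facial_J:
 assumes "i <= k" "w0 \<in> LV i" "kap \<subseteq> tg i w0" "kap ~= {}"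
 shows "facial s VS (J i kap)"
proof -
 define x where "x = (\<Sum>u\<in>kap. u)"
 have x: "posc kap x" using posc_sum by (simp add: x_def)
 have xd: "x \<in> dualC" "x ~= 0" using cell_facts(3)[OF assms(1-3) x] span_ne_0[OF assms(1-3) x assms(4)] by auto
 have lay: "Phi j x \<inter> lay i = J i kap" if "j = i | i = j + 1" for j using Phi_lay[OF assms(1-3) x that] .
 consider "i = 0" | "i = k" | "0 < i" "i < k" using assms(1) by linarith
 thus ?thesis
 proof cases
  case 1
  thus ?thesis using facial_Int[OF facial_Phi[of 0 x] facial_lay_0] lay[of 0] k1 xd by simp
 next
  case 2
  thus ?thesis using facial_Int[OF facial_Phi[of "k - 1" x] facial_lay_k] lay[of "k - 1"] k1 xd by simp
 next
  case 3
  have "Phi (i - 1) x \<inter> Phi i x = J i kap"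
  proof -
   have "Phi (i - 1) x \<inter> Phi i x \<subseteq> lay i"
   proof
    fix n assume n: "n \<in> Phi (i - 1) x \<inter> Phi i x"
    hence "n \<in> VS" using Phi_VS by blast
    thus "n \<in> lay i" using n 3 by (cases rule: VS_cases) auto
   qed
   thus ?thesis using lay[of i] lay[of "i - 1"] 3 by auto
  qed
  thus ?thesis using facial_Int[OF facial_Phi[of "i - 1" x] facial_Phi[of i x]] 3 xd by simp
 qed
qed

lemma facial_sub_base: "B \<subseteq> VP ==> facial s VS (Inl ` B) \<longleftrightarrow> facial p VP B"
proof -
 assume B: "B \<subseteq> VP"
 have "facial s VS (Inl ` B) \<longleftrightarrow> facial s (Inl ` VP) (Inl ` B)"
  using facial_sub[OF finite_VS facial_base, of "Inl ` B"] B by auto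
 also have "\<dots> \<longleftrightarrow> facial (%v. s (Inl v)) VP B" using B by (intro facial_image) auto
 also have "\<dots> \<longleftrightarrow> facial p VP B"
 proof
  assume "facial (%v. s (Inl v)) VP B"
  thus "facial p VP B"
   by (rule facial_mono_linear[where T = "%w. (w, 0, 0)" and c = "%_. 1"])
     (auto simp: s_simps intro!: linearI)
 next
  assume "facial p VP B"
  thus "facial (%v. s (Inl v)) VP B"
   by (rule facial_mono_linear[where T = fst and c = "%_. 1"]) (auto simp: s_simps linear_fst)
 qed
 finally show ?thesis .
qed

text \<open>The tight normals at a vertex of a layer span, so they cut out this vertex
  alone.\<close>

lemma facial_single:
 assumes "n \<in> VS"
 shows "facial s VS {n}"
 using assms
proof (cases rule: VS_cases)
 case (1 v)
 thus ?thesis using facial_sub_base[of "{v}"] single_p by simp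
next
 case (2 i w)
 have t0: "tg i w ~= {}" using tg_card[OF 2(2,3)] D3 by auto
 have "J i (tg i w) = {n}"
 proof (intro set_eqI)
  fix m
  show "m \<in> J i (tg i w) \<longleftrightarrow> m \<in> {n}"
  proof (cases m)
   case (Inl v)
   have "\<not> (\<forall>u\<in>tg i w. ip D u (p v) = 0)" if "v \<in> VP"
   proof
    assume "\<forall>u\<in>tg i w. ip D u (p v) = 0"
    hence z: "p v = 0" using ip_eq_on_spanning[OF tg_span[OF 2(2,3)] p_coord[OF that]] by blast
    obtain f where f: "linear f" "!!v. v \<in> VP ==> v ~: {} ==> 0 < (f (p v) :: real)"
     using empty_p by (elim facialE) blast
    thus False using that z by (metis empty_iff less_irrefl linear_0)
   qed
   thus ?thesis using Inl 2 by auto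
  next
   case (Inr y)
   obtain l z where "y = (l, z)" by (cases y)
   thus ?thesis using Inr 2 tg_inj[OF 2(2,3)] by auto
  qed
 qed
 thus ?thesis using facial_J[OF 2(2,3) order_refl t0] by simp
qed

lemma dim_s_le: "dim (s ` VS) <= D + 2"
proof -
 define b :: "nat => vec \<times> real \<times> real"
  where "b = (%j. if j < D then (axis' j, 0, 0) else if j = D then (0, 1, 0) else (0, 0, 1))"
 have "(w, a, c) \<in> span (b ` {..<D + 2})" if "w \<in> csp D" for w a c
 proof -
  have "(w, a, c) = (\<Sum>j<D. lkp w j *\<^sub>R b j) + a *\<^sub>R b D + c *\<^sub>R b (D + 1)"
   using csp_expand[OF that] by (simp add: b_def prod_eq_iff fst_sum snd_sum)
  also have "\<dots> \<in> span (b ` {..<D + 2})"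
   by (intro span_add span_sum span_scale span_base) auto
  finally show ?thesis .
 qed
 moreover have "fst (s n) \<in> csp D" if "n \<in> VS" for n
  using that
 proof (cases rule: VS_cases)
  case (1 v) thus ?thesis by (simp add: s_simps p_coord)
 next
  case (2 i w)
  thus ?thesis using LV_coord wbar_coord subspace_csp by (simp add: s_simps subspace_add subspace_scale)
 qed
 ultimately have "s ` VS \<subseteq> span (b ` {..<D + 2})" by (metis (no_types, lifting) image_subsetI prod.collapse)
 hence "dim (s ` VS) <= card (b ` {..<D + 2})" by (intro dim_le_card_fin) auto
 also have "\<dots> <= D + 2" using card_image_le[of "{..<D + 2}" b] by simp
 finally show ?thesis .
qed

end

section \<open>Realizations of a stack\<close>

text \<open>\<open>s'\<close> stands for the homogenized vertices of an arbitrary realization. Its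
  facial sets are all that is known, and the ambient space is left open.\<close>

locale stack_realization = stack VP p D k Gam om
 for VP :: "'v set" and p and D k and Gam :: "nat => vec set" and om +
 fixes s' :: "'v + nat \<times> vec => 'x::real_vector"
 assumes same: "!!B. facial s' VS B \<longleftrightarrow> facial s VS B"
begin

definition d :: "('v + nat \<times> vec) set => nat" where "d A = dim (s' ` A)"

lemma empty_facial: "facial s VS {}"
 using facial_sub_base[of "{}"] empty_p by simp

lemma d_VS_le: "d VS <= D + 2"
 using facial_dim_eq[of VS s' s] same empty_facial finite_VS dim_s_le by (simp add: d_def)

lemma d_less: "facial s VS A ==> A \<subset> B ==> B \<subseteq> VS ==> d A < d B"
 unfolding d_def using facial_dim_less[OF finite_VS] same by blast

lemma span_mem: "facial s VS A ==> n \<in> VS ==> C \<subseteq> A ==> s' n \<in> span (s' ` C) ==> n \<in> A"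
 using facial_span_mem[of s' VS A n C] same by blast

lemma finite_img: "A \<subseteq> VS ==> finite (s' ` A)"
 using finite_VS finite_subset by blast

lemma J_VS: "i <= k ==> J i kap \<subseteq> VS"
 using J_lay lay_VS by blast

lemma neighbour_exists:
 assumes i: "i <= k" and w: "w \<in> LV i" "u \<in> tg i w"
 shows "\<exists>n. n \<in> J i (tg i w - {u}) & n ~: J i {u}"
proof -
 interpret layer VP p D "Gam i" "om i" using layers[OF i] .
 have wV: "w \<in> Vt" "u \<in> tight w" using w by (simp_all add: LV_def tg_def)
 show ?thesis
  using edge[OF wV]
 proof (elim disjE exE bexE conjE)
  fix t assume "w + t *\<^sub>R dvec w u \<in> Vt" "tight w - {u} \<subseteq> tight (w + t *\<^sub>R dvec w u)" "u ~: tight (w + t *\<^sub>R dvec w u)"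
  thus ?thesis by (intro exI[of _ "Inr (i, w + t *\<^sub>R dvec w u)"]) (simp add: LV_def tg_def)
 next
  fix v t assume v: "v \<in> VP" "t > 0" "p v = t *\<^sub>R dvec w u"
  hence "ip D x (p v) = 0" if "x \<in> tg i w - {u}" for x
   using dvec(2)[OF wV, of x] that by (simp add: ip_scale_right tg_def)
  moreover have "ip D u (p v) ~= 0" using v dvec(3)[OF wV] by (simp add: ip_scale_right)
  ultimately show ?thesis using v(1) by (intro exI[of _ "Inl v"]) simp
 qed
qed

text \<open>The far end of the edge at \<open>w\<close> that leaves \<open>u\<close>: a vertex of
  the layer, or a ray at infinity.\<close>

definition nbr :: "nat => vec => vec => 'v + nat \<times> vec" where
 "nbr i w u = (SOME n. n \<in> J i (tg i w - {u}) & n ~: J i {u})"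

lemma nbr:
 assumes "i <= k" "w \<in> LV i" "u \<in> tg i w"
 shows "nbr i w u \<in> J i (tg i w - {u})" "nbr i w u ~: J i {u}"
 using someI_ex[OF neighbour_exists[OF assms]] by (simp_all add: nbr_def)

lemma J_insert_less:
 assumes "i <= k" "w \<in> LV i" "insert u kap \<subseteq> tg i w" "u ~: kap"
 shows "J i (insert u kap) \<subset> J i kap"
proof -
 have "nbr i w u \<in> J i kap"
  using nbr(1)[OF assms(1,2), of u] J_anti[of kap "tg i w - {u}" i] assms(3,4) by blast
 moreover have "nbr i w u ~: J i (insert u kap)"
  using nbr(2)[OF assms(1,2), of u] J_anti[of "{u}" "insert u kap" i] assms(3) by blast
 ultimately show ?thesis using J_anti[of kap "insert u kap" i] by blast
qed

text \<open>Strict chains of faces from both ends. From above, the whole has dimension at most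
  \<open>D + 2\<close>, \<open>Phi\<close> less, and each further normal lowers it again; from
  below, the \<open>D\<close> normals at \<open>w\<close> still leave a nonempty face. The two
  bounds meet.\<close>

lemma d_J:
 assumes i: "i <= k" and w: "w \<in> LV i" and kap: "kap \<subseteq> tg i w" "kap ~= {}"
 shows "d (J i kap) + card kap = D + 1"
proof (rule antisym)
 have fin: "finite kap" using kap(1) tg_fin[OF i] finite_subset by blast
 show "d (J i kap) + card kap <= D + 1"
  using fin kap(2,1)
 proof (induction rule: finite_ne_induct)
  case (singleton x)
  have x: "x \<in> dualC" "x ~= 0" using Gam_dual[OF i] singleton tg_sub[OF i] by blast+
  \<comment> \<open>A gap bordering on layer \<open>i\<close>, with \<open>j'\<close> as its other
    layer. A vertex there shows that \<open>J i {x}\<close> is a proper part of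
    \<open>Phi j x\<close>.\<close>
  define j where "j = (if i < k then i else i - 1)"
  define j' where "j' = (if i < k then i + 1 else i - 1)"
  have j: "j < k" "j = i | i = j + 1" "j' <= k" "j' = j | j' = j + 1" "j' ~= i"
   using i k1 by (auto simp: j_def j'_def)
  have lay: "Phi j x \<inter> lay i = J i {x}" using Phi_lay[OF i w singleton posc_single j(2)] .
  obtain z where z: "z \<in> LV j'" "ip D x z = \<phi> j' x" using \<phi>_attained[OF j(3)] by blast
  have "Inr (j', z) \<in> Phi j x" "Inr (j', z) ~: J i {x}" using z j by auto
  hence "J i {x} \<subset> Phi j x" using lay by blast
  hence "d (J i {x}) < d (Phi j x)"
   using facial_J[OF i w singleton] Phi_VS by (intro d_less) auto
  moreover have "d (Phi j x) < d VS"
  proof (rule d_less[OF facial_Phi[OF j(1) x]])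
   obtain v where "v \<in> VP" "ip D x (p v) ~= 0"
    using dual_wbar_pos[OF x] unfolding ip_wbar by (metis less_irrefl sum.neutral)
   hence "Inl v \<in> VS" "Inl v ~: Phi j x" by auto
   thus "Phi j x \<subset> VS" using Phi_VS by blast
  qed simp
  ultimately show ?case using d_VS_le by simp
 next
  case (insert u F)
  have "d (J i (insert u F)) < d (J i F)"
   using J_insert_less[OF i w insert.prems insert.hyps(3)] facial_J[OF i w insert.prems] J_VS[OF i]
   by (intro d_less) auto
  thus ?case using insert by simp
 qed
 have "D + 1 <= d (J i kap) + card kap" if "kap \<subseteq> tg i w" "kap ~= {}" for kap
  using that
 proof (induction "D - card kap" arbitrary: kap rule: less_induct)
  case less
  have fin: "finite kap" using less.prems(1) tg_fin[OF i] finite_subset by blast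
  show ?case
  proof (cases "kap = tg i w")
   case True
   have "facial s' VS {}" using same empty_facial by simp
   hence "d {} < d (J i kap)"
   proof (intro d_less[OF empty_facial _ J_VS[OF i]] psubsetI)
    have "Inr (i, w) \<in> J i kap" using w True by simp
    thus "{} ~= J i kap" by blast
   qed simp
   thus ?thesis using True tg_card[OF i w] by simp
  next
   case False
   then obtain u where u: "u \<in> tg i w" "u ~: kap" using less.prems(1) by blast
   have sub: "insert u kap \<subseteq> tg i w" using u less.prems by blast
   hence le: "card (insert u kap) <= D" using tg_card[OF i w] tg_fin[OF i] card_mono by metis
   have c: "card (insert u kap) = Suc (card kap)" using u fin by simp
   have "D + 1 <= d (J i (insert u kap)) + card (insert u kap)"
    using c le sub by (intro less.hyps) auto
   moreover have "d (J i (insert u kap)) < d (J i kap)"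
    using J_insert_less[OF i w sub u(2)] facial_J[OF i w sub] J_VS[OF i] by (intro d_less) auto
   ultimately show ?thesis using c by simp
  qed
 qed
 thus "D + 1 <= d (J i kap) + card kap" using kap by blast
qed

lemma span_eqI:
 assumes "A \<subseteq> VS" "finite X" "X \<subseteq> span (s' ` A)" "d A <= dim X"
 shows "span X = span (s' ` A)"
 using assms finite_img[OF assms(1)] by (intro span_eq_if_dim) (auto simp: d_def)

lemma single_span: "n \<in> VS ==> dim {s' n} = 1"
proof -
 assume n: "n \<in> VS"
 have "d {} < d {n}" using n by (intro d_less empty_facial) auto
 moreover have "dim {s' n} <= card {s' n}" by (intro dim_le_card_fin) (auto intro: span_base)
 ultimately show ?thesis by (simp add: d_def)
qed

lemma span_edge:
 assumes i: "i <= k" and w: "w \<in> LV i" and u: "u \<in> tg i w"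
 shows "span {s' (Inr (i, w)), s' (nbr i w u)} = span (s' ` J i (tg i w - {u}))"
proof (rule span_eqI[OF J_VS[OF i]])
 have t0: "tg i w ~= {}" using u by auto
 have c: "card (tg i w - {u}) = D - 1" using tg_card[OF i w] u tg_fin[OF i] by simp
 hence ne: "tg i w - {u} ~= {}" using D3 by (intro notI) simp
 have "d (J i (tg i w - {u})) = 2" using d_J[OF i w _ ne] c D3 by auto
 moreover have "s' (nbr i w u) ~: span {s' (Inr (i, w))}"
 proof
  assume "s' (nbr i w u) \<in> span {s' (Inr (i, w))}"
  hence "nbr i w u \<in> J i (tg i w)"
   using w nbr(1)[OF i w u] J_VS[OF i]
   by (intro span_mem[OF facial_J[OF i w order_refl t0], of _ "{Inr (i, w)}"]) auto
  thus False using nbr(2)[OF i w u] J_anti[of "{u}" "tg i w" i] u by blast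
 qed
 hence "dim {s' (nbr i w u), s' (Inr (i, w))} = 2"
  using dim_insert_fin[of "{s' (Inr (i, w))}"] single_span[of "Inr (i, w)"] i w by simp
 ultimately show "d (J i (tg i w - {u})) <= dim {s' (Inr (i, w)), s' (nbr i w u)}" by (simp add: insert_commute)
 show "{s' (Inr (i, w)), s' (nbr i w u)} \<subseteq> span (s' ` J i (tg i w - {u}))"
  using nbr(1)[OF i w u] w by (auto intro!: span_base)
qed simp

text \<open>Needed for the walk along edges: an edge at the next vertex lies in a two-dimensional
  face through the present one, hence in the span of two edges already known.\<close>

lemma span_two_face:
 assumes i: "i <= k" and w: "w \<in> LV i" and u: "u \<in> tg i w" "m \<in> tg i w" "u ~= m"
 shows "span {s' (Inr (i, w)), s' (nbr i w u), s' (nbr i w m)} = span (s' ` J i (tg i w - {u, m}))"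
proof (rule span_eqI[OF J_VS[OF i]])
 have c: "card (tg i w - {u, m}) = D - 2" using tg_card[OF i w] u tg_fin[OF i] by (simp add: card_Diff_subset)
 hence ne: "tg i w - {u, m} ~= {}" using D3 by (intro notI) simp
 have d3: "d (J i (tg i w - {u, m})) = 3" using d_J[OF i w _ ne] c D3 by auto
 have neu: "tg i w - {u} ~= {}" using u by auto
 have du: "d (J i (tg i w - {u})) = 2"
  using d_J[OF i w _ neu] tg_card[OF i w] u(1) tg_fin[OF i] D3 by auto
 have "s' (nbr i w m) ~: span {s' (Inr (i, w)), s' (nbr i w u)}"
 proof
  assume "s' (nbr i w m) \<in> span {s' (Inr (i, w)), s' (nbr i w u)}"
  hence "nbr i w m \<in> J i (tg i w - {u})"
   using w nbr(1)[OF i w u(1)] nbr(1)[OF i w u(2)] J_VS[OF i]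
   by (intro span_mem[OF facial_J[OF i w _ neu], of _ "{Inr (i, w), nbr i w u}"]) auto
  thus False using nbr(2)[OF i w u(2)] J_anti[of "{m}" "tg i w - {u}" i] u by blast
 qed
 moreover have "dim {s' (Inr (i, w)), s' (nbr i w u)} = 2"
  using span_edge[OF i w u(1)] du by (metis d_def dim_span)
 ultimately have "dim {s' (nbr i w m), s' (Inr (i, w)), s' (nbr i w u)} = 3"
  using dim_insert_fin[of "{s' (Inr (i, w)), s' (nbr i w u)}" "s' (nbr i w m)"] by simp
 thus "d (J i (tg i w - {u, m})) <= dim {s' (Inr (i, w)), s' (nbr i w u), s' (nbr i w m)}"
  using d3 by (simp add: insert_commute)
 show "{s' (Inr (i, w)), s' (nbr i w u), s' (nbr i w m)} \<subseteq> span (s' ` J i (tg i w - {u, m}))"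
  using nbr(1)[OF i w u(1)] nbr(1)[OF i w u(2)] w J_anti[of "tg i w - {u, m}" "tg i w - {u}" i]
   J_anti[of "tg i w - {u, m}" "tg i w - {m}" i]
  by (auto intro!: span_base)
qed simp

text \<open>Each layer, together with the polytope at infinity, stays flat: walk along the edges of the layer.\<close>

lemma d_lay:
 assumes i: "i <= k"
 shows "d (lay i) = D + 1"
proof -
 interpret lyr: layer VP p D "Gam i" "om i" using layers[OF i] .
 have VT: "lyr.Vt = LV i" "lyr.tight = tg i" by (auto simp: LV_def tg_def)
 obtain w0 where w0: "w0 \<in> LV i" using LV_ne[OF i] by blast
 \<comment> \<open>The vertex \<open>w0\<close> and its \<open>D\<close> neighbours; their span
   \<open>L\<close> will contain the layer.\<close>
 define X where "X = insert (s' (Inr (i, w0))) ((%u. s' (nbr i w0 u)) ` tg i w0)"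
 define L where "L = span X"
 have subL: "subspace L" by (simp add: L_def)
 have finX: "finite X" using tg_fin[OF i] by (simp add: X_def)
 have cX: "card X <= D + 1"
  using card_image_le[OF tg_fin[OF i], of "%u. s' (nbr i w0 u)" w0] tg_card[OF i w0] card_insert_le_m1[of "D + 1"]
  by (auto simp: X_def intro: order_trans[OF card_insert_le_m1])
 define good where "good w \<longleftrightarrow> s' (Inr (i, w)) \<in> L & (\<forall>u\<in>tg i w. s' ` J i (tg i w - {u}) \<subseteq> L)" for w
 have g0: "good w0"
  unfolding good_def
 proof (intro conjI ballI)
  show "s' (Inr (i, w0)) \<in> L" by (simp add: L_def X_def span_base)
  fix u assume u: "u \<in> tg i w0"
  have "span {s' (Inr (i, w0)), s' (nbr i w0 u)} \<subseteq> L"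
   unfolding L_def using u by (intro span_mono) (auto simp: X_def)
  thus "s' ` J i (tg i w0 - {u}) \<subseteq> L"
   using span_edge[OF i w0 u] span_superset by blast
 qed
 have good: "good w" if "w \<in> LV i" for w
 proof (rule lyr.vertex_connected[unfolded VT, where G = good, OF w0 g0 _ that])
  fix w u t assume w: "w \<in> LV i" "good w" and u: "u \<in> tg i w"
   and w': "w + t *\<^sub>R lyr.dvec w u \<in> LV i" "tg i w - {u} \<subseteq> tg i (w + t *\<^sub>R lyr.dvec w u)"
    "u ~: tg i (w + t *\<^sub>R lyr.dvec w u)"
  define y where "y = w + t *\<^sub>R lyr.dvec w u"
  note y = w'[folded y_def]
  have Jm: "s' ` J i (tg i w - {m}) \<subseteq> L" if "m \<in> tg i w" for m using w(2) that by (simp add: good_def)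
  show "good (w + t *\<^sub>R lyr.dvec w u)"
   unfolding y_def[symmetric] good_def
  proof (intro conjI ballI)
   have "Inr (i, y) \<in> J i (tg i w - {u})" using y by simp
   thus "s' (Inr (i, y)) \<in> L" using Jm[OF u] by blast
   fix m assume m: "m \<in> tg i y"
   \<comment> \<open>If \<open>m\<close> was tight at \<open>w\<close>, the new edge lies in the
     two-dimensional face that omits \<open>u\<close> and \<open>m\<close>, spanned by edges at
     \<open>w\<close>. Otherwise \<open>m\<close> is the constraint met on arrival, and the new edge
     is the one just walked.\<close>
   show "s' ` J i (tg i y - {m}) \<subseteq> L"
   proof (cases "m \<in> tg i w")
    case True
    hence mu: "m ~= u" using m y(3) by auto
    have "tg i w - {u, m} \<subseteq> tg i y - {m}" using y(2) by blast
    hence "s' ` J i (tg i y - {m}) \<subseteq> s' ` J i (tg i w - {u, m})" using J_anti by blast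
    also have "\<dots> \<subseteq> span {s' (Inr (i, w)), s' (nbr i w u), s' (nbr i w m)}"
     unfolding span_two_face[OF i w(1) u True mu[symmetric]] by (rule span_superset)
    also have "\<dots> \<subseteq> L"
     using subL nbr(1)[OF i w(1) u] nbr(1)[OF i w(1) True] Jm[OF u] Jm[OF True] w(2)
     by (intro span_minimal) (auto simp: good_def)
    finally show ?thesis .
   next
    case False
    have "tg i w - {u} \<subseteq> tg i y - {m}" using y(2) False by blast
    hence "J i (tg i y - {m}) \<subseteq> J i (tg i w - {u})" by (rule J_anti)
    thus ?thesis using Jm[OF u] by blast
   qed
  qed
 qed
 have "s' n \<in> L" if n: "n \<in> lay i" for n
 proof (cases n)
  case (Inl v)
  hence v: "v \<in> VP" using n by simp
  obtain w u t where w: "w \<in> LV i" "u \<in> tg i w" "t > 0" "p v = t *\<^sub>R lyr.dvec w u"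
   using lyr.ray_at_some_vertex[OF v] LV_ne[OF i] unfolding VT by blast
  have "ip D x (p v) = 0" if "x \<in> tg i w - {u}" for x
   using lyr.dvec(2)[of w u x] w that unfolding VT by (simp add: ip_scale_right)
  hence "n \<in> J i (tg i w - {u})" using Inl v by simp
  thus ?thesis using good[OF w(1)] w(2) unfolding good_def by blast
 next
  case (Inr y)
  then obtain w where "n = Inr (i, w)" "w \<in> LV i" using n by (cases y) auto
  thus ?thesis using good by (simp add: good_def)
 qed
 hence "d (lay i) <= card X"
  unfolding d_def L_def using finX by (intro dim_le_card_fin) auto
 moreover obtain u where u: "u \<in> tg i w0" using tg_card[OF i w0] D3 by fastforce
 have us: "{u} \<subseteq> tg i w0" "{u} ~= {}" using u by auto
 have "d (J i {u}) < d (lay i)"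
  using nbr[OF i w0 u] J_lay lay_VS[OF i] by (intro d_less facial_J[OF i w0 us]) blast+
 ultimately show ?thesis using cX d_J[OF i w0 us] by simp
qed

lemma base_same: "facial (%v. s' (Inl v)) VP B \<longleftrightarrow> facial p VP B"
proof (cases "B \<subseteq> VP")
 case True
 have base': "facial s' VS (Inl ` VP)" using same facial_base by simp
 have "facial (%v. s' (Inl v)) VP B \<longleftrightarrow> facial s' (Inl ` VP) (Inl ` B)"
  using facial_image[of Inl VP B s'] True by simp
 also have "\<dots> \<longleftrightarrow> facial s' VS (Inl ` B)"
  using facial_sub[OF finite_VS base', of "Inl ` B"] True by auto
 also have "\<dots> \<longleftrightarrow> facial p VP B" using same facial_sub_base[OF True] by simp
 finally show ?thesis .
qed (auto dest: facial_subset)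

lemma d_base: "d (Inl ` VP) = D"
 using facial_dim_eq[OF finVP base_same] base_same empty_p dim_csp_set[OF span_p]
 by (simp add: d_def image_image)

section \<open>Functionals of the facets of a realization, compared along common layers\<close>

definition fnl :: "('v + nat \<times> vec) set => 'x => real" where
 "fnl A = (SOME f. linear f & (\<forall>n\<in>VS. 0 <= f (s' n)) & A = {n\<in>VS. f (s' n) = 0})"

lemma fnl:
 assumes "facial s VS A"
 shows "linear (fnl A)" "n \<in> VS ==> fnl A (s' n) = 0 \<longleftrightarrow> n \<in> A" "n \<in> VS ==> n ~: A ==> 0 < fnl A (s' n)"
  "n \<in> VS ==> 0 <= fnl A (s' n)"
proof -
 have "facial s' VS A" using assms same by simp
 hence "\<exists>f. linear f & (\<forall>n\<in>VS. 0 <= (f (s' n) :: real)) & A = {n\<in>VS. f (s' n) = 0}"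
  unfolding facial_def .
 hence f: "linear (fnl A) & (\<forall>n\<in>VS. 0 <= fnl A (s' n)) & A = {n\<in>VS. fnl A (s' n) = 0}"
  unfolding fnl_def by (rule someI_ex)
 show "linear (fnl A)" using f by blast
 show z: "n \<in> VS ==> fnl A (s' n) = 0 \<longleftrightarrow> n \<in> A" using f by blast
 show nn: "n \<in> VS ==> 0 <= fnl A (s' n)" using f by blast
 show "n \<in> VS ==> n ~: A ==> 0 < fnl A (s' n)" using z nn by (metis order_le_less)
qed

definition gap :: "nat => vec => 'x => real" where "gap i x = fnl (Phi i x)"

lemma gap:
 assumes "i < k" "x \<in> dualC" "x ~= 0"
 shows "linear (gap i x)" "n \<in> VS ==> gap i x (s' n) = 0 \<longleftrightarrow> n \<in> Phi i x"
  "n \<in> VS ==> n ~: Phi i x ==> 0 < gap i x (s' n)" "n \<in> VS ==> 0 <= gap i x (s' n)"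
 using fnl[OF facial_Phi[OF assms]] by (simp_all add: gap_def)

text \<open>Positive multiples of \<open>x\<close> have the same \<open>Phi\<close>, and
  \<open>fnl\<close> chooses one functional for each set; so the functionals are equal and not
  merely proportional.\<close>

lemma gap_scale:
 assumes "c > 0"
 shows "gap i (c *\<^sub>R x) = gap i x"
proof -
 have m: "\<phi> j (c *\<^sub>R x) = c * \<phi> j x" if "j <= k" for j
 proof -
  have "ip D (c *\<^sub>R x) ` LV j = (%t. c * t) ` ip D x ` LV j" by (simp add: image_image ip_scale_left)
  thus ?thesis unfolding \<phi>_def
   using mono_Min_commute[of "%t. c * t" "ip D x ` LV j"] assms LV_fin[OF that] LV_ne[OF that]
   by (simp add: mono_def mult_left_mono)
 qed
 have "Phi i (c *\<^sub>R x) = Phi i x"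
 proof (intro set_eqI)
  fix n show "n \<in> Phi i (c *\<^sub>R x) \<longleftrightarrow> n \<in> Phi i x"
  proof (cases n)
   case (Inl v) thus ?thesis using assms by (simp add: ip_scale_left)
  next
   case (Inr y)
   obtain j w where "y = (j, w)" by (cases y)
   thus ?thesis using Inr assms m[of j] by (auto simp: ip_scale_left)
  qed
 qed
 thus ?thesis by (simp add: gap_def)
qed

text \<open>By \<open>d_lay\<close> a subset of dimension \<open>D + 1\<close> spans the layer,
  which includes the polytope at infinity. This is how identities checked on finite vertices reach
  the ridge.\<close>

lemma agree_on_lay:
 assumes "linear f" "linear g" "A \<subseteq> lay i" "i <= k" "D + 1 <= dim (s' ` A)"
  "!!n. n \<in> A ==> f (s' n) = (g (s' n) :: real)" "n \<in> lay i"
 shows "f (s' n) = g (s' n)"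
proof -
 have "span (s' ` A) = span (s' ` lay i)"
  using assms(3,4,5) d_lay[OF assms(4)] lay_VS[OF assms(4)] finite_img[of A]
  by (intro span_eqI) (auto intro: span_base)
 hence "s' n \<in> span (s' ` A)" using assms(7) by (simp add: span_base)
 thus ?thesis using linear_eq_on_span[OF assms(1,2), of "s' ` A"] assms(6) by auto
qed

lemma dim_insert_img:
 assumes "facial s VS A" "n \<in> VS" "n ~: A" "B \<subseteq> A" "B \<subseteq> VS"
 shows "dim (s' ` insert n B) = Suc (dim (s' ` B))"
proof -
 have "s' n ~: span (s' ` B)" using span_mem[OF assms(1,2,4)] assms(3) by blast
 thus ?thesis using dim_insert_fin[OF finite_img[OF assms(5)]] by simp
qed

text \<open>The gaps on both sides of the layer meet it in the same face, which is a hyperplane in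
  its span because \<open>x\<close> is one of its normals. Two functionals with this zero set are
  proportional; the factor is read off at one neighbour.\<close>

lemma gap_step:
 assumes i: "i + 1 < k" and x: "x \<in> Gam (i + 1)"
 shows "\<exists>c>0. \<forall>v\<in>VP. gap (i + 1) x (s' (Inl v)) = c * gap i x (s' (Inl v))"
proof -
 have ik: "i + 1 <= k" "i < k" using i by auto
 have xd: "x \<in> dualC" "x ~= 0" using Gam_dual[OF ik(1) x] by auto
 obtain w where w: "w \<in> LV (i + 1)" "x \<in> tg (i + 1) w" using cell[OF ik(1) x] by blast
 have xs: "{x} \<subseteq> tg (i + 1) w" "{x} ~= {}" using w by auto
 note g1 = gap[OF i xd] and g0 = gap[OF ik(2) xd]
 let ?J = "J (i + 1) {x}" and ?n = "nbr (i + 1) w x"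
 have lay: "Phi (i + 1) x \<inter> lay (i + 1) = ?J" "Phi i x \<inter> lay (i + 1) = ?J"
  using Phi_lay[OF ik(1) w(1) xs(1) posc_single] by auto
 have n: "?n \<in> lay (i + 1)" "?n ~: ?J" "?n \<in> VS" using nbr[OF ik(1) w] J_lay lay_VS[OF ik(1)] by blast+
 have p0: "0 < gap i x (s' ?n)" and p1: "0 < gap (i + 1) x (s' ?n)" using g0(3) g1(3) n lay by blast+
 define c where "c = gap (i + 1) x (s' ?n) / gap i x (s' ?n)"
 have c: "c > 0" using p0 p1 by (simp add: c_def)
 have JV: "?J \<subseteq> VS" using J_VS[OF ik(1)] .
 have zero: "gap (i + 1) x (s' m) = 0" "gap i x (s' m) = 0" if "m \<in> ?J" for m
  using g0(2) g1(2) that JV lay by blast+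
 have "gap (i + 1) x (s' m) = (%y. c * gap i x y) (s' m)" if "m \<in> lay (i + 1)" for m
 proof (rule agree_on_lay[where A = "insert ?n ?J" and i = "i + 1"])
  show "linear (gap (i + 1) x)" using g1(1) .
  show "linear (%y. c * gap i x y)" using linear_compose_scale_right[OF g0(1), of c] by simp
  show "insert ?n ?J \<subseteq> lay (i + 1)" using n(1) J_lay by blast
  show "D + 1 <= dim (s' ` insert ?n ?J)"
   using dim_insert_img[OF facial_J[OF ik(1) w(1) xs] n(3,2) order_refl JV] d_J[OF ik(1) w(1) xs] by (simp add: d_def)
  show "gap (i + 1) x (s' m) = c * gap i x (s' m)" if "m \<in> insert ?n ?J" for m
   using that zero p0 by (auto simp: c_def)
 qed (use ik that in auto)
 thus ?thesis using c by auto
qed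

text \<open>All three functionals vanish on the face cut out by \<open>b\<close> and
  \<open>c\<close>, of codimension two in the span of the layer. The coefficients are read off at
  two neighbours, one on the facet \<open>b\<close> and one on the facet \<open>c\<close>.\<close>

lemma gap_edge:
 assumes i: "i <= k" and w: "w \<in> LV i" "{b, c} \<subseteq> tg i w" "b ~= c"
  and j: "j < k" "j = i | i = j + 1" and a: "posc {b, c} a"
 shows "\<exists>al>0. \<exists>be>0. \<forall>v\<in>VP. gap j a (s' (Inl v)) = al * gap j b (s' (Inl v)) + be * gap j c (s' (Inl v))"
proof -
 have sb: "{b} \<subseteq> tg i w" "{c} \<subseteq> tg i w" "b \<in> tg i w" "c \<in> tg i w" using w by auto
 have bd: "b \<in> dualC" "b ~= 0" "c \<in> dualC" "c ~= 0" using Gam_dual[OF i] tg_sub[OF i] sb by blast+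
 have ad: "a \<in> dualC" "a ~= 0" using cell_facts(3)[OF i w(1,2) a] span_ne_0[OF i w(1,2) a] by auto
 note ga = gap[OF j(1) ad] and gb = gap[OF j(1) bd(1,2)] and gc = gap[OF j(1) bd(3,4)]
 have lay: "Phi j a \<inter> lay i = J i {b, c}" "Phi j b \<inter> lay i = J i {b}" "Phi j c \<inter> lay i = J i {c}"
  using Phi_lay[OF i w(1,2) a j(2)] Phi_lay[OF i w(1) sb(1) posc_single j(2)] Phi_lay[OF i w(1) sb(2) posc_single j(2)] by auto
 define nb nc where "nb = nbr i w c" and "nc = nbr i w b"
 have nb: "nb \<in> J i {b}" "nb ~: J i {c}" "nb \<in> lay i" "nb \<in> VS"
  using nbr[OF i w(1) sb(4)] J_anti[of "{b}" "tg i w - {c}" i] sb(3) w(3) J_lay lay_VS[OF i] unfolding nb_def by blast+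
 have nc: "nc \<in> J i {c}" "nc ~: J i {b}" "nc \<in> lay i" "nc \<in> VS"
  using nbr[OF i w(1) sb(3)] J_anti[of "{c}" "tg i w - {b}" i] sb(4) w(3) J_lay lay_VS[OF i] unfolding nc_def by blast+
 have Jb: "J i {b, c} \<subseteq> J i {b}" "J i {b, c} \<subseteq> J i {c}" using J_anti[of "{b}" "{b, c}" i] J_anti[of "{c}" "{b, c}" i] by auto
 have vals: "gap j b (s' nb) = 0" "gap j c (s' nb) > 0" "gap j c (s' nc) = 0" "gap j b (s' nc) > 0"
  "gap j a (s' nb) > 0" "gap j a (s' nc) > 0"
 proof -
  have m: "nb \<in> Phi j b" "nb ~: Phi j c" "nb ~: Phi j a" "nc \<in> Phi j c" "nc ~: Phi j b" "nc ~: Phi j a"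
   using nb nc lay Jb by blast+
  show "gap j b (s' nb) = 0" "gap j c (s' nb) > 0" "gap j c (s' nc) = 0" "gap j b (s' nc) > 0"
   "gap j a (s' nb) > 0" "gap j a (s' nc) > 0"
   using gb(2,3)[of nb] gc(2,3)[of nb] ga(3)[of nb] gb(2,3)[of nc] gc(2,3)[of nc] ga(3)[of nc] nb nc m by simp_all
 qed
 define al be where "al = gap j a (s' nc) / gap j b (s' nc)" and "be = gap j a (s' nb) / gap j c (s' nb)"
 have pos: "al > 0" "be > 0" using vals by (simp_all add: al_def be_def)
 have JV: "J i {b, c} \<subseteq> VS" using J_VS[OF i] .
 have zero: "gap j a (s' m) = 0" "gap j b (s' m) = 0" "gap j c (s' m) = 0" if "m \<in> J i {b, c}" for m
 proof -
  have "m \<in> VS" "m \<in> Phi j a" "m \<in> Phi j b" "m \<in> Phi j c" using that JV lay Jb by blast+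
  thus "gap j a (s' m) = 0" "gap j b (s' m) = 0" "gap j c (s' m) = 0" using ga(2) gb(2) gc(2) by simp_all
 qed
 have "gap j a (s' m) = (%y. al * gap j b y + be * gap j c y) (s' m)" if "m \<in> lay i" for m
 proof (rule agree_on_lay[where A = "insert nc (insert nb (J i {b, c}))" and i = i])
  show "linear (gap j a)" using ga(1) .
  show "linear (%y. al * gap j b y + be * gap j c y)"
   using linear_compose_add[OF linear_compose_scale_right[OF gb(1), of al] linear_compose_scale_right[OF gc(1), of be]] by simp
  show "insert nc (insert nb (J i {b, c})) \<subseteq> lay i" using nb nc J_lay by blast
  have "dim (s' ` insert nb (J i {b, c})) = Suc (dim (s' ` J i {b, c}))"
   using nb Jb JV by (intro dim_insert_img[OF facial_J[OF i w(1) sb(2)]]) auto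
  moreover have "dim (s' ` insert nc (insert nb (J i {b, c}))) = Suc (dim (s' ` insert nb (J i {b, c})))"
   using nb nc Jb JV by (intro dim_insert_img[OF facial_J[OF i w(1) sb(1)]]) auto
  ultimately show "D + 1 <= dim (s' ` insert nc (insert nb (J i {b, c})))"
   using d_J[OF i w(1,2)] w(3) by (simp add: d_def)
  show "gap j a (s' m) = al * gap j b (s' m) + be * gap j c (s' m)" if "m \<in> insert nc (insert nb (J i {b, c}))" for m
   using that zero vals by (auto simp: al_def be_def)
 qed (use i that in auto)
 thus ?thesis using pos by auto
qed

text \<open>A relation on the polytope at infinity also holds at the vertex \<open>w\<close>, where
  all terms vanish, hence on the whole layer. At the neighbour of \<open>w\<close> off the facet
  \<open>u\<close> only the term of \<open>u\<close> survives.\<close>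

lemma gap_indep:
 assumes i: "i <= k" and w: "w \<in> LV i" "kap \<subseteq> tg i w" and j: "j < k" "j = i | i = j + 1"
  and z: "!!v. v \<in> VP ==> (\<Sum>x\<in>kap. c x * gap j x (s' (Inl v))) = 0" and u: "u \<in> kap"
 shows "c u = 0"
proof -
 have fin: "finite kap" using w(2) tg_fin[OF i] finite_subset by blast
 have xd: "x \<in> dualC" "x ~= 0" if "x \<in> kap" for x using Gam_dual[OF i] tg_sub[OF i] that w(2) by blast+
 have lay: "Phi j x \<inter> lay i = J i {x}" if "x \<in> kap" for x
  using Phi_lay[OF i w(1) _ posc_single j(2)] that w(2) by auto
 define f where "f y = (\<Sum>x\<in>kap. c x * gap j x y)" for y
 have lf: "linear f" unfolding f_def
  using gap(1)[OF j(1) xd] by (intro linear_compose_sum ballI linear_compose_scale_right[where 'b = real, simplified])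
 have wl: "Inr (i, w) \<in> lay i" "Inr (i, w) \<in> VS" using w i by auto
 have zw: "gap j x (s' (Inr (i, w))) = 0" if "x \<in> kap" for x
 proof -
  have "Inr (i, w) \<in> J i {x}" using w that by auto
  thus ?thesis using gap(2)[OF j(1) xd[OF that] wl(2)] lay[OF that] by blast
 qed
 have ul: "u \<in> tg i w" using u w(2) by blast
 have n: "nbr i w u \<in> lay i" "nbr i w u \<in> VS" using nbr(1)[OF i w(1) ul] J_lay lay_VS[OF i] by blast+
 have "f (s' (nbr i w u)) = (%y. 0) (s' (nbr i w u))"
 proof (rule agree_on_lay[where A = "insert (Inr (i, w)) (Inl ` VP)" and i = i])
  show "linear f" using lf .
  show "insert (Inr (i, w)) (Inl ` VP) \<subseteq> lay i" using wl by (auto simp: lay_def)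
  show "D + 1 <= dim (s' ` insert (Inr (i, w)) (Inl ` VP))"
  proof -
   have "Inr (i, w) ~: Inl ` VP" "Inl ` VP \<subseteq> VS" by auto
   thus ?thesis using dim_insert_img[OF facial_base wl(2) _ order_refl] d_base by (simp add: d_def)
  qed
  show "f (s' m) = 0" if "m \<in> insert (Inr (i, w)) (Inl ` VP)" for m
   using that z zw by (auto simp: f_def)
 qed (use i n linear_zero_fun in auto)
 moreover have "gap j x (s' (nbr i w u)) = 0" if "x \<in> kap" "x ~= u" for x
 proof -
  have "nbr i w u \<in> J i {x}"
   using nbr(1)[OF i w(1) ul] J_anti[of "{x}" "tg i w - {u}" i] that w(2) by blast
  thus ?thesis using gap(2)[OF j(1) xd[OF that(1)] n(2)] lay[OF that(1)] by blast
 qed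
 moreover from this have "f (s' (nbr i w u)) = (\<Sum>x\<in>kap. if x = u then c x * gap j x (s' (nbr i w u)) else 0)"
  unfolding f_def by (intro sum.cong) auto
 ultimately have "(\<Sum>x\<in>kap. if x = u then c x * gap j x (s' (nbr i w u)) else 0) = 0" by simp
 hence "c u * gap j u (s' (nbr i w u)) = 0" using fin u by (simp add: sum.delta)
 moreover have "gap j u (s' (nbr i w u)) > 0"
  using gap(3)[OF j(1) xd[OF u] n(2)] lay[OF u] nbr(2)[OF i w(1) ul] n(1) by blast
 ultimately show ?thesis by simp
qed

end

section \<open>Existence of layers\<close>

context cone_config
begin

definition dualizing :: "vec set => bool" where
 "dualizing Gam \<longleftrightarrow> (\<forall>w\<in>csp D. (\<forall>x\<in>Gam. 0 <= ip D x w) -->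
   (\<exists>c. (\<forall>v\<in>VP. 0 <= c v) & w = (\<Sum>v\<in>VP. c v *\<^sub>R p v)))"

definition cell_of :: "vec set => (vec => real) => vec set => bool" where
 "cell_of Gam om kap \<longleftrightarrow> (\<exists>w\<in>layer.Vt D Gam om. kap \<subseteq> layer.tight D Gam om w)"

text \<open>The strict inequalities off \<open>kap\<close> make this stable under small
  perturbations of \<open>om\<close>; in a layer it yields \<open>cell_of\<close> through
  \<open>ex_vertex\<close>.\<close>

definition strict_cell :: "vec set => (vec => real) => vec set => bool" where
 "strict_cell Gam om kap \<longleftrightarrow> kap \<subseteq> Gam &
   (\<exists>w\<in>csp D. (\<forall>x\<in>kap. ip D x w = om x) & (\<forall>y\<in>Gam - kap. om y < ip D y w))"

lemma eventually_avoid_finite: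
 fixes S :: "real set"
 assumes "finite S"
 shows "\<forall>\<^sub>F e in at_right 0. e ~: S"
 using assms by (induction S) (auto intro: eventually_conj eventually_neq_at_within)

text \<open>Any heights can be made generic by adding \<open>e, e\<^sup>2, \<dots>\<close> for small \<open>e\<close>; strict cells survive.\<close>

lemma layer_exists:
 assumes fin: "finite Gam" and sl: "Gam \<subseteq> slice" and dual: "dualizing Gam"
  and F: "finite F" "!!kap. kap \<in> F ==> independent kap" "!!kap. kap \<in> F ==> strict_cell Gam om kap" "Gam \<subseteq> \<Union> F"
 shows "\<exists>om'. layer VP p D Gam om' & (\<forall>kap\<in>F. cell_of Gam om' kap)"
proof -
 obtain idx :: "vec => nat" where idx: "inj_on idx Gam" using finite_imp_inj_to_nat_seg[OF fin] by blast
 define om' where "om' e x = om x + e ^ Suc (idx x)" for e x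
 have gen: "\<forall>\<^sub>F e in at_right 0. \<exists>c. (\<Sum>x\<in>Y. c x *\<^sub>R x) = 0 & (\<Sum>x\<in>Y. c x * om' e x) ~= 0"
  if Y: "Y \<in> {Y. Y \<subseteq> Gam & dependent Y}" for Y
 proof -
  have fY: "finite Y" using Y fin finite_subset by blast
  obtain c x0 where c: "(\<Sum>x\<in>Y. c x *\<^sub>R x) = 0" "x0 \<in> Y" "c x0 ~= 0"
   using Y dependent_finite[OF fY] by auto
  \<comment> \<open>Heights attained at a common point satisfy every linear relation of their
    normals. For the perturbed heights the relation \<open>c\<close> is a polynomial in
    \<open>e\<close>, nonzero since the exponents are distinct.\<close>
  define P where "P = (\<Sum>x\<in>Y. smult (c x) ([:om x:] + monom 1 (Suc (idx x))))"
  have val: "poly P e = (\<Sum>x\<in>Y. c x * om' e x)" for e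
   by (simp add: P_def poly_sum poly_monom om'_def)
  have "coeff P (Suc (idx x0)) = (\<Sum>x\<in>Y. if x = x0 then c x else 0)"
   unfolding P_def coeff_sum
  proof (intro sum.cong refl)
   fix x assume "x \<in> Y"
   hence "idx x = idx x0 \<longleftrightarrow> x = x0" using idx c(2) Y by (auto simp: inj_on_def)
   thus "coeff (smult (c x) ([:om x:] + monom 1 (Suc (idx x)))) (Suc (idx x0)) = (if x = x0 then c x else 0)"
    by (simp add: coeff_monom)
  qed
  hence "P ~= 0" using c fY by (auto simp: sum.delta)
  hence "finite {e. poly P e = 0}" by (rule poly_roots_finite)
  from eventually_avoid_finite[OF this] show ?thesis
   by eventually_elim (use c val in auto)
 qed
 have fY: "finite {Y. Y \<subseteq> Gam & dependent Y}" using fin by (auto intro: finite_subset[of _ "Pow Gam"])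
 have ev1: "\<forall>\<^sub>F e in at_right 0. \<forall>Y\<in>{Y. Y \<subseteq> Gam & dependent Y}.
   \<exists>c. (\<Sum>x\<in>Y. c x *\<^sub>R x) = 0 & (\<Sum>x\<in>Y. c x * om' e x) ~= 0"
  using fY gen by (intro eventually_ball_finite) auto
 have "\<forall>\<^sub>F e in at_right 0. strict_cell Gam (om' e) kap" if kapF: "kap \<in> F" for kap
 proof -
  obtain w where w: "w \<in> csp D" "\<forall>x\<in>kap. ip D x w = om x" "\<forall>y\<in>Gam - kap. om y < ip D y w" and kap: "kap \<subseteq> Gam"
   using F(3)[OF kapF] by (auto simp: strict_cell_def)
  have fkap: "finite kap" using kap fin finite_subset by blast
  have "kap \<subseteq> csp D" using kap sl slice_coord by blast
  hence "\<forall>u\<in>kap. \<exists>e\<in>csp D. (\<forall>y\<in>kap - {u}. ip D y e = 0) & ip D u e = 1"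
   using ip_dual[OF F(2)[OF kapF]] by blast
  then obtain b where b: "\<forall>u\<in>kap. b u \<in> csp D & (\<forall>y\<in>kap - {u}. ip D y (b u) = 0) & ip D u (b u) = 1"
   unfolding Bex_def by (drule_tac bchoice) blast
  \<comment> \<open>\<open>w\<close>, moved along the dual basis so that the perturbed equations of
    \<open>kap\<close> hold exactly.\<close>
  define z where "z e = w + (\<Sum>u\<in>kap. e ^ Suc (idx u) *\<^sub>R b u)" for e
  have zc: "z e \<in> csp D" for e
   unfolding z_def using w(1) b subspace_csp by (intro subspace_add subspace_sum subspace_scale) auto
  have ipz: "ip D y (z e) = ip D y w + (\<Sum>u\<in>kap. e ^ Suc (idx u) * ip D y (b u))" for y e
   by (simp add: z_def ip_add_right ip_sum_right ip_scale_right)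
  have on: "ip D y (z e) = om' e y" if y: "y \<in> kap" for y e
  proof -
   have "(\<Sum>u\<in>kap. e ^ Suc (idx u) * ip D y (b u)) = (\<Sum>u\<in>kap. if u = y then e ^ Suc (idx u) else 0)"
    using b y by (intro sum.cong) auto
   thus ?thesis using y fkap w(2) by (simp add: ipz om'_def sum.delta)
  qed
  have "\<forall>\<^sub>F e in at_right 0. 0 < ip D y (z e) - om' e y" if "y \<in> Gam - kap" for y
  proof (rule order_tendstoD(1))
   have p0: "((%e::real. e ^ Suc n) \<longlongrightarrow> 0) (at_right 0)" for n by (auto intro!: tendsto_eq_intros)
   have "((%e. (ip D y w + (\<Sum>u\<in>kap. e ^ Suc (idx u) * ip D y (b u))) - (om y + e ^ Suc (idx y)))
     \<longlongrightarrow> (ip D y w + (\<Sum>u\<in>kap. 0 * ip D y (b u))) - (om y + 0)) (at_right 0)"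
    by (intro tendsto_intros p0)
   thus "((%e. ip D y (z e) - om' e y) \<longlongrightarrow> ip D y w - om y) (at_right 0)"
    by (simp add: ipz om'_def)
   show "0 < ip D y w - om y" using w(3) that by simp
  qed
  hence "\<forall>\<^sub>F e in at_right 0. \<forall>y\<in>Gam - kap. 0 < ip D y (z e) - om' e y"
   using fin by (intro eventually_ball_finite) auto
  thus ?thesis
  proof eventually_elim
   fix e assume "\<forall>y\<in>Gam - kap. 0 < ip D y (z e) - om' e y"
   thus "strict_cell Gam (om' e) kap" using zc[of e] on[of _ e] kap by (auto simp: strict_cell_def)
  qed
 qed
 hence ev2: "\<forall>\<^sub>F e in at_right 0. \<forall>kap\<in>F. strict_cell Gam (om' e) kap"
  using F(1) by (intro eventually_ball_finite) auto
 have "\<forall>\<^sub>F e in at_right (0::real). (\<forall>Y\<in>{Y. Y \<subseteq> Gam & dependent Y}.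
   \<exists>c. (\<Sum>x\<in>Y. c x *\<^sub>R x) = 0 & (\<Sum>x\<in>Y. c x * om' e x) ~= 0) & (\<forall>kap\<in>F. strict_cell Gam (om' e) kap)"
  using ev1 ev2 by (rule eventually_conj)
 then obtain e where e: "!!Y. Y \<subseteq> Gam ==> dependent Y ==>
   \<exists>c. (\<Sum>x\<in>Y. c x *\<^sub>R x) = 0 & (\<Sum>x\<in>Y. c x * om' e x) ~= 0" "\<forall>kap\<in>F. strict_cell Gam (om' e) kap"
  using eventually_happens'[OF trivial_limit_at_right_real] by blast
 have L: "layer VP p D Gam (om' e)"
 proof
  show "\<exists>c. (\<forall>v\<in>VP. 0 <= c v) & w = (\<Sum>v\<in>VP. c v *\<^sub>R p v)"
   if "w \<in> csp D" "!!x. x \<in> Gam ==> 0 <= ip D x w" for w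
   using dual that by (simp add: dualizing_def)
  show "independent {x \<in> Gam. ip D x w = om' e x}" if "w \<in> csp D" for w
  proof
   assume dep: "dependent {x \<in> Gam. ip D x w = om' e x}" (is "dependent ?T")
   obtain c where c: "(\<Sum>x\<in>?T. c x *\<^sub>R x) = 0" "(\<Sum>x\<in>?T. c x * om' e x) ~= 0"
    using e(1)[OF _ dep] by auto
   have "(\<Sum>x\<in>?T. c x * om' e x) = (\<Sum>x\<in>?T. c x * ip D x w)" by (intro sum.cong) auto
   also have "\<dots> = ip D (\<Sum>x\<in>?T. c x *\<^sub>R x) w" by (simp add: ip_sum_left ip_scale_left)
   finally show False using c by simp
  qed
  show "\<exists>w\<in>csp D. ip D x w = om' e x & (\<forall>y\<in>Gam. om' e y <= ip D y w)" if x: "x \<in> Gam" for x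
  proof -
   obtain kap where kap: "kap \<in> F" "x \<in> kap" using F(4) x by blast
   then obtain w where "w \<in> csp D" "\<forall>x\<in>kap. ip D x w = om' e x" "\<forall>y\<in>Gam - kap. om' e y < ip D y w"
    using e(2)[rule_format, OF kap(1)] unfolding strict_cell_def by blast
   thus ?thesis using kap(2) by (intro bexI[of _ w]) (auto intro: less_imp_le)
  qed
 qed (use fin sl in auto)
 have "cell_of Gam (om' e) kap" if kapF: "kap \<in> F" for kap
 proof -
  interpret L: layer VP p D Gam "om' e" by (rule L)
  obtain w where w: "w \<in> csp D" "\<forall>x\<in>kap. ip D x w = om' e x" "\<forall>y\<in>Gam - kap. om' e y < ip D y w" "kap \<subseteq> Gam"
   using e(2)[rule_format, OF kapF] unfolding strict_cell_def by blast
  have "om' e y <= ip D y w" if "y \<in> Gam" for y using w(2,3) that by (cases "y \<in> kap") (auto intro: less_imp_le)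
  hence "w \<in> L.Q" "kap \<subseteq> L.tight w" using w(1,2,4) by (auto simp: L.Q_def L.tight_def)
  thus ?thesis using L.ex_vertex[of w] unfolding cell_of_def by blast
 qed
 thus ?thesis using L by blast
qed

text \<open>On \<open>slice\<close> the heights form a strictly concave function, so every generator
  is strictly supported by its tangent. The heights are zero on \<open>kap\<close> and negative
  elsewhere, so the origin witnesses the strict cell \<open>kap\<close>.\<close>

lemma quadratic_layer:
 assumes fin: "finite Gam" and sl: "Gam \<subseteq> slice" and dual: "dualizing Gam"
  and c: "b \<in> csp D" "u \<in> csp D" "w' \<in> csp D"
  and pos: "!!y. y \<in> csp D ==> y ~= 0 ==> 0 < al * ip D y y - be * (ip D y u)\<^sup>2"
  and om: "!!z. om z = ip D z w' - (al * ip D (z - b) (z - b) - be * (ip D (z - b) u)\<^sup>2)"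
  and kap: "kap \<subseteq> Gam" "independent kap" "!!z. z \<in> kap ==> om z = 0" "!!z. z \<in> Gam - kap ==> om z < 0"
 shows "\<exists>om'. layer VP p D Gam om' & cell_of Gam om' kap"
proof -
 have strict1: "strict_cell Gam om {x}" if x: "x \<in> Gam" for x
 proof -
  have xs: "ip D x wbar = 1" "x \<in> csp D" using x sl by (auto simp: slice_wbar slice_coord)
  define r where "r = (2 * al) *\<^sub>R (x - b) - (2 * be * ip D (x - b) u) *\<^sub>R u"
  \<comment> \<open>The tangent at \<open>x\<close>: an affine function on \<open>slice\<close>,
    made linear by \<open>ip D z wbar = 1\<close>.\<close>
  define w where "w = (om x - ip D x (w' - r)) *\<^sub>R wbar + (w' - r)"
  have rc: "r \<in> csp D" "w \<in> csp D"
   unfolding w_def r_def using c xs(2) subspace_csp wbar_coord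
   by (auto intro!: subspace_add subspace_diff subspace_scale)
  have ipw: "ip D z w - om z = al * ip D (z - x) (z - x) - be * (ip D (z - x) u)\<^sup>2" if "ip D z wbar = 1" for z
  proof -
   define z0 x0 where "z0 = z - b" and "x0 = x - b"
   have e: "z - x = z0 - x0" "z - b = z0" "x - b = x0" by (simp_all add: z0_def x0_def)
   have zr: "ip D z r - ip D x r = 2 * al * ip D (z0 - x0) x0 - 2 * be * ip D x0 u * ip D (z0 - x0) u"
    unfolding ip_diff_left[symmetric] e(1)[symmetric]
    by (simp add: r_def e(3) ip_diff_right ip_scale_right)
   show ?thesis
    using zr unfolding w_def om e
    by (simp add: ip_add_right ip_scale_right ip_diff_right ip_diff_left that e ip_commute[of D x0 z0]
     power2_eq_square algebra_simps)
  qed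
  show ?thesis
   unfolding strict_cell_def
  proof (intro conjI bexI[of _ w] ballI)
   show "ip D y w = om y" if "y \<in> {x}" for y using ipw[OF xs(1)] that by simp
   show "om y < ip D y w" if "y \<in> Gam - {x}" for y
   proof -
    have y: "ip D y wbar = 1" "y \<in> csp D" using that sl by (auto simp: slice_wbar slice_coord)
    hence "y - x \<in> csp D" "y - x ~= 0"
     using xs(2) that subspace_csp by (auto intro: subspace_diff)
    thus ?thesis using ipw[OF y(1)] pos[of "y - x"] by simp
   qed
  qed (use x rc in auto)
 qed
 have strict2: "strict_cell Gam om kap"
  unfolding strict_cell_def using kap subspace_csp
  by (intro conjI bexI[of _ 0]) (auto simp: subspace_0)
 have "\<exists>om'. layer VP p D Gam om' & (\<forall>kap'\<in>insert kap ((%x. {x}) ` Gam). cell_of Gam om' kap')"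
  by (rule layer_exists[where om = om])
   (use fin sl dual kap(2) strict1 strict2 slice_nz in \<open>auto simp: subset_iff\<close>)
 thus ?thesis by blast
qed

end

section \<open>Gadgets forcing collinearities\<close>

lemma independent_triple:
 fixes a b c :: "'x::real_vector"
 assumes "!!al be gam. al *\<^sub>R a + be *\<^sub>R b + gam *\<^sub>R c = 0 ==> al = 0 & be = 0 & gam = 0"
 shows "independent {a, b, c}" "a ~= b" "a ~= c" "b ~= c"
proof -
 show d: "a ~= b" "a ~= c" "b ~= c"
  using assms[of 1 "-1" 0] assms[of 1 0 "-1"] assms[of 0 1 "-1"] by auto
 show "independent {a, b, c}"
 proof
  assume "dependent {a, b, c}"
  then obtain r where r: "\<exists>v\<in>{a, b, c}. r v ~= 0" "(\<Sum>v\<in>{a, b, c}. r v *\<^sub>R v) = 0"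
   using dependent_finite[of "{a, b, c}"] by auto
  hence "r a *\<^sub>R a + r b *\<^sub>R b + r c *\<^sub>R c = 0" using d by (simp add: add.assoc)
  thus False using assms r(1) by blast
 qed
qed

lemma eventually_perturbed_pos:
 fixes A B :: real
 assumes "0 <= A" "A = 0 ==> 0 < B"
 shows "\<forall>\<^sub>F e in at_right 0. 0 < A + e * B"
proof (cases "A = 0")
 case True
 thus ?thesis using assms(2) by (auto intro!: eventually_mono[OF eventually_at_right_less])
next
 case False
 have "((%e. A + e * B) \<longlongrightarrow> A + 0 * B) (at_right 0)" by (intro tendsto_intros)
 thus ?thesis using assms(1) False by (intro order_tendstoD(1)) auto
qed

lemma ip_gram:
 assumes "v \<in> csp D" "v ~= 0"
 shows "ip D v v * ip D y y - (ip D y v)\<^sup>2 =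
  ip D v v * ip D (y - (ip D y v / ip D v v) *\<^sub>R v) (y - (ip D y v / ip D v v) *\<^sub>R v)"
proof -
 have "ip D v v > 0" using ip_self_pos[OF assms] .
 thus ?thesis
  by (simp add: ip_diff_left ip_diff_right ip_scale_left ip_scale_right ip_commute[of D v y]
    power2_eq_square field_simps)
qed

context cone_config
begin

text \<open>The interior of the dual cone, where small changes of \<open>a\<close> are
  harmless.\<close>

definition inner :: "vec => bool" where "inner a \<longleftrightarrow> (\<forall>v\<in>VP. 0 < ip D a (p v))"

text \<open>
 \<open>A\<close> and \<open>B\<close> are the layers used in the order \<open>A\<close>, \<open>B\<close>, \<open>A\<close>. The edge \<open>b x\<close> of \<open>B\<close> forces the
 collinearity of \<open>b\<close>, \<open>a\<close>, \<open>x\<close>; the lines \<open>a c1\<close> and \<open>a c2\<close> carry \<open>a\<close> across \<open>B\<close>, where it is missing.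
\<close>

definition gadget ::
 "vec set => vec => vec => vec => vec set \<times> (vec => real) => vec set \<times> (vec => real) => bool" where
 "gadget Gam\<^sub>0 b a x A B \<longleftrightarrow>
   layer VP p D (fst A) (snd A) & layer VP p D (fst B) (snd B) & Gam\<^sub>0 \<subseteq> fst A & Gam\<^sub>0 - {a} \<subseteq> fst B &
   cell_of (fst B) (snd B) {b, x} &
   (\<exists>c1 c2 y1 y2. {c1, c2, y1, y2} \<subseteq> fst B & cell_of (fst A) (snd A) {a, c1, c2} &
    a ~= c1 & a ~= c2 & c1 ~= c2 & posc {a, c1} y1 & posc {a, c2} y2)"

lemma direction_exists:
 assumes "a \<in> csp D" "ip D a wbar = 1" "v \<in> csp D"
 obtains e where "e \<in> csp D" "ip D e wbar = 0" "e ~: span {a, v}"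
proof -
 have "\<not> csp D \<subseteq> span {a, v}"
 proof
  assume "csp D \<subseteq> span {a, v}"
  hence "dim (axis' ` {..<D}) <= card {a, v}"
   using span_axes[of D] span_superset[of "axis' ` {..<D}"] by (intro dim_le_card_fin) auto
  moreover have "card {a, v} <= 2" by (simp add: card_insert_if)
  ultimately show False using dim_csp_set[OF span_axes] D3 by simp
 qed
 then obtain y where y: "y \<in> csp D" "y ~: span {a, v}" by blast
 show thesis
 proof
  show "y - ip D y wbar *\<^sub>R a \<in> csp D"
   using y assms subspace_csp by (auto intro: subspace_diff subspace_scale)
  show "ip D (y - ip D y wbar *\<^sub>R a) wbar = 0" by (simp add: ip_diff_left ip_scale_left assms)
  show "y - ip D y wbar *\<^sub>R a ~: span {a, v}"
  proof
   assume "y - ip D y wbar *\<^sub>R a \<in> span {a, v}"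
   moreover have "ip D y wbar *\<^sub>R a \<in> span {a, v}" by (intro span_scale span_base) auto
   ultimately have "(y - ip D y wbar *\<^sub>R a) + ip D y wbar *\<^sub>R a \<in> span {a, v}" by (rule span_add)
   thus False using y by simp
  qed
 qed
qed

text \<open>The Gram determinant \<open>G (z - b)\<close> vanishes exactly on the line through
  \<open>b\<close> and \<open>x\<close>. At the parameter \<open>t\<close> of this line the second
  term is \<open>t * (t - 1)\<close> times the square of \<open>v\<close>: zero at \<open>b\<close>
  and \<open>x\<close>, positive at the remaining generators on the line. A small multiple
  \<open>e\<close> of it does not disturb those off the line.\<close>

lemma edge_layer:
 assumes fin: "finite Gam" and sl: "Gam \<subseteq> slice" and dual: "dualizing Gam"
  and bx: "b \<in> Gam" "x \<in> Gam" "b ~= x" and only: "!!z t. z \<in> Gam ==> z = b + t *\<^sub>R (x - b) ==> t <= 0 | 1 <= t"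
 shows "\<exists>om. layer VP p D Gam om & cell_of Gam om {b, x}"
proof -
 define v where "v = x - b"
 have bc: "b \<in> csp D" "x \<in> csp D" "ip D b wbar = 1" "ip D x wbar = 1"
  using bx sl slice_coord slice_wbar by blast+
 have v: "v \<in> csp D" "v ~= 0" using bc bx subspace_csp by (auto simp: v_def subspace_diff)
 have vv: "ip D v v > 0" using ip_self_pos[OF v] .
 define G where "G y = ip D v v * ip D y y - (ip D y v)\<^sup>2" for y
 have G0: "0 <= G y" for y unfolding G_def ip_gram[OF v] using vv ip_self_nonneg by (intro mult_nonneg_nonneg) auto
 have Gz: "y = (ip D y v / ip D v v) *\<^sub>R v" if "G y = 0" "y \<in> csp D" for y
 proof -
  have "y - (ip D y v / ip D v v) *\<^sub>R v \<in> csp D"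
   using that v subspace_csp by (auto intro: subspace_diff subspace_scale)
  hence "y - (ip D y v / ip D v v) *\<^sub>R v = 0"
   using that(1) vv unfolding G_def ip_gram[OF v] by (intro ip_self_zero) auto
  thus ?thesis by simp
 qed
 have "\<forall>\<^sub>F e in at_right 0. 0 < G (z - b) + e * (ip D (z - b) (z - b) - ip D (z - b) v)" if z: "z \<in> Gam - {b, x}" for z
 proof (rule eventually_perturbed_pos[OF G0])
  assume g: "G (z - b) = 0"
  have "z - b \<in> csp D" using z sl slice_coord bc subspace_csp by (auto intro: subspace_diff)
  from Gz[OF g this] obtain t where t: "z - b = t *\<^sub>R v" by blast
  hence zt: "z = b + t *\<^sub>R (x - b)" by (simp add: v_def algebra_simps)
  have "t ~= 0" "t ~= 1" using zt z by auto
  hence "t < 0 | 1 < t" using only[OF _ zt] z by auto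
  hence "0 < t * (t - 1)" by (auto intro: mult_pos_pos mult_neg_neg)
  hence "0 < (t * (t - 1)) * ip D v v" using vv by simp
  thus "0 < ip D (z - b) (z - b) - ip D (z - b) v"
   unfolding t by (simp add: ip_scale_left ip_scale_right algebra_simps)
 qed
 hence "\<forall>\<^sub>F e in at_right 0. \<forall>z\<in>Gam - {b, x}. 0 < G (z - b) + e * (ip D (z - b) (z - b) - ip D (z - b) v)"
  using fin by (intro eventually_ball_finite) auto
 hence "\<forall>\<^sub>F e in at_right 0. 0 < e &
   (\<forall>z\<in>Gam - {b, x}. 0 < G (z - b) + e * (ip D (z - b) (z - b) - ip D (z - b) v))"
  by (intro eventually_conj eventually_at_right_less)
 then obtain e where e: "0 < e"
  "!!z. z \<in> Gam - {b, x} ==> 0 < G (z - b) + e * (ip D (z - b) (z - b) - ip D (z - b) v)"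
  using eventually_happens'[OF trivial_limit_at_right_real] by blast
 \<comment> \<open>The linear part of the heights; the constant in it becomes linear through
   \<open>wbar\<close>.\<close>
 define w where "w = e *\<^sub>R (v - ip D b v *\<^sub>R wbar)"
 define om where "om z = ip D z w - ((ip D v v + e) * ip D (z - b) (z - b) - 1 * (ip D (z - b) v)\<^sup>2)" for z
 have om: "om z = - (G (z - b) + e * (ip D (z - b) (z - b) - ip D (z - b) v))" if "ip D z wbar = 1" for z
  by (simp add: om_def w_def G_def ip_scale_right ip_diff_right ip_diff_left[of D z b v] that algebra_simps)
 show ?thesis
 proof (rule quadratic_layer[OF fin sl dual bc(1) v(1), where om = om])
  show "w \<in> csp D"
   unfolding w_def using v wbar_coord subspace_csp by (auto intro: subspace_diff subspace_scale)
  show "0 < (ip D v v + e) * ip D y y - 1 * (ip D y v)\<^sup>2" if "y \<in> csp D" "y ~= 0" for y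
   using G0[of y] e(1) mult_pos_pos[OF e(1) ip_self_pos[OF that]] by (simp add: G_def algebra_simps)
  show "om z < 0" if "z \<in> Gam - {b, x}" for z
  proof -
   have "ip D z wbar = 1" using that sl slice_wbar by blast
   thus ?thesis using e(2)[OF that] om by simp
  qed
  show "om z = 0" if "z \<in> {b, x}" for z
  proof -
   have "ip D z wbar = 1" "z - b = 0 | z - b = v" using that bc by (auto simp: v_def)
   thus ?thesis using om[of z] by (auto simp: G_def power2_eq_square)
  qed
  show "independent {b, x}"
  proof -
   have "b ~= 0" using bc by auto
   moreover have "x ~: span {b}"
   proof
    assume "x \<in> span {b}"
    then obtain k where k: "x = k *\<^sub>R b" by (auto simp: span_singleton)
    hence "k = 1" using bc by (simp add: ip_scale_left)
    thus False using k bx by simp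
   qed
   ultimately have "independent {x, b}" using bx(3) by (simp add: independent_insert)
   thus ?thesis by (simp add: insert_commute)
  qed
 qed (use bx om_def in auto)
qed

text \<open>Layer \<open>A\<close> bends a paraboloid around \<open>a\<close>, tilted so that
  \<open>a\<close>, \<open>c1\<close>, \<open>c2\<close> are level. Layer \<open>B\<close> is an
  \<open>edge_layer\<close> for \<open>b\<close> and \<open>x\<close> after removal of
  \<open>a\<close>; its auxiliary normals avoid the line through \<open>b\<close> and
  \<open>x\<close>. That \<open>a\<close> is inner keeps \<open>c1\<close> and \<open>c2\<close> in
  the dual cone.\<close>

lemma gadget_exists:
 assumes fin: "finite Gam\<^sub>0" and sl: "Gam\<^sub>0 \<subseteq> slice" and dual: "dualizing Gam\<^sub>0"
  and bx: "b \<in> Gam\<^sub>0" "a \<in> Gam\<^sub>0" "x \<in> Gam\<^sub>0" and a: "Gam\<^sub>0 \<inter> open_segment b x = {a}" "inner a"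
 shows "\<exists>A B. gadget Gam\<^sub>0 b a x A B"
proof -
 define v where "v = x - b"
 have bc: "b \<in> csp D" "x \<in> csp D" "a \<in> csp D"
  "ip D b wbar = 1" "ip D x wbar = 1" "ip D a wbar = 1"
  using bx sl slice_coord slice_wbar by blast+
 have "a \<in> open_segment b x" using a by blast
 then obtain t where t: "0 < t" "t < 1" "a = (1 - t) *\<^sub>R b + t *\<^sub>R x" and nbx: "b ~= x"
  by (auto simp: in_segment)
 have at: "a = b + t *\<^sub>R v" by (simp add: t(3) v_def algebra_simps)
 have v: "v \<in> csp D" "v ~= 0" "ip D v wbar = 0"
  using bc nbx subspace_csp by (auto simp: v_def subspace_diff ip_diff_left)
 obtain e1 where e1: "e1 \<in> csp D" "ip D e1 wbar = 0" "e1 ~: span {a, v}"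
  using direction_exists[OF bc(3,6) v(1)] by blast
 \<comment> \<open>\<open>a\<close>, \<open>e1\<close>, \<open>e2\<close> are independent, so the
   two auxiliary lines through \<open>a\<close> are distinct, and neither is parallel to
   \<open>v\<close>.\<close>
 define e2 where "e2 = e1 + v"
 have e2: "e2 \<in> csp D" "ip D e2 wbar = 0"
  using e1 v subspace_csp by (auto simp: e2_def subspace_add ip_add_left)
 have "v ~: span {a}"
 proof
  assume "v \<in> span {a}"
  then obtain r where "v = r *\<^sub>R a" by (auto simp: span_singleton)
  thus False using v bc(6) by (auto simp: ip_scale_left)
 qed
 then obtain f where f: "f \<in> csp D" "ip D a f = 0" "ip D v f = 1"
  using ip_separate[of "{a}" D v] bc v by auto
 obtain f1 where f1: "f1 \<in> csp D" "ip D a f1 = 0" "ip D v f1 = 0" "ip D e1 f1 = 1"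
  using ip_separate[of "{a, v}" D e1] bc v e1 by auto
 define f2 where "f2 = f - ip D e1 f *\<^sub>R f1"
 have f2: "f2 \<in> csp D" "ip D a f2 = 0" "ip D v f2 = 1" "ip D e1 f2 = 0"
  using f f1 subspace_csp by (auto simp: f2_def subspace_diff subspace_scale ip_diff_right ip_scale_right)
 \<comment> \<open>Built from the dual vectors \<open>f1\<close> and \<open>f2\<close> so that the
   linear term cancels the squared distance from \<open>a\<close> at \<open>c1\<close> and at
   \<open>c2\<close>.\<close>
 define w1 where "w1 = ip D e1 e1 *\<^sub>R f1 + (ip D e2 e2 - ip D e1 e1) *\<^sub>R f2"
 have w1: "w1 \<in> csp D" "ip D a w1 = 0" "ip D e1 w1 = ip D e1 e1" "ip D e2 w1 = ip D e2 e2"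
  using f1 f2 subspace_csp
  by (auto simp: w1_def e2_def subspace_add subspace_scale ip_add_right ip_scale_right ip_add_left[of D e1 v f1] ip_add_left[of D e1 v f2])
 have ev1: "\<forall>\<^sub>F s in at_right 0. 0 < ip D a (p v) + s * ip D e (p v)" if "v \<in> VP" for v e
  using a(2) that by (intro eventually_perturbed_pos) (auto simp: inner_def less_imp_le)
 have "\<forall>\<^sub>F s in at_right 0. 0 < ip D (z - a) (z - a) + s * - ip D z w1" if "z \<in> Gam\<^sub>0 - {a}" for z
 proof (rule eventually_perturbed_pos)
  have "z - a \<in> csp D" "z - a ~= 0"
   using that sl slice_coord bc subspace_csp by (auto intro: subspace_diff)
  thus "0 <= ip D (z - a) (z - a)" "ip D (z - a) (z - a) = 0 ==> 0 < - ip D z w1"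
   using ip_self_pos[of "z - a" D] by auto
 qed
 hence "\<forall>\<^sub>F s in at_right 0. 0 < s & (\<forall>z\<in>Gam\<^sub>0 - {a}. 0 < ip D (z - a) (z - a) + s * - ip D z w1) &
   (\<forall>v\<in>VP. 0 < ip D a (p v) + s * ip D e1 (p v)) & (\<forall>v\<in>VP. 0 < ip D a (p v) + s * ip D e2 (p v))"
  using ev1 fin finVP by (intro eventually_conj eventually_at_right_less eventually_ball_finite) auto
 from eventually_happens'[OF trivial_limit_at_right_real this] obtain s where
  s: "0 < s" "\<forall>z\<in>Gam\<^sub>0 - {a}. 0 < ip D (z - a) (z - a) + s * - ip D z w1"
   "\<forall>v\<in>VP. 0 < ip D a (p v) + s * ip D e1 (p v)" "\<forall>v\<in>VP. 0 < ip D a (p v) + s * ip D e2 (p v)"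
  by blast
 define c1 c2 y1 y2 where "c1 = a + s *\<^sub>R e1" and "c2 = a + s *\<^sub>R e2" and
  "y1 = (1/2) *\<^sub>R a + (1/2) *\<^sub>R c1" and "y2 = (1/2) *\<^sub>R a + (1/2) *\<^sub>R c2"
 have sc: "a + s *\<^sub>R e \<in> slice" if "e \<in> {e1, e2}" for e
 proof -
  have "e \<in> csp D" "ip D e wbar = 0" "!!v. v \<in> VP ==> 0 <= ip D (a + s *\<^sub>R e) (p v)"
   using that e1 e2 s(3,4) by (auto simp: ip_add_left ip_scale_left less_imp_le)
  thus ?thesis using bc subspace_csp
   by (auto simp: slice_def dualC_def ip_add_left ip_scale_left subspace_add subspace_scale)
 qed
 have as: "a \<in> slice" using bx sl by blast
 have half: "(1/2) *\<^sub>R a + (1/2) *\<^sub>R c \<in> slice" if "c \<in> slice" for c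
  using as that by (auto simp: slice_def ip_add_left ip_scale_left intro!: dualC_add dualC_scale)
 have cs: "c1 \<in> slice" "c2 \<in> slice" "y1 \<in> slice" "y2 \<in> slice"
  using sc half by (simp_all add: c1_def c2_def y1_def y2_def)
 have ind: "al = 0 & be = 0 & gam = 0" if "al *\<^sub>R a + be *\<^sub>R c1 + gam *\<^sub>R c2 = 0" for al be gam
 proof -
  have *: "al * ip D a w + be * ip D c1 w + gam * ip D c2 w = 0" for w
   using arg_cong[OF that, of "%z. ip D z w"] by (simp add: ip_add_left ip_scale_left)
  have "gam = 0" using *[of f2] s f2 by (simp add: c1_def c2_def e2_def ip_add_left ip_scale_left)
  moreover have "be = 0" using *[of f1] s f1 calculation by (simp add: c1_def c2_def e2_def ip_add_left ip_scale_left)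
  ultimately show ?thesis using *[of wbar] bc(6) by simp
 qed
 note tri = independent_triple[of a c1 c2, OF ind]
 define GamA where "GamA = Gam\<^sub>0 \<union> {c1, c2}"
 define GamB where "GamB = (Gam\<^sub>0 - {a}) \<union> {c1, c2, y1, y2}"
 have subA: "GamA \<subseteq> slice" and subB: "GamB \<subseteq> slice" using sl cs by (auto simp: GamA_def GamB_def)
 have dA: "dualizing GamA" using dual by (auto simp: dualizing_def GamA_def)
 have nb: "b ~= a" "x ~= a" using \<open>a \<in> open_segment b x\<close> by (auto simp: open_segment_def)
 have dB: "dualizing GamB"
  unfolding dualizing_def
 proof (intro ballI impI)
  fix w assume w: "w \<in> csp D" "\<forall>x\<in>GamB. 0 <= ip D x w"
  hence "0 <= ip D b w" "0 <= ip D x w" using bx nb by (auto simp: GamB_def)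
  hence "0 <= ip D a w" using t by (simp add: ip_add_left ip_scale_left)
  hence "\<forall>x\<in>Gam\<^sub>0. 0 <= ip D x w" using w(2) by (auto simp: GamB_def)
  thus "\<exists>c. (\<forall>v\<in>VP. 0 <= c v) & w = (\<Sum>v\<in>VP. c v *\<^sub>R p v)" using dual w(1) by (simp add: dualizing_def)
 qed
 define om where "om z = ip D z (s *\<^sub>R w1) - (1 * ip D (z - a) (z - a) - 0 * (ip D (z - a) 0)\<^sup>2)" for z
 have "\<exists>om'. layer VP p D GamA om' & cell_of GamA om' {a, c1, c2}"
 proof (rule quadratic_layer[OF _ subA dA bc(3), where om = om and w' = "s *\<^sub>R w1" and u = 0 and al = 1 and be = 0])
  show "om z < 0" if "z \<in> GamA - {a, c1, c2}" for z using that s(2)[rule_format, of z] by (auto simp: GamA_def om_def ip_scale_right)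
  show "om z = 0" if "z \<in> {a, c1, c2}" for z
   using that w1 by (auto simp: om_def c1_def c2_def ip_scale_right ip_scale_left ip_add_left)
 qed (use fin w1 subspace_csp bx tri ip_self_pos om_def in \<open>auto simp: GamA_def subspace_0 subspace_scale\<close>)
 then obtain omA where A: "layer VP p D GamA omA" "cell_of GamA omA {a, c1, c2}" by blast
 have off: "r *\<^sub>R e ~= q *\<^sub>R v" if "0 < r" "e \<in> {e1, e2}" for r q e
 proof
  assume *: "r *\<^sub>R e = q *\<^sub>R v"
  have "e = (1 / r) *\<^sub>R (r *\<^sub>R e)" using that by simp
  also have "\<dots> = (q / r) *\<^sub>R v" unfolding * by simp
  finally have "e1 = (q / r) *\<^sub>R v | e1 = (q / r - 1) *\<^sub>R v"
   using that by (auto simp: e2_def algebra_simps)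
  thus False using e1(3) by (auto simp: span_scale span_base)
 qed
 have ne: "a + r *\<^sub>R e ~= b + q *\<^sub>R v" if "0 < r" "e \<in> {e1, e2}" for r q e
  using off[OF that, of "q - t"] by (auto simp: at algebra_simps)
 have y: "y1 = a + (s / 2) *\<^sub>R e1" "y2 = a + (s / 2) *\<^sub>R e2"
 proof -
  have "(1/2) *\<^sub>R a + (1/2) *\<^sub>R a = a" by (simp flip: scaleR_add_left)
  hence "(1/2) *\<^sub>R a + (1/2) *\<^sub>R (a + s *\<^sub>R e) = a + (s / 2) *\<^sub>R e" for e
   by (simp add: scaleR_add_right flip: add.assoc)
  thus "y1 = a + (s / 2) *\<^sub>R e1" "y2 = a + (s / 2) *\<^sub>R e2" by (simp_all add: y1_def y2_def c1_def c2_def)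
 qed
 have "\<exists>om. layer VP p D GamB om & cell_of GamB om {b, x}"
 proof (rule edge_layer[OF _ subB dB])
  fix z r assume z: "z \<in> GamB" "z = b + r *\<^sub>R (x - b)"
  have "z ~: {c1, c2, y1, y2}"
   using ne[of s e1 r] ne[of s e2 r] ne[of "s/2" e1 r] ne[of "s/2" e2 r] s(1) z(2)
   unfolding y c1_def c2_def v_def by auto
  hence z0: "z \<in> Gam\<^sub>0 - {a}" using z(1) by (auto simp: GamB_def)
  show "r <= 0 | 1 <= r"
  proof (rule ccontr)
   assume "\<not> ?thesis"
   hence "z \<in> open_segment b x" using z(2) nbx by (auto simp: in_segment algebra_simps intro!: exI[of _ r])
   thus False using z0 a(1) by blast
  qed
 qed (use fin bx nbx nb in \<open>auto simp: GamB_def\<close>)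
 then obtain omB where B: "layer VP p D GamB omB" "cell_of GamB omB {b, x}" by blast
 have "posc {a, c1} y1" "posc {a, c2} y2"
  unfolding posc_def using tri by (auto simp: y1_def y2_def intro!: exI[of _ "%_. 1/2"])
 hence "gadget Gam\<^sub>0 b a x (GamA, omA) (GamB, omB)"
  unfolding gadget_def fst_conv snd_conv using A B tri
  by (intro conjI exI[of _ c1] exI[of _ c2] exI[of _ y1] exI[of _ y2]) (auto simp: GamA_def GamB_def)
 thus ?thesis by blast
qed

end

section \<open>The stamp\<close>

context stack_realization
begin

definition val :: "nat => vec => 'v => real" where "val j x v = gap j x (s' (Inl v))"

lemma val_pos:
 assumes "j < k" "x \<in> dualC" "x ~= 0" "v \<in> VP"
 shows "0 <= val j x v" "val j x v = 0 \<longleftrightarrow> ip D x (p v) = 0"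
proof -
 have "Inl v \<in> VS" "Inl v \<in> Phi j x \<longleftrightarrow> ip D x (p v) = 0" using assms(4) by auto
 thus "0 <= val j x v" "val j x v = 0 \<longleftrightarrow> ip D x (p v) = 0"
  using gap(2,4)[OF assms(1-3), of "Inl v"] by (auto simp: val_def)
qed

lemma val_pos_exists:
 assumes "x \<in> dualC" "x ~= 0"
 obtains v where "v \<in> VP" "!!j. j < k ==> 0 < val j x v"
proof -
 obtain v where v: "v \<in> VP" "ip D x (p v) ~= 0"
  using dual_wbar_pos[OF assms] unfolding ip_wbar by (metis less_irrefl sum.neutral)
 hence "0 < val j x v" if "j < k" for j using val_pos[OF that assms v(1)] by auto
 thus thesis using that v(1) by blast
qed

text \<open>For \<open>y\<close> between \<open>a\<close> and \<open>c\<close>, the relation of the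
  three holds at layers \<open>i\<close> and \<open>i + 2\<close>, and \<open>y\<close> and
  \<open>c\<close> cross layer \<open>i + 1\<close> by \<open>gap_step\<close>. So the new
  functional of \<open>a\<close> is a combination of the old ones of \<open>a\<close> and
  \<open>c\<close>. With \<open>c1\<close> and with \<open>c2\<close> this gives two combinations,
  and by independence only the old functional of \<open>a\<close> remains.\<close>

lemma gap_cross:
 assumes i: "i + 2 <= k" and w: "w \<in> LV i" "{a, c1, c2} \<subseteq> tg i w" and z: "z \<in> LV (i + 2)" "{a, c1, c2} \<subseteq> tg (i + 2) z"
  and dist: "a ~= c1" "a ~= c2" "c1 ~= c2" and y: "posc {a, c1} y1" "posc {a, c2} y2"
  and mid: "{c1, c2, y1, y2} \<subseteq> Gam (i + 1)"
 shows "\<exists>c>0. \<forall>v\<in>VP. val (i + 1) a v = c * val i a v"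
proof -
 have k: "i < k" "i + 1 < k" "i <= k" using i by auto
 have one: "\<exists>r t. \<forall>v\<in>VP. val (i + 1) a v = r * val i a v + t * val i c v"
  if c: "{a, c} \<subseteq> {a, c1, c2}" "a ~= c" "posc {a, c} y" "c \<in> Gam (i + 1)" "y \<in> Gam (i + 1)" for c y
 proof -
  have s: "{a, c} \<subseteq> tg i w" "{a, c} \<subseteq> tg (i + 2) z" using c(1) w z by blast+
  obtain al be where 1: "\<forall>v\<in>VP. val i y v = al * val i a v + be * val i c v"
   using gap_edge[OF k(3) w(1) s(1) c(2) k(1) _ c(3)] unfolding val_def by blast
  obtain al' be' where 2: "al' > 0" "\<forall>v\<in>VP. val (i + 1) y v = al' * val (i + 1) a v + be' * val (i + 1) c v"
   using gap_edge[OF i z(1) s(2) c(2) k(2) _ c(3)] unfolding val_def by auto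
  obtain m where 3: "\<forall>v\<in>VP. val (i + 1) y v = m * val i y v" using gap_step[OF k(2) c(5)] unfolding val_def by blast
  obtain n where 4: "\<forall>v\<in>VP. val (i + 1) c v = n * val i c v" using gap_step[OF k(2) c(4)] unfolding val_def by blast
  have "val (i + 1) a v = (m * al / al') * val i a v + ((m * be - be' * n) / al') * val i c v" if "v \<in> VP" for v
  proof -
   have "al' * val (i + 1) a v = m * (al * val i a v + be * val i c v) - be' * (n * val i c v)"
    using 1[rule_format, OF that] 2(2)[rule_format, OF that] 3[rule_format, OF that] 4[rule_format, OF that] by simp
   thus ?thesis using 2(1) by (simp add: field_simps)
  qed
  thus ?thesis by blast
 qed
 obtain r1 t1 where 1: "\<forall>v\<in>VP. val (i + 1) a v = r1 * val i a v + t1 * val i c1 v"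
  using one[of c1 y1] dist y mid by auto
 obtain r2 t2 where 2: "\<forall>v\<in>VP. val (i + 1) a v = r2 * val i a v + t2 * val i c2 v"
  using one[of c2 y2] dist y mid by auto
 define c where "c x = (if x = a then r1 - r2 else if x = c1 then t1 else - t2)" for x
 have "c c1 = 0"
 proof (rule gap_indep[OF k(3) w k(1)])
  show "(\<Sum>x\<in>{a, c1, c2}. c x * gap i x (s' (Inl v))) = 0" if "v \<in> VP" for v
  proof -
   have "r1 * val i a v + t1 * val i c1 v = r2 * val i a v + t2 * val i c2 v"
    using 1 2 that by auto
   thus ?thesis using dist unfolding val_def by (simp add: c_def algebra_simps)
  qed
 qed auto
 hence t1: "t1 = 0" using dist by (simp add: c_def split: if_splits)
 have a: "a \<in> dualC" "a ~= 0" using Gam_dual[OF k(3), of a] tg_sub[OF k(3), of w] w(2) by auto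
 obtain v where v: "v \<in> VP" "0 < val i a v" "0 < val (i + 1) a v" using val_pos_exists[OF a] k by metis
 hence "0 < r1 * val i a v" using 1 t1 by auto
 hence "r1 > 0" using v(2) by (simp add: zero_less_mult_iff)
 thus ?thesis using 1 t1 by auto
qed

end

lemma open_segment_sub:
 fixes b :: "'x::real_vector"
 assumes "y \<in> open_segment b x"
 shows "open_segment b y \<subseteq> open_segment b x"
proof
 fix z assume "z \<in> open_segment b y"
 then obtain u where u: "0 < u" "u < 1" "z = (1 - u) *\<^sub>R b + u *\<^sub>R y" by (auto simp: in_segment)
 obtain t where t: "0 < t" "t < 1" "y = (1 - t) *\<^sub>R b + t *\<^sub>R x" and ne: "b ~= x" using assms by (auto simp: in_segment)
 have "z = (1 - u * t) *\<^sub>R b + (u * t) *\<^sub>R x" unfolding u(3) t(3) by (simp add: algebra_simps)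
 moreover have "0 < u * t" "u * t < 1" using u t mult_strict_mono[of u 1 t 1] by auto
 ultimately show "z \<in> open_segment b x" using ne unfolding in_segment by blast
qed

lemma open_segment_two:
 fixes b :: "'x::real_vector"
 assumes "a \<in> open_segment b x" "q \<in> open_segment b x" "a ~= q"
 shows "(a \<in> open_segment b q & q \<in> open_segment a x) | (a \<in> open_segment x q & q \<in> open_segment a b)"
proof -
 obtain s where s: "0 < s" "s < 1" "a = (1 - s) *\<^sub>R b + s *\<^sub>R x" and ne: "b ~= x" using assms by (auto simp: in_segment)
 obtain t where t: "0 < t" "t < 1" "q = (1 - t) *\<^sub>R b + t *\<^sub>R x" using assms by (auto simp: in_segment)
 have *: "a \<in> open_segment b q & q \<in> open_segment a x"
  if s: "0 < s" "s < 1" "a = (1 - s) *\<^sub>R b + s *\<^sub>R x" and t: "0 < t" "t < 1" "q = (1 - t) *\<^sub>R b + t *\<^sub>R x"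
   and st: "s < t" and ne: "b ~= x" for s t b x
 proof
  have nb: "b ~= q" "a ~= x"
  proof -
   have "q - b = t *\<^sub>R (x - b)" "x - a = (1 - s) *\<^sub>R (x - b)" unfolding t(3) s(3) by (simp_all add: algebra_simps)
   thus "b ~= q" "a ~= x" using s t ne by auto
  qed
  have "a = (1 - s / t) *\<^sub>R b + (s / t) *\<^sub>R q" unfolding s(3) t(3) using t(1) by (simp add: algebra_simps)
  thus "a \<in> open_segment b q" using nb s t st unfolding in_segment by (auto intro!: exI[of _ "s / t"])
  define r where "r = (t - s) / (1 - s)"
  have r: "0 < r" "r < 1" "(1 - r) * (1 - s) = 1 - t" using s t st by (auto simp: r_def field_simps)
  have "(1 - r) *\<^sub>R a + r *\<^sub>R x = ((1 - r) * (1 - s)) *\<^sub>R b + (1 - (1 - r) * (1 - s)) *\<^sub>R x"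
   unfolding s(3) by (simp add: algebra_simps)
  also have "\<dots> = q" unfolding r(3) t(3) by simp
  finally show "q \<in> open_segment a x" using nb r unfolding in_segment by metis
 qed
 have "s ~= t" using assms(3) s t by auto
 then consider "s < t" | "1 - s < 1 - t" by linarith
 thus ?thesis
 proof cases
  case 1
  thus ?thesis using *[OF s t _ ne] by blast
 next
  case 2
  have "a \<in> open_segment x q & q \<in> open_segment a b"
   using s t 2 ne by (intro *[where s = "1 - s" and t = "1 - t" and b = x and x = b]) (auto simp: add.commute)
  thus ?thesis by blast
 qed
qed

context cone_config
begin

text \<open>Each triple with no further ray in its open segment gets a block of layers
  \<open>A\<close>, \<open>B\<close>, \<open>A\<close>. The relation found at its \<open>B\<close>
  is carried down to gap \<open>0\<close>; the other triples follow by induction on the number of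
  rays inside the segment.\<close>

lemma stack_forces_betweenness:
 fixes Gam\<^sub>0 :: "vec set"
 assumes fin: "finite Gam\<^sub>0" and sl: "Gam\<^sub>0 \<subseteq> slice" and dual: "dualizing Gam\<^sub>0" and ne: "Gam\<^sub>0 ~= {}"
 shows "\<exists>k Gam om. stack VP p D k Gam om &
  (\<forall>s' :: _ => 'x::real_vector. stack_realization VP p D k Gam om s' -->
   (\<forall>b\<in>Gam\<^sub>0. \<forall>x\<in>Gam\<^sub>0. \<forall>a\<in>Gam\<^sub>0 \<inter> open_segment b x. inner a -->
    (\<exists>al>0. \<exists>be>0. \<forall>v\<in>VP. stack_realization.val VP p D k Gam om s' 0 a v =
     al * stack_realization.val VP p D k Gam om s' 0 b v + be * stack_realization.val VP p D k Gam om s' 0 x v)))"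
proof -
 define Adj where "Adj = {(b, a, x). b \<in> Gam\<^sub>0 & a \<in> Gam\<^sub>0 & x \<in> Gam\<^sub>0 & Gam\<^sub>0 \<inter> open_segment b x = {a} & inner a}"
 have "Adj \<subseteq> Gam\<^sub>0 \<times> Gam\<^sub>0 \<times> Gam\<^sub>0" by (auto simp: Adj_def)
 hence "finite Adj" using fin by (meson finite_SigmaI finite_subset)
 then obtain ts where ts: "set ts = Adj" using finite_list by blast
 have "\<exists>A B. gadget Gam\<^sub>0 (fst tau) (fst (snd tau)) (snd (snd tau)) A B" if "tau \<in> Adj" for tau
  using that gadget_exists[OF fin sl dual] by (auto simp: Adj_def)
 then obtain fA fB where gad: "!!tau. tau \<in> Adj ==> gadget Gam\<^sub>0 (fst tau) (fst (snd tau)) (snd (snd tau)) (fA tau) (fB tau)"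
  by metis
 obtain b0 where b0: "b0 \<in> Gam\<^sub>0" using ne by blast
 have "\<exists>om. layer VP p D Gam\<^sub>0 om & cell_of Gam\<^sub>0 om {b0}"
 proof (rule quadratic_layer[OF fin sl dual, where w' = 0 and b = b0 and u = 0 and al = 1 and be = 0
    and om = "%z. ip D z 0 - (1 * ip D (z - b0) (z - b0) - 0 * (ip D (z - b0) 0)\<^sup>2)"])
  have bc: "z \<in> csp D" if "z \<in> Gam\<^sub>0" for z using that sl slice_coord by blast
  show "ip D z 0 - (1 * ip D (z - b0) (z - b0) - 0 * (ip D (z - b0) 0)\<^sup>2) < 0" if "z \<in> Gam\<^sub>0 - {b0}" for z
   using that ip_self_pos[of "z - b0" D] bc[of z] bc[OF b0] subspace_csp by (auto simp: subspace_diff)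
 qed (use b0 sl slice_nz slice_coord subspace_csp ip_self_pos in \<open>auto simp: subspace_0\<close>)
 then obtain om0 where om0: "layer VP p D Gam\<^sub>0 om0" by blast
 define T where "T = length ts"
 \<comment> \<open>Blocks of three, closed by two plain layers \<open>3 * T\<close> and
   \<open>3 * T + 1\<close>, so that there is a gap even without triples.\<close>
 define L where "L i = (if i < 3 * T then (if i mod 3 = 1 then fB (ts ! (i div 3)) else fA (ts ! (i div 3))) else (Gam\<^sub>0, om0))" for i
 define k where "k = 3 * T + 1"
 define Gam where "Gam i = fst (L i)" for i
 define om where "om i = snd (L i)" for i
 have gadt: "gadget Gam\<^sub>0 (fst (ts ! (i div 3))) (fst (snd (ts ! (i div 3)))) (snd (snd (ts ! (i div 3)))) (fA (ts ! (i div 3))) (fB (ts ! (i div 3)))"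
  "ts ! (i div 3) \<in> Adj" if "i < 3 * T" for i
 proof -
  have "i div 3 < T" using that by auto
  thus "ts ! (i div 3) \<in> Adj" using ts unfolding T_def by auto
  thus "gadget Gam\<^sub>0 (fst (ts ! (i div 3))) (fst (snd (ts ! (i div 3)))) (snd (snd (ts ! (i div 3)))) (fA (ts ! (i div 3))) (fB (ts ! (i div 3)))"
   by (rule gad)
 qed
 have lay: "layer VP p D (Gam i) (om i)" for i
  using gadt(1)[of i] om0 by (auto simp: Gam_def om_def L_def gadget_def)
 have sub: "Gam\<^sub>0 - (if i < 3 * T & i mod 3 = 1 then {fst (snd (ts ! (i div 3)))} else {}) \<subseteq> Gam i" for i
  using gadt(1)[of i] by (auto simp: Gam_def L_def gadget_def)
 have st: "stack VP p D k Gam om"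
 proof (intro stack.intro stack_axioms.intro)
  show "cone_config VP p D" by (rule cone_config_axioms)
  show "1 <= k" by (simp add: k_def)
  show "layer VP p D (Gam i) (om i)" for i by (rule lay)
  show "Gam i ~= {}" for i
  proof (cases "i < 3 * T & i mod 3 = 1")
   case True
   obtain b a x where t: "ts ! (i div 3) = (b, a, x)" by (cases "ts ! (i div 3)")
   have "(b, a, x) \<in> Adj" using gadt(2)[of i] True unfolding t by blast
   hence "b \<in> Gam\<^sub>0" "a \<in> open_segment b x" by (auto simp: Adj_def)
   hence "b \<in> Gam\<^sub>0 - {a}" by (auto simp: open_segment_def)
   moreover have "Gam\<^sub>0 - {a} \<subseteq> Gam i" using sub[of i] True t by simp
   ultimately show ?thesis by blast
  qed (use sub[of i] ne in auto)
 qed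
 have main: "\<exists>al>0. \<exists>be>0. \<forall>v\<in>VP. stack_realization.val VP p D k Gam om s' 0 a v =
   al * stack_realization.val VP p D k Gam om s' 0 b v + be * stack_realization.val VP p D k Gam om s' 0 x v"
  if R: "stack_realization VP p D k Gam om s'" and bx: "b \<in> Gam\<^sub>0" "x \<in> Gam\<^sub>0" "a \<in> Gam\<^sub>0 \<inter> open_segment b x" "inner a"
  for s' :: "_ => 'x" and b x a
 proof -
  interpret R: stack_realization VP p D k Gam om s' by (rule R)
  have cellI: "\<exists>w\<in>R.LV i. kap \<subseteq> R.tg i w" if "cell_of (Gam i) (om i) kap" for i kap
   using that by (simp add: cell_of_def R.LV_def R.tg_def)
  \<comment> \<open>Only the middle layer of a block can lack \<open>y\<close>, and then
    \<open>y\<close> is the middle point of its triple, for which the block was built.\<close>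
  have step: "\<exists>c>0. \<forall>v\<in>VP. R.val (i + 1) y v = c * R.val i y v" if i: "i + 1 < k" and y: "y \<in> Gam\<^sub>0" for i y
  proof (cases "y \<in> Gam (i + 1)")
   case True
   thus ?thesis using R.gap_step[OF i True] by (simp add: R.val_def)
  next
   case False
   define m where "m = i div 3"
   have i1: "i + 1 < 3 * T" "(i + 1) mod 3 = 1" "y = fst (snd (ts ! ((i + 1) div 3)))"
    using sub[of "i + 1"] False y by (auto split: if_splits)
   hence im: "i = 3 * m" by (auto simp: m_def mod_Suc split: if_splits)
   have d: "(i + 1) div 3 = m" "(i + 2) div 3 = m" "i div 3 = m" using im by auto
   have T: "i + 2 < 3 * T" using i1(1) unfolding im by presburger
   have L: "L i = fA (ts ! m)" "L (i + 1) = fB (ts ! m)" "L (i + 2) = fA (ts ! m)"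
   proof -
    have "i mod 3 ~= 1" "(i + 2) mod 3 ~= 1" unfolding im by presburger+
    thus "L i = fA (ts ! m)" "L (i + 1) = fB (ts ! m)" "L (i + 2) = fA (ts ! m)"
     using T i1(1,2) d by (simp_all only: L_def) simp_all
   qed
   obtain c1 c2 y1 y2 where c: "{c1, c2, y1, y2} \<subseteq> Gam (i + 1)" "cell_of (Gam i) (om i) {y, c1, c2}"
    "y ~= c1" "y ~= c2" "c1 ~= c2" "posc {y, c1} y1" "posc {y, c2} y2"
    using gadt(1)[of "i + 1"] i1 unfolding d gadget_def Gam_def om_def L by blast
   have "cell_of (Gam (i + 2)) (om (i + 2)) {y, c1, c2}" using c(2) by (simp only: Gam_def om_def L)
   from cellI[OF c(2)] cellI[OF this] obtain w z where w: "w \<in> R.LV i" "{y, c1, c2} \<subseteq> R.tg i w"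
    and z: "z \<in> R.LV (i + 2)" "{y, c1, c2} \<subseteq> R.tg (i + 2) z" by blast
   have "i + 2 <= k" using T by (simp add: k_def)
   from R.gap_cross[OF this w z c(3,4,5,6,7,1)] show ?thesis .
  qed
  have trans: "\<exists>c>0. \<forall>v\<in>VP. R.val i y v = c * R.val 0 y v" if ik: "i < k" and y: "y \<in> Gam\<^sub>0" for i y
   using ik
  proof (induction i)
   case 0
   thus ?case by (intro exI[of _ 1]) auto
  next
   case (Suc i)
   obtain c where c: "c > 0" "\<forall>v\<in>VP. R.val i y v = c * R.val 0 y v" using Suc by auto
   obtain c' where c': "c' > 0" "\<forall>v\<in>VP. R.val (Suc i) y v = c' * R.val i y v" using step[OF _ y, of i] Suc.prems by auto
   have "\<forall>v\<in>VP. R.val (Suc i) y v = (c' * c) * R.val 0 y v" using c c' by simp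
   thus ?case using c(1) c'(1) mult_pos_pos by blast
  qed
  have adj: "\<exists>al>0. \<exists>be>0. \<forall>v\<in>VP. R.val 0 a v = al * R.val 0 b v + be * R.val 0 x v" if A: "(b, a, x) \<in> Adj" for a b x
  proof -
   obtain m where m: "m < T" "ts ! m = (b, a, x)" using A[folded ts] by (auto simp: in_set_conv_nth T_def)
   have i: "3 * m + 1 < 3 * T" "(3 * m + 1) mod 3 = 1" "(3 * m + 1) div 3 = m" "3 * m + 1 <= k" "3 * m < k"
    using m(1) unfolding k_def by presburger+
   have L: "L (3 * m + 1) = fB (ts ! m)" using i by (simp only: L_def refl if_True)
   have "cell_of (Gam (3 * m + 1)) (om (3 * m + 1)) {b, x}"
    using gadt(1)[OF i(1)] unfolding i(3) Gam_def om_def L gadget_def m(2) by simp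
   from cellI[OF this] obtain w where w: "w \<in> R.LV (3 * m + 1)" "{b, x} \<subseteq> R.tg (3 * m + 1) w" by blast
   have o: "a \<in> open_segment b x" "b ~= x" "a \<in> Gam\<^sub>0" "b \<in> Gam\<^sub>0" "x \<in> Gam\<^sub>0" using A by (auto simp: Adj_def)
   then obtain t where t: "0 < t" "t < 1" "a = (1 - t) *\<^sub>R b + t *\<^sub>R x" by (auto simp: in_segment)
   have pc: "posc {b, x} a"
    unfolding posc_def using t o(2) by (intro exI[of _ "%z. if z = b then 1 - t else t"]) auto
   obtain al be where 1: "al > 0" "be > 0" "\<forall>v\<in>VP. R.val (3 * m) a v = al * R.val (3 * m) b v + be * R.val (3 * m) x v"
    using R.gap_edge[OF i(4) w o(2) i(5) _ pc] unfolding R.val_def by auto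
   obtain ca where ca: "ca > 0" "\<forall>v\<in>VP. R.val (3 * m) a v = ca * R.val 0 a v" using trans[OF i(5) o(3)] by blast
   obtain cb where cb: "cb > 0" "\<forall>v\<in>VP. R.val (3 * m) b v = cb * R.val 0 b v" using trans[OF i(5) o(4)] by blast
   obtain cx where cx: "cx > 0" "\<forall>v\<in>VP. R.val (3 * m) x v = cx * R.val 0 x v" using trans[OF i(5) o(5)] by blast
   have "R.val 0 a v = al * cb / ca * R.val 0 b v + be * cx / ca * R.val 0 x v" if v: "v \<in> VP" for v
   proof -
    have "ca * R.val 0 a v = al * (cb * R.val 0 b v) + be * (cx * R.val 0 x v)"
     using 1(3) ca(2) cb(2) cx(2) v by simp
    thus ?thesis using ca(1) by (simp add: field_simps)
   qed
   moreover have "0 < al * cb / ca" "0 < be * cx / ca" using 1 ca cb cx by simp_all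
   ultimately show ?thesis by blast
  qed
  show ?thesis
   using bx
  proof (induction "card (Gam\<^sub>0 \<inter> open_segment b x)" arbitrary: a b x rule: less_induct)
   case less
   have val: "0 <= R.val 0 y v" "R.val 0 y v = 0 \<longleftrightarrow> ip D y (p v) = 0" if "y \<in> Gam\<^sub>0" "v \<in> VP" for y v
   proof -
    have "y \<in> slice" using that(1) sl by blast
    thus "0 <= R.val 0 y v" "R.val 0 y v = 0 \<longleftrightarrow> ip D y (p v) = 0"
     using R.val_pos[of 0 y v] that(2) slice_dual slice_nz by (auto simp: k_def)
   qed
   define P where "P b a x \<longleftrightarrow> (\<exists>al>0. \<exists>be>0. \<forall>v\<in>VP. R.val 0 a v = al * R.val 0 b v + be * R.val 0 x v)" for b a x
   have Psym: "P b a x ==> P x a b" for b a x unfolding P_def by (metis add.commute)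
   show ?case
   proof (cases "Gam\<^sub>0 \<inter> open_segment b x = {a}")
    case True
    thus ?thesis using less.prems by (intro adj) (auto simp: Adj_def)
   next
    case False
    then obtain q where q: "q \<in> Gam\<^sub>0" "q \<in> open_segment b x" "q ~= a" using less.prems(3) by blast
    have a: "a \<in> Gam\<^sub>0" "a \<in> open_segment b x" "inner a" using less.prems by auto
    \<comment> \<open>As \<open>a\<close> is inner, no \<open>p v\<close> is annihilated by both
      ends; so the whole open segment is inner, in particular \<open>q\<close>.\<close>
    have ends: "0 < R.val 0 b v | 0 < R.val 0 x v" "0 < (1 - t) * ip D b (p v) + t * ip D x (p v)"
     if v: "v \<in> VP" and t: "0 < t" "t < 1" for v t
    proof -
     obtain r where "0 < r" "r < 1" "a = (1 - r) *\<^sub>R b + r *\<^sub>R x" using a(2) by (auto simp: in_segment)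
     hence "0 < (1 - r) * ip D b (p v) + r * ip D x (p v)"
      using a(3) v by (auto simp: inner_def ip_add_left ip_scale_left)
     hence nz: "ip D b (p v) ~= 0 | ip D x (p v) ~= 0" by auto
     thus "0 < R.val 0 b v | 0 < R.val 0 x v"
      using val[OF less.prems(1) v] val[OF less.prems(2) v] by auto
     have "0 <= ip D b (p v)" "0 <= ip D x (p v)" using less.prems sl slice_dual v by (auto simp: dualC_def)
     thus "0 < (1 - t) * ip D b (p v) + t * ip D x (p v)"
      using nz t by (auto intro: add_pos_nonneg add_nonneg_pos)
    qed
    have core: "P b' a x'"
     if e: "(b' = b & x' = x) | (b' = x & x' = b)" and aq: "a \<in> open_segment b' q" "q \<in> open_segment a x'" for b' x'
    proof -
     have seg: "open_segment b' x' = open_segment b x" using e open_segment_commute by blast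
     have m: "b' \<in> Gam\<^sub>0" "x' \<in> Gam\<^sub>0" "a \<in> open_segment b' x'" "q \<in> open_segment b' x'" using e less.prems q a seg by auto
     have s1: "Gam\<^sub>0 \<inter> open_segment b' q \<subset> Gam\<^sub>0 \<inter> open_segment b x"
     proof -
      have "q ~: open_segment b' q" by (simp add: open_segment_def)
      thus ?thesis using open_segment_sub[OF m(4)] seg q by blast
     qed
     have s2: "Gam\<^sub>0 \<inter> open_segment a x' \<subset> Gam\<^sub>0 \<inter> open_segment b x"
     proof -
      have "open_segment x' a \<subseteq> open_segment x' b'"
       using m(3) by (intro open_segment_sub) (simp add: open_segment_commute)
      hence "open_segment a x' \<subseteq> open_segment b x" using seg open_segment_commute by metis
      moreover have "a ~: open_segment a x'" by (simp add: open_segment_def)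
      ultimately show ?thesis using a by blast
     qed
     obtain r where "0 < r" "r < 1" "q = (1 - r) *\<^sub>R b + r *\<^sub>R x" using q(2) by (auto simp: in_segment)
     hence iq: "inner q" using ends(2) by (auto simp: inner_def ip_add_left ip_scale_left)
     have "P b' a q"
      unfolding P_def using aq m q a by (intro less.hyps psubset_card_mono s1) (auto simp: fin)
     then obtain l mu where 1: "l > 0" "mu > 0" "\<forall>v\<in>VP. R.val 0 a v = l * R.val 0 b' v + mu * R.val 0 q v"
      unfolding P_def by blast
     have "P a q x'"
      unfolding P_def using aq m q a iq by (intro less.hyps psubset_card_mono s2) (auto simp: fin)
     then obtain al be where 2: "al > 0" "be > 0" "\<forall>v\<in>VP. R.val 0 q v = al * R.val 0 a v + be * R.val 0 x' v"
      unfolding P_def by blast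
     \<comment> \<open>Elimination of \<open>q\<close> from the two relations writes
       \<open>e\<close> times the functional of \<open>a\<close> as a positive combination of those
       of the ends; its value at one \<open>v\<close> shows \<open>e > 0\<close>.\<close>
     define e where "e = 1 - mu * al"
     have eq: "e * R.val 0 a v = l * R.val 0 b' v + (mu * be) * R.val 0 x' v" if "v \<in> VP" for v
      using 1(3)[rule_format, OF that] 2(3)[rule_format, OF that] by (simp add: e_def algebra_simps)
     have "a \<in> slice" using a sl by blast
     then obtain v where v: "v \<in> VP" "0 < R.val 0 a v"
      using R.val_pos_exists[of a] slice_dual slice_nz by (metis R.k1 less_le_trans zero_less_one)
     have "0 < l * R.val 0 b' v + (mu * be) * R.val 0 x' v"
      using ends(1)[OF v(1), of "1/2"] e val[OF m(1) v(1)] val[OF m(2) v(1)] 1 2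
      by (auto intro: add_pos_nonneg add_nonneg_pos)
     hence e0: "e > 0" using eq[OF v(1)] v(2) by (metis zero_less_mult_pos2)
     have "\<forall>v\<in>VP. R.val 0 a v = (l / e) * R.val 0 b' v + (mu * be / e) * R.val 0 x' v"
      using eq e0 by (simp add: field_simps)
     moreover have "0 < l / e" "0 < mu * be / e" using e0 1 2 by simp_all
     ultimately show ?thesis unfolding P_def by blast
    qed
    have "P b a x"
     using open_segment_two[OF a(2) q(2) q(3)[symmetric]] core[of b x] Psym[OF core[of x b]] by blast
    thus ?thesis by (simp add: P_def)
   qed
  qed
 qed
 show ?thesis using st main by blast
qed

end

section \<open>Rigid finite sets of numbers\<close>

text \<open>Positivity carries the order; it is what tells an algebraic number from its
  conjugates.\<close>

definition partial_hom :: "real set => (real => real) => bool" where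
 "partial_hom R th \<longleftrightarrow> (\<forall>x\<in>R. 0 < th x) & th 1 = 1 &
   (\<forall>x\<in>R. \<forall>y\<in>R. (x + y \<in> R --> th (x + y) = th x + th y) & (x * y \<in> R --> th (x * y) = th x * th y))"

text \<open>\<open>S\<close> holds the positive values at \<open>al\<close> of all integer
  polynomials of bounded degree and coefficients. The odd extension \<open>Th\<close> of
  \<open>th\<close> commutes with their evaluation; so \<open>th al\<close> is a root of
  \<open>P\<close>, and positivity preserves the two inequalities that isolate
  \<open>al\<close>.\<close>

lemma rigid_set_exists:
 assumes alg: "algebraic al" and al: "0 < al"
 shows "\<exists>S. finite S & S \<subseteq> {0<..} & al \<in> S & (\<forall>R th. S \<subseteq> R & R \<subseteq> {0<..} & partial_hom R th --> th al = al)"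
proof -
 obtain P n m where P: "\<forall>i. coeff P i \<in> \<int>" "poly P al = 0" "(n::nat) > 0" "of_int m <= real n * al" "real n * al <= of_int m + 1"
  "!!be. poly P be = 0 ==> of_int m <= real n * be ==> real n * be <= of_int m + 1 ==> be = al"
  using algebraic_isolated[OF alg] by blast
 have "\<forall>i. \<exists>z::int. coeff P i = of_int z" using P(1) by (auto elim: Ints_cases)
 then obtain c where c: "!!i. coeff P i = of_int (c i)" by metis
 \<comment> \<open>At least \<open>1\<close>, so that \<open>al\<close> itself is among the
   powers.\<close>
 define N where "N = Suc (degree P)"
 have c0: "c i = 0" if "i >= N" for i using c[of i] that by (simp add: N_def coeff_eq_0)
 \<comment> \<open>Bounds the coefficients of \<open>P\<close> and of the linear polynomials
   \<open>n * t - m\<close> and \<open>m + 1 - n * t\<close>.\<close>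
 define M where "M = (\<Sum>i\<le>N. \<bar>c i\<bar>) + int n + \<bar>m\<bar> + 1"
 have M: "\<bar>c i\<bar> <= M" if "i <= N" for i
 proof -
  have "\<bar>c i\<bar> <= (\<Sum>i\<le>N. \<bar>c i\<bar>)" using that by (intro member_le_sum) auto
  thus ?thesis by (simp add: M_def)
 qed
 have sumc: "0 <= (\<Sum>i\<le>N. \<bar>c i\<bar>)" by (intro sum_nonneg) auto
 hence M1: "1 <= M" "int n <= M" "\<bar>m\<bar> <= M" "\<bar>m + 1\<bar> <= M" unfolding M_def by linarith+
 define ev where "ev d t = (\<Sum>k\<le>N. of_int (d k) * t ^ k)" for d :: "nat => int" and t :: real
 define C where "C = {d. \<forall>k\<le>N. \<bar>d k\<bar> <= M}"
 have "(%d. ev d al) ` C \<subseteq> (%d. ev d al) ` PiE {..N} (%_. {- M..M})"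
 proof
  fix x assume "x \<in> (%d. ev d al) ` C"
  then obtain d where d: "d \<in> C" "x = ev d al" by blast
  have "restrict d {..N} \<in> PiE {..N} (%_. {- M..M})" using d(1) by (auto simp: C_def abs_le_iff)
  moreover have "ev (restrict d {..N}) al = x" unfolding d(2) ev_def by (intro sum.cong) auto
  ultimately show "x \<in> (%d. ev d al) ` PiE {..N} (%_. {- M..M})" by (metis image_eqI)
 qed
 hence fin: "finite ((%d. ev d al) ` C)" by (rule finite_subset) (auto intro!: finite_imageI finite_PiE)
 define unit where "unit k = (%i. if i = k then 1 else (0::int))" for k :: nat
 have ev_unit: "ev (unit k) t = t ^ k" if "k <= N" for k t
  using that by (simp add: ev_def unit_def if_distrib[of "%z. of_int z * _"] sum.delta cong: if_cong)
 have unitC: "unit k \<in> C" for k using M1 by (auto simp: C_def unit_def)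
 define S where "S = (%d. ev d al) ` C \<inter> {0<..}"
 have pow: "al ^ k \<in> S" if "k <= N" for k
  unfolding S_def using al unitC[of k] ev_unit[OF that, of al] by (auto intro!: image_eqI[of _ _ "unit k"])
 have "th al = al" if SR: "S \<subseteq> R" and h: "partial_hom R th" for R th
 proof -
  have th: "0 < th x" if "x \<in> S" for x using h that SR by (auto simp: partial_hom_def)
  have add: "th (x + y) = th x + th y" if "x \<in> S" "y \<in> S" "x + y \<in> S" for x y
   using h that SR unfolding partial_hom_def by blast
  have mult: "th (x * y) = th x * th y" if "x \<in> S" "y \<in> S" "x * y \<in> S" for x y
   using h that SR unfolding partial_hom_def by blast
  have thp: "th (al ^ k) = th al ^ k" if "k <= N" for k
   using that
  proof (induction k)
   case 0 thus ?case using h by (simp add: partial_hom_def)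
  next
   case (Suc k)
   have "th (al * al ^ k) = th al * th (al ^ k)"
    using pow[of 1] pow[of k] pow[of "Suc k"] Suc.prems by (intro mult) (auto simp: N_def)
   thus ?case using Suc by simp
  qed
  define Th where "Th x = (if 0 < x then th x else if x < 0 then - th (- x) else 0)" for x
  define E where "E = (%d. ev d al) ` C"
  have Eneg: "- x \<in> E" if xE: "x \<in> E" for x
  proof -
   obtain d where "d \<in> C" "x = ev d al" using xE by (auto simp: E_def)
   hence "(%k. - d k) \<in> C" "- x = ev (%k. - d k) al" by (auto simp: C_def ev_def sum_negf)
   thus ?thesis by (auto simp: E_def)
  qed
  have SE: "x \<in> S \<longleftrightarrow> x \<in> E & 0 < x" for x by (auto simp: S_def E_def)
  have pos: "th (x + y) = th x + th y" if "x \<in> E" "y \<in> E" "x + y \<in> E" "0 < x" "0 < y" for x y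
   using that by (intro add) (auto simp: SE)
  have Tadd: "Th (x + y) = Th x + Th y" if "x \<in> E" "y \<in> E" "x + y \<in> E" for x y
  proof -
   note n = Eneg[OF that(1)] Eneg[OF that(2)] Eneg[OF that(3)]
   consider "x = 0" | "y = 0" | "0 < x" "0 < y" | "x < 0" "y < 0" | "0 < x" "y < 0" | "x < 0" "0 < y" by linarith
   thus ?thesis
   proof cases
    case 3 thus ?thesis using pos that by (simp add: Th_def)
   next
    case 4 thus ?thesis using pos[of "- x" "- y"] that n by (simp add: Th_def)
   next
    case 5
    consider "0 < x + y" | "x + y < 0" | "x + y = 0" by linarith
    thus ?thesis
    proof cases
     case 1 thus ?thesis using 5 pos[of "x + y" "- y"] that n by (simp add: Th_def)
    next
     case 2 thus ?thesis using 5 pos[of x "- (x + y)"] that n by (simp add: Th_def)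
    next
     case 3
     hence "y = - x" by simp
     thus ?thesis using 5 by (simp add: Th_def)
    qed
   next
    case 6
    consider "0 < x + y" | "x + y < 0" | "x + y = 0" by linarith
    thus ?thesis
    proof cases
     case 1 thus ?thesis using 6 pos[of "x + y" "- x"] that n by (simp add: Th_def)
    next
     case 2 thus ?thesis using 6 pos[of "- (x + y)" y] that n by (simp add: Th_def)
    next
     case 3
     hence "x = - y" by simp
     thus ?thesis using 6 by (simp add: Th_def)
    qed
   qed (auto simp: Th_def)
  qed
  have Tev: "Th (ev d al) = ev d (th al)" if "d \<in> C" for d
   using that
  proof (induction "\<Sum>k\<le>N. nat \<bar>d k\<bar>" arbitrary: d rule: less_induct)
   case less
   show ?case
   proof (cases "\<forall>k\<le>N. d k = 0")
    case True
    thus ?thesis by (simp add: ev_def Th_def)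
   next
    case False
    then obtain k where k: "k <= N" "d k ~= 0" by blast
    \<comment> \<open>A coefficient moved one unit towards zero stays within the bound, so all
      intermediate values belong to \<open>E\<close> and additivity applies.\<close>
    define s where "s = sgn (d k)"
    define d' where "d' i = d i - s * unit k i" for i
    have lt: "nat \<bar>d' k\<bar> < nat \<bar>d k\<bar>" using k(2) by (auto simp: d'_def s_def unit_def sgn_if)
    have le: "nat \<bar>d' i\<bar> <= nat \<bar>d i\<bar>" for i using lt by (cases "i = k") (auto simp: d'_def unit_def)
    have d'C: "d' \<in> C"
     unfolding C_def
    proof (intro CollectI allI impI)
     fix i assume "i <= N"
     thus "\<bar>d' i\<bar> <= M" using le[of i] less.prems by (force simp: C_def)
    qed
    have "(\<Sum>k\<le>N. nat \<bar>d' k\<bar>) < (\<Sum>k\<le>N. nat \<bar>d k\<bar>)"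
     using k(1) le lt by (intro sum_strict_mono_ex1) auto
    hence IH: "Th (ev d' al) = ev d' (th al)" using d'C by (rule less.hyps)
    have split: "ev d t = ev d' t + of_int s * t ^ k" for t
    proof -
     have "ev d' t = ev d t - of_int s * ev (unit k) t"
      by (simp add: ev_def d'_def sum_subtractf algebra_simps sum_distrib_left)
     thus ?thesis using ev_unit[OF k(1)] by simp
    qed
    have s: "s = 1 | s = - 1" using k(2) by (auto simp: s_def sgn_if)
    have "of_int s * al ^ k \<in> E" using s pow[OF k(1)] Eneg by (auto simp: SE)
    hence "Th (ev d al) = Th (ev d' al) + Th (of_int s * al ^ k)"
     using d'C less.prems unfolding split[of al] by (intro Tadd) (auto simp: E_def simp flip: split)
    moreover have "Th (of_int s * al ^ k) = of_int s * th al ^ k"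
     using s al thp[OF k(1)] by (auto simp: Th_def)
    ultimately show ?thesis using IH split[of "th al"] by simp
   qed
  qed
  have Tnn: "0 <= Th x" if "x \<in> E" "0 <= x" for x
   using that th[of x] by (auto simp: Th_def SE less_imp_le)
  have evP: "poly P t = ev c t" for t
  proof -
   have "poly P t = (\<Sum>i\<le>degree P. coeff P i * t ^ i)" by (rule poly_altdef)
   also have "\<dots> = ev c t" unfolding ev_def N_def using c c0[of "Suc (degree P)"] by (simp add: N_def)
   finally show ?thesis .
  qed
  have "c \<in> C" using M by (simp add: C_def)
  hence "ev c (th al) = Th (ev c al)" using Tev by simp
  hence "poly P (th al) = 0" using evP[of al] evP[of "th al"] P(2) by (simp add: Th_def)
  moreover
  define lin where "lin a b = (%k::nat. if k = 0 then b else if k = 1 then a else (0::int))" for a b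
  have ev_lin: "ev (lin a b) t = of_int b + of_int a * t" for a b t
  proof -
   have "ev (lin a b) t = (\<Sum>k\<in>{0, 1}. of_int (lin a b k) * t ^ k)"
    unfolding ev_def by (intro sum.mono_neutral_right) (auto simp: lin_def N_def)
   thus ?thesis by (simp add: lin_def)
  qed
  have l: "lin (int n) (- m) \<in> C" "lin (- int n) (m + 1) \<in> C" using M1 by (auto simp: C_def lin_def)
  hence "0 <= ev (lin (int n) (- m)) (th al)" "0 <= ev (lin (- int n) (m + 1)) (th al)"
   using P(4,5) imageI[OF l(1), of "%d. ev d al"] imageI[OF l(2), of "%d. ev d al"]
   unfolding Tev[OF l(1), symmetric] Tev[OF l(2), symmetric]
   by (auto intro!: Tnn simp: E_def ev_lin)
  ultimately show ?thesis by (intro P(6)) (auto simp: ev_lin)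
 qed
 thus ?thesis
  using fin pow[of 1] by (intro exI[of _ S]) (auto simp: S_def N_def)
qed

section \<open>Coordinates from collinearities\<close>

lemma ex_third_index: "3 <= D ==> \<exists>i<D. i ~= j & i ~= (k::nat)"
 by presburger

text \<open>\<open>b f\<close> holds the coordinates of the counterpart of the grid vector
  \<open>f\<close>, in a frame normalized by \<open>b_unit\<close>. Counterparts are known up to
  positive factors only: hence the unspecified coefficients in \<open>b_add\<close>, and
  \<open>b_scale\<close> for proportional vectors.\<close>

locale staudt =
 fixes D :: nat and R :: "real set" and b :: "(nat => real) => nat => real" and gr :: "(nat => real) => bool"
 assumes D3: "3 <= D" and R1: "1 \<in> R" and Rpos: "!!r. r \<in> R ==> 0 < r"
  and gr: "!!f. gr f \<longleftrightarrow> (\<forall>j<D. f j \<in> insert 0 R) & (\<exists>j<D. f j ~= 0)"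
  and b_nonneg: "!!f j. gr f ==> j < D ==> 0 <= b f j"
  and b_zero: "!!f j. gr f ==> j < D ==> b f j = 0 \<longleftrightarrow> f j = 0"
  and b_add: "!!f g. gr f ==> gr g ==> gr (%j. f j + g j) ==>
    \<exists>l>0. \<exists>m>0. \<forall>j<D. b (%j. f j + g j) j = l * b f j + m * b g j"
  and b_scale: "!!f c j. gr f ==> 0 < c ==> gr (%j. c * f j) ==> j < D ==> b (%j. c * f j) j = b f j"
  and b_cong: "!!f g j. (!!j. j < D ==> f j = g j) ==> b f j = b g j"
  and b_unit: "!!j. j < D ==> b (%_. 1) j = 1"
begin

lemma b_pos: "gr f ==> j < D ==> f j ~= 0 ==> 0 < b f j"
 using b_nonneg[of f j] b_zero[of f j] by auto

text \<open>The rest \<open>r\<close> of \<open>f\<close> vanishes at \<open>i\<close> and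
  \<open>k\<close>, so adding it to \<open>h\<close> rescales both coordinates by one factor: their
  ratio depends on these two entries only.\<close>

lemma ratio_pair:
 assumes f: "gr f" and ik: "i < D" "k < D" "f i ~= 0"
 defines "h \<equiv> %j. if j = i | j = k then f j else 0"
 shows "gr h" "b f i * b h k = b h i * b f k"
proof -
 show h: "gr h" using f ik by (auto simp: gr h_def)
 show "b f i * b h k = b h i * b f k"
 proof (cases "\<forall>j<D. f j = h j")
  case True
  hence "b f j = b h j" for j by (intro b_cong) auto
  thus ?thesis by simp
 next
  case False
  define r where "r j = (if j = i | j = k then 0 else f j)" for j
  have r: "gr r" using f False by (auto simp: gr r_def h_def split: if_splits)
  have e: "f = (%j. h j + r j)" by (auto simp: h_def r_def)
  obtain l m where "\<forall>j<D. b f j = l * b h j + m * b r j" using b_add[OF h r] f e by auto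
  moreover have "b r i = 0" "b r k = 0" using b_zero[OF r] ik by (auto simp: r_def)
  ultimately show ?thesis using ik by simp
 qed
qed

lemma ratio:
 assumes f: "gr f" "gr f'" and ik: "i < D" "k < D" "f i ~= 0" "f k ~= 0" and c: "0 < c" "f' i = c * f i" "f' k = c * f k"
 shows "b f i * b f' k = b f' i * b f k"
proof -
 define h where "h = (%j. if j = i | j = k then f j else 0)"
 define h' where "h' = (%j. if j = i | j = k then f' j else 0)"
 have 1: "gr h" "b f i * b h k = b h i * b f k" using ratio_pair[OF f(1) ik(1,2,3)] by (simp_all add: h_def)
 have 2: "gr h'" "b f' i * b h' k = b h' i * b f' k"
  using ratio_pair[OF f(2) ik(1,2)] ik c by (simp_all add: h'_def)
 have e: "h' = (%j. c * h j)" using c by (auto simp: h_def h'_def)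
 have "b h' j = b h j" if "j < D" for j using b_scale[OF 1(1) c(1) _ that] 2(1) by (simp add: e)
 hence 3: "b f' i * b h k = b h i * b f' k" using 2(2) ik by simp
 have "0 < b h i" using b_pos[OF 1(1)] ik by (simp add: h_def)
 have "(b f i * b f' k) * b h i = (b f' i * b f k) * b h i" using 1(2) 3 by algebra
 thus ?thesis using \<open>0 < b h i\<close> by simp
qed

text \<open>The image of a number, read off as a ratio of the coordinates \<open>1\<close> and
  \<open>0\<close>; \<open>theta\<close> shows that any other pair gives the same.\<close>

definition th :: "real => real" where
 "th x = b (%j. if j = 1 then x else if j = 0 then 1 else 0) 1 / b (%j. if j = 1 then x else if j = 0 then 1 else 0) 0"

abbreviation "three i x j y k z \<equiv> (%l::nat. if l = i then x else if l = j then y else if l = k then z else 0::real)"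

lemma gr_three: "i < D ==> x \<in> R ==> y \<in> insert 0 R ==> z \<in> insert 0 R ==> gr (three i x j y k z)"
 using Rpos[of x] by (auto simp: gr)

lemma gr_unit: "gr (%_. 1)"
 using R1 D3 by (auto simp: gr intro: exI[of _ 0])

lemma equal_entries:
 assumes "gr f" "i < D" "k < D" "f i = f k" "f i ~= 0"
 shows "b f i = b f k"
proof -
 have "0 < f i" using assms Rpos[of "f i"] by (auto simp: gr)
 hence "b (%_. 1) i * b f k = b f i * b (%_. 1) k"
  using assms by (intro ratio[OF gr_unit assms(1-3), where c = "f i"]) simp_all
 thus ?thesis using b_unit assms(2,3) by simp
qed

text \<open>A third index moves the ratio from one pair to another: a vector with entries
  \<open>x\<close>, \<open>x\<close>, \<open>1\<close> exchanges the numerator, and one with entries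
  \<open>x\<close>, \<open>1\<close>, \<open>1\<close> the denominator.\<close>

lemma theta:
 assumes f: "gr f" and ik: "i < D" "k < D" "i ~= k" and x: "f i = x" "f k = 1" "x ~= 0"
 shows "b f i = th x * b f k"
proof -
 have "f i \<in> insert 0 R" using f ik(1) unfolding gr by blast
 hence xR: "x \<in> R" using x by simp
 have xp: "0 < x" using Rpos[OF xR] .
 define P where "P i k \<longleftrightarrow> (\<forall>f. gr f & f i = x & f k = 1 --> b f i = th x * b f k)" for i k
 have one: "P i k" if "gr f" "b f i = th x * b f k" "i < D" "k < D" "f i = x" "f k = 1" for i k f
  unfolding P_def
 proof (intro allI impI)
  fix f' assume f': "gr f' & f' i = x & f' k = 1"
  hence "b f i * b f' k = b f' i * b f k" using ratio[of f f' i k 1] that x(3) by simp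
  moreover have "0 < b f k" using b_pos[OF that(1,4)] that(6) by simp
  moreover from calculation(1) that(2) have "b f' i * b f k = (th x * b f' k) * b f k" by algebra
  ultimately show "b f' i = th x * b f' k" by simp
 qed
 have P10: "P 1 0"
 proof (rule one)
  show g: "gr (%j. if j = 1 then x else if j = 0 then 1 else 0)" using xR R1 D3 x(3) by (auto simp: gr intro!: exI[of _ 1])
  show "b (%j. if j = 1 then x else if j = 0 then 1 else 0) 1 = th x * b (%j. if j = 1 then x else if j = 0 then 1 else 0) 0"
   using b_pos[OF g, of 0] D3 by (simp add: th_def)
 qed (use D3 in auto)
 have num: "P j k" if P: "P i k" and d: "i ~= j" "i ~= k" "j ~= k" "i < D" "j < D" "k < D" for i j k
 proof (rule one)
  show g: "gr (three i x j x k 1)" using gr_three d xR R1 by simp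
  have "b (three i x j x k 1) i = b (three i x j x k 1) j" using d x(3) by (intro equal_entries[OF g]) auto
  moreover have "b (three i x j x k 1) i = th x * b (three i x j x k 1) k"
   using P[unfolded P_def, rule_format, of "three i x j x k 1"] g d by simp
  ultimately show "b (three i x j x k 1) j = th x * b (three i x j x k 1) k" by simp
 qed (use d in auto)
 have den: "P i j" if P: "P i k" and d: "i ~= j" "i ~= k" "j ~= k" "i < D" "j < D" "k < D" for i j k
 proof (rule one)
  show g: "gr (three i x j 1 k 1)" using gr_three d xR R1 by simp
  have "b (three i x j 1 k 1) j = b (three i x j 1 k 1) k" using d by (intro equal_entries[OF g]) auto
  moreover have "b (three i x j 1 k 1) i = th x * b (three i x j 1 k 1) k"
   using P[unfolded P_def, rule_format, of "three i x j 1 k 1"] g d by simp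
  ultimately show "b (three i x j 1 k 1) i = th x * b (three i x j 1 k 1) j" by simp
 qed (use d in auto)
 have Pi0: "P i 0" if "i ~= 0" "i < D" for i
  using num[OF P10, of i] P10 that D3 by (cases "i = 1") auto
 have Pik: "P i k" if "i ~= 0" "i < D" "k < D" "i ~= k" for i k
  using den[OF Pi0, of i k] Pi0 that by (cases "k = 0") auto
 have "P i k"
 proof (cases "i = 0")
  case True
  define j where "j = (if k = 1 then 2 else 1 :: nat)"
  have "j ~= 0" "j ~= k" "j < D" "k ~= 0" using D3 True ik by (auto simp: j_def)
  thus ?thesis using num[OF Pik[of j k], of 0] True ik D3 by auto
 qed (use Pik ik in auto)
 thus ?thesis using f x by (simp add: P_def)
qed

lemma theta_pos: "x \<in> R ==> 0 < th x"
proof -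
 assume x: "x \<in> R"
 have g: "gr (three 1 x 0 1 2 1)" using gr_three x R1 D3 by simp
 have x0: "x ~= 0" using Rpos[OF x] by simp
 have "b (three 1 x 0 1 2 1) 1 = th x * b (three 1 x 0 1 2 1) 0" using x0 D3 by (intro theta[OF g]) auto
 moreover have "0 < b (three 1 x 0 1 2 1) 1" "0 < b (three 1 x 0 1 2 1) 0" using b_pos[OF g] x0 D3 by auto
 ultimately show ?thesis by (simp add: zero_less_mult_iff)
qed

text \<open>The calculus of throws. For the product, the pairs \<open>(x, 1)\<close> and
  \<open>(x * y, y)\<close> have equal ratios. For the sum, \<open>(1, x + y, y)\<close> splits as
  \<open>(1, x, 0)\<close> plus \<open>(0, y, y)\<close>, at the coordinates \<open>2\<close>,
  \<open>0\<close>, \<open>1\<close>.\<close>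

lemma theta_hom: "partial_hom R th"
 unfolding partial_hom_def
proof (intro conjI ballI impI)
 show "0 < th x" if "x \<in> R" for x using theta_pos[OF that] .
 show "th 1 = 1" using theta[OF gr_unit, of 1 0 1] b_unit D3 by simp
 fix x y assume R: "x \<in> R" "y \<in> R"
 hence nz: "x ~= 0" "y ~= 0" "0 < y" using Rpos[of x] Rpos[of y] by auto
 show "th (x * y) = th x * th y" if xy: "x * y \<in> R"
 proof -
  define f where "f = three 1 (x * y) 2 y 0 1"
  have f: "gr f" unfolding f_def using gr_three R R1 D3 xy by simp
  define h where "h = three 1 x 2 1 0 1"
  have h: "gr h" unfolding h_def using gr_three R R1 D3 by simp
  have 1: "b f 1 = th (x * y) * b f 0" "b f 2 = th y * b f 0"
   using nz D3 by (intro theta[OF f]; simp add: f_def)+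
  have 2: "b h 1 = th x * b h 2" using nz D3 by (intro theta[OF h]) (auto simp: h_def)
  have 3: "b h 1 * b f 2 = b f 1 * b h 2"
   using nz D3 by (intro ratio[OF h f, where c = y]) (auto simp: h_def f_def)
  have "0 < b h 2" "0 < b f 0" using b_pos[OF h] b_pos[OF f] D3 by (auto simp: h_def f_def)
  thus ?thesis using 1 2 3 by simp
 qed
 show "th (x + y) = th x + th y" if xy: "x + y \<in> R"
 proof -
  have nz': "x + y ~= 0" using Rpos[OF xy] by simp
  define f where "f = three 2 1 0 x 1 0"
  define g where "g = three 0 y 1 y 2 0"
  define s where "s = three 2 1 0 (x + y) 1 y"
  have f: "gr f" and g: "gr g" and s: "gr s"
   unfolding f_def g_def s_def using gr_three R R1 D3 xy by simp_all
  have e: "s = (%j. f j + g j)" by (auto simp: s_def f_def g_def)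
  obtain l m where lm: "0 < l" "\<forall>j<D. b s j = l * b f j + m * b g j" using b_add[OF f g] s e by auto
  have z: "b g 2 = 0" "b f 1 = 0" using b_zero[OF g, of 2] b_zero[OF f, of 1] D3 by (simp_all add: f_def g_def)
  have 1: "b s 0 = th (x + y) * b s 2" "b s 1 = th y * b s 2" "b f 0 = th x * b f 2" "b g 0 = b g 1"
   using nz nz' D3 by (intro theta[OF s] theta[OF f] equal_entries[OF g]; simp add: s_def f_def g_def)+
  have 2: "b s 0 = l * b f 0 + m * b g 0" "b s 1 = m * b g 1" "b s 2 = l * b f 2" using lm z D3 by simp_all
  have "th (x + y) * b s 2 = (th x + th y) * b s 2" using 1 2 by (simp add: algebra_simps)
  moreover have "0 < b s 2" using b_pos[OF s] D3 by (simp add: s_def)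
  ultimately show ?thesis by simp
 qed
qed

text \<open>Two entries of \<open>f\<close> are compared in an auxiliary vector that has the entry
  \<open>1\<close> at a third index \<open>i\<close>.\<close>

lemma coordinates:
 assumes f: "gr f"
 shows "\<exists>l>0. \<forall>j<D. b f j = l * (if f j = 0 then 0 else th (f j))"
proof -
 obtain k where k: "k < D" "f k ~= 0" using f by (auto simp: gr)
 have fR: "f j \<in> R" if "j < D" "f j ~= 0" for j using f that by (auto simp: gr)
 have tk: "0 < th (f k)" using theta_pos fR k by blast
 have "b f j = (b f k / th (f k)) * (if f j = 0 then 0 else th (f j))" if j: "j < D" for j
 proof (cases "f j = 0 | j = k")
  case True
  thus ?thesis using b_zero[OF f j] tk k by auto
 next
  case False
  obtain i where i: "i < D" "i ~= j" "i ~= k" using ex_third_index[OF D3] by blast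
  define h where "h = three j (f j) k (f k) i 1"
  have h: "gr h" unfolding h_def using gr_three fR False j k R1 by simp
  have "b h j = th (f j) * b h i" "b h k = th (f k) * b h i"
   using i j k False by (intro theta[OF h]; simp add: h_def)+
  moreover have "b f j * b h k = b h j * b f k"
   using False i j k by (intro ratio[OF f h, where c = 1]) (auto simp: h_def)
  moreover have "0 < b h i" using b_pos[OF h] i by (simp add: h_def)
  ultimately show ?thesis using tk False by (simp add: field_simps)
 qed
 moreover have "0 < b f k / th (f k)" using b_pos[OF f k] tk by simp
 ultimately show ?thesis by blast
qed

end

section \<open>Reconstruction up to projectivity\<close>

definition mkvec :: "nat => (nat => real) => vec" where "mkvec n f = (\<Sum>j<n. f j *\<^sub>R axis' j)"

lemma pt_coord: "mkvec n f \<in> csp n"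
 unfolding mkvec_def using subspace_csp by (intro subspace_sum subspace_scale axis'_in_csp) auto

lemma lkp_pt: "j < n ==> lkp (mkvec n f) j = f j"
 by (simp add: mkvec_def lookup_sum lookup_scaleR lookup_axis' if_distrib sum.delta cong: if_cong)

lemma pt_eqI: "x \<in> csp n ==> (!!j. j < n ==> lkp x j = f j) ==> x = mkvec n f"
 unfolding mkvec_def using csp_expand[of x n] by (metis (no_types, lifting) lessThan_iff sum.cong)

lemma pt_cong: "(!!j. j < n ==> f j = g j) ==> mkvec n f = mkvec n g"
 unfolding mkvec_def by (intro sum.cong) auto

lemma pt_add: "mkvec n (%j. f j + g j) = mkvec n f + mkvec n g"
 by (simp add: mkvec_def scaleR_add_left sum.distrib)

lemma pt_scale: "mkvec n (%j. c * f j) = c *\<^sub>R mkvec n f"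
 by (simp add: mkvec_def scaleR_sum_right)

lemma ip_pt: "ip n (mkvec n f) y = (\<Sum>j<n. f j * lkp y j)"
 by (simp add: ip_def lkp_pt)

context cone_config
begin

abbreviation "pt \<equiv> mkvec D"

text \<open>
 What a realization of the stamp over the rays \<open>R\<^sub>0\<close> knows about the images \<open>p'\<close> of \<open>p\<close>: every \<open>x\<close>
 in the dual cone has a counterpart \<open>f x\<close>, and collinearities within \<open>R\<^sub>0\<close> are respected.
\<close>

definition forced :: "vec set => ('v => 'x::real_vector) => (vec => 'x => real) => bool" where
 "forced R\<^sub>0 p' f \<longleftrightarrow>
   (\<forall>x\<in>dualC. x ~= 0 --> linear (f x) & (\<forall>v\<in>VP. 0 <= f x (p' v) & (f x (p' v) = 0 \<longleftrightarrow> ip D x (p v) = 0))) &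
   (\<forall>c>0. \<forall>x. f (c *\<^sub>R x) = f x) &
   (\<forall>x\<in>R\<^sub>0. \<forall>y\<in>R\<^sub>0. x + y \<in> R\<^sub>0 --> inner (x + y) -->
    (\<exists>al>0. \<exists>be>0. \<forall>v\<in>VP. f (x + y) (p' v) = al * f x (p' v) + be * f y (p' v)))"

text \<open>Layers need normals in \<open>slice\<close>, so the rays are normalized, to which the
  functionals are insensitive by \<open>gap_scale\<close>. The sum of two rays becomes a point
  between them, with weights given by their values \<open>X\<close> and \<open>Y\<close> at
  \<open>wbar\<close>.\<close>

lemma stamp_exists:
 assumes fin: "finite R\<^sub>0" and sub: "R\<^sub>0 \<subseteq> dualC - {0}" and dual: "dualizing R\<^sub>0" and ne: "R\<^sub>0 ~= {}"
 shows "\<exists>k Gam om. stack VP p D k Gam om &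
  (\<forall>s' :: _ => 'x::real_vector. stack_realization VP p D k Gam om s' --> (\<exists>f. forced R\<^sub>0 (%v. s' (Inl v)) f))"
proof -
 define n where "n x = (1 / ip D x wbar) *\<^sub>R x" for x
 have w: "0 < ip D x wbar" if "x \<in> R\<^sub>0" for x using that sub by (intro dual_wbar_pos) auto
 have sl: "n ` R\<^sub>0 \<subseteq> slice"
 proof
  fix y assume "y \<in> n ` R\<^sub>0"
  then obtain x where x: "x \<in> R\<^sub>0" "y = n x" by blast
  hence "x \<in> dualC" using sub by blast
  thus "y \<in> slice" using w[OF x(1)] by (auto simp: slice_def x(2) n_def ip_scale_left dualC_scale)
 qed
 have dn: "dualizing (n ` R\<^sub>0)"
  unfolding dualizing_def
 proof (intro ballI impI)
  fix z assume z: "z \<in> csp D" "\<forall>x\<in>n ` R\<^sub>0. 0 <= ip D x z"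
  have "0 <= ip D x z" if "x \<in> R\<^sub>0" for x
  proof -
   have "0 <= ip D (n x) z" using z(2) that by blast
   thus ?thesis using w[OF that] by (simp add: n_def ip_scale_left zero_le_divide_iff)
  qed
  thus "\<exists>c. (\<forall>v\<in>VP. 0 <= c v) & z = (\<Sum>v\<in>VP. c v *\<^sub>R p v)" using dual z(1) by (simp add: dualizing_def)
 qed
 obtain k Gam om where S: "stack VP p D k Gam om"
  and bet: "\<forall>s' :: _ => 'x. stack_realization VP p D k Gam om s' -->
   (\<forall>b\<in>n ` R\<^sub>0. \<forall>x\<in>n ` R\<^sub>0. \<forall>a\<in>n ` R\<^sub>0 \<inter> open_segment b x. inner a -->
    (\<exists>al>0. \<exists>be>0. \<forall>v\<in>VP. stack_realization.val VP p D k Gam om s' 0 a v =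
     al * stack_realization.val VP p D k Gam om s' 0 b v + be * stack_realization.val VP p D k Gam om s' 0 x v))"
  using stack_forces_betweenness[OF finite_imageI[OF fin] sl dn] ne by auto
 have "forced R\<^sub>0 (%v. s' (Inl v)) (stack_realization.gap VP p D k Gam om s' 0)"
  if R: "stack_realization VP p D k Gam om s'" for s' :: "_ => 'x"
 proof -
  interpret R: stack_realization VP p D k Gam om s' by (rule R)
  have k0: "0 < k" using R.k1 by simp
  show ?thesis
   unfolding forced_def R.val_def[symmetric]
  proof (intro conjI allI ballI impI)
   show "linear (R.gap 0 x)" if "x \<in> dualC" "x ~= 0" for x using R.gap(1)[OF k0 that] .
   show "0 <= R.val 0 x v" "R.val 0 x v = 0 \<longleftrightarrow> ip D x (p v) = 0" if "x \<in> dualC" "x ~= 0" "v \<in> VP" for x v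
    using R.val_pos[OF k0 that] by auto
   show "R.gap 0 (c *\<^sub>R x) = R.gap 0 x" if "0 < c" for c x using R.gap_scale[OF that] .
   fix x y assume xy: "x \<in> R\<^sub>0" "y \<in> R\<^sub>0" "x + y \<in> R\<^sub>0" "inner (x + y)"
   have g: "R.val 0 (n z) = R.val 0 z" if "z \<in> R\<^sub>0" for z
    using R.gap_scale[of "1 / ip D z wbar" 0 z] w[OF that] by (simp add: R.val_def n_def fun_eq_iff)
   define X Y where "X = ip D x wbar" and "Y = ip D y wbar"
   have XY: "0 < X" "0 < Y" "ip D (x + y) wbar = X + Y" using w xy by (auto simp: X_def Y_def ip_add_left)
   have nxy: "n (x + y) = (1 - Y / (X + Y)) *\<^sub>R n x + (Y / (X + Y)) *\<^sub>R n y"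
   proof -
    have "1 - Y / (X + Y) = X / (X + Y)" using XY by (simp add: field_simps)
    thus ?thesis using XY by (simp add: n_def scaleR_add_right flip: X_def Y_def)
   qed
   show "\<exists>al>0. \<exists>be>0. \<forall>v\<in>VP. R.val 0 (x + y) v = al * R.val 0 x v + be * R.val 0 y v"
   \<comment> \<open>Proportional rays span no segment, but their functionals coincide and any
     weights of sum \<open>1\<close> serve.\<close>
   proof (cases "n x = n y")
    case True
    hence "n (x + y) = n x" unfolding nxy by (simp flip: scaleR_add_left)
    hence "R.val 0 (x + y) = R.val 0 x" "R.val 0 y = R.val 0 x" using g xy True by metis+
    thus ?thesis by (intro exI[of _ "1/2"] conjI) auto
   next
    case False
    hence "n (x + y) \<in> open_segment (n x) (n y)"
     using XY nxy unfolding in_segment by (intro conjI exI[of _ "Y / (X + Y)"]) auto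
    moreover have "inner (n (x + y))" using xy(4) w[OF xy(3)] by (auto simp: inner_def n_def ip_scale_left)
    ultimately show ?thesis
     using bet[rule_format, OF R, of "n x" "n y" "n (x + y)"] xy g by auto
   qed
  qed
 qed
 thus ?thesis using S by blast
qed

definition proper :: "'v set => bool" where "proper B \<longleftrightarrow> facial p VP B & B ~= {} & B ~= VP"

end

text \<open>As \<open>p\<close> lies in the positive orthant, all grid vectors are inner. The
  functionals \<open>u B\<close> may have entries of any sign; adding \<open>M\<close> to all
  entries moves them into the grid, and \<open>R\<close> is rigid at the shifted entries.\<close>

locale pinned = cone_config VP p D for VP :: "'v set" and p D +
 fixes u :: "'v set => vec" and M :: nat and R :: "real set" and gr :: "(nat => real) => bool"
 assumes card2: "2 <= card VP" and p_pos: "!!v j. v \<in> VP ==> j < D ==> 0 < lkp (p v) j"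
  and u_coord: "!!B. proper B ==> u B \<in> csp D"
  and u_nonneg: "!!B v. proper B ==> v \<in> VP ==> 0 <= ip D (u B) (p v)"
  and u_zero: "!!B v. proper B ==> v \<in> VP ==> ip D (u B) (p v) = 0 \<longleftrightarrow> v \<in> B"
  and M1: "1 <= M" and R_nat: "!!n. 1 <= n ==> n <= 2 * M ==> real n \<in> R" and R_pos: "R \<subseteq> {0<..}"
  and R_u: "!!B j. proper B ==> j < D ==> lkp (u B) j + M \<in> R & lkp (u B) j + M + M \<in> R"
  and rigid: "!!B j th. proper B ==> j < D ==> partial_hom R th ==> th (lkp (u B) j + M) = lkp (u B) j + M"
  and gr: "!!h. gr h \<longleftrightarrow> (\<forall>j<D. h j \<in> insert 0 R) & (\<exists>j<D. h j ~= 0)"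
begin

lemma VP_ne: "VP ~= {}" using card2 by auto

lemma grid_ip: "gr h ==> v \<in> VP ==> 0 < ip D (pt h) (p v)"
proof -
 assume h: "gr h" and v: "v \<in> VP"
 obtain i where i: "i < D" "h i ~= 0" using h by (auto simp: gr)
 have nn: "0 <= h j" if "j < D" for j using h that R_pos by (force simp: gr)
 have "0 < h i * lkp (p v) i" using i nn[OF i(1)] p_pos[OF v i(1)] by simp
 also have "\<dots> <= (\<Sum>j<D. h j * lkp (p v) j)"
  using i nn p_pos[OF v] by (intro member_le_sum) (auto simp: less_imp_le)
 finally show ?thesis by (simp add: ip_pt)
qed

lemma grid_inner: "gr h ==> inner (pt h)" and grid_dual: "gr h ==> pt h \<in> dualC" and grid_nz: "gr h ==> pt h ~= 0"
proof -
 assume h: "gr h"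
 show "inner (pt h)" "pt h \<in> dualC" using grid_ip[OF h] pt_coord by (auto simp: inner_def dualC_def less_imp_le)
 obtain v where "v \<in> VP" using VP_ne by blast
 thus "pt h ~= 0" using grid_ip[OF h, of v] by auto
qed

lemma u_dual: "proper B ==> u B \<in> dualC" and u_nz: "proper B ==> u B ~= 0"
proof -
 assume B: "proper B"
 show "u B \<in> dualC" using u_coord[OF B] u_nonneg[OF B] by (simp add: dualC_def)
 obtain v where "v \<in> VP" "v ~: B" using B facial_subset[of p VP B] unfolding proper_def by blast
 thus "u B ~= 0" using u_zero[OF B, of v] by auto
qed

lemma one_R: "1 \<in> R" using R_nat[of 1] M1 by simp

abbreviation "rays \<equiv> pt ` Collect gr \<union> u ` Collect proper"

lemma dualizing_rays: "dualizing rays"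
 unfolding dualizing_def
proof (intro ballI impI)
 fix w assume w: "w \<in> csp D" "\<forall>x\<in>rays. 0 <= ip D x w"
 have "linear (ip D (u B)) & (\<forall>v\<in>VP. 0 <= ip D (u B) (p v)) & B = {v \<in> VP. ip D (u B) (p v) = 0}" if "proper B" for B
  using that linear_ip u_nonneg[OF that] u_zero[OF that] facial_subset[of p VP B] by (auto simp: proper_def)
 moreover have "w \<in> span (p ` VP)" using w(1) span_p by simp
 moreover have "0 <= ip D (u B) w" if "proper B" for B using w(2) that by auto
 ultimately show "\<exists>c. (\<forall>v\<in>VP. 0 <= c v) & w = (\<Sum>v\<in>VP. c v *\<^sub>R p v)"
  by (intro cone_by_facial_functionals[OF finVP card2 single_p, where u = "%B. ip D (u B)"]) (simp_all add: proper_def)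
qed

end

locale reconstruction = pinned VP p D u M R gr for VP :: "'v set" and p D u M R gr +
 fixes p' :: "'v => 'x::real_vector" and f :: "vec => 'x => real"
 assumes same': "!!B. facial p' VP B \<longleftrightarrow> facial p VP B" and forced: "forced rays p' f"
begin

section \<open>The coordinate frame in a realization, and coordinates with respect to it\<close>

lemma f_linear: "x \<in> dualC ==> x ~= 0 ==> linear (f x)"
 and f_nonneg: "x \<in> dualC ==> x ~= 0 ==> v \<in> VP ==> 0 <= f x (p' v)"
 and f_zero: "x \<in> dualC ==> x ~= 0 ==> v \<in> VP ==> f x (p' v) = 0 \<longleftrightarrow> ip D x (p v) = 0"
 and f_scale: "0 < c ==> f (c *\<^sub>R x) = f x"
 using forced unfolding forced_def by auto

lemma f_add:
 assumes "x \<in> pt ` Collect gr \<union> u ` Collect proper" "gr h" "gr h'" "x + pt h = pt h'"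
 shows "\<exists>al>0. \<exists>be>0. \<forall>v\<in>VP. f (pt h') (p' v) = al * f x (p' v) + be * f (pt h) (p' v)"
proof -
 have "x + pt h \<in> pt ` Collect gr \<union> u ` Collect proper" "inner (x + pt h)"
  using assms grid_inner by auto
 moreover have "pt h \<in> pt ` Collect gr \<union> u ` Collect proper" using assms by auto
 ultimately show ?thesis using forced assms(1) unfolding forced_def assms(4)[symmetric] by blast
qed

definition ax :: "nat => 'x => real" where "ax j = f (axis' j)"

lemma gr_unit: "gr (%_. 1)" and gr_axis: "j < D ==> gr (%i. if i = j then 1 else 0)"
 using one_R D3 by (auto simp: gr intro: exI[of _ 0])

lemma pt_axis: "j < D ==> pt (%i. if i = j then c else 0) = c *\<^sub>R axis' j"
 by (simp add: mkvec_def if_distrib[of "%z. z *\<^sub>R _"] sum.delta cong: if_cong)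

lemma ax_linear: "j < D ==> linear (ax j)" and ax_pos: "j < D ==> v \<in> VP ==> 0 < ax j (p' v)"
proof -
 assume j: "j < D"
 have a: "axis' j \<in> dualC" "axis' j ~= 0"
  using grid_dual[OF gr_axis[OF j]] grid_nz[OF gr_axis[OF j]] pt_axis[OF j, of 1] by auto
 show "linear (ax j)" unfolding ax_def by (rule f_linear[OF a])
 show "0 < ax j (p' v)" if v: "v \<in> VP"
  using f_nonneg[OF a v] f_zero[OF a v] grid_ip[OF gr_axis[OF j] v] pt_axis[OF j, of 1]
  by (auto simp: ax_def order_less_le)
qed

text \<open>A relation, since uniqueness of the coefficients comes only with
  \<open>frame_independent\<close>.\<close>

definition coeffs :: "(nat => real) => (nat => real) => bool" where
 "coeffs h c \<longleftrightarrow> (\<forall>j<D. 0 <= c j & (c j = 0 \<longleftrightarrow> h j = 0)) &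
   (\<forall>v\<in>VP. f (pt h) (p' v) = (\<Sum>j<D. c j * ax j (p' v)))"

lemma coeffs_add:
 assumes "gr h" "gr h'" "gr (%j. h j + h' j)" "coeffs h c" "coeffs h' c'"
 shows "\<exists>al>0. \<exists>be>0. coeffs (%j. h j + h' j) (%j. al * c j + be * c' j)"
proof -
 obtain al be where ab: "al > 0" "be > 0" "\<forall>v\<in>VP. f (pt (%j. h j + h' j)) (p' v) = al * f (pt h) (p' v) + be * f (pt h') (p' v)"
  using f_add[of "pt h" h' "%j. h j + h' j"] assms(1-3) by (auto simp: pt_add)
 have nn: "0 <= h j" "0 <= h' j" if "j < D" for j using assms(1,2) that R_pos by (force simp: gr)+
 have "coeffs (%j. h j + h' j) (%j. al * c j + be * c' j)"
  unfolding coeffs_def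
 proof (intro conjI allI impI ballI)
  fix j assume j: "j < D"
  have cc: "0 <= c j" "0 <= c' j" "c j = 0 \<longleftrightarrow> h j = 0" "c' j = 0 \<longleftrightarrow> h' j = 0"
   using assms(4,5) j by (auto simp: coeffs_def)
  show "0 <= al * c j + be * c' j" using ab cc by simp
  have "al * c j + be * c' j = 0 \<longleftrightarrow> c j = 0 & c' j = 0" using ab cc by (subst add_nonneg_eq_0_iff) auto
  thus "al * c j + be * c' j = 0 \<longleftrightarrow> h j + h' j = 0"
   using cc nn[OF j] by (simp add: add_nonneg_eq_0_iff)
 next
  fix v assume "v \<in> VP"
  thus "f (pt (%j. h j + h' j)) (p' v) = (\<Sum>j<D. (al * c j + be * c' j) * ax j (p' v))"
   using ab assms(4,5) by (simp add: coeffs_def sum_distrib_left sum.distrib algebra_simps)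
 qed
 thus ?thesis using ab by blast
qed

text \<open>The vector is built up one coordinate at a time; its parts are grid vectors again, so
  every sum on the way is respected.\<close>

lemma coeffs_exist: "gr h ==> \<exists>c. coeffs h c"
proof (induction "card {j. j < D & h j ~= 0}" arbitrary: h rule: less_induct)
 case less
 obtain i where i: "i < D" "h i ~= 0" using less.prems by (auto simp: gr)
 define h1 where "h1 = (%j. if j = i then h i else 0)"
 define h2 where "h2 = (%j. if j = i then 0 else h j)"
 have e: "h = (%j. h1 j + h2 j)" by (auto simp: h1_def h2_def)
 have h1: "gr h1" using less.prems i by (auto simp: gr h1_def)
 have hi: "0 < h i" using less.prems i R_pos by (force simp: gr)
 have "f (pt h1) = ax i" unfolding h1_def pt_axis[OF i(1)] ax_def by (rule f_scale[OF hi])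
 hence c1: "coeffs h1 (%j. if j = i then 1 else 0)"
  using i by (auto simp: coeffs_def h1_def if_distrib[of "%z. z * _"] sum.delta cong: if_cong)
 show ?case
 proof (cases "\<exists>j<D. h2 j ~= 0")
  case True
  hence h2: "gr h2" using less.prems by (auto simp: gr h2_def)
  have "{j. j < D & h2 j ~= 0} \<subset> {j. j < D & h j ~= 0}" using i by (auto simp: h2_def)
  hence "card {j. j < D & h2 j ~= 0} < card {j. j < D & h j ~= 0}" by (intro psubset_card_mono) auto
  then obtain c2 where "coeffs h2 c2" using less.hyps h2 by blast
  thus ?thesis using coeffs_add[OF h1 h2 _ c1] less.prems e by auto
 next
  case False
  hence "coeffs h = coeffs h1" using pt_cong[of D h h1] by (auto simp: coeffs_def e fun_eq_iff)
  thus ?thesis using c1 by auto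
 qed
qed

text \<open>Two lines join \<open>u B\<close> to the grid: for \<open>e = 0\<close> through the
  constant vector \<open>M\<close>, for \<open>e = 1\<close> through the vector that has
  \<open>2 * M\<close> instead at \<open>i\<close>.\<close>

lemma u_plus_const:
 fixes e :: real
 assumes B: "proper B" and i: "i < D" and e: "e = 0 | e = 1"
 shows "\<exists>a>0. \<exists>b>0. \<forall>v\<in>VP. f (pt (%j. lkp (u B) j + M + (if j = i then e * real M else 0))) (p' v) =
  a * f (u B) (p' v) + b * f (pt (%j. M + (if j = i then e * real M else 0))) (p' v)"
proof (rule f_add)
 have MR: "real M \<in> R" "real M + real M \<in> R" using R_nat[of M] R_nat[of "2 * M"] M1 by simp_all
 thus "gr (%j. real M + (if j = i then e * real M else 0))"
  using e M1 i by (auto simp: gr intro!: exI[of _ i])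
 have "lkp (u B) i + M + (if i = i then e * real M else 0) \<in> R" using e R_u[OF B i] by auto
 hence "lkp (u B) i + M + (if i = i then e * real M else 0) ~= 0" using R_pos by force
 thus "gr (%j. lkp (u B) j + M + (if j = i then e * real M else 0))"
  using e R_u[OF B] i by (auto simp: gr)
 show "u B + pt (%j. real M + (if j = i then e * real M else 0)) = pt (%j. lkp (u B) j + M + (if j = i then e * real M else 0))"
  using subspace_csp pt_coord u_coord[OF B] by (intro pt_eqI) (auto simp: subspace_add lookup_add lkp_pt)
qed (use B in auto)

lemma u_span: "proper B ==> \<exists>c. \<forall>v\<in>VP. f (u B) (p' v) = (\<Sum>j<D. c j * ax j (p' v))"
proof -
 assume B: "proper B"
 have D0: "0 < D" using D3 by simp
 obtain a b where ab: "a > 0" "b > 0" "\<forall>v\<in>VP. f (pt (%j. lkp (u B) j + M)) (p' v) =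
  a * f (u B) (p' v) + b * f (pt (%j. M)) (p' v)" using u_plus_const[OF B D0, of 0] by (auto cong: if_cong)
 have "lkp (u B) 0 + M ~= 0" using R_u[OF B D0] R_pos by force
 hence "gr (%j. lkp (u B) j + M)" using R_u[OF B] D0 by (auto simp: gr)
 then obtain c where c: "coeffs (%j. lkp (u B) j + M) c" using coeffs_exist by blast
 have "gr (%j. real M)" using R_nat[of M] M1 D0 by (auto simp: gr)
 then obtain c' where c': "coeffs (%j. real M) c'" using coeffs_exist by blast
 have "f (u B) (p' v) = (\<Sum>j<D. ((c j - b * c' j) / a) * ax j (p' v))" if v: "v \<in> VP" for v
 proof -
  have "a * f (u B) (p' v) = (\<Sum>j<D. (c j - b * c' j) * ax j (p' v))"
   using ab(3) v c c' by (simp add: coeffs_def sum_distrib_left sum_subtractf algebra_simps)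
  thus ?thesis using ab(1) by (simp add: sum_divide_distrib[symmetric] field_simps)
 qed
 thus ?thesis by (intro exI[of _ "%j. (c j - b * c' j) / a"]) simp
qed

lemma dim_p': "dim (p' ` VP) = D"
 using facial_dim_eq[OF finVP same'] same' empty_p dim_csp_set[OF span_p] by simp

text \<open>Each \<open>f (u B)\<close> is a combination of the \<open>ax j\<close> and vanishes at
  \<open>y\<close>. By \<open>cone_by_facial_functionals\<close> both \<open>y\<close> and
  \<open>- y\<close> then lie in the cone of the \<open>p' v\<close>, which is pointed.\<close>

lemma no_common_zero:
 assumes y: "y \<in> span (p' ` VP)" "\<forall>j<D. ax j y = 0"
 shows "y = 0"
proof -
 have fu: "f (u B) y = 0" if B: "proper B" for B
 proof -
  obtain c where c: "\<forall>v\<in>VP. f (u B) (p' v) = (\<Sum>j<D. c j * ax j (p' v))" using u_span[OF B] by blast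
  have "linear (%z. \<Sum>j<D. c j * ax j z)"
   using ax_linear by (intro linear_compose_sum ballI linear_compose_scale_right[where 'b = real, simplified]) auto
  hence "f (u B) y = (\<Sum>j<D. c j * ax j y)"
   using linear_eq_on_span[OF f_linear[OF u_dual[OF B] u_nz[OF B]], of _ "p' ` VP" y] c y(1) by auto
  thus ?thesis using y(2) by simp
 qed
 have U: "linear (f (u B)) & (\<forall>v\<in>VP. 0 <= f (u B) (p' v)) & B = {v \<in> VP. f (u B) (p' v) = 0}" if B: "proper B" for B
 proof -
  note d = u_dual[OF B] u_nz[OF B]
  have "B \<subseteq> VP" using B facial_subset[of p VP B] by (simp add: proper_def)
  thus ?thesis using f_linear[OF d] f_nonneg[OF d] f_zero[OF d] u_zero[OF B] by auto
 qed
 have "\<exists>c. (\<forall>v\<in>VP. 0 <= c v) & z = (\<Sum>v\<in>VP. c v *\<^sub>R p' v)" if "z = y | z = - y" for z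
 proof (rule cone_by_facial_functionals[OF finVP card2, where u = "%B. f (u B)"])
  show "facial p' VP {v}" if "v \<in> VP" for v using single_p[OF that] same' by simp
  show "z \<in> span (p' ` VP)" using that y(1) by (auto simp: span_neg)
  fix B assume "facial p' VP B" "B ~= {}" "B ~= VP"
  hence B: "proper B" using same' by (simp add: proper_def)
  show "linear (f (u B)) & (\<forall>v\<in>VP. 0 <= f (u B) (p' v)) & B = {v \<in> VP. f (u B) (p' v) = 0}" by (rule U[OF B])
  show "0 <= f (u B) z" using that fu[OF B] f_linear[OF u_dual[OF B] u_nz[OF B]] by (auto simp: linear_neg)
 qed
 then obtain c c' where c: "\<forall>v\<in>VP. 0 <= c v" "y = (\<Sum>v\<in>VP. c v *\<^sub>R p' v)" "\<forall>v\<in>VP. 0 <= c' v" "- y = (\<Sum>v\<in>VP. c' v *\<^sub>R p' v)"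
  by metis
 obtain l where l: "linear l" "!!v. v \<in> VP ==> v ~: {} ==> 0 < (l (p' v) :: real)"
  using empty_p same' by (metis facialE)
 have "l y = (\<Sum>v\<in>VP. c v * l (p' v))" using l(1) by (simp add: c(2) linear_sum linear_cmul)
 moreover have "l (- y) = (\<Sum>v\<in>VP. c' v * l (p' v))"
  unfolding c(4) using l(1) by (simp add: linear_sum linear_cmul)
 ultimately have s: "0 <= l (- y)" "l y = (\<Sum>v\<in>VP. c v * l (p' v))"
  using c(3) l(2) by (auto intro!: sum_nonneg simp: less_imp_le)
 moreover have nn: "\<forall>v\<in>VP. 0 <= c v * l (p' v)" using c(1) l(2) by (auto simp: less_imp_le)
 ultimately have "(\<Sum>v\<in>VP. c v * l (p' v)) = 0"
  using l(1) sum_nonneg[of VP "%v. c v * l (p' v)"] by (simp add: linear_neg)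
 hence "\<forall>v\<in>VP. c v * l (p' v) = 0" using nn finVP by (simp add: sum_nonneg_eq_0_iff)
 hence "\<forall>v\<in>VP. c v = 0" using l(2) by fastforce
 thus ?thesis using c(2) by simp
qed

text \<open>The map \<open>H\<close> with components \<open>ax j\<close> is injective by
  \<open>no_common_zero\<close>, and both dimensions are \<open>D\<close>; so its image spans, and
  no nonzero vector is orthogonal to it.\<close>

lemma frame_independent:
 assumes c: "\<forall>v\<in>VP. (\<Sum>j<D. c j * ax j (p' v)) = 0" and j: "j < D"
 shows "c j = 0"
proof -
 define H where "H y = (\<Sum>j<D. ax j y *\<^sub>R axis' j)" for y
 have Hpt: "H y = pt (%j. ax j y)" for y by (simp add: H_def mkvec_def)
 have lin: "linear H"
  using ax_linear by (intro linearI) (simp_all add: Hpt linear_add linear_cmul pt_add pt_scale cong: pt_cong)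
 obtain B where B: "B \<subseteq> p' ` VP" "independent B" "p' ` VP \<subseteq> span B" "card B = dim (p' ` VP)"
  using basis_exists by blast
 have "inj_on H (span B)"
 proof (subst linear_injective_on_subspace_0[OF lin subspace_span], intro ballI impI)
  fix y assume y: "y \<in> span B" "H y = 0"
  have "ax j y = 0" if "j < D" for j using lkp_pt[OF that, of "%j. ax j y"] y(2) by (simp add: Hpt)
  moreover have "y \<in> span (p' ` VP)" using span_mono[OF B(1)] y(1) by blast
  ultimately show "y = 0" using no_common_zero by blast
 qed
 hence ind: "independent (H ` B)" "inj_on H B"
  using linear_independent_injective_image[OF lin B(2)] inj_on_subset span_superset by blast+
 have "span (H ` B) = csp D"
 proof (rule span_full_independent[OF ind(1)])
  show "H ` B \<subseteq> csp D" using pt_coord by (auto simp: Hpt)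
  show "card (H ` B) = D" using card_image[OF ind(2)] B(4) dim_p' by simp
 qed
 moreover have "ip D x (pt c) = 0" if "x \<in> H ` B" for x
  using that B(1) c by (auto simp: Hpt ip_commute[of D _ "pt c"] ip_pt lkp_pt subset_iff)
 ultimately have "pt c = 0" using ip_eq_on_spanning[of "H ` B" D "pt c"] pt_coord by blast
 thus ?thesis using lkp_pt[OF j, of c] by simp
qed

lemma coeffs_unique: "coeffs h c ==> coeffs h c' ==> j < D ==> c j = c' j"
 using frame_independent[of "%j. c j - c' j" j] by (simp add: coeffs_def left_diff_distrib sum_subtractf)

definition cf :: "(nat => real) => nat => real" where "cf h = (SOME c. coeffs h c)"

lemma coeffs_cf: "gr h ==> coeffs h (cf h)"
 unfolding cf_def using someI_ex[OF coeffs_exist] .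

lemma cf_unit_pos: "j < D ==> 0 < cf (%_. 1) j"
 using coeffs_cf[OF gr_unit] by (auto simp: coeffs_def order_less_le)

text \<open>Division by the coefficients of the all-one vector normalizes the frame.\<close>

sublocale st: staudt D R "%h j. cf h j / cf (%_. 1) j" gr
proof
 show "3 <= D" "1 \<in> R" using D3 one_R .
 show "0 < r" if "r \<in> R" for r using that R_pos by auto
 show "gr h \<longleftrightarrow> (\<forall>j<D. h j \<in> insert 0 R) & (\<exists>j<D. h j ~= 0)" for h by (rule gr)
 show "0 <= cf h j / cf (%_. 1) j" "cf h j / cf (%_. 1) j = 0 \<longleftrightarrow> h j = 0" if "gr h" "j < D" for h j
  using coeffs_cf[OF that(1)] cf_unit_pos[OF that(2)] that(2) by (auto simp: coeffs_def)
 show "cf (%_. 1) j / cf (%_. 1) j = 1" if "j < D" for j using cf_unit_pos[OF that] by simp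
 show "cf h j / cf (%_. 1) j = cf h' j / cf (%_. 1) j" if "!!j. j < D ==> h j = h' j" for h h' j
 proof -
  have "coeffs h = coeffs h'" using pt_cong[of D h h'] that by (auto simp: coeffs_def fun_eq_iff)
  thus ?thesis by (simp add: cf_def)
 qed
 show "cf (%j. c * h j) j / cf (%_. 1) j = cf h j / cf (%_. 1) j"
  if h: "gr h" "0 < c" "gr (%j. c * h j)" "j < D" for h c j
 proof -
  have "coeffs (%j. c * h j) (cf h)"
   using coeffs_cf[OF h(1)] h(2) f_scale[OF h(2), of "pt h"] by (simp add: coeffs_def pt_scale)
  thus ?thesis using coeffs_unique[OF coeffs_cf[OF h(3)]] h(4) by simp
 qed
 show "\<exists>l>0. \<exists>m>0. \<forall>j<D. cf (%j. h j + h' j) j / cf (%_. 1) j = l * (cf h j / cf (%_. 1) j) + m * (cf h' j / cf (%_. 1) j)"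
  if h: "gr h" "gr h'" "gr (%j. h j + h' j)" for h h'
 proof -
  obtain l m where lm: "l > 0" "m > 0" "coeffs (%j. h j + h' j) (%j. l * cf h j + m * cf h' j)"
   using coeffs_add[OF h coeffs_cf[OF h(1)] coeffs_cf[OF h(2)]] by blast
  have "cf (%j. h j + h' j) j = l * cf h j + m * cf h' j" if "j < D" for j
   using coeffs_unique[OF coeffs_cf[OF h(3)] lm(3) that] .
  thus ?thesis using lm(1,2) by (intro exI[of _ l] exI[of _ m] conjI) (auto simp: add_divide_distrib)
 qed
qed

definition fr :: "nat => 'v => real" where "fr j v = cf (%_. 1) j * ax j (p' v)"

lemma fr_pos: "j < D ==> v \<in> VP ==> 0 < fr j v"
 using cf_unit_pos ax_pos by (simp add: fr_def)

lemma fr_independent: "\<forall>v\<in>VP. (\<Sum>j<D. c j * fr j v) = 0 ==> j < D ==> c j = 0"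
 using frame_independent[of "%j. c j * cf (%_. 1) j" j] cf_unit_pos[of j] by (simp add: fr_def mult.assoc)

lemma theta_nat: "1 <= n ==> n <= 2 * M ==> st.th (real n) = real n"
proof (induction n rule: dec_induct)
 case base
 thus ?case using st.theta_hom by (simp add: partial_hom_def)
next
 case (step n)
 have "real n \<in> R" "1 \<in> R" "real n + 1 \<in> R" using R_nat[of n] R_nat[of "Suc n"] one_R step by (simp_all add: add.commute)
 hence "st.th (real n + 1) = st.th (real n) + st.th 1" using st.theta_hom unfolding partial_hom_def by blast
 thus ?case using step st.theta_hom by (simp add: partial_hom_def add.commute)
qed

lemma f_pt:
 assumes h: "!!j. j < D ==> h j \<in> R & st.th (h j) = h j"
 shows "\<exists>l>0. \<forall>v\<in>VP. f (pt h) (p' v) = l * (\<Sum>j<D. h j * fr j v)"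
proof -
 have nz: "h j ~= 0" if "j < D" for j using h[OF that] R_pos by force
 hence g: "gr h" using h D3 by (auto simp: gr intro!: exI[of _ 0])
 obtain l where l: "l > 0" "\<forall>j<D. cf h j / cf (%_. 1) j = l * (if h j = 0 then 0 else st.th (h j))"
  using st.coordinates[OF g] by blast
 have "cf h j = l * h j * cf (%_. 1) j" if "j < D" for j
  using l(2) that h[OF that] nz[OF that] cf_unit_pos[OF that] by (auto simp: field_simps)
 hence "f (pt h) (p' v) = l * (\<Sum>j<D. h j * fr j v)" if "v \<in> VP" for v
  using coeffs_cf[OF g] that by (simp add: coeffs_def fr_def sum_distrib_left mult.assoc)
 thus ?thesis using l(1) by blast
qed

text \<open>The two lines of \<open>u_plus_const\<close> give two expressions for the functional of
  \<open>u B\<close>. Compared at two indices other than \<open>i\<close> where the entries differ,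
  they have the same coefficients \<open>kap\<close> and \<open>m\<close>; the index
  \<open>i\<close> then gives \<open>m = kap\<close>, which removes the shift by
  \<open>M\<close>.\<close>

lemma u_pinned:
 assumes B: "proper B"
 shows "\<exists>kap>0. \<forall>v\<in>VP. f (u B) (p' v) = kap * (\<Sum>j<D. lkp (u B) j * fr j v)"
proof -
 define t where "t j = lkp (u B) j + M" for j
 have thom: "st.th (x + y) = st.th x + st.th y" if "x \<in> R" "y \<in> R" "x + y \<in> R" for x y
  using st.theta_hom that unfolding partial_hom_def by blast
 have MR: "real M \<in> R" "real M + real M \<in> R" "st.th (real M) = real M" "st.th (real M + real M) = real M + real M"
  using R_nat[of M] R_nat[of "2 * M"] theta_nat[of M] theta_nat[of "2 * M"] M1 by simp_all
 have tR: "t j \<in> R" "t j + M \<in> R" "st.th (t j) = t j" "st.th (t j + M) = t j + M" if "j < D" for j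
 proof -
  show *: "t j \<in> R" "t j + M \<in> R" "st.th (t j) = t j"
   using R_u[OF B that] rigid[OF B that st.theta_hom] by (simp_all add: t_def)
  show "st.th (t j + M) = t j + M" using thom[OF *(1) MR(1) *(2)] * MR by simp
 qed
 have pin: "\<exists>kap>0. \<exists>m. \<forall>v\<in>VP. f (u B) (p' v) =
   (\<Sum>j<D. (kap * (t j + (if j = i then e * real M else 0)) - m * (M + (if j = i then e * real M else 0))) * fr j v)"
  if i: "i < D" and e: "e = 0 | e = 1" for i and e :: real
 proof -
  define h where "h j = t j + (if j = i then e * real M else 0)" for j
  define h' where "h' j = M + (if j = i then e * real M else 0)" for j
  obtain a b where ab: "a > 0" "b > 0" "\<forall>v\<in>VP. f (pt h) (p' v) = a * f (u B) (p' v) + b * f (pt h') (p' v)"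
   using u_plus_const[OF B i e] unfolding h_def h'_def t_def by blast
  obtain l where l: "l > 0" "\<forall>v\<in>VP. f (pt h) (p' v) = l * (\<Sum>j<D. h j * fr j v)"
  proof -
   have "h j \<in> R & st.th (h j) = h j" if "j < D" for j using tR[OF that] e by (auto simp: h_def)
   thus ?thesis using f_pt[of h] that by blast
  qed
  obtain l' where l': "l' > 0" "\<forall>v\<in>VP. f (pt h') (p' v) = l' * (\<Sum>j<D. h' j * fr j v)"
  proof -
   have "h' j \<in> R & st.th (h' j) = h' j" if "j < D" for j using MR e by (auto simp: h'_def)
   thus ?thesis using f_pt[of h'] that by blast
  qed
  have "f (u B) (p' v) = (\<Sum>j<D. ((l / a) * h j - (b * l' / a) * h' j) * fr j v)" if v: "v \<in> VP" for v
  proof -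
   have "a * f (u B) (p' v) = l * (\<Sum>j<D. h j * fr j v) - b * (l' * (\<Sum>j<D. h' j * fr j v))"
    using ab(3) l(2) l'(2) v by simp
   hence "f (u B) (p' v) = (l / a) * (\<Sum>j<D. h j * fr j v) - (b * l' / a) * (\<Sum>j<D. h' j * fr j v)"
    using ab(1) by (simp add: field_simps)
   thus ?thesis by (simp add: sum_distrib_left sum_subtractf left_diff_distrib mult.assoc)
  qed
  moreover have "0 < l / a" using l(1) ab(1) by simp
  ultimately show ?thesis unfolding h_def h'_def by blast
 qed
 have D0: "0 < D" using D3 by simp
 obtain kap m :: real where k: "kap > 0" "\<forall>v\<in>VP. f (u B) (p' v) = (\<Sum>j<D. (kap * t j - m * M) * fr j v)"
  using pin[OF D0, of 0] by (auto cong: if_cong)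
 \<comment> \<open>With equal entries \<open>u B\<close> would be a multiple of the sum of the
   coordinates, which is positive at every \<open>p v\<close>; it could not vanish on a proper
   nonempty set only.\<close>
 have "\<exists>j1<D. \<exists>j2<D. t j1 ~= t j2"
 proof (rule ccontr)
  assume "\<not> ?thesis"
  hence "t j = t 0" if "j < D" for j using D0 that by blast
  hence const: "lkp (u B) j = lkp (u B) 0" if "j < D" for j
   using that unfolding t_def by (metis add_right_imp_eq)
  have eq: "ip D (u B) (p v) = lkp (u B) 0 * (\<Sum>j<D. lkp (p v) j)" for v
   unfolding ip_def sum_distrib_left by (intro sum.cong arg_cong2[where f = "(*)"] const) auto
  obtain v w where v: "v \<in> VP" "v \<in> B" "w \<in> VP" "w ~: B"
   using B facial_subset[of p VP B] unfolding proper_def by blast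
  have s: "0 < (\<Sum>j<D. lkp (p v) j)" using p_pos[OF v(1)] D0 by (intro sum_pos) auto
  have "ip D (u B) (p v) = 0" using u_zero[OF B v(1)] v(2) by simp
  hence "lkp (u B) 0 = 0" using eq s by simp
  thus False using eq[of w] u_zero[OF B v(3)] v(4) by simp
 qed
 then obtain j1 j2 where j: "j1 < D" "j2 < D" "t j1 ~= t j2" by blast
 obtain i where i: "i < D" "i ~= j1" "i ~= j2" using ex_third_index[OF D3] by blast
 obtain kap' m' :: real where k': "\<forall>v\<in>VP. f (u B) (p' v) =
   (\<Sum>j<D. (kap' * (t j + (if j = i then real M else 0)) - m' * (M + (if j = i then real M else 0))) * fr j v)"
  using pin[OF i(1), of 1] unfolding mult_1_left by blast
 have eq: "kap * t j - m * M = kap' * (t j + (if j = i then real M else 0)) - m' * (M + (if j = i then real M else 0))"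
  if "j < D" for j
  using fr_independent[of "%j. (kap * t j - m * M) - (kap' * (t j + (if j = i then real M else 0)) - m' * (M + (if j = i then real M else 0)))" j]
   k(2) k' that by (simp add: left_diff_distrib sum_subtractf)
 have 1: "(kap - kap') * t j1 = (m - m') * M" "(kap - kap') * t j2 = (m - m') * M"
  using eq[OF j(1)] eq[OF j(2)] i by (simp_all add: algebra_simps)
 hence kk: "kap' = kap" using j(3) by (metis eq_iff_diff_eq_0 mult_cancel_left)
 hence mm: "m' = m" using 1 M1 by simp
 have "kap * M = m * M" using eq[OF i(1)] unfolding kk mm by (auto simp: algebra_simps)
 hence "m = kap" using M1 by simp
 hence "f (u B) (p' v) = kap * (\<Sum>j<D. lkp (u B) j * fr j v)" if "v \<in> VP" for v
  using k(2) that by (simp add: t_def sum_distrib_left algebra_simps)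
 thus ?thesis using k(1) by blast
qed

text \<open>\<open>G\<close> evaluates the normalized frame. By \<open>u_pinned\<close> the vector
  \<open>G (p' v)\<close> satisfies the inequalities of all rays, so it lies in the cone over the
  polytope, and it is annihilated by \<open>u {v}\<close>; this leaves only multiples of
  \<open>p v\<close>.\<close>

theorem projectively_equivalent:
 "\<exists>G mu. linear G & (\<forall>v\<in>VP. 0 < mu v & G (p' v) = mu v *\<^sub>R p v)"
proof -
 define G where "G y = pt (%j. cf (%_. 1) j * ax j y)" for y
 have lin: "linear G"
  using ax_linear
  by (intro linearI) (simp_all add: G_def linear_add linear_cmul distrib_left mult.left_commute pt_add pt_scale cong: pt_cong)
 have ex: "\<exists>m>0. G (p' v) = m *\<^sub>R p v" if v: "v \<in> VP" for v
 proof -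
  have lk: "lkp (G (p' v)) j = fr j v" if "j < D" for j using lkp_pt[OF that] by (simp add: G_def fr_def)
  have ipu: "\<exists>kap>0. f (u B) (p' v) = kap * ip D (u B) (G (p' v))" if B: "proper B" for B
   using u_pinned[OF B] v lk by (auto simp: ip_def)
  have "0 <= ip D x (G (p' v))" if "x \<in> rays" for x
   using that
  proof
   assume "x \<in> pt ` Collect gr"
   then obtain h where h: "gr h" "x = pt h" by blast
   have "0 <= h j" if "j < D" for j using h(1) that R_pos by (force simp: gr)
   thus ?thesis using lk fr_pos[OF _ v] by (auto simp: h(2) ip_pt less_imp_le intro!: sum_nonneg)
  next
   assume "x \<in> u ` Collect proper"
   then obtain B where B: "proper B" "x = u B" by blast
   obtain kap where "kap > 0" "f (u B) (p' v) = kap * ip D (u B) (G (p' v))" using ipu[OF B(1)] by blast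
   thus ?thesis using f_nonneg[OF u_dual[OF B(1)] u_nz[OF B(1)] v] B(2) by (simp add: zero_le_mult_iff)
  qed
  hence "\<exists>c. (\<forall>w\<in>VP. 0 <= c w) & G (p' v) = (\<Sum>w\<in>VP. c w *\<^sub>R p w)"
   using dualizing_rays[unfolded dualizing_def, rule_format, of "G (p' v)"] pt_coord by (simp add: G_def)
  then obtain c where c: "\<forall>w\<in>VP. 0 <= c w" "G (p' v) = (\<Sum>w\<in>VP. c w *\<^sub>R p w)" by blast
  have pv: "proper {v}" using single_p[OF v] card2 by (auto simp: proper_def)
  obtain kap where "kap > 0" "f (u {v}) (p' v) = kap * ip D (u {v}) (G (p' v))" using ipu[OF pv] by blast
  hence "ip D (u {v}) (G (p' v)) = 0"
   using f_zero[OF u_dual[OF pv] u_nz[OF pv] v] u_zero[OF pv v] by simp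
  hence "(\<Sum>w\<in>VP. c w * ip D (u {v}) (p w)) = 0" by (simp add: c(2) ip_sum_right ip_scale_right)
  hence "\<forall>w\<in>VP. c w * ip D (u {v}) (p w) = 0"
   using c(1) u_nonneg[OF pv] finVP by (subst (asm) sum_nonneg_eq_0_iff) auto
  hence z: "c w = 0" if "w \<in> VP" "w ~= v" for w using that u_zero[OF pv that(1)] by auto
  have "(\<Sum>w\<in>VP. c w *\<^sub>R p w) = (\<Sum>w\<in>VP. if w = v then c v *\<^sub>R p v else 0)"
   using z by (intro sum.cong) auto
  hence Gv: "G (p' v) = c v *\<^sub>R p v" using c(2) v finVP by (simp add: sum.delta)
  have "0 < D" using D3 by simp
  hence "c v ~= 0" using lk[of 0] fr_pos[of 0 v] v Gv by auto
  thus ?thesis using Gv c(1) v by (intro exI[of _ "c v"]) (auto simp: order_less_le)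
 qed
 then obtain mu where "\<forall>v\<in>VP. 0 < mu v & G (p' v) = mu v *\<^sub>R p v" by metis
 thus ?thesis using lin by blast
qed

end

context cone_config
begin

text \<open>Each of the finitely many shifted entries is algebraic and brings its own rigid set;
  \<open>R\<close> unites these with the numbers needed for shifts by \<open>M\<close>.\<close>

theorem stamp:
 assumes card2: "2 <= card VP" and p_pos: "!!v j. v \<in> VP ==> j < D ==> 0 < lkp (p v) j"
  and u: "!!B. proper B ==> u B \<in> csp D"
   "!!B v. proper B ==> v \<in> VP ==> 0 <= ip D (u B) (p v)"
   "!!B v. proper B ==> v \<in> VP ==> ip D (u B) (p v) = 0 \<longleftrightarrow> v \<in> B"
  and M1: "1 <= M" and alg: "!!B j. proper B ==> j < D ==> algebraic (lkp (u B) j + real M) & 0 < lkp (u B) j + real M"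
 shows "\<exists>k Gam om. stack VP p D k Gam om &
  (\<forall>s' :: _ => 'x::real_vector. stack_realization VP p D k Gam om s' -->
   (\<exists>G mu. linear G & (\<forall>v\<in>VP. 0 < mu v & G (s' (Inl v)) = mu v *\<^sub>R p v)))"
proof -
 define T where "T = (%(B, j). lkp (u B) j + real M) ` (Collect proper \<times> {..<D})"
 have finp: "finite (Collect proper)"
 proof (rule finite_subset)
  show "Collect proper \<subseteq> Pow VP" using facial_subset[of p VP] unfolding proper_def by blast
 qed (use finVP in simp)
 have T: "finite T" "!!t. t \<in> T ==> algebraic t & 0 < t" using finp alg by (auto simp: T_def)
 have TI: "lkp (u B) j + real M \<in> T" if "proper B" "j < D" for B j using that by (auto simp: T_def)
 have "\<exists>S. finite S & S \<subseteq> {0<..} & t \<in> S & (\<forall>R th. S \<subseteq> R & R \<subseteq> {0<..} & partial_hom R th --> th t = t)" if "t \<in> T" for t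
  using rigid_set_exists T(2)[OF that] by blast
 then obtain S where S: "!!t. t \<in> T ==> finite (S t) & S t \<subseteq> {0<..} & t \<in> S t &
   (\<forall>R th. S t \<subseteq> R & R \<subseteq> {0<..} & partial_hom R th --> th t = t)" by metis
 define R where "R = (\<Union>t\<in>T. S t) \<union> (%t. t + real M) ` T \<union> real ` {1..2 * M}"
 have Rpos: "R \<subseteq> {0<..}" using S T(2) by (fastforce simp: R_def intro: add_pos_nonneg)
 have finR: "finite R" using S T(1) by (auto simp: R_def)
 define gr where "gr h \<longleftrightarrow> (\<forall>j<D. h j \<in> insert 0 R) & (\<exists>j<D. h j ~= 0)" for h
 interpret P: pinned VP p D u M R gr
 proof
  fix B j th assume B: "proper B" "j < D"
  show "lkp (u B) j + real M \<in> R & lkp (u B) j + real M + real M \<in> R"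
   using TI[OF B] S[OF TI[OF B]] unfolding R_def by blast
  assume "partial_hom R th"
  moreover have "S (lkp (u B) j + real M) \<subseteq> R" using TI[OF B] by (auto simp: R_def)
  ultimately show "th (lkp (u B) j + real M) = lkp (u B) j + real M" using S[OF TI[OF B]] Rpos by blast
 qed (use assms Rpos gr_def in \<open>auto simp: R_def\<close>)
 have "pt ` Collect gr \<subseteq> pt ` PiE {..<D} (%_. insert 0 R)"
 proof
  fix x assume "x \<in> pt ` Collect gr"
  then obtain h where h: "gr h" "x = pt h" by blast
  hence "restrict h {..<D} \<in> PiE {..<D} (%_. insert 0 R)" by (auto simp: gr_def)
  moreover have "pt (restrict h {..<D}) = x" unfolding h(2) by (intro pt_cong) auto
  ultimately show "x \<in> pt ` PiE {..<D} (%_. insert 0 R)" by blast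
 qed
 hence "finite (pt ` Collect gr)" by (rule finite_subset) (auto intro!: finite_imageI finite_PiE finR)
 hence "finite P.rays" using finp by simp
 moreover have "P.rays \<subseteq> dualC - {0}" using P.grid_dual P.grid_nz P.u_dual P.u_nz by auto
 moreover have "gr (%_. 1)" using P.one_R D3 by (auto simp: gr_def intro: exI[of _ 0])
 hence "P.rays ~= {}" by blast
 ultimately obtain k Gam om where st: "stack VP p D k Gam om"
  and f: "\<forall>s' :: _ => 'x. stack_realization VP p D k Gam om s' --> (\<exists>f. forced P.rays (%v. s' (Inl v)) f)"
  using stamp_exists[OF _ _ P.dualizing_rays, where 'x = 'x] by blast
 have "\<exists>G mu. linear G & (\<forall>v\<in>VP. 0 < mu v & G (s' (Inl v)) = mu v *\<^sub>R p v)"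
  if R: "stack_realization VP p D k Gam om s'" for s' :: "_ => 'x"
 proof -
  obtain f where f: "forced P.rays (%v. s' (Inl v)) f" using f R by blast
  interpret reconstruction VP p D u M R gr "%v. s' (Inl v)" f
   using f stack_realization.base_same[OF R] by unfold_locales auto
  show ?thesis by (rule projectively_equivalent)
 qed
 thus ?thesis using st by blast
qed

end

section \<open>Algebraic sample points\<close>

text \<open>The homogenizing coordinate is put at index \<open>d\<close>, so that the vectors stay
  in a coordinate space.\<close>

definition homv :: "nat => vec => vec" where "homv d x = x + axis' d"

lemma lkp_homv: "x \<in> csp d ==> i <= d ==> lkp (homv d x) i = (if i < d then lkp x i else 1)"
 by (auto simp: homv_def lookup_add lookup_axis' coord_space_def)

lemma csp_mono: "m <= n ==> csp m \<subseteq> csp n"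
 by (auto simp: coord_space_def)

lemma homv_coord: "x \<in> csp d ==> homv d x \<in> csp (Suc d)"
 unfolding homv_def using csp_mono[of d "Suc d"] axis'_in_csp[of d "Suc d"]
 by (intro subspace_add[OF subspace_csp]) auto

lemma linear_to_homv: "linear (%y :: vec \<times> real. fst y + snd y *\<^sub>R axis' d)"
 by (intro linearI) (auto simp: algebra_simps)

lemma linear_from_homv: "linear (%y. (y - lkp y d *\<^sub>R axis' d, lkp y d))"
 by (intro linearI) (auto simp: lookup_add lookup_scaleR algebra_simps)

lemma from_homv: "x \<in> csp d ==> (homv d x - lkp (homv d x) d *\<^sub>R axis' d, lkp (homv d x) d) = hom x"
 by (simp add: lkp_homv) (simp add: homv_def)

lemma facial_homv:
 assumes "!!v. v \<in> V ==> q v \<in> csp d"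
 shows "facial (%v. homv d (q v)) V B \<longleftrightarrow> facial (%v. hom (q v)) V B"
proof
 assume "facial (%v. homv d (q v)) V B"
 thus "facial (%v. hom (q v)) V B"
  by (rule facial_mono_linear[OF _ linear_to_homv[of d], where c = "%_. 1"]) (simp add: homv_def)
next
 assume "facial (%v. hom (q v)) V B"
 thus "facial (%v. homv d (q v)) V B"
  by (rule facial_mono_linear[OF _ linear_from_homv[of d], where c = "%_. 1"]) (simp only: from_homv assms scaleR_one simp_thms zero_less_one)
qed

lemma facial_coord:
 assumes "!!v. v \<in> V ==> a v \<in> csp D"
 shows "facial a V B \<longleftrightarrow> B \<subseteq> V & (\<exists>w. \<forall>v\<in>V. 0 <= (\<Sum>i<D. w i * lkp (a v) i) & ((\<Sum>i<D. w i * lkp (a v) i) = 0 \<longleftrightarrow> v \<in> B))"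
proof
 assume f: "facial a V B"
 obtain f where f': "linear f" "!!v. v \<in> V ==> 0 <= (f (a v) :: real)" "!!v. v \<in> V ==> f (a v) = 0 \<longleftrightarrow> v \<in> B"
  using f by (rule facialE3) blast
 obtain z where z: "\<forall>x\<in>csp D. f x = ip D x z" using lin_as_ip[OF f'(1)] by blast
 have "f (a v) = (\<Sum>i<D. lkp z i * lkp (a v) i)" if "v \<in> V" for v
  using z assms[OF that] by (simp add: ip_def mult.commute)
 thus "B \<subseteq> V & (\<exists>w. \<forall>v\<in>V. 0 <= (\<Sum>i<D. w i * lkp (a v) i) & ((\<Sum>i<D. w i * lkp (a v) i) = 0 \<longleftrightarrow> v \<in> B))"
  using f'(2,3) facial_subset[OF f] by (intro conjI exI[of _ "lkp z"]) auto
next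
 assume r: "B \<subseteq> V & (\<exists>w. \<forall>v\<in>V. 0 <= (\<Sum>i<D. w i * lkp (a v) i) & ((\<Sum>i<D. w i * lkp (a v) i) = 0 \<longleftrightarrow> v \<in> B))"
 then obtain w where "\<forall>v\<in>V. 0 <= ip D (mkvec D w) (a v) & (ip D (mkvec D w) (a v) = 0 \<longleftrightarrow> v \<in> B)"
  by (auto simp: ip_pt)
 thus "facial a V B" using r by (intro facialI[OF linear_ip[of D "mkvec D w"]]) auto
qed

lemma sign_determined_iff_const: "sign_determined A ==> sign_determined (%e. A e \<longleftrightarrow> c)"
 by (cases c) (auto intro: sign_determined_not)

text \<open>\<open>\<phi>\<close> is the formula that semialgebraicity provides for
  \<open>r\<close>, read in the field of all reals.\<close>

locale sample = realized r P for r :: "'i rel" and P +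
 fixes d K :: nat and \<psi> :: "'i poly_property" and \<phi> vs
 assumes d: "d = nat (affdim (body P))" and vs: "distinct vs" "set vs = vertices r" and ne: "vertices r ~= {}"
  and free: "free_vars \<phi> \<subseteq> {..<d} \<times> {..<length vs} \<times> {..<K}"
  and sat: "!!Ps. realizations K r Ps ==> \<psi> r Ps \<longleftrightarrow> sat UNIV (coordinates vs Ps) \<phi>"
begin

abbreviation "D \<equiv> Suc d"
abbreviation "lower B \<equiv> \<exists>f\<in>Field r. B = below r f"

definition equivalent :: "('i => vec) => ('i => vec) => bool" where
 "equivalent a q \<longleftrightarrow> (\<exists>g mu. linear g & (\<forall>v\<in>V. 0 < mu v & g (a v) = mu v *\<^sub>R q v))"

lemma equivalent_cong: "(!!v. v \<in> V ==> q v = q' v) ==> equivalent a q \<longleftrightarrow> equivalent a q'"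
 unfolding equivalent_def by simp

text \<open>Failure of a projective type, expressed for a vector configuration and without
  \<open>P\<close>, so that it can pass to another configuration.\<close>

definition fails :: "('i => vec) => bool" where
 "fails a \<longleftrightarrow> \<not> (\<exists>Qs. realizations K r Qs & \<psi> r Qs & (\<forall>Q\<in>set Qs. equivalent a (%v. homv d (vertex_point Q v))))"

lemma dims: "int (dim ((%v. hom (p v)) ` V)) = int D"
proof -
 have "dim ((%v. hom (p v)) ` V) > 0"
 proof -
  obtain v where v: "v \<in> V" using ne by blast
  have "dim {hom (p v)} <= dim ((%v. hom (p v)) ` V)"
   using finV v by (intro dim_mono_fin) (auto intro: span_base)
  moreover have "dim {hom (p v)} = 1"
   using dim_eq_card_independent[of "{hom (p v)}"] by (simp add: zero_prod_def dependent_single)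
  ultimately show ?thesis by simp
 qed
 thus ?thesis using affdim_body d by simp
qed

lemma Q_coords: "realization r Q ==> v \<in> V ==> vertex_point Q v \<in> csp d"
 using realized.p_coords[OF realized.intro, of r Q v] realization_same_affdim[OF real, of Q] d by simp

lemma Q_facial: "realization r Q ==> facial (%v. homv d (vertex_point Q v)) V B \<longleftrightarrow> lower B"
 using realized.facial_iff[OF realized.intro, of r Q B] facial_homv[of V "vertex_point Q" d B, OF Q_coords] by simp

lemma realize:
 assumes q: "!!v. v \<in> V ==> q v \<in> csp d" and f: "!!B. facial (%v. homv d (q v)) V B \<longleftrightarrow> lower B"
 shows "\<exists>Q. realization r Q & (\<forall>v\<in>V. vertex_point Q v = q v)"
proof -
 have fac: "facial (%v. hom (q v)) V B \<longleftrightarrow> lower B" for B using f[of B] facial_homv[of V q d B, OF q] by simp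
 have "dim ((%v. hom (p v)) ` V) = dim ((%v. hom (q v)) ` V)"
  using fac facial_iff by (intro facial_dim_eq[OF finV _ facial_hom_empty]) simp
 hence dq: "dim ((%v. hom (q v)) ` V) = Suc d" using dims by simp
 have "inj_on (%v. hom (q v)) V" using fac facial_iff facial_vertex by (intro facial_singletons_inj) simp
 hence inj: "inj_on q V" by (simp add: inj_on_def)
 have R: "realization r (convex hull (q ` V), %f. convex hull (q ` below r f))"
  using dq by (intro realizationI[OF po finV inj q _ fac below_mono]) auto
 have "vertex_point (convex hull (q ` V), %f. convex hull (q ` below r f)) v = q v" if "v \<in> V" for v
  using below_vertex[OF that] by (simp add: vertex_point_def face_def)
 thus ?thesis using R by blast
qed

section \<open>Definability of failing configurations\<close>

definition ix :: "'i => nat" where "ix v = (SOME j. j < length vs & vs ! j = v)"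

lemma ix: "v \<in> V ==> ix v < length vs & vs ! ix v = v"
proof -
 assume "v \<in> V"
 hence "\<exists>j. j < length vs & vs ! j = v" by (simp only: vs(2)[symmetric] in_set_conv_nth)
 thus ?thesis unfolding ix_def by (rule someI_ex)
qed

lemma ix_nth: "j < length vs ==> ix (vs ! j) = j"
 using ix[of "vs ! j"] nth_eq_iff_index_eq[OF vs(1)] nth_mem[of j vs, unfolded vs(2)] by blast

text \<open>
 Block \<open>k < K\<close> of the variables holds the polytope \<open>Q k\<close>, block \<open>K\<close> the cone vectors \<open>a\<close>, block
 \<open>K + 1\<close> the facet functionals, and block \<open>K + 2\<close> is scratch space for bound variables.
\<close>

definition ent :: "nat => nat => 'i => (nat \<times> nat \<times> nat => real) => real" where
 "ent k i v e = (if k = K | i < d then e (i, ix v, k) else 1)"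

definition cv :: "nat => (nat \<times> nat \<times> nat => real) => 'i => vec" where
 "cv k e v = mkvec D (%i. ent k i v e)"

lemma ent_Pol: "ent k i v \<in> Pol"
 unfolding ent_def[abs_def] by (cases "k = K | i < d") (auto intro: Pol.intros)

lemma cv_coord: "cv k e v \<in> csp D" and lkp_cv: "i < D ==> lkp (cv k e v) i = ent k i v e"
 by (simp_all add: cv_def pt_coord lkp_pt)

abbreviation "X0 \<equiv> {..<d} \<times> {..<length vs} \<times> {..<K}"
abbreviation "XS \<equiv> {..<D} \<times> {..<Suc D + length vs} \<times> {K + 2}"
abbreviation "upd X u e \<equiv> (%x. if x \<in> X then u x else e x)"

lemma ent_upd: "k <= K ==> ent k i v (upd XS u e) = ent k i v e"
 by (auto simp: ent_def)

text \<open>By \<open>facial_coord\<close>, the exposing functional is a vector of scratch variables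
  to be quantified.\<close>

lemma facial_definable: "k <= K ==> sign_determined (%e. facial (cv k e) V B)"
proof -
 assume k: "k <= K"
 define A where "A e \<longleftrightarrow> (\<forall>v\<in>V. 0 <= (\<Sum>i<D. e (i, 0, K + 2) * ent k i v e) &
   ((\<Sum>i<D. e (i, 0, K + 2) * ent k i v e) = 0 \<longleftrightarrow> v \<in> B))" for e
 have "sign_determined A"
  unfolding A_def[abs_def] using finV
  by (intro sign_determined_ball sign_determined_conj sign_determined_iff_const sign_determined_le sign_determined_eq
    Pol_sum Pol_mult ent_Pol Pol.intros) auto
 hence "sign_determined (%e. \<exists>u. A (upd XS u e))" by (rule sign_determined_ex_block) auto
 moreover have "facial (cv k e) V B \<longleftrightarrow> B \<subseteq> V & (\<exists>u. A (upd XS u e))" for e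
 proof -
  have s: "(\<Sum>i<D. w i * lkp (cv k e v) i) = (\<Sum>i<D. w i * ent k i v e)" for w v
   by (intro sum.cong) (auto simp: lkp_cv)
  have A: "A (upd XS u e) \<longleftrightarrow> (\<forall>v\<in>V. 0 <= (\<Sum>i<D. u (i, 0, K + 2) * ent k i v e) &
    ((\<Sum>i<D. u (i, 0, K + 2) * ent k i v e) = 0 \<longleftrightarrow> v \<in> B))" for u
   unfolding A_def ent_upd[OF k] by simp
  have "(\<exists>u. A (upd XS u e)) \<longleftrightarrow> (\<exists>w. \<forall>v\<in>V. 0 <= (\<Sum>i<D. w i * ent k i v e) &
    ((\<Sum>i<D. w i * ent k i v e) = 0 \<longleftrightarrow> v \<in> B))" (is "_ \<longleftrightarrow> (\<exists>w. ?R w)")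
  proof
   assume "\<exists>u. A (upd XS u e)"
   then obtain u where "A (upd XS u e)" ..
   hence "?R (%i. u (i, 0, K + 2))" unfolding A .
   thus "\<exists>w. ?R w" by (rule exI[where x = "%i. u (i, 0, K + 2)"])
  next
   assume "\<exists>w. ?R w"
   then obtain w where "?R w" ..
   hence "A (upd XS (%(i, _). w i) e)" unfolding A prod.case .
   thus "\<exists>u. A (upd XS u e)" by (rule exI[where x = "%(i, _). w i"])
  qed
  thus ?thesis unfolding facial_coord[OF cv_coord] s by simp
 qed
 ultimately show ?thesis by (simp add: sign_determined_conj sign_determined_const)
qed

text \<open>The scratch block holds the matrix of \<open>g\<close> in the columns below
  \<open>D\<close>, and the factors \<open>mu\<close> from column \<open>Suc D\<close> on.\<close>

lemma equivalent_definable: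
 assumes k: "k <= K"
 shows "sign_determined (%e. equivalent (cv K e) (cv k e))"
proof -
 define A where "A e \<longleftrightarrow> (\<forall>v\<in>V. 0 < e (0, Suc D + ix v, K + 2) &
   (\<forall>i\<in>{..<D}. (\<Sum>j<D. e (i, j, K + 2) * ent K j v e) = e (0, Suc D + ix v, K + 2) * ent k i v e))" for e
 have "sign_determined A"
  unfolding A_def[abs_def] using finV
  by (intro sign_determined_ball sign_determined_conj sign_determined_less sign_determined_eq
    Pol_sum Pol_mult ent_Pol Pol.intros) auto
 hence "sign_determined (%e. \<exists>u. A (upd XS u e))" by (rule sign_determined_ex_block) auto
 moreover have "equivalent (cv K e) (cv k e) \<longleftrightarrow> (\<exists>u. A (upd XS u e))" for e
 proof -
  have A: "A (upd XS u e) \<longleftrightarrow> (\<forall>v\<in>V. 0 < u (0, Suc D + ix v, K + 2) &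
    (\<forall>i\<in>{..<D}. (\<Sum>j<D. u (i, j, K + 2) * ent K j v e) = u (0, Suc D + ix v, K + 2) * ent k i v e))" for u
   unfolding A_def ent_upd[OF k] ent_upd[OF order_refl]
   using ix by (intro ball_cong conj_cong arg_cong2[where f = "(=)"] sum.cong) auto
  show ?thesis
  proof
   assume "equivalent (cv K e) (cv k e)"
   then obtain g mu where g: "linear g" "\<forall>v\<in>V. 0 < mu v & g (cv K e v) = mu v *\<^sub>R cv k e v"
    unfolding equivalent_def by blast
   define u where "u = (%(i, j, _::nat). if j < D then lkp (g (axis' j)) i else mu (vs ! (j - Suc D)))"
   have "(\<Sum>j<D. lkp (g (axis' j)) i * ent K j v e) = mu v * ent k i v e" if v: "v \<in> V" and i: "i < D" for v i
   proof -
    have "g (cv K e v) = (\<Sum>j<D. ent K j v e *\<^sub>R g (axis' j))"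
     unfolding cv_def mkvec_def using g(1) by (simp add: linear_sum linear_cmul linear_add)
    hence "lkp (g (cv K e v)) i = (\<Sum>j<D. lkp (g (axis' j)) i * ent K j v e)"
     by (simp add: lookup_sum lookup_scaleR lookup_add mult.commute)
    thus ?thesis using g(2) v lkp_cv[OF i] by (simp add: lookup_scaleR)
   qed
   hence "A (upd XS u e)" unfolding A using g(2) ix by (auto simp: u_def)
   thus "\<exists>u. A (upd XS u e)" by (rule exI[where x = u])
  next
   assume "\<exists>u. A (upd XS u e)"
   then obtain u where u: "\<forall>v\<in>V. 0 < u (0, Suc D + ix v, K + 2) &
    (\<forall>i\<in>{..<D}. (\<Sum>j<D. u (i, j, K + 2) * ent K j v e) = u (0, Suc D + ix v, K + 2) * ent k i v e)"
    unfolding A by blast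
   define g where "g y = mkvec D (%i. \<Sum>j<D. u (i, j, K + 2) * lkp y j)" for y
   have "linear g"
    by (intro linearI) (simp_all add: g_def lookup_add lookup_scaleR distrib_left sum.distrib
      sum_distrib_left mult.left_commute flip: pt_add pt_scale)
   moreover have "g (cv K e v) = u (0, Suc D + ix v, K + 2) *\<^sub>R cv k e v" if "v \<in> V" for v
    unfolding g_def cv_def pt_scale[symmetric] using u that by (intro pt_cong) (simp add: lkp_pt)
   ultimately show "equivalent (cv K e) (cv k e)"
    unfolding equivalent_def using u by (intro exI[of _ g] exI[of _ "%v. u (0, Suc D + ix v, K + 2)"]) auto
  qed
 qed
 ultimately show ?thesis by simp
qed

definition good :: "(nat \<times> nat \<times> nat => real) => bool" where
 "good e \<longleftrightarrow> (\<forall>k\<in>{..<K}. (\<forall>B\<in>Pow V. facial (cv k e) V B \<longleftrightarrow> lower B) & equivalent (cv K e) (cv k e)) & sat UNIV e \<phi>"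

lemma good_definable: "sign_determined good"
 unfolding good_def[abs_def] using finV
 by (intro sign_determined_conj sign_determined_ball sign_determined_iff_const facial_definable
   equivalent_definable sign_determined_sat) auto

lemma cv_upd: "cv K (upd X0 u e) = cv K e"
 by (auto simp: cv_def ent_def fun_eq_iff intro!: pt_cong)

text \<open>The quantified variables \<open>X0\<close> are the coordinates of the \<open>K\<close>
  polytopes; \<open>realize\<close> turns a solution back into realizations.\<close>

lemma fails_iff: "fails (cv K e) \<longleftrightarrow> \<not> (\<exists>u. good (upd X0 u e))"
proof -
 have "(\<exists>Qs. realizations K r Qs & \<psi> r Qs & (\<forall>Q\<in>set Qs. equivalent (cv K e) (%v. homv d (vertex_point Q v)))) \<longleftrightarrow>
   (\<exists>u. good (upd X0 u e))"
 proof
  assume "\<exists>Qs. realizations K r Qs & \<psi> r Qs & (\<forall>Q\<in>set Qs. equivalent (cv K e) (%v. homv d (vertex_point Q v)))"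
  then obtain Qs where Q: "realizations K r Qs" "\<psi> r Qs"
   and eq: "!!Q. Q \<in> set Qs ==> equivalent (cv K e) (%v. homv d (vertex_point Q v))" by blast
  define u where "u = coordinates vs Qs"
  have QK: "length Qs = K" "!!k. k < K ==> Qs ! k \<in> set Qs" "!!k. k < K ==> realization r (Qs ! k)"
   using Q(1) by (auto simp: realizations_def)
  have cv: "cv k (upd X0 u e) v = homv d (vertex_point (Qs ! k) v)" if k: "k < K" and v: "v \<in> V" for k v
   unfolding cv_def
  proof (rule pt_eqI[symmetric])
   note c = Q_coords[OF QK(3)[OF k] v]
   show "homv d (vertex_point (Qs ! k) v) \<in> csp D" by (rule homv_coord[OF c])
   show "lkp (homv d (vertex_point (Qs ! k) v)) i = ent k i v (upd X0 u e)" if "i < D" for i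
    using that k ix[OF v] lkp_homv[OF c, of i] by (auto simp: ent_def u_def coordinates_def)
  qed
  have "facial (cv k (upd X0 u e)) V B \<longleftrightarrow> lower B" if "k < K" for k B
   using Q_facial[OF QK(3)[OF that]] cv[OF that] facial_cong[of V "cv k (upd X0 u e)"] by simp
  moreover have "equivalent (cv K (upd X0 u e)) (cv k (upd X0 u e))" if "k < K" for k
   using eq[OF QK(2)[OF that]] cv[OF that] unfolding cv_upd equivalent_def by simp
  moreover have "sat UNIV (upd X0 u e) \<phi> \<longleftrightarrow> sat UNIV u \<phi>"
   using free by (intro sat_agree) auto
  ultimately have "good (upd X0 u e)" using sat[OF Q(1)] Q(2) by (auto simp: good_def u_def)
  thus "\<exists>u. good (upd X0 u e)" by (rule exI[where x = u])
 next
  assume "\<exists>u. good (upd X0 u e)"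
  then obtain u where u: "good (upd X0 u e)" by blast
  define q where "q k v = mkvec d (%i. u (i, ix v, k))" for k v
  have qc: "q k v \<in> csp d" for k v by (simp add: q_def pt_coord)
  have cv: "cv k (upd X0 u e) v = homv d (q k v)" if k: "k < K" and v: "v \<in> V" for k v
   unfolding cv_def
  proof (rule pt_eqI[symmetric])
   show "lkp (homv d (q k v)) i = ent k i v (upd X0 u e)" if "i < D" for i
    using that k ix[OF v] lkp_homv[OF qc, of i] by (auto simp: ent_def q_def lkp_pt)
  qed (rule homv_coord[OF qc])
  have "\<exists>Q. realization r Q & (\<forall>v\<in>V. vertex_point Q v = q k v)" if "k < K" for k
  proof (rule realize[OF qc])
   fix B
   show "facial (%v. homv d (q k v)) V B \<longleftrightarrow> lower B"
   proof (cases "B \<subseteq> V")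
    case True
    have "facial (%v. homv d (q k v)) V B = facial (cv k (upd X0 u e)) V B"
     by (rule facial_cong) (simp add: cv[OF that])
    thus ?thesis using u that True unfolding good_def by blast
   qed (use facial_subset below_subset in blast)
  qed
  then obtain Q where Q: "!!k. k < K ==> realization r (Q k) & (\<forall>v\<in>V. vertex_point (Q k) v = q k v)" by metis
  define Qs where "Qs = map Q [0..<K]"
  have R: "realizations K r Qs" using Q by (auto simp: realizations_def Qs_def)
  have "sat UNIV (coordinates vs Qs) \<phi> \<longleftrightarrow> sat UNIV (upd X0 u e) \<phi>"
  proof (rule sat_agree)
   fix x assume "x \<in> free_vars \<phi>"
   then obtain i j k where x: "x = (i, j, k)" "i < d" "j < length vs" "k < K" using free by auto
   have "vs ! j \<in> V" using nth_mem[OF x(3)] unfolding vs(2) .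
   thus "coordinates vs Qs x = upd X0 u e x"
    using x Q[OF x(4)] ix_nth[OF x(3)] by (simp add: coordinates_def Qs_def q_def lkp_pt)
  qed
  hence "\<psi> r Qs" using sat[OF R] u by (simp add: good_def)
  moreover have "equivalent (cv K e) (%v. homv d (vertex_point (Q k) v))" if "k < K" for k
  proof -
   have "equivalent (cv K e) (cv k (upd X0 u e))" using u that unfolding good_def cv_upd by blast
   thus ?thesis using equivalent_cong[of "cv k (upd X0 u e)" "%v. homv d (vertex_point (Q k) v)"] cv[OF that] Q[OF that] by simp
  qed
  ultimately show "\<exists>Qs. realizations K r Qs & \<psi> r Qs & (\<forall>Q\<in>set Qs. equivalent (cv K e) (%v. homv d (vertex_point Q v)))"
   using R by (intro exI[of _ Qs]) (auto simp: Qs_def)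
 qed
 thus ?thesis by (simp add: fails_def)
qed

abbreviation "prop B \<equiv> lower B & B ~= {} & B ~= V"

text \<open>\<open>P\<close>, shifted into the positive orthant and taken together with functionals
  for its proper facial sets, satisfies the sign-determined condition \<open>A\<close>;
  \<open>algebraic_point\<close> provides a solution with algebraic entries. It need not be
  projectively equivalent to \<open>P\<close>, since only \<open>fails\<close> is carried over. The
  functionals are variables too, because the stamp needs their entries algebraic.\<close>

theorem algebraic_sample:
 assumes nh: "\<not> holds_projective K \<psi> r P"
 shows "\<exists>a u M. fails a & (\<forall>v\<in>V. a v \<in> csp D & (\<forall>j<D. 0 < lkp (a v) j)) &
  (\<forall>B. facial a V B \<longleftrightarrow> lower B) & 1 <= M &
  (\<forall>B. prop B --> u B \<in> csp D & (\<forall>v\<in>V. 0 <= ip D (u B) (a v) & (ip D (u B) (a v) = 0 \<longleftrightarrow> v \<in> B)) &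
   (\<forall>j<D. algebraic (lkp (u B) j + real M) & 0 < lkp (u B) j + real M))"
proof -
 obtain N where N: "N >= 0" "!!v i. v \<in> V ==> i < d ==> 0 < lkp (p v) i + N * 1"
  using ex_bound_scale[of "V \<times> {..<d}" "%_. 1" "%(v, i). lkp (p v) i"] finV by auto
 define c where "c = mkvec d (%_. N) + axis' d"
 define T where "T = (%y :: vec \<times> real. fst y + snd y *\<^sub>R c)"
 have T: "linear T" unfolding T_def by (intro linearI) (auto simp: algebra_simps)
 define a0 where "a0 v = T (hom (p v))" for v
 have pc: "p v \<in> csp d" if "v \<in> V" for v using p_coords[OF that] d by simp
 have a0: "a0 v = homv d (p v + mkvec d (%_. N))" for v by (simp add: a0_def T_def c_def homv_def)
 have sc: "p v + mkvec d (%_. N) \<in> csp d" if "v \<in> V" for v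
  using pc[OF that] pt_coord subspace_csp by (intro subspace_add) auto
 have a0c: "a0 v \<in> csp D" if "v \<in> V" for v unfolding a0 by (rule homv_coord[OF sc[OF that]])
 have a0p: "0 < lkp (a0 v) i" if "v \<in> V" "i < D" for v i
  using N(2)[OF that(1), of i] lkp_homv[OF sc[OF that(1)], of i] that(2) by (auto simp: a0 lookup_add lkp_pt)
 have a0f: "facial a0 V B \<longleftrightarrow> lower B" for B
 proof -
  have "facial a0 V B \<longleftrightarrow> facial (%v. hom (p v)) V B"
  proof
   assume "facial a0 V B"
   thus "facial (%v. hom (p v)) V B"
    by (rule facial_mono_linear[OF _ T, where c = "%_. 1"]) (simp add: a0_def)
  next
   assume *: "facial (%v. hom (p v)) V B"
   have l: "linear (%y. (y - lkp y d *\<^sub>R c, lkp y d))"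
    by (intro linearI) (auto simp: lookup_add lookup_scaleR algebra_simps)
   have "lkp (a0 v) d = 1" if "v \<in> V" for v using lkp_homv[OF sc[OF that], of d] by (simp add: a0)
   thus "facial a0 V B"
    by (intro facial_mono_linear[OF * l, where c = "%_. 1"]) (simp add: a0_def T_def)
  qed
  thus ?thesis using facial_iff by simp
 qed
 have a0fail: "fails a0"
  unfolding fails_def
 proof
  assume "\<exists>Qs. realizations K r Qs & \<psi> r Qs & (\<forall>Q\<in>set Qs. equivalent a0 (%v. homv d (vertex_point Q v)))"
  then obtain Qs where Q: "realizations K r Qs" "\<psi> r Qs"
   and eq: "!!Q. Q \<in> set Qs ==> equivalent a0 (%v. homv d (vertex_point Q v))" by blast
  have "same_projective_type r P Q" if QQ: "Q \<in> set Qs" for Q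
  proof -
   have RQ: "realization r Q" using Q(1) QQ by (auto simp: realizations_def)
   obtain g mu where g: "linear g" "\<forall>v\<in>V. 0 < mu v & g (a0 v) = mu v *\<^sub>R homv d (vertex_point Q v)"
    using eq[OF QQ] unfolding equivalent_def by blast
   let ?h = "%y. (y - lkp y d *\<^sub>R axis' d, lkp y d)"
   have l: "linear (%y. ?h (g (T y)))"
    using linear_compose[OF linear_compose[OF T g(1)] linear_from_homv[of d]] by (simp add: o_def)
   show ?thesis
   proof (rule same_projective_typeI[OF real RQ l])
    fix v assume v: "v \<in> vertices r"
    show "0 < mu v" using g(2) v by blast
    have "g (T (hom (p v))) = mu v *\<^sub>R homv d (vertex_point Q v)" using g(2) v by (simp add: a0_def)
    thus "?h (g (T (hom (p v)))) = mu v *\<^sub>R hom (vertex_point Q v)"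
     using linear_cmul[OF linear_from_homv[of d], of "mu v" "homv d (vertex_point Q v)"]
     by (simp only: from_homv[OF Q_coords[OF RQ v]])
   qed
  qed
  thus False using nh Q unfolding holds_projective_def realizations_def by blast
 qed
 define L where "L = {B. prop B}"
 have Lsub: "L \<subseteq> Pow V" using below_subset by (auto simp: L_def)
 hence finL: "finite L" using finV finite_subset by blast
 obtain be :: "'i set => nat" where be: "inj_on be L" using finite_imp_inj_to_nat_seg[OF finL] by blast
 have "\<exists>w. \<forall>v\<in>V. 0 <= (\<Sum>i<D. w i * lkp (a0 v) i) & ((\<Sum>i<D. w i * lkp (a0 v) i) = 0 \<longleftrightarrow> v \<in> B)" if "B \<in> L" for B
 proof -
  have "facial a0 V B \<longleftrightarrow> B \<subseteq> V & (\<exists>w. \<forall>v\<in>V. 0 <= (\<Sum>i<D. w i * lkp (a0 v) i) & ((\<Sum>i<D. w i * lkp (a0 v) i) = 0 \<longleftrightarrow> v \<in> B))"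
   by (rule facial_coord) (rule a0c)
  thus ?thesis using a0f that unfolding L_def by blast
 qed
 then obtain w where w: "!!B v. B \<in> L ==> v \<in> V ==> 0 <= (\<Sum>i<D. w B i * lkp (a0 v) i) & ((\<Sum>i<D. w B i * lkp (a0 v) i) = 0 \<longleftrightarrow> v \<in> B)"
  by metis
 obtain M0 where M0: "M0 >= 0" "!!B i. B \<in> L ==> i < D ==> 0 < w B i + M0 * 1"
  using ex_bound_scale[of "L \<times> {..<D}" "%_. 1" "%(B, i). w B i"] finL by auto
 define M where "M = Suc (nat \<lceil>M0\<rceil>)"
 have M: "M0 <= real M" "1 <= M" by (simp_all add: M_def) linarith
 \<comment> \<open>The variable stores the entry increased by \<open>M\<close>, so that algebraicity
   and positivity concern the variable itself.\<close>
 define W where "W B i e = e (i, be B, K + 1) - real M" for B i and e :: "nat \<times> nat \<times> nat => real"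
 define A where "A e \<longleftrightarrow> ((\<forall>v\<in>V. \<forall>i\<in>{..<D}. 0 < ent K i v e) & (\<forall>B\<in>Pow V. facial (cv K e) V B \<longleftrightarrow> lower B)) &
  (\<forall>B\<in>L. (\<forall>v\<in>V. 0 <= (\<Sum>i<D. W B i e * ent K i v e) & ((\<Sum>i<D. W B i e * ent K i v e) = 0 \<longleftrightarrow> v \<in> B)) &
   (\<forall>i\<in>{..<D}. 0 < e (i, be B, K + 1))) & \<not> (\<exists>u. good (upd X0 u e))" for e
 define X where "X = {..<D} \<times> ({..<length vs} \<union> be ` L) \<times> {..K + 1}"
 have SA: "sign_determined A"
  unfolding A_def[abs_def] W_def using finV finL
  by (intro sign_determined_conj sign_determined_ball sign_determined_iff_const sign_determined_le sign_determined_less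
    sign_determined_eq sign_determined_not sign_determined_ex_block good_definable facial_definable
    Pol_sum Pol_mult Pol_diff Pol_of_nat ent_Pol Pol.intros) auto
 have dep: "A e'" if X: "!!x. x \<in> X ==> e x = e' x" and "A e" for e e'
 proof -
  have en: "ent K i v e = ent K i v e'" if "i < D" "v \<in> V" for i v
   using that ix by (auto simp: ent_def X_def intro!: X)
  hence cvK: "cv K e v = cv K e' v" if "v \<in> V" for v using that by (auto simp: cv_def intro!: pt_cong)
  have eB: "e (i, be B, K + 1) = e' (i, be B, K + 1)" if "B \<in> L" "i < D" for i B using that by (intro X) (auto simp: X_def)
  have "fails (cv K e) = fails (cv K e')" using cvK by (simp add: fails_def equivalent_def)
  hence 1: "(\<exists>u. good (upd X0 u e)) = (\<exists>u. good (upd X0 u e'))" unfolding fails_iff by blast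
  have 2: "facial (cv K e) V B = facial (cv K e') V B" for B using cvK by (rule facial_cong)
  have 3: "(\<Sum>i<D. W B i e * ent K i v e) = (\<Sum>i<D. W B i e' * ent K i v e')" if "B \<in> L" "v \<in> V" for B v
   using en eB that by (intro sum.cong) (auto simp: W_def)
  show ?thesis using \<open>A e\<close> en eB 3 unfolding A_def 1 2 by simp
 qed
 define e0 where "e0 = (%(i, j, k). if k = K then lkp (a0 (vs ! j)) i else w (inv_into L be j) i + real M)"
 have ent0: "ent K i v e0 = lkp (a0 v) i" if "v \<in> V" for i v using ix[OF that] by (simp add: ent_def e0_def)
 have cv0: "cv K e0 v = a0 v" if "v \<in> V" for v
  unfolding cv_def using a0c[OF that] ent0[OF that] by (intro pt_eqI[symmetric]) auto
 have W0: "W B i e0 = w B i" if "B \<in> L" for B i using that be by (simp add: W_def e0_def)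
 have "fails (cv K e0)" using a0fail cv0 by (simp add: fails_def equivalent_def)
 moreover have "0 < e0 (i, be B, K + 1)" if "B \<in> L" "i < D" for i B
  using M0(2)[OF that] M(1) that be by (simp add: e0_def)
 ultimately have A0: "A e0"
  using a0p a0f w facial_cong[of V "cv K e0" a0] cv0 ent0 W0 unfolding A_def fails_iff by simp
 have "finite X" using finL by (auto simp: X_def)
 hence "\<exists>e. A e & (\<forall>x\<in>X. algebraic (e x))" by (rule algebraic_point[OF SA _ dep A0])
 then obtain e where e: "A e" "\<forall>x\<in>X. algebraic (e x)" by (elim exE conjE)
 define u where "u B = mkvec D (%i. W B i e)" for B
 have ipu: "ip D (u B) (cv K e v) = (\<Sum>i<D. W B i e * ent K i v e)" for B v
  by (simp add: u_def ip_pt lkp_cv)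
 have fac: "facial (cv K e) V B \<longleftrightarrow> lower B" for B
 proof (cases "B \<subseteq> V")
  case True thus ?thesis using e(1) by (simp add: A_def)
 qed (use facial_subset below_subset in blast)
 have props: "u B \<in> csp D & (\<forall>v\<in>V. 0 <= ip D (u B) (cv K e v) & (ip D (u B) (cv K e v) = 0 \<longleftrightarrow> v \<in> B)) &
   (\<forall>j<D. algebraic (lkp (u B) j + real M) & 0 < lkp (u B) j + real M)" if "prop B" for B
 proof -
  have B: "B \<in> L" using that by (simp add: L_def)
  have "algebraic (e (j, be B, K + 1))" if "j < D" for j using e(2) B that by (simp add: X_def)
  thus ?thesis using e(1) B unfolding ipu A_def by (simp add: u_def pt_coord lkp_pt W_def)
 qed
 have "fails (cv K e)" using e(1) by (simp add: A_def fails_iff)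
 moreover have "cv K e v \<in> csp D & (\<forall>j<D. 0 < lkp (cv K e v) j)" if "v \<in> V" for v
  using e(1) that by (auto simp: A_def cv_coord lkp_cv)
 ultimately show ?thesis using fac M(2) props by blast
qed

end

section \<open>Polytopes from vector configurations\<close>

text \<open>\<open>f\<close> supplies the homogenizing coordinate. \<open>L\<close> sends one basis
  vector to \<open>0\<close> and the others to the axes; as \<open>f\<close> is positive at that
  basis vector, the pair \<open>(L, f)\<close> is injective on the span.\<close>

lemma dehomogenize:
 fixes s :: "'n => 'x::real_vector"
 assumes fin: "finite N" and e: "facial s N {}" and dim: "dim (s ` N) = Suc m"
 shows "\<exists>q. (\<forall>n\<in>N. q n \<in> csp m) & (\<forall>B. facial (%n. hom (q n)) N B \<longleftrightarrow> facial s N B)"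
proof -
 obtain f where f: "linear f" "!!n. n \<in> N ==> 0 < (f (s n) :: real)" using e by (rule facialE) blast
 obtain B where B: "B \<subseteq> s ` N" "independent B" "span B = span (s ` N)" "card B = Suc m"
  using fin_basis[of "s ` N"] fin dim by auto
 have fB: "finite B" using B(1) fin finite_subset by blast
 obtain b0 where b0: "b0 \<in> B" using B(4) by fastforce
 have "card (B - {b0}) = m" using B(4) b0 fB by simp
 then obtain h where h: "bij_betw h (B - {b0}) {..<m}"
  using fB by (metis card_lessThan finite_Diff finite_lessThan finite_same_card_bij)
 define l where "l b = (if b = b0 then 0 else axis' (h b))" for b
 obtain L where L: "linear L" "\<forall>b\<in>B. L b = l b" using linear_independent_extend[OF B(2), of l] by blast
 have lc: "l b \<in> csp m" if "b \<in> B" for b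
 proof (cases "b = b0")
  case False
  hence "h b < m" using h that by (auto simp: bij_betw_def)
  thus ?thesis using False axis'_in_csp by (simp add: l_def)
 qed (use subspace_0[OF subspace_csp] in \<open>simp add: l_def\<close>)
 have Lc: "L y \<in> csp m" if "y \<in> span (s ` N)" for y
 proof -
  have "L y \<in> span (L ` B)" using linear_span_image[OF L(1), of B] that B(3) by blast
  moreover have "span (L ` B) \<subseteq> csp m" using L(2) lc subspace_csp by (intro span_minimal) auto
  ultimately show ?thesis by blast
 qed
 define T where "T y = (L y, f y)" for y
 have T: "linear T" unfolding T_def using L(1) f(1) by (intro linearI) (auto simp: linear_add linear_cmul)
 have inj: "inj_on T (span (s ` N))"
 proof (subst linear_injective_on_subspace_0[OF T subspace_span], intro ballI impI)
  fix y assume y: "y \<in> span (s ` N)" "T y = 0"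
  then obtain c where c: "y = (\<Sum>b\<in>B. c b *\<^sub>R b)" using B(3) span_finite[OF fB] by auto
  have "c b = 0" if b: "b \<in> B - {b0}" for b
  proof -
   have "L y = (\<Sum>b\<in>B. c b *\<^sub>R l b)" unfolding c using L by (simp add: linear_sum linear_cmul)
   hence "lkp (L y) (h b) = (\<Sum>b'\<in>B. c b' * lkp (l b') (h b))" by (simp add: lookup_sum lookup_scaleR)
   also have "\<dots> = (\<Sum>b'\<in>B. if b' = b then c b' else 0)"
    using h b by (intro sum.cong) (auto simp: l_def lookup_axis' bij_betw_def inj_on_def)
   finally show ?thesis using y(2) b fB by (simp add: T_def zero_prod_def sum.delta)
  qed
  hence y0: "y = c b0 *\<^sub>R b0" unfolding c using b0 fB by (simp add: sum.remove[of B b0])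
  moreover have "0 < f b0" using b0 B(1) f(2) by auto
  ultimately have "c b0 = 0" using y(2) f(1) by (simp add: T_def zero_prod_def linear_cmul)
  thus "y = 0" using y0 by simp
 qed
 define q where "q n = (1 / f (s n)) *\<^sub>R L (s n)" for n
 have Tq: "0 < f (s n) & T (s n) = f (s n) *\<^sub>R hom (q n)" if "n \<in> N" for n
  using f(2)[OF that] by (simp add: T_def q_def)
 obtain g where g: "linear g" "\<forall>n\<in>N. g (hom (q n)) = (1 / f (s n)) *\<^sub>R s n" using scaled_inverse[OF T inj Tq] by blast
 show ?thesis
 proof (intro exI[of _ q] conjI allI ballI iffI)
  show "q n \<in> csp m" if "n \<in> N" for n
   unfolding q_def using Lc[of "s n"] that subspace_csp by (intro subspace_scale) (auto simp: span_base)
  show "facial s N B" if "facial (%n. hom (q n)) N B" for B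
   using Tq by (intro facial_mono_linear[OF that T, where c = "%n. f (s n)"])
  show "facial (%n. hom (q n)) N B" if "facial s N B" for B
   using f(2) g(2) by (intro facial_mono_linear[OF that g(1), where c = "%n. 1 / f (s n)"]) simp
 qed
qed

text \<open>\<open>lb\<close> labels the facial sets by elements of the given index type, since the
  property speaks of posets over this type.\<close>

locale configuration =
 fixes N :: "'n set" and s :: "'n => 'x::real_vector" and lb :: "'n set => 'i" and m :: nat
 assumes fin: "finite N" and empty: "facial s N {}" and single: "!!n. n \<in> N ==> facial s N {n}"
  and inj: "inj_on lb {A. facial s N A}" and dim: "dim (s ` N) = Suc m"
begin

definition poset :: "'i rel" where "poset = {(lb A, lb B) |A B. facial s N A & facial s N B & A \<subseteq> B}"
definition lab :: "'n => 'i" where "lab n = lb {n}"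

lemma inj_iff: "facial s N A ==> facial s N B ==> lb A = lb B \<longleftrightarrow> A = B"
 using inj by (auto simp: inj_on_def)

lemma poset_iff: "facial s N A ==> facial s N B ==> (lb A, lb B) \<in> poset \<longleftrightarrow> A \<subseteq> B"
 unfolding poset_def using inj_iff by auto

lemma Field_poset: "Field poset = lb ` {A. facial s N A}"
 by (auto simp: Field_def poset_def)

lemma lab_inj: "inj_on lab N"
 using inj_iff single by (auto simp: inj_on_def lab_def)

lemma vertices_poset: "vertices poset = lab ` N"
proof (intro set_eqI iffI)
 fix v assume "v \<in> vertices poset"
 then obtain z where v: "v \<in> Field poset" "z \<in> Field poset" "\<forall>g\<in>Field poset. (z, g) \<in> poset" "z ~= v"
  "\<forall>g. (g, v) \<in> poset --> g = z | g = v" by (auto simp: vertices_def)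
 obtain A Z where A: "facial s N A" "v = lb A" and Z: "facial s N Z" "z = lb Z" using v(1,2) by (auto simp: Field_poset)
 have "(lb Z, lb {}) \<in> poset" using v(3) empty Z(2) by (auto simp: Field_poset)
 hence "Z = {}" using poset_iff[OF Z(1) empty] by simp
 hence "A ~= {}" using v(4) A Z by blast
 then obtain n where n: "n \<in> A" by blast
 hence nN: "n \<in> N" using facial_subset[OF A(1)] by blast
 have "(lb {n}, v) \<in> poset" using poset_iff[OF single[OF nN] A(1)] n A(2) by simp
 hence "lb {n} = z | lb {n} = v" using v(5) by blast
 moreover have "lb {n} ~= z" using inj_iff[OF single[OF nN] Z(1)] \<open>Z = {}\<close> Z(2) by simp
 ultimately show "v \<in> lab ` N" using nN by (auto simp: lab_def)
next
 fix v assume "v \<in> lab ` N"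
 then obtain n where n: "n \<in> N" "v = lb {n}" by (auto simp: lab_def)
 have "g = lb {} | g = v" if g: "(g, v) \<in> poset" for g
 proof -
  obtain A where A: "facial s N A" "g = lb A" using g by (auto simp: poset_def)
  hence "A \<subseteq> {n}" using g n poset_iff[OF A(1) single[OF n(1)]] by simp
  thus ?thesis using A n(2) by (auto simp: subset_singleton_iff)
 qed
 moreover have "\<forall>g\<in>Field poset. (lb {}, g) \<in> poset" using poset_iff[OF empty] by (auto simp: Field_poset)
 moreover have "lb {} ~= v" using inj_iff[OF empty single[OF n(1)]] n(2) by simp
 ultimately show "v \<in> vertices poset"
  using empty single[OF n(1)] n(2) unfolding vertices_def Field_poset by blast
qed

lemma below_poset:
 assumes A: "facial s N A"
 shows "below poset (lb A) = lab ` A"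
 using facial_subset[OF A] poset_iff[OF single A] by (auto simp: below_def vertices_poset lab_def)

lemma realization_facial:
 assumes "realization poset Q"
 shows "facial (%n. hom (vertex_point Q (lab n))) N B \<longleftrightarrow> facial s N B"
proof (cases "B \<subseteq> N")
 case True
 interpret Q: realized poset Q by (rule realized.intro) (rule assms)
 have "facial (%n. hom (vertex_point Q (lab n))) N B \<longleftrightarrow> facial (%v. hom (vertex_point Q v)) (lab ` N) (lab ` B)"
  by (rule facial_image[OF lab_inj True, symmetric])
 also have "\<dots> \<longleftrightarrow> (\<exists>A. facial s N A & lab ` B = lab ` A)"
  using Q.facial_iff[of "lab ` B"] below_poset by (auto simp: vertices_poset Field_poset)
 also have "\<dots> \<longleftrightarrow> facial s N B"
 proof
  assume "\<exists>A. facial s N A & lab ` B = lab ` A"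
  then obtain A where "facial s N A" "lab ` B = lab ` A" by (elim exE conjE)
  thus "facial s N B" using inj_on_image_eq_iff[OF lab_inj True facial_subset] by metis
 qed (auto intro: exI[of _ B])
 finally show ?thesis .
qed (auto dest: facial_subset)

lemma realization_exists: "\<exists>Q. realization poset Q & affdim (body Q) = int m"
proof -
 obtain q0 where q0: "\<forall>n\<in>N. q0 n \<in> csp m" "\<forall>B. facial (%n. hom (q0 n)) N B \<longleftrightarrow> facial s N B"
  using dehomogenize[OF fin empty dim] by blast
 define q where "q v = q0 (inv_into N lab v)" for v
 have q: "q (lab n) = q0 n" if "n \<in> N" for n using that lab_inj by (simp add: q_def)
 have sub: "B \<subseteq> lab ` N ==> \<exists>A\<subseteq>N. B = lab ` A" for B by (auto simp: subset_image_iff)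
 have fac: "facial (%v. hom (q v)) (lab ` N) (lab ` A) \<longleftrightarrow> facial s N A" if A: "A \<subseteq> N" for A
 proof -
  have "facial (%v. hom (q v)) (lab ` N) (lab ` A) \<longleftrightarrow> facial (%n. hom (q (lab n))) N A"
   using facial_image[OF lab_inj A] by simp
  also have "\<dots> \<longleftrightarrow> facial (%n. hom (q0 n)) N A" using q by (intro facial_cong) simp
  finally show ?thesis using q0(2) by simp
 qed
 have d: "dim ((%v. hom (q v)) ` (lab ` N)) = Suc m"
 proof -
  have "(%v. hom (q v)) ` (lab ` N) = (%n. hom (q0 n)) ` N" using q by (auto simp: image_image)
  moreover have "dim ((%n. hom (q0 n)) ` N) = dim (s ` N)"
   using q0(2) empty by (intro facial_dim_eq[OF fin]) auto
  ultimately show ?thesis using dim by simp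
 qed
 have R: "realization poset (convex hull (q ` vertices poset), %f. convex hull (q ` below poset f))"
 proof (rule realizationI[where n = m])
  show "Partial_order poset"
   unfolding partial_order_on_def preorder_on_def
  proof (intro conjI)
   show "poset \<subseteq> Field poset \<times> Field poset" by (auto simp: Field_def)
   show "refl_on (Field poset) poset" by (auto simp: refl_on_def Field_poset poset_iff)
   show "trans poset"
   proof (rule transI)
    fix x y z assume "(x, y) \<in> poset" "(y, z) \<in> poset"
    then obtain A B C E where *: "x = lb A" "y = lb B" "facial s N A" "facial s N B" "A \<subseteq> B"
     "y = lb C" "z = lb E" "facial s N C" "facial s N E" "C \<subseteq> E" by (auto simp: poset_def)
    hence "B = C" using inj_iff[of B C] by simp
    thus "(x, z) \<in> poset" using * by (simp add: poset_iff)
   qed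
   show "antisym poset" by (rule antisymI) (auto simp: poset_def inj_iff)
  qed
  have "inj_on (%n. hom (q0 n)) N" using single q0(2) by (intro facial_singletons_inj) simp
  thus "inj_on q (vertices poset)" unfolding vertices_poset using q by (auto simp: inj_on_def)
  show "dim ((%v. hom (q v)) ` vertices poset) = Suc m | vertices poset = {} & m = 0" using d by (simp add: vertices_poset)
  show "facial (%v. hom (q v)) (vertices poset) B \<longleftrightarrow> (\<exists>f\<in>Field poset. B = below poset f)" for B
  proof
   assume f: "facial (%v. hom (q v)) (vertices poset) B"
   then obtain A where A: "A \<subseteq> N" "B = lab ` A" using sub facial_subset vertices_poset by metis
   hence "facial s N A" using f fac by (simp add: vertices_poset)
   thus "\<exists>f\<in>Field poset. B = below poset f" using A below_poset by (auto simp: Field_poset)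
  next
   assume "\<exists>f\<in>Field poset. B = below poset f"
   then obtain A where "facial s N A" "B = lab ` A" using below_poset by (auto simp: Field_poset)
   thus "facial (%v. hom (q v)) (vertices poset) B" using fac facial_subset vertices_poset by metis
  qed
  show "(f, g) \<in> poset \<longleftrightarrow> below poset f \<subseteq> below poset g" if "f \<in> Field poset" "g \<in> Field poset" for f g
  proof -
   obtain A B where A: "facial s N A" "f = lb A" and B: "facial s N B" "g = lb B" using \<open>f \<in> _\<close> \<open>g \<in> _\<close> by (auto simp: Field_poset)
   have "lab ` A \<subseteq> lab ` B \<longleftrightarrow> A \<subseteq> B"
    using facial_subset[OF A(1)] facial_subset[OF B(1)] lab_inj by (meson inj_on_image_subset_iff)
   thus ?thesis using A B below_poset poset_iff by simp
  qed
 qed (use fin q q0 in \<open>auto simp: vertices_poset\<close>)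
 interpret R: realized poset "(convex hull (q ` vertices poset), %f. convex hull (q ` below poset f))"
  by (rule realized.intro) (rule R)
 have "dim ((%n. hom (vertex_point (convex hull (q ` vertices poset), %f. convex hull (q ` below poset f)) (lab n))) ` N) = Suc m"
  using realization_facial[OF R] empty dim by (subst facial_dim_eq[OF fin, where b = s]) auto
 thus ?thesis using R R.affdim_body by (intro exI conjI) (auto simp: vertices_poset image_image)
qed

end

section \<open>The theorem\<close>

lemma real_closed_UNIV: "real_closed_subfield UNIV"
proof -
 have pos: "\<exists>x. poly p x = 0" if odd: "odd (degree p)" and lc: "0 < lead_coeff p" for p :: "real poly"
 proof -
  define q where "q = - pcompose p [:0, -1:]"
  have "lead_coeff q = lead_coeff p" using odd lead_coeff_comp[of "[:0, -1:]" p] by (simp add: q_def)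
  then obtain n m where n: "\<forall>x\<ge>n. lead_coeff p <= poly p x" and m: "\<forall>x\<ge>m. lead_coeff p <= poly q x"
   using poly_pinfty_gt_lc[of p] poly_pinfty_gt_lc[of q] lc by auto
  define z where "z = max 1 (max n m)"
  have "lead_coeff p <= poly p z" "lead_coeff p <= poly q z" using n m by (simp_all add: z_def)
  hence "0 < poly p z" "0 < poly q z" using lc by simp_all
  hence "poly p (- z) < 0" "0 < poly p z" by (simp_all add: q_def poly_pcompose)
  moreover have "- z < z" by (simp add: z_def)
  ultimately show ?thesis using poly_IVT_pos[of "- z" z p] by blast
 qed
 have "\<exists>x. poly p x = 0" if odd: "odd (degree p)" for p :: "real poly"
 proof (cases "0 < lead_coeff p")
  case False
  have "p ~= 0" using odd by auto
  hence "0 < lead_coeff (- p)" using False by (simp add: order_less_le)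
  thus ?thesis using pos[of "- p"] odd by auto
 qed (use pos odd in blast)
 moreover have "\<exists>y. y * y = x" if "0 <= x" for x :: real
  using that by (intro exI[of _ "sqrt x"]) simp
 ultimately show ?thesis by (auto simp: real_closed_subfield_def)
qed

text \<open>Values \<open>a\<close> and \<open>- b\<close> of opposite sign at two vertices would
  produce a zero on the segment between them.\<close>

lemma sign_constant_on_hull:
 fixes h :: "vec \<times> real => real"
 assumes h: "linear h" and nz: "!!x. x \<in> convex hull (p ` V) ==> h (hom x) ~= 0"
 shows "\<exists>eps. \<forall>v\<in>V. 0 < eps * h (hom (p v))"
proof -
 have False if v: "v \<in> V" "0 < h (hom (p v))" and w: "w \<in> V" "h (hom (p w)) < 0" for v w
 proof -
  define a b where "a = h (hom (p v))" and "b = - h (hom (p w))"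
  have ab: "0 < a" "0 < b" using v w by (simp_all add: a_def b_def)
  define x where "x = (b / (a + b)) *\<^sub>R p v + (a / (a + b)) *\<^sub>R p w"
  have "x \<in> convex hull (p ` V)"
   unfolding x_def using v w ab
   by (intro convexD[OF convex_convex_hull]) (auto intro: hull_inc simp flip: add_divide_distrib)
  moreover have "b / (a + b) + a / (a + b) = 1" using ab by (simp flip: add_divide_distrib)
  hence hx: "hom x = (b / (a + b)) *\<^sub>R hom (p v) + (a / (a + b)) *\<^sub>R hom (p w)" by (simp add: x_def)
  have e: "h (hom (p v)) = a" "h (hom (p w)) = - b" by (simp_all add: a_def b_def)
  have "h (hom x) = (b / (a + b)) * a + (a / (a + b)) * - b"
   by (simp only: hx linear_add[OF h] linear_cmul[OF h] e real_scaleR_def)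
  hence "h (hom x) = 0" by simp
  ultimately show False using nz by blast
 qed
 moreover have "h (hom (p v)) ~= 0" if "v \<in> V" for v using nz[of "p v"] that by (auto intro: hull_inc)
 ultimately have "(\<forall>v\<in>V. 0 < h (hom (p v))) | (\<forall>v\<in>V. h (hom (p v)) < 0)" by (metis linorder_neqE_linordered_idom)
 thus ?thesis
 proof
  assume "\<forall>v\<in>V. 0 < h (hom (p v))" thus ?thesis by (intro exI[of _ 1]) simp
 next
  assume "\<forall>v\<in>V. h (hom (p v)) < 0" thus ?thesis by (intro exI[of _ "- 1"]) simp
 qed
qed

lemma fresh_labels:
 fixes X :: "'i::infinite set" and F :: "'a set"
 assumes "finite X" "finite F"
 shows "\<exists>fr. inj_on fr F & fr ` F \<inter> X = {}"
proof -
 have "infinite (- X)" using assms(1) infinite_UNIV by (simp add: Compl_eq_Diff_UNIV)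
 then obtain T where T: "finite T" "card T = card F" "T \<subseteq> - X" using infinite_arbitrarily_large by blast
 then obtain fr where "bij_betw fr F T" using finite_same_card_bij[OF assms(2) T(1)] by auto
 thus ?thesis using T(3) by (intro exI[of _ fr]) (auto simp: bij_betw_def)
qed

text \<open>Realizations of the stamp with the property would pass it on to the ridge
  \<open>f0\<close>. Each resulting ridge is equivalent to the sample: the map \<open>G\<close> of
  the stamp is inverted and followed by the projectivity that moves the ridge into place. This
  contradicts \<open>fails\<close>.\<close>

lemma stamp_fails:
 fixes r :: "('i::infinite) rel" and \<psi> :: "'i poly_property"
 assumes samp: "sample r P d K \<psi> \<phi> vs" and d2: "2 <= d"
  and inh: "ridges_inherit K \<psi>" and nh: "\<not> holds_projective K \<psi> r P"
 shows "\<exists>r'. has_dimension r' (int d + 2) & \<not> holds_combinatorial K \<psi> r'"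
proof -
 interpret S0: sample r P d K \<psi> \<phi> vs by (rule samp)
 let ?V = "vertices r" and ?D = "Suc d"
 obtain a u M where fails: "S0.fails a" and ac: "!!v. v \<in> ?V ==> a v \<in> csp ?D"
  and ap: "!!v j. v \<in> ?V ==> j < ?D ==> 0 < lkp (a v) j"
  and af: "!!B. facial a ?V B \<longleftrightarrow> (\<exists>f\<in>Field r. B = below r f)" and M: "1 <= M"
  and u: "!!B. S0.prop B ==> u B \<in> csp ?D &
   (\<forall>v\<in>?V. 0 <= ip ?D (u B) (a v) & (ip ?D (u B) (a v) = 0 \<longleftrightarrow> v \<in> B)) &
   (\<forall>j<?D. algebraic (lkp (u B) j + real M) & 0 < lkp (u B) j + real M)"
  using S0.algebraic_sample[OF nh] by (elim exE conjE) blast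
 have pa: "facial (%v. hom (S0.p v)) ?V B \<longleftrightarrow> facial a ?V B" for B using S0.facial_iff af by simp
 have "dim (a ` ?V) = dim ((%v. hom (S0.p v)) ` ?V)"
  using facial_dim_eq[OF S0.finV pa facial_hom_empty] by simp
 hence da: "dim (a ` ?V) = ?D" using S0.dims by simp
 have sa: "span (a ` ?V) = csp ?D"
  unfolding span_axes[symmetric]
  using da S0.finV ac dim_csp_set[OF span_axes, of ?D]
  by (intro span_eq_if_dim) (auto simp: span_axes simp del: lessThan_Suc)
 interpret C: cone_config ?V a ?D
 proof
  show "facial a ?V {v}" if "v \<in> ?V" for v using S0.facial_vertex[OF that] pa by simp
  show "facial a ?V {}" using pa facial_hom_empty by blast
 qed (use S0.finV ac sa d2 in auto)
 have "?D <= card (a ` ?V)" using dim_le_card_fin[OF span_superset, of "a ` ?V"] S0.finV da by simp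
 hence c2: "2 <= card ?V" using card_image_le[OF S0.finV, of a] d2 by simp
 have proper: "C.proper B \<longleftrightarrow> S0.prop B" for B by (auto simp: C.proper_def af)
 have "\<exists>k Gam om. stack ?V a ?D k Gam om &
  (\<forall>s' :: _ => vec \<times> real. stack_realization ?V a ?D k Gam om s' -->
   (\<exists>G mu. linear G & (\<forall>v\<in>?V. 0 < mu v & G (s' (Inl v)) = mu v *\<^sub>R a v)))"
  using u unfolding proper[symmetric] by (intro C.stamp[OF c2 ap _ _ _ M]) blast+
 then obtain k Gam om where st: "stack ?V a ?D k Gam om"
  and force: "!!s' :: _ => vec \<times> real. stack_realization ?V a ?D k Gam om s' ==>
   \<exists>G mu. linear G & (\<forall>v\<in>?V. 0 < mu v & G (s' (Inl v)) = mu v *\<^sub>R a v)" by (elim exE conjE) blast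
 interpret S: stack ?V a ?D k Gam om by (rule st)
 interpret SS: stack_realization ?V a ?D k Gam om S.s by (intro stack_realization.intro stack_realization_axioms.intro st refl)
 \<comment> \<open>The lower bound: the bottom layer has dimension one more than
   \<open>Suc d\<close> and is a proper face.\<close>
 have dimS: "dim (S.s ` S.VS) = Suc (?D + 1)"
 proof -
  obtain w where "w \<in> S.LV 1" using S.LV_ne[of 1] S.k1 by blast
  hence "Inr (1, w) \<in> S.VS" "Inr (1, w) ~: S.lay 0" using S.k1 by auto
  hence "S.lay 0 \<subset> S.VS" using S.lay_VS[of 0] by blast
  hence "SS.d (S.lay 0) < SS.d S.VS" by (intro SS.d_less S.facial_lay_0 order_refl)
  thus ?thesis using SS.d_lay[of 0] S.dim_s_le by (simp add: SS.d_def)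
 qed
 have below_inj: "f = g" if "f \<in> Field r" "g \<in> Field r" "below r f = below r g" for f g
 proof -
  have "(f, g) \<in> r" "(g, f) \<in> r" using S0.below_mono that by auto
  thus ?thesis using S0.po unfolding partial_order_on_def by (meson antisymD)
 qed
 have "finite (Field r)"
  using below_inj S0.below_subset S0.finV by (intro inj_on_finite[of "below r" _ "Pow ?V"]) (auto simp: inj_on_def)
 moreover have finF: "finite {A. facial S.s S.VS A}"
  using S.finite_VS by (rule finite_subset[rotated, OF finite_Pow_iff[THEN iffD2]]) (auto dest: facial_subset)
 ultimately obtain fr where fr: "inj_on fr {A. facial S.s S.VS A}" "fr ` {A. facial S.s S.VS A} \<inter> Field r = {}"
  using fresh_labels by blast
 \<comment> \<open>Faces of the polytope at infinity keep their labels from \<open>r\<close>, so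
   that the face poset of the ridge is \<open>r\<close> itself and not merely isomorphic to it; all
   other faces get fresh labels.\<close>
 define lb where "lb A = (if \<exists>f\<in>Field r. A = Inl ` below r f then (THE f. f \<in> Field r & A = Inl ` below r f) else fr A)"
  for A :: "('i + nat \<times> vec) set"
 have inl: "Inl ` below r f = (Inl ` below r g :: ('i + nat \<times> vec) set) \<longleftrightarrow> below r f = below r g" for f g by (auto simp: inj_image_eq_iff)
 have lb: "lb (Inl ` below r f) = f" if "f \<in> Field r" for f
 proof -
  have "(THE g. g \<in> Field r & Inl ` below r f = (Inl ` below r g :: ('i + nat \<times> vec) set)) = f"
   using that below_inj[of f] unfolding inl by (intro the_equality) metis+
  thus ?thesis using that by (auto simp: lb_def)
 qed
 have inj: "inj_on lb {A. facial S.s S.VS A}"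
 proof (rule inj_onI)
  fix A B assume AB: "A \<in> {A. facial S.s S.VS A}" "B \<in> {A. facial S.s S.VS A}" "lb A = lb B"
  consider f g where "f \<in> Field r" "A = Inl ` below r f" "g \<in> Field r" "B = Inl ` below r g"
   | f where "f \<in> Field r" "A = Inl ` below r f" "lb B = fr B"
   | f where "f \<in> Field r" "B = Inl ` below r f" "lb A = fr A"
   | "lb A = fr A" "lb B = fr B" unfolding lb_def by metis
  thus "A = B"
  proof cases
   case 1 thus ?thesis using lb AB(3) by simp
  next
   case 2 hence "fr B \<in> Field r" using lb AB(3) by simp
   thus ?thesis using fr(2) AB(2) by blast
  next
   case 3 hence "fr A \<in> Field r" using lb AB(3) by simp
   thus ?thesis using fr(2) AB(1) by blast
  next
   case 4 thus ?thesis using fr(1) AB by (simp add: inj_on_def)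
  qed
 qed
 interpret Cf: configuration S.VS S.s lb "?D + 1"
  by (intro configuration.intro S.finite_VS SS.empty_facial S.facial_single inj dimS)
 let ?r = Cf.poset
 have lab: "Cf.lab (Inl v) = v" if "v \<in> ?V" for v
  using lb[of v] S0.below_vertex[OF that] S0.V_Field that by (auto simp: Cf.lab_def)
 obtain f0 where f0: "f0 \<in> Field r" "below r f0 = ?V" using af facial_self by metis
 have base: "lb (Inl ` ?V) = f0" using lb[OF f0(1)] f0(2) by simp
 have vsub: "v \<in> vertices ?r" if "v \<in> ?V" for v
 proof -
  have "Inl v \<in> S.VS" using that by simp
  hence "Cf.lab (Inl v) \<in> vertices ?r" unfolding Cf.vertices_poset by (rule imageI)
  thus ?thesis by (simp add: lab that)
 qed
 have below0: "below ?r f0 = ?V"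
  using Cf.below_poset[OF S.facial_base] base lab by (force simp: image_image)
 have sub: "facial S.s S.VS A & A \<subseteq> Inl ` ?V \<longleftrightarrow> (\<exists>f\<in>Field r. A = Inl ` below r f)" for A
 proof
  assume A: "facial S.s S.VS A & A \<subseteq> Inl ` ?V"
  then obtain A' where A': "A = Inl ` A'" "A' \<subseteq> ?V" by (auto simp: subset_image_iff)
  hence "facial a ?V A'" using S.facial_sub_base[OF A'(2)] A by simp
  then obtain f where "f \<in> Field r" "A' = below r f" unfolding af by (elim bexE)
  thus "\<exists>f\<in>Field r. A = Inl ` below r f" using A'(1) by (intro bexI[of _ f]) simp_all
 next
  assume "\<exists>f\<in>Field r. A = Inl ` below r f"
  then obtain f where f: "f \<in> Field r" "A = Inl ` below r f" by blast
  have "facial a ?V (below r f)" using af f(1) by blast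
  thus "facial S.s S.VS A & A \<subseteq> Inl ` ?V" using S.facial_sub_base[OF S0.below_subset] f(2) S0.below_subset by auto
 qed
 have fp: "face_poset ?r f0 = r"
 proof (intro set_eqI iffI)
  fix x assume "x \<in> face_poset ?r f0"
  then obtain A B where A: "x = (lb A, lb B)" "facial S.s S.VS A" "facial S.s S.VS B" "A \<subseteq> B" "(lb B, f0) \<in> ?r"
  proof -
   obtain y z where "x = (y, z)" by (cases x)
   moreover from this have "(y, z) \<in> ?r" "(z, f0) \<in> ?r" using \<open>x \<in> _\<close> by (simp_all add: face_poset_def)
   moreover from this(1) obtain A B where "y = lb A" "z = lb B" "facial S.s S.VS A" "facial S.s S.VS B" "A \<subseteq> B"
    unfolding Cf.poset_def by blast
   ultimately show ?thesis using that by simp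
  qed
  have BV: "B \<subseteq> Inl ` ?V" using Cf.poset_iff[OF A(3) S.facial_base] A(5) base by simp
  hence AV: "A \<subseteq> Inl ` ?V" using A(4) by blast
  obtain f where f: "f \<in> Field r" "A = Inl ` below r f" using iffD1[OF sub conjI[OF A(2) AV]] by (elim bexE)
  obtain g where g: "g \<in> Field r" "B = Inl ` below r g" using iffD1[OF sub conjI[OF A(3) BV]] by (elim bexE)
  have "Inl ` below r f \<subseteq> (Inl ` below r g :: ('i + nat \<times> vec) set)" using A(4) f(2) g(2) by simp
  hence "below r f \<subseteq> below r g" by auto
  thus "x \<in> r" using S0.below_mono[OF f(1) g(1)] A(1) f g lb by simp
 next
  fix x assume "x \<in> r"
  then obtain f g where x: "x = (f, g)" "(f, g) \<in> r" "f \<in> Field r" "g \<in> Field r" by (cases x) (auto simp: Field_def)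
  have F: "facial S.s S.VS (Inl ` below r f)" "facial S.s S.VS (Inl ` below r g)" "Inl ` below r g \<subseteq> (Inl ` ?V :: ('i + nat \<times> vec) set)"
   using iffD2[OF sub, OF bexI[OF refl x(3)]] iffD2[OF sub, OF bexI[OF refl x(4)]] by simp_all
  have "(lb (Inl ` below r f), lb (Inl ` below r g)) \<in> ?r" "(lb (Inl ` below r g), lb (Inl ` ?V)) \<in> ?r"
   using Cf.poset_iff[OF F(1,2)] Cf.poset_iff[OF F(2) S.facial_base] F(3) S0.below_mono[OF x(3,4)] x(2) by auto
  thus "x \<in> face_poset ?r f0" using x lb base by (simp add: face_poset_def)
 qed
 have SR: "stack_realization ?V a ?D k Gam om (%n. hom (vertex_point Q (Cf.lab n)))" if "realization ?r Q" for Q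
  using Cf.realization_facial[OF that] by (intro stack_realization.intro stack_realization_axioms.intro st)
 have dimQ: "dim ((%v. hom (vertex_point Q v)) ` ?V) = ?D" if "realization ?r Q" for Q
 proof -
  interpret R: stack_realization ?V a ?D k Gam om "%n. hom (vertex_point Q (Cf.lab n))" by (rule SR[OF that])
  have "(%v. hom (vertex_point Q v)) ` ?V = (%n. hom (vertex_point Q (Cf.lab n))) ` Inl ` ?V" using lab by (auto simp: image_image)
  thus ?thesis using R.d_base by (simp add: R.d_def)
 qed
 obtain Q0 where Q0: "realization ?r Q0" "affdim (body Q0) = int d + 2"
  using Cf.realization_exists by auto
 have rd: "ridge ?r f0"
 proof -
  interpret R: realized ?r Q0 by (rule realized.intro) (rule Q0(1))
  have fF: "f0 \<in> Field ?r" using S.facial_base base unfolding Cf.Field_poset by blast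
  have "affdim (face Q0 f0) = int d" using R.affdim_face[OF fF] dimQ[OF Q0(1)] below0 by simp
  thus ?thesis unfolding ridge_def using fF Q0 by (intro conjI exI[of _ Q0]) simp_all
 qed
 have equiv: "S0.equivalent a (%v. homv d (vertex_point (proj_image h (face_polytope P' f0)) v))"
  if P': "realization ?r P'" and h: "linear h" "finite_on h (face P' f0)" for P' h
 proof -
  interpret R: realized ?r P' by (rule realized.intro) (rule P')
  obtain G mu where G: "linear G" "\<forall>v\<in>?V. 0 < mu v & G (hom (vertex_point P' (Cf.lab (Inl v)))) = mu v *\<^sub>R a v"
   using force[OF SR[OF P']] by blast
  have Gv: "0 < mu v & G (hom (R.p v)) = mu v *\<^sub>R a v" if "v \<in> ?V" for v using G(2)[rule_format, OF that] lab[OF that] by simp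
  let ?X = "(%v. hom (R.p v)) ` ?V"
  have "span (G ` ?X) = span (a ` ?V)" unfolding image_image using Gv by (rule span_scaled)
  hence "dim (G ` ?X) = dim ?X" using da dimQ[OF P'] by (metis dim_span)
  hence inj: "inj_on G (span ?X)" by (intro linear_inj_on_if_dim[OF _ G(1)] finite_imageI S0.finV)
  obtain g where g: "linear g" "!!v. v \<in> ?V ==> g (a v) = (1 / mu v) *\<^sub>R hom (R.p v)"
   using scaled_inverse[OF G(1) inj Gv] by blast
  have fh: "face P' f0 = convex hull (R.p ` ?V)"
   using R.face_hull[of f0] below0 S.facial_base base unfolding Cf.Field_poset by auto
  have "linear (%y. snd (h y))" using linear_compose[OF h(1) linear_snd] by (simp add: o_def)
  \<comment> \<open>The projectivity is finite on the ridge, so its denominator has constant sign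
    there; \<open>eps\<close> corrects the sign, since the factors in \<open>equivalent\<close> must
    be positive.\<close>
  then obtain eps where eps: "\<forall>v\<in>?V. 0 < eps * snd (h (hom (R.p v)))"
   using sign_constant_on_hull[of "%y. snd (h y)" R.p ?V] h(2) unfolding fh finite_on_def by blast
  define F where "F y = eps *\<^sub>R (fst (h (g y)) + snd (h (g y)) *\<^sub>R axis' d)" for y
  have "linear F"
   unfolding F_def using h(1) g(1) by (intro linearI) (auto simp: linear_add linear_cmul algebra_simps)
  moreover have "F (a v) = (eps * snd (h (hom (R.p v))) / mu v) *\<^sub>R homv d (vertex_point (proj_image h (face_polytope P' f0)) v)"
   if v: "v \<in> ?V" for v
  proof -
   define y where "y = h (hom (R.p v))"
   have "snd y ~= 0" using eps v by (auto simp: y_def)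
   moreover have "vertex_point (proj_image h (face_polytope P' f0)) v = fst y /\<^sub>R snd y"
   proof -
    have "face (proj_image h (face_polytope P' f0)) v = proj_map h ` face P' v"
     by (simp add: proj_image_def face_polytope_def face_def)
    also have "\<dots> = {proj_map h (R.p v)}" by (simp only: R.vertex_face[OF vsub[OF v]] image_insert image_empty)
    finally show ?thesis unfolding vertex_point_def[of "proj_image h _"] by (simp add: proj_map_def y_def)
   qed
   moreover have "h (g (a v)) = (1 / mu v) *\<^sub>R y" unfolding g(2)[OF v] y_def by (rule linear_cmul[OF h(1)])
   ultimately show ?thesis unfolding F_def y_def[symmetric] by (simp add: homv_def scaleR_add_right)
  qed
  ultimately show ?thesis
   unfolding S0.equivalent_def using eps Gv
   by (intro exI[of _ F] exI[of _ "%v. eps * snd (h (hom (R.p v))) / mu v"]) auto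
 qed
 have "\<not> holds_combinatorial K \<psi> ?r"
 proof
  assume "holds_combinatorial K \<psi> ?r"
  then obtain Ps where Ps: "realizations K ?r Ps" "\<psi> ?r Ps" unfolding holds_combinatorial_def by blast
  have "projectively_inherits K \<psi> ?r f0"
   using inh rd Q0(1) unfolding ridges_inherit_def combinatorial_polytope_def by blast
  then obtain hs where hs: "length hs = K"
   "\<forall>k<K. projectivity (nat (affdim (body (Ps ! k)))) (hs ! k) & finite_on (hs ! k) (face (Ps ! k) f0)"
   "realizations K r (map2 (%h P. proj_image h (face_polytope P f0)) hs Ps)"
   "\<psi> r (map2 (%h P. proj_image h (face_polytope P f0)) hs Ps)"
   using Ps unfolding projectively_inherits_def Let_def fp by blast
  have "S0.equivalent a (%v. homv d (vertex_point Q v))"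
   if QQ: "Q \<in> set (map2 (%h P. proj_image h (face_polytope P f0)) hs Ps)" for Q
  proof -
   obtain k where k: "k < K" "Q = proj_image (hs ! k) (face_polytope (Ps ! k) f0)"
    using QQ hs(1) Ps(1) by (auto simp: set_zip realizations_def)
   have "realization ?r (Ps ! k)" using Ps(1) k(1) by (auto simp: realizations_def)
   thus ?thesis unfolding k(2) using hs(2) k(1) by (intro equiv) (auto simp: projectivity_def)
  qed
  thus False using fails hs(3,4) unfolding S0.fails_def by blast
 qed
 thus ?thesis using Q0 unfolding has_dimension_def by blast
qed

text \<open>A cone of dimension at most two has at most two extreme rays.\<close>

lemma independent_low_dim:
 fixes p :: "'i => vec"
 assumes fin: "finite V" and single: "!!v. v \<in> V ==> facial (%v. hom (p v)) V {v}" and inj: "inj_on p V"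
  and dim: "dim ((%v. hom (p v)) ` V) <= 2"
 shows "independent ((%v. hom (p v)) ` V)"
proof
 let ?a = "%v. hom (p v)"
 assume "dependent (?a ` V)"
 then obtain v where v: "v \<in> V" "?a v \<in> span (?a ` V - {?a v})" unfolding dependent_def by blast
 have "?a ` V - {?a v} \<subseteq> ?a ` (V - {v})" by auto
 hence "?a v \<in> span (?a ` (V - {v}))" using v(2) span_mono by blast
 moreover have fV: "finite (?a ` (V - {v}))" using fin by simp
 obtain B where B: "B \<subseteq> ?a ` (V - {v})" "independent B" "span B = span (?a ` (V - {v}))" "card B = dim (?a ` (V - {v}))"
  using fin_basis[OF fV] by blast
 moreover have "dim (?a ` (V - {v})) <= dim (?a ` V)" using fin by (intro dim_mono_fin) (auto intro: span_base)
 ultimately have vB: "?a v \<in> span B" "card B <= 2" and fB: "finite B"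
  using dim B finite_subset[OF B(1) fV] by simp_all
 \<comment> \<open>A combination of at most two other vertices; \<open>w1 = w2\<close> if one
   suffices.\<close>
 have "\<exists>w1\<in>V - {v}. \<exists>w2\<in>V - {v}. \<exists>c1 c2. ?a v = c1 *\<^sub>R ?a w1 + c2 *\<^sub>R ?a w2"
 proof -
  have "B ~= {}" using vB(1) by (auto simp: zero_prod_def)
  hence "card B = 1 | card B = 2" using vB(2) fB by (cases "card B") auto
  then obtain b1 b2 where b: "B = {b1, b2}" by (auto simp: card_1_singleton_iff card_2_iff)
  then obtain c1 c2 where "?a v = c1 *\<^sub>R b1 + c2 *\<^sub>R b2"
   using vB(1) unfolding b span_insert span_singleton by (auto simp: algebra_simps)
  moreover obtain w1 where "w1 \<in> V - {v}" "b1 = ?a w1" using B(1) b by blast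
  moreover obtain w2 where "w2 \<in> V - {v}" "b2 = ?a w2" using B(1) b by blast
  ultimately show ?thesis by blast
 qed
 then obtain w1 w2 c1 c2 where w: "w1 \<in> V" "w2 \<in> V" "w1 ~= v" "w2 ~= v" "?a v = c1 *\<^sub>R ?a w1 + c2 *\<^sub>R ?a w2" by blast
 have f: "\<exists>f. (f (?a v) = c1 * f (?a w1) + c2 * f (?a w2)) & (\<forall>y\<in>V. (y = x --> f (?a y) = 0) & (y ~= x --> 0 < (f (?a y) :: real)))"
  if xV: "x \<in> V" for x
 proof -
  obtain f where f: "linear f" "!!y. y \<in> V ==> y ~: {x} ==> 0 < (f (?a y) :: real)" "!!y. y \<in> V ==> f (?a y) = 0 \<longleftrightarrow> y \<in> {x}"
   using single[OF xV] by (rule facialE) (rule that; assumption)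
  have "f (?a v) = c1 * f (?a w1) + c2 * f (?a w2)"
   unfolding w(5) using f(1) by (simp add: linear_add linear_cmul del: scaleR_Pair)
  thus ?thesis using f(2,3) by blast
 qed
 have s: "1 = c1 + c2" using w(5) by simp
 obtain f0 where f0: "c1 * f0 (?a w1) + c2 * f0 (?a w2) = 0" "0 < (f0 (?a w1) :: real)" "0 < f0 (?a w2)"
  using f[OF v(1)] w v(1) by metis
 show False
 proof (cases "w1 = w2")
  case True
  hence "(c1 + c2) * f0 (?a w1) = 0" using f0(1) by (simp add: distrib_right)
  thus ?thesis using s f0(2) by simp
 next
  case False
  obtain f1 where f1: "f1 (?a v) = c1 * f1 (?a w1) + c2 * f1 (?a w2)" "f1 (?a w1) = 0" "0 < (f1 (?a v) :: real)" "0 < f1 (?a w2)"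
   using f[OF w(1)] w(1-4) v(1) False by metis
  obtain f2 where f2: "f2 (?a v) = c1 * f2 (?a w1) + c2 * f2 (?a w2)" "f2 (?a w2) = 0" "0 < (f2 (?a v) :: real)" "0 < f2 (?a w1)"
   using f[OF w(2)] w(1-4) v(1) False by metis
  \<comment> \<open>The functionals exposing \<open>w1\<close> and \<open>w2\<close> make both
    coefficients positive, which the one exposing \<open>v\<close> forbids.\<close>
  have "0 < c2" "0 < c1" using f1 f2 by (simp_all add: zero_less_mult_iff)
  hence "0 < c1 * f0 (?a w1) + c2 * f0 (?a w2)" using f0(2,3) by (intro add_pos_pos mult_pos_pos)
  thus ?thesis using f0(1) by simp
 qed
qed

text \<open>The homogenized vertices are independent, so a linear map can send them to those of
  \<open>Q\<close> even without rescaling.\<close>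

lemma low_dimension:
 assumes P: "realization r P" and Q: "realization r Q" and d: "affdim (body P) <= 1"
 shows "same_projective_type r P Q"
proof -
 interpret P: realized r P by (rule realized.intro) (rule P)
 have ind: "independent ((%v. hom (P.p v)) ` P.V)"
  using d P.affdim_body by (intro independent_low_dim P.finV P.facial_vertex P.injp) auto
 have inj: "inj_on (%v. hom (P.p v)) P.V" using P.injp by (auto simp: inj_on_def)
 obtain T where T: "linear T" "\<forall>x\<in>(%v. hom (P.p v)) ` P.V. T x = hom (vertex_point Q (inv_into P.V (%v. hom (P.p v)) x))"
  using linear_independent_extend[OF ind, of "%x. hom (vertex_point Q (inv_into P.V (%v. hom (P.p v)) x))"] by blast
 have "T (hom (P.p v)) = 1 *\<^sub>R hom (vertex_point Q v)" if "v \<in> P.V" for v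
  using T(2) that inv_into_f_f[OF inj that] by simp
 thus ?thesis by (intro same_projective_typeI[OF P Q T(1), where c = "%_. 1"]) auto
qed

text \<open>Up to dimension one a combinatorial type is a single projective type and fails itself.
  From dimension two on there are at least three homogeneous coordinates, as the stamp
  requires.\<close>

lemma failing_combinatorial_type:
 fixes r :: "('i::infinite) rel" and \<psi> :: "'i poly_property"
 assumes sa: "semialgebraic K \<psi>" and inh: "ridges_inherit K \<psi>"
  and P: "realization r P" and nh: "\<not> holds_projective K \<psi> r P"
 shows "\<exists>r' d. has_dimension r' d & d <= affdim (body P) + 2 & \<not> holds_combinatorial K \<psi> r'"
proof (cases "affdim (body P) <= 1")
 case True
 have "\<not> holds_combinatorial K \<psi> r"
  using low_dimension[OF P _ True] nh unfolding holds_combinatorial_def holds_projective_def realizations_def by metis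
 moreover have "has_dimension r (affdim (body P))" using P unfolding has_dimension_def by blast
 ultimately show ?thesis by (intro exI[of _ r] exI[of _ "affdim (body P)"]) simp
next
 case False
 interpret P: realized r P by (rule realized.intro) (rule P)
 obtain vs where vs: "distinct vs" "set vs = vertices r" using finite_distinct_list[OF P.finV] by blast
 define d where "d = nat (affdim (body P))"
 have hd: "has_dimension r (affdim (body P))" using P unfolding has_dimension_def by blast
 let ?I = "{..<d} \<times> {..<length vs} \<times> {..<K}"
 have "\<exists>\<phi>. free_vars \<phi> \<subseteq> ?I & (\<forall>F Ps. real_closed_subfield F & realizations K r Ps &
   (\<forall>x\<in>?I. coordinates vs Ps x \<in> F) --> (\<psi> r Ps \<longleftrightarrow> sat F (coordinates vs Ps) \<phi>))"
  using sa[unfolded semialgebraic_def Let_def, rule_format, of r "affdim (body P)" vs] hd vs by (simp add: d_def)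
 then obtain \<phi> where \<phi>: "free_vars \<phi> \<subseteq> {..<d} \<times> {..<length vs} \<times> {..<K}"
  "\<forall>F Ps. real_closed_subfield F & realizations K r Ps &
   (\<forall>x\<in>?I. coordinates vs Ps x \<in> F) --> (\<psi> r Ps \<longleftrightarrow> sat F (coordinates vs Ps) \<phi>)" by (elim exE conjE)
 have ne: "vertices r ~= {}"
 proof
  assume "vertices r = {}"
  thus False using P.affdim_body False by (simp add: dim_empty_fin)
 qed
 have "sample r P d K \<psi> \<phi> vs"
  using \<phi>(1) \<phi>(2)[rule_format, of UNIV] real_closed_UNIV vs ne d_def by unfold_locales auto
 moreover have "2 <= d" using False by (simp add: d_def)
 ultimately obtain r' where "has_dimension r' (int d + 2)" "\<not> holds_combinatorial K \<psi> r'"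
  using stamp_fails[OF _ _ inh nh] by blast
 thus ?thesis using False by (intro exI[of _ r'] exI[of _ "int d + 2"]) (simp add: d_def)
qed

theorem theorem2p3:
  fixes K :: nat and \<psi> :: "('i :: infinite) poly_property"
  assumes "semialgebraic K \<psi>"
    and "ridges_inherit K \<psi>"
  shows "((\<forall>r. combinatorial_polytope r \<longrightarrow> holds_combinatorial K \<psi> r) \<longleftrightarrow>
          (\<forall>r P. realization r P \<longrightarrow> holds_projective K \<psi> r P)) \<and>
         (\<forall>dc dp.
            lowest {d. \<exists>r. has_dimension r d \<and> \<not> holds_combinatorial K \<psi> r} dc \<and>
            lowest {d. \<exists>r P. realization r P \<and> affdim (body P) = d \<and>
                             \<not> holds_projective K \<psi> r P} dp \<longrightarrow>
            \<bar>dc - dp\<bar> \<le> 2)"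
proof -
 note main = failing_combinatorial_type[OF assms]
 have weaker: "holds_combinatorial K \<psi> r" if "holds_projective K \<psi> r P" for r P
  using that unfolding holds_projective_def holds_combinatorial_def realizations_def same_projective_type_def by metis
 have "(\<forall>r. combinatorial_polytope r --> holds_combinatorial K \<psi> r) \<longleftrightarrow>
   (\<forall>r P. realization r P --> holds_projective K \<psi> r P)"
 proof
  assume c: "\<forall>r. combinatorial_polytope r --> holds_combinatorial K \<psi> r"
  show "\<forall>r P. realization r P --> holds_projective K \<psi> r P"
   using main c unfolding has_dimension_def combinatorial_polytope_def by metis
 next
  assume "\<forall>r P. realization r P --> holds_projective K \<psi> r P"
  thus "\<forall>r. combinatorial_polytope r --> holds_combinatorial K \<psi> r"
   using weaker unfolding combinatorial_polytope_def by blast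
 qed
 moreover have "\<bar>dc - dp\<bar> <= 2"
  if dc: "lowest {d. \<exists>r. has_dimension r d & \<not> holds_combinatorial K \<psi> r} dc"
   and dp: "lowest {d. \<exists>r P. realization r P & affdim (body P) = d & \<not> holds_projective K \<psi> r P} dp" for dc dp
 proof -
  obtain r P where r: "realization r P" "affdim (body P) = dc" "\<not> holds_combinatorial K \<psi> r"
   using dc unfolding lowest_def has_dimension_def by blast
  \<comment> \<open>Any realization of a failing combinatorial type represents a failing projective
    type of the same dimension.\<close>
  hence "dp <= dc" using dp weaker unfolding lowest_def by blast
  obtain r P where r: "realization r P" "affdim (body P) = dp" "\<not> holds_projective K \<psi> r P"
   using dp unfolding lowest_def by blast
  obtain r' d where "has_dimension r' d" "d <= dp + 2" "\<not> holds_combinatorial K \<psi> r'"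
   using main[OF r(1,3)] r(2) by blast
  hence "dc <= dp + 2" using dc unfolding lowest_def by fastforce
  thus ?thesis using \<open>dp <= dc\<close> by simp
 qed
 ultimately show ?thesis by blast
qed

end
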